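(* Let $f:(0,\infty)\to\mathbb R$ be operator convex, let $\mathcal H$ be a Hilbert space, and let $A,B$ be positive trace-class operators on $\mathcal H$. Then the extended operator perspective $\phi_f(A,B)$ belongs to $\widehat{B(\mathcal H)}_++\mathcal C_1(\mathcal H)_{\mathrm{sa}}$, and $$\mathrm{Tr}\,\phi_f(A,B)=\widehat S_f(A\|B),$$ where $\widehat S_f(A\|B)$ is the maximal $f$-divergence of $A,B$.
   Context: $B(\mathcal H)_+$, $B(\mathcal H)_{\mathrm{sa}}$ are the positive and self-adjoint bounded operators on $\mathcal H$; $\mathcal C_1(\mathcal H)_{\mathrm{sa}}$ is the set of self-adjoint trace-class operators. $B(\mathcal H)_*^+$ is the set of positive normal functionals on $B(\mathcal H)$ (i.e. $X\mapsto\mathrm{Tr}(X\rho)$ with $\rho$ positive trace-class); $\omega_\xi:=\langle\,\cdot\,\xi,\xi\rangle$. $\widehat{B(\mathcal H)}_{\mathrm{lb}}$ is the set of maps $m:B(\mathcal H)_*^+\to(-\infty,\infty]$ that are positively homogeneous (with $0\cdot\infty=0$), additive, lower semicontinuous (in norm), and satisfy $m(\rho)+\ell\rho(I)\ge0$ for all $\rho$ for some $\ell\ge0$; $\widehat{B(\mathcal H)}_+$ is the subset of those $m$ with values in $[0,\infty]$. Sums are pointwise, and $X\in B(\mathcal H)_{\mathrm{sa}}$ is identified with $\rho\mapsto\rho(X)$. $\widehat{B(\mathcal H)}_++\mathcal C_1(\mathcal H)_{\mathrm{sa}}:=\{T+X:T\in\widehat{B(\mathcal H)}_+,\ X\in\mathcal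 C_1(\mathcal H)_{\mathrm{sa}}\}$. The trace extends canonically to $\widehat{B(\mathcal H)}_+$ as a normal functional: $\mathrm{Tr}\,T=\sum_iT(\omega_{e_i})\in[0,\infty]$ for any orthonormal basis $(e_i)$ of $\mathcal H$; then $\mathrm{Tr}(T+X):=\mathrm{Tr}\,T+\mathrm{Tr}\,X\in(-\infty,\infty]$. Extended operator perspective: put $f'(\infty):=\lim_{t\to\infty}f(t)/t$, $f(0^+):=\lim_{t\searrow0}f(t)$ in $(-\infty,\infty]$, and $\phi_f(x,y):=yf(x/y)$ for $x,y>0$, $\phi_f(x,0):=f'(\infty)x$ for $x\ge0$, $\phi_f(0,y):=f(0^+)y$ for $y\ge0$. For $A,B\in B(\mathcal H)_+$ put $\mathcal H_{A,B}:=\overline{\mathrm{ran}}(A+B)$ and $T_{A,B}:\mathcal H\to\mathcal H_{A,B}$, $T_{A,B}\xi:=(A+B)^{1/2}\xi$. There are unique positive contractions $R_{A,B},S_{A,B}$ on $\mathcal H_{A,B}$ with $R_{A,B}+S_{A,B}=I$, $A=T_{A,B}^*R_{A,B}T_{A,B}$, $B=T_{A,B}^*S_{A,B}T_{A,B}$. Then $\phi_f(A,B)\in\widehat{B(\mathcal H)}_{\mathrm{lb}}$ is $\phi_f(A,B)(\rho):=\int_{[0,1]}\phi_f(r,1-r)\,d\rho(T_{A,B}^*E_{R_{A,B}}(r)T_{A,B})$, with $E_{R_{A,B}}$ the spectral measure of $R_{A,B}$. Maximal $f$-divergence: if $A,B$ are positive trace-class with $\lambda^{-1}B\le A\le\lambda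 B$ for some $\lambda>0$, let $P$ be the support projection of $B$ and $W$ the unique positive invertible operator on $P\mathcal H$ with $A=B^{1/2}WB^{1/2}$; then $\widehat S_f(A\|B):=\mathrm{Tr}\,Bf(W)$ ($f(W)$ by continuous functional calculus on $P\mathcal H$). For general positive trace-class $A,B$, with $C:=A+B$, $\widehat S_f(A\|B):=\lim_{\varepsilon\searrow0}\widehat S_f(A+\varepsilon C\|B+\varepsilon C)\in(-\infty,\infty]$. *)

theory Defs
  imports "HOL-Analysis.Analysis" "HOL-Computational_Algebra.Polynomial"
begin

section \<open>Complex Hilbert spaces and bounded operators\<close>

class scaleC =
  fixes scaleC :: "complex \<Rightarrow> 'a \<Rightarrow> 'a"  (infixr \<open>*\<^sub>C\<close> 75)

text \<open>A complex Hilbert space, of arbitrary dimension (the zero space included). The library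
  inner product is the real part of the complex one, which is linear in its first argument; so the
  norm and the topology are those of the complex inner product.\<close>

class complex_hilbert = real_inner + complete_space + scaleC +
  fixes cinner :: "'a \<Rightarrow> 'a \<Rightarrow> complex"
  assumes scaleC_add_right: "a *\<^sub>C (x + y) = a *\<^sub>C x + a *\<^sub>C y"
    and scaleC_add_left: "(a + b) *\<^sub>C x = a *\<^sub>C x + b *\<^sub>C x"
    and scaleC_scaleC: "a *\<^sub>C b *\<^sub>C x = (a * b) *\<^sub>C x"
    and scaleC_of_real: "complex_of_real r *\<^sub>C x = r *\<^sub>R x"
    and cinner_commute: "cinner x y = cnj (cinner y x)"
    and cinner_add_left: "cinner (x + y) z = cinner x z + cinner y z"
    and cinner_scaleC_left: "cinner (a *\<^sub>C x) y = a * cinner x y"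
    and inner_eq_Re_cinner: "inner x y = Re (cinner x y)"

lemma scaleC_diff_right: "a *\<^sub>C (x - y) = a *\<^sub>C x - a *\<^sub>C (y :: 'a::complex_hilbert)"
  by (metis add_diff_cancel diff_add_cancel scaleC_add_right)

lemma scaleC_zero_right: "a *\<^sub>C 0 = (0 :: 'a::complex_hilbert)"
  using scaleC_diff_right[of a 0 0] by simp

lemma scaleC_minus_right: "a *\<^sub>C (- x) = - (a *\<^sub>C (x :: 'a::complex_hilbert))"
  using scaleC_diff_right[of a 0 x] by (simp add: scaleC_zero_right)

lemma scaleR_scaleC_commute: "r *\<^sub>R a *\<^sub>C x = a *\<^sub>C r *\<^sub>R (x :: 'a::complex_hilbert)"
  by (simp add: scaleC_of_real[symmetric] scaleC_scaleC mult.commute)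

lemma norm_scaleC: "norm (a *\<^sub>C x) = cmod a * norm (x :: 'a::complex_hilbert)"
proof -
  have "cinner (a *\<^sub>C x) (a *\<^sub>C x) = a * cnj (a * cinner x x)"
    by (metis cinner_commute cinner_scaleC_left)
  also have "\<dots> = complex_of_real ((cmod a)\<^sup>2) * cnj (cinner x x)"
    by (simp only: complex_norm_square complex_cnj_mult mult.assoc)
  finally have "inner (a *\<^sub>C x) (a *\<^sub>C x) = (cmod a)\<^sup>2 * inner x x"
    by (simp add: inner_eq_Re_cinner)
  then show ?thesis
    by (simp add: norm_eq_sqrt_inner real_sqrt_mult)
qed

lemma bounded_linear_scaleC_right: "bounded_linear (\<lambda>x :: 'a::complex_hilbert. a *\<^sub>C x)"
  by (rule bounded_linear_intro[where K = "cmod a"])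
    (simp_all add: scaleC_add_right scaleR_scaleC_commute norm_scaleC)

lemma bounded_linear_cinner_left: "bounded_linear (\<lambda>x :: 'a::complex_hilbert. cinner x y)"
proof (rule bounded_linear_intro[where K = "2 * norm y"])
  fix x :: 'a and r :: real
  show "cinner (r *\<^sub>R x) y = r *\<^sub>R cinner x y"
    by (simp add: scaleC_of_real[symmetric] cinner_scaleC_left scaleR_conv_of_real)
  have "Im (cinner x y) = inner ((- \<i>) *\<^sub>C x) y"
    by (simp only: inner_eq_Re_cinner cinner_scaleC_left) simp
  then have "\<bar>Im (cinner x y)\<bar> \<le> norm x * norm y"
    using Cauchy_Schwarz_ineq2[of "(- \<i>) *\<^sub>C x" y] by (simp add: norm_scaleC)
  moreover have "\<bar>Re (cinner x y)\<bar> \<le> norm x * norm y"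
    using Cauchy_Schwarz_ineq2[of x y] by (simp add: inner_eq_Re_cinner)
  ultimately show "norm (cinner x y) \<le> norm x * (2 * norm y)"
    using cmod_le[of "cinner x y"] by (simp add: algebra_simps)
qed (rule cinner_add_left)

text \<open>The space of bounded complex-linear operators on \<open>'a\<close>, with operator norm and composition.\<close>

typedef (overloaded) ('a::complex_hilbert) bop =
  "{T :: 'a \<Rightarrow> 'a. bounded_linear T \<and> (\<forall>c x. T (c *\<^sub>C x) = c *\<^sub>C T x)}"
  morphisms bop_apply Bop
  by (rule exI[of _ "\<lambda>x. x"]) (simp add: bounded_linear_ident)

declare [[coercion "bop_apply :: 'a::complex_hilbert bop \<Rightarrow> 'a \<Rightarrow> 'a"]]

setup_lifting type_definition_bop

instantiation bop :: (complex_hilbert) real_normed_vector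
begin

lift_definition norm_bop :: "'a bop \<Rightarrow> real" is onorm .

lift_definition minus_bop :: "'a bop \<Rightarrow> 'a bop \<Rightarrow> 'a bop" is "\<lambda>S T x. S x - T x"
  by (simp add: bounded_linear_sub scaleC_diff_right)

definition dist_bop :: "'a bop \<Rightarrow> 'a bop \<Rightarrow> real"
  where "dist_bop S T = norm (S - T)"

definition
  "(uniformity :: ('a bop \<times> 'a bop) filter) = (INF e\<in>{0 <..}. principal {(x, y). dist x y < e})"

definition open_bop :: "'a bop set \<Rightarrow> bool"
  where "open_bop U = (\<forall>x\<in>U. \<forall>\<^sub>F (x', y) in uniformity. x' = x \<longrightarrow> y \<in> U)"

lift_definition uminus_bop :: "'a bop \<Rightarrow> 'a bop" is "\<lambda>T x. - T x"
  by (simp add: bounded_linear_minus scaleC_minus_right)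

lift_definition zero_bop :: "'a bop" is "\<lambda>x. 0"
  by (simp add: bounded_linear_zero scaleC_zero_right)

lift_definition plus_bop :: "'a bop \<Rightarrow> 'a bop \<Rightarrow> 'a bop" is "\<lambda>S T x. S x + T x"
  by (simp add: bounded_linear_add scaleC_add_right)

lift_definition scaleR_bop :: "real \<Rightarrow> 'a bop \<Rightarrow> 'a bop" is "\<lambda>r T x. r *\<^sub>R T x"
  by (simp add: bounded_linear_const_scaleR scaleR_scaleC_commute)

definition sgn_bop :: "'a bop \<Rightarrow> 'a bop"
  where "sgn_bop T = scaleR (inverse (norm T)) T"

instance
  apply standard
  unfolding dist_bop_def open_bop_def sgn_bop_def uniformity_bop_def
  apply (rule refl | (transfer, force simp: onorm_triangle onorm_scaleR onorm_eq_0 algebra_simps))+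
  done

end

instantiation bop :: (complex_hilbert) real_normed_algebra
begin

lift_definition times_bop :: "'a bop \<Rightarrow> 'a bop \<Rightarrow> 'a bop" is "\<lambda>S T x. S (T x)"
  by (auto intro: bounded_linear_compose)

instance
proof
  fix R S T :: "'a bop" and a :: real
  show "R * S * T = R * (S * T)" by transfer simp
  show "(R + S) * T = R * T + S * T" by transfer simp
  show "R * (S + T) = R * S + R * T"
    by transfer (auto simp: linear_add bounded_linear.linear)
  show "a *\<^sub>R S * T = a *\<^sub>R (S * T)" by transfer simp
  show "S * a *\<^sub>R T = a *\<^sub>R (S * T)"
    by transfer (auto simp: linear_scale bounded_linear.linear)
  show "norm (S * T) \<le> norm S * norm T"
    by transfer (auto intro!: onorm_compose[unfolded o_def])
qed

end

instantiation bop :: (complex_hilbert) monoid_mult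
begin

lift_definition one_bop :: "'a bop" is "\<lambda>x. x"
  by (simp add: bounded_linear_ident)

instance
  by standard (transfer, simp)+

end

instantiation bop :: (complex_hilbert) scaleC
begin

lift_definition scaleC_bop :: "complex \<Rightarrow> 'a bop \<Rightarrow> 'a bop" is "\<lambda>c T x. c *\<^sub>C T x"
  by (auto intro: bounded_linear_compose[OF bounded_linear_scaleC_right]
      simp: scaleC_scaleC mult.commute)

instance ..

end

definition selfadjoint_op :: "'a::complex_hilbert bop \<Rightarrow> bool"
  where "selfadjoint_op T \<longleftrightarrow> (\<forall>x y. cinner (T x) y = cinner x (T y))"

definition adj_op :: "'a::complex_hilbert bop \<Rightarrow> 'a bop"
  where "adj_op T = (THE S :: 'a bop. \<forall>x y. cinner (T x) y = cinner x (S y))"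

definition positive_op :: "'a::complex_hilbert bop \<Rightarrow> bool"
  where "positive_op T \<longleftrightarrow> (\<forall>x. Im (cinner (T x) x) = 0 \<and> 0 \<le> Re (cinner (T x) x))"

definition op_le :: "'a::complex_hilbert bop \<Rightarrow> 'a bop \<Rightarrow> bool"  (infix \<open>\<le>\<^sub>B\<close> 50)
  where "S \<le>\<^sub>B T \<longleftrightarrow> positive_op (T - S)"

definition sqrt_op :: "'a::complex_hilbert bop \<Rightarrow> 'a bop"
  where "sqrt_op A = (THE S. positive_op S \<and> S * S = A)"

definition projection_op :: "'a::complex_hilbert bop \<Rightarrow> bool"
  where "projection_op P \<longleftrightarrow> selfadjoint_op P \<and> P * P = P"

text \<open>The projection onto the closed range, which for self-adjoint \<open>T\<close> is the support projection.\<close>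

definition support_proj :: "'a::complex_hilbert bop \<Rightarrow> 'a bop"
  where "support_proj T = (THE P. projection_op P \<and> range P = closure (range T))"

text \<open>For a projection \<open>P\<close>, the algebra \<open>B(PH)\<close> is represented as the corner \<open>P B(H) P\<close>, whose
  unit is \<open>P\<close>: an operator on \<open>PH\<close> is extended by zero to the orthogonal complement.\<close>

definition corner :: "'a::complex_hilbert bop \<Rightarrow> 'a bop set"
  where "corner P = {T. P * T * P = T}"

definition invertible_on :: "'a::complex_hilbert bop \<Rightarrow> 'a bop \<Rightarrow> bool"
  where "invertible_on P T \<longleftrightarrow> (\<exists>S\<in>corner P. S * T = P \<and> T * S = P)"

definition spectrum_on :: "'a::complex_hilbert bop \<Rightarrow> 'a bop \<Rightarrow> complex set"
  where "spectrum_on P T = {z. \<not> invertible_on P (T - z *\<^sub>C P)}"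

definition poly_op :: "'a::complex_hilbert bop \<Rightarrow> real poly \<Rightarrow> 'a bop \<Rightarrow> 'a bop"
  where "poly_op P p T = (\<Sum>i\<le>degree p. coeff p i *\<^sub>R (P * T ^ i))"

text \<open>Continuous functional calculus in \<open>B(PH)\<close> for self-adjoint \<open>T\<close>, whose spectrum is real:
  \<open>f(T)\<close> is the norm limit of \<open>p\<^sub>n(T)\<close> for polynomials \<open>p\<^sub>n\<close> tending to \<open>f\<close> uniformly on the spectrum.\<close>

definition cfc_on :: "'a::complex_hilbert bop \<Rightarrow> (real \<Rightarrow> real) \<Rightarrow> 'a bop \<Rightarrow> 'a bop"
  where "cfc_on P f T = (THE Y. \<exists>p :: nat \<Rightarrow> real poly.
    uniform_limit {t. complex_of_real t \<in> spectrum_on P T} (\<lambda>n. poly (p n)) f sequentially \<and>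
    (\<lambda>n. poly_op P (p n) T) \<longlonglongrightarrow> Y)"


section \<open>Operator convex functions\<close>

typedef ell2 = "{x :: nat \<Rightarrow> complex. summable (\<lambda>n. (cmod (x n))\<^sup>2)}"
  morphisms ell2_coord Ell2
  by (rule exI[of _ "\<lambda>_. 0"]) simp

setup_lifting type_definition_ell2

lemma ell2_summable_add:
  assumes "summable (\<lambda>n. (cmod (x n))\<^sup>2)" "summable (\<lambda>n. (cmod (y n))\<^sup>2)"
  shows "summable (\<lambda>n. (cmod (x n + y n))\<^sup>2)"
proof (rule summable_comparison_test'[where N = 0])
  show "summable (\<lambda>n. 2 * (cmod (x n))\<^sup>2 + 2 * (cmod (y n))\<^sup>2)"
    using assms by (intro summable_add summable_mult)
  fix n
  have "(cmod (x n + y n))\<^sup>2 \<le> (cmod (x n) + cmod (y n))\<^sup>2"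
    by (intro power_mono norm_triangle_ineq) auto
  also have "\<dots> \<le> 2 * (cmod (x n))\<^sup>2 + 2 * (cmod (y n))\<^sup>2"
    using sum_squares_bound[of "cmod (x n)" "cmod (y n)"] by (simp add: power2_sum)
  finally show "norm ((cmod (x n + y n))\<^sup>2) \<le> 2 * (cmod (x n))\<^sup>2 + 2 * (cmod (y n))\<^sup>2"
    by simp
qed

lemma ell2_summable_scale:
  assumes "summable (\<lambda>n. (cmod (x n))\<^sup>2)"
  shows "summable (\<lambda>n. (cmod (c * x n))\<^sup>2)"
  using summable_mult[OF assms, of "(cmod c)\<^sup>2"] by (simp add: norm_mult power_mult_distrib)

lemma ell2_summable_mult:
  assumes "summable (\<lambda>n. (cmod (x n))\<^sup>2)" "summable (\<lambda>n. (cmod (y n))\<^sup>2)"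
  shows "summable (\<lambda>n. x n * cnj (y n))"
proof (rule summable_comparison_test'[where N = 0])
  show "summable (\<lambda>n. (cmod (x n))\<^sup>2 + (cmod (y n))\<^sup>2)"
    using assms by (intro summable_add)
  fix n
  have "2 * (cmod (x n) * cmod (y n)) \<le> (cmod (x n))\<^sup>2 + (cmod (y n))\<^sup>2"
    using sum_squares_bound[of "cmod (x n)" "cmod (y n)"] by simp
  moreover have "0 \<le> cmod (x n) * cmod (y n)" by simp
  ultimately show "norm (x n * cnj (y n)) \<le> (cmod (x n))\<^sup>2 + (cmod (y n))\<^sup>2"
    unfolding norm_mult complex_mod_cnj by linarith
qed

lemma ell2_summable: "summable (\<lambda>n. (cmod (ell2_coord x n))\<^sup>2)"
  using ell2_coord[of x] by simp

instantiation ell2 :: real_vector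
begin

lift_definition zero_ell2 :: ell2 is "\<lambda>_. 0" by simp
lift_definition plus_ell2 :: "ell2 \<Rightarrow> ell2 \<Rightarrow> ell2" is "\<lambda>x y n. x n + y n"
  by (rule ell2_summable_add)
lift_definition uminus_ell2 :: "ell2 \<Rightarrow> ell2" is "\<lambda>x n. - x n" by simp
lift_definition minus_ell2 :: "ell2 \<Rightarrow> ell2 \<Rightarrow> ell2" is "\<lambda>x y n. x n - y n"
  using ell2_summable_add[of _ "\<lambda>n. - _ n"] by simp
lift_definition scaleR_ell2 :: "real \<Rightarrow> ell2 \<Rightarrow> ell2" is "\<lambda>r x n. complex_of_real r * x n"
  by (rule ell2_summable_scale)

instance
proof
  fix x y z :: ell2 and a b :: real
  show "x + y + z = x + (y + z)" by transfer (simp add: algebra_simps)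
  show "x + y = y + x" by transfer (simp add: algebra_simps)
  show "0 + x = x" by transfer simp
  show "- x + x = 0" by transfer simp
  show "x - y = x + - y" by transfer simp
  show "a *\<^sub>R (x + y) = a *\<^sub>R x + a *\<^sub>R y" by transfer (simp add: algebra_simps)
  show "(a + b) *\<^sub>R x = a *\<^sub>R x + b *\<^sub>R x" by transfer (simp add: algebra_simps)
  show "a *\<^sub>R b *\<^sub>R x = (a * b) *\<^sub>R x" by transfer (simp add: algebra_simps)
  show "1 *\<^sub>R x = x" by transfer simp
qed

end

instantiation ell2 :: real_inner
begin

definition inner_ell2 :: "ell2 \<Rightarrow> ell2 \<Rightarrow> real"
  where "inner_ell2 x y = Re (\<Sum>n. ell2_coord x n * cnj (ell2_coord y n))"
definition norm_ell2 :: "ell2 \<Rightarrow> real" where "norm_ell2 x = sqrt (inner x x)"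
definition sgn_ell2 :: "ell2 \<Rightarrow> ell2" where "sgn_ell2 x = x /\<^sub>R norm x"
definition dist_ell2 :: "ell2 \<Rightarrow> ell2 \<Rightarrow> real" where "dist_ell2 x y = norm (x - y)"
definition
  "(uniformity :: (ell2 \<times> ell2) filter) = (INF e\<in>{0 <..}. principal {(x, y). dist x y < e})"
definition open_ell2 :: "ell2 set \<Rightarrow> bool"
  where "open_ell2 U = (\<forall>x\<in>U. \<forall>\<^sub>F (x', y) in uniformity. x' = x \<longrightarrow> y \<in> U)"

lemma inner_ell2_alt:
  "inner x y = (\<Sum>n. Re (ell2_coord x n * cnj (ell2_coord y n)))"
  unfolding inner_ell2_def
  by (rule Re_suminf[OF ell2_summable_mult[OF ell2_summable ell2_summable], symmetric, THEN sym])

lemma inner_ell2_self: "inner (x :: ell2) x = (\<Sum>n. (cmod (ell2_coord x n))\<^sup>2)"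
  unfolding inner_ell2_alt
  by (rule arg_cong[where f = suminf], rule ext) (simp flip: complex_norm_square)

lemma summable_Re_ell2: "summable (\<lambda>n. Re (ell2_coord x n * cnj (ell2_coord y n)))"
  by (rule summable_Re[OF ell2_summable_mult[OF ell2_summable ell2_summable]])

instance
proof
  fix x y z :: ell2 and a b :: real
  show "sgn x = x /\<^sub>R norm x" by (rule sgn_ell2_def)
  show "dist x y = norm (x - y)" by (rule dist_ell2_def)
  show "(uniformity :: (ell2 \<times> ell2) filter) = (INF e\<in>{0 <..}. principal {(x, y). dist x y < e})"
    by (rule uniformity_ell2_def)
  show "open U = (\<forall>x\<in>U. \<forall>\<^sub>F (x', y) in uniformity. x' = x \<longrightarrow> y \<in> U)" for U :: "ell2 set"
    by (rule open_ell2_def)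
  show "inner x y = inner y x"
    unfolding inner_ell2_alt by (rule arg_cong[where f = suminf], rule ext) simp
  show "inner (x + y) z = inner x z + inner y z"
    unfolding inner_ell2_alt suminf_add[OF summable_Re_ell2 summable_Re_ell2]
    by (rule arg_cong[where f = suminf], rule ext) (simp add: plus_ell2.rep_eq algebra_simps)
  show "inner (a *\<^sub>R x) y = a * inner x y"
    unfolding inner_ell2_alt suminf_mult[OF summable_Re_ell2, symmetric]
    by (rule arg_cong[where f = suminf], rule ext) (simp add: scaleR_ell2.rep_eq algebra_simps)
  show "0 \<le> inner x x"
    unfolding inner_ell2_self by (rule suminf_nonneg[OF ell2_summable]) simp
  show "inner x x = 0 \<longleftrightarrow> x = 0"
    unfolding inner_ell2_self suminf_eq_zero_iff[OF ell2_summable, simplified]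
    by transfer (auto simp: fun_eq_iff)
  show "norm x = sqrt (inner x x)" by (rule norm_ell2_def)
qed

end

lemma norm_ell2_sq: "(norm (x :: ell2))\<^sup>2 = (\<Sum>n. (cmod (ell2_coord x n))\<^sup>2)"
  unfolding inner_ell2_self[symmetric] by (simp add: power2_norm_eq_inner)

lemma ell2_partial_sum_le: "(\<Sum>n<K. (cmod (ell2_coord x n))\<^sup>2) \<le> (norm x)\<^sup>2"
  unfolding norm_ell2_sq by (rule sum_le_suminf[OF ell2_summable]) auto

instance ell2 :: complete_space
proof
  fix X :: "nat \<Rightarrow> ell2"
  assume X: "Cauchy X"
  have coord_le: "cmod (ell2_coord x n) \<le> norm x" for x n
  proof -
    have "(cmod (ell2_coord x n))\<^sup>2 \<le> (\<Sum>n<Suc n. (cmod (ell2_coord x n))\<^sup>2)"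
      by (simp add: sum_nonneg)
    also have "\<dots> \<le> (norm x)\<^sup>2" by (rule ell2_partial_sum_le)
    finally show ?thesis by (simp add: power2_le_iff_abs_le)
  qed
  have "Cauchy (\<lambda>k. ell2_coord (X k) n)" for n
  proof (rule CauchyI)
    fix e :: real assume "0 < e"
    with X obtain M where M: "\<And>j k. M \<le> j \<Longrightarrow> M \<le> k \<Longrightarrow> norm (X j - X k) < e"
      by (meson CauchyD)
    show "\<exists>M. \<forall>j\<ge>M. \<forall>k\<ge>M. norm (ell2_coord (X j) n - ell2_coord (X k) n) < e"
    proof (intro exI[of _ M] allI impI)
      fix j k assume "M \<le> j" "M \<le> k"
      then show "norm (ell2_coord (X j) n - ell2_coord (X k) n) < e"
        using M[of j k] coord_le[of "X j - X k" n] by (simp add: minus_ell2.rep_eq)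
    qed
  qed
  then have lim: "(\<lambda>k. ell2_coord (X k) n) \<longlonglongrightarrow> lim (\<lambda>k. ell2_coord (X k) n)" for n
    by (simp add: Cauchy_convergent_iff convergent_LIMSEQ_iff)
  define v where "v n = lim (\<lambda>k. ell2_coord (X k) n)" for n
  have v: "(\<lambda>k. ell2_coord (X k) n) \<longlonglongrightarrow> v n" for n
    unfolding v_def by (rule lim)
  have tail: "summable (\<lambda>n. (cmod (ell2_coord (X j) n - v n))\<^sup>2) \<and>
      (\<Sum>n. (cmod (ell2_coord (X j) n - v n))\<^sup>2) \<le> e\<^sup>2"
    if M: "\<And>j k. M \<le> j \<Longrightarrow> M \<le> k \<Longrightarrow> norm (X j - X k) < e" and "M \<le> j" for M j e
  proof -
    have part: "(\<Sum>n<K. (cmod (ell2_coord (X j) n - v n))\<^sup>2) \<le> e\<^sup>2" for K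
    proof (rule tendsto_upperbound)
      show "(\<lambda>k. \<Sum>n<K. (cmod (ell2_coord (X j) n - ell2_coord (X k) n))\<^sup>2)
          \<longlonglongrightarrow> (\<Sum>n<K. (cmod (ell2_coord (X j) n - v n))\<^sup>2)"
        by (intro tendsto_intros v)
      show "\<forall>\<^sub>F k in sequentially. (\<Sum>n<K. (cmod (ell2_coord (X j) n - ell2_coord (X k) n))\<^sup>2) \<le> e\<^sup>2"
      proof (rule eventually_sequentiallyI)
        fix k assume "M \<le> k"
        have "(\<Sum>n<K. (cmod (ell2_coord (X j) n - ell2_coord (X k) n))\<^sup>2) \<le> (norm (X j - X k))\<^sup>2"
          using ell2_partial_sum_le[where x = "X j - X k"] by (simp add: minus_ell2.rep_eq)
        also have "\<dots> \<le> e\<^sup>2"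
          using M[OF \<open>M \<le> j\<close> \<open>M \<le> k\<close>] by (intro power_mono) auto
        finally show "(\<Sum>n<K. (cmod (ell2_coord (X j) n - ell2_coord (X k) n))\<^sup>2) \<le> e\<^sup>2" .
      qed
    qed simp
    have "summable (\<lambda>n. (cmod (ell2_coord (X j) n - v n))\<^sup>2)"
    proof (rule summableI_nonneg_bounded)
      show "(\<Sum>n<K. (cmod (ell2_coord (X j) n - v n))\<^sup>2) \<le> e\<^sup>2" for K by (rule part)
    qed simp
    moreover from this have "(\<Sum>n. (cmod (ell2_coord (X j) n - v n))\<^sup>2) \<le> e\<^sup>2"
      using part by (intro suminf_le_const) auto
    ultimately show ?thesis ..
  qed
  obtain M where "\<And>j k. M \<le> j \<Longrightarrow> M \<le> k \<Longrightarrow> norm (X j - X k) < 1"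
    using X by (meson CauchyD zero_less_one)
  from tail[OF this order_refl] have "summable (\<lambda>n. (cmod (ell2_coord (X M) n - v n))\<^sup>2)" by blast
  then have "summable (\<lambda>n. (cmod (- 1 * (ell2_coord (X M) n - v n)))\<^sup>2)"
    by (rule ell2_summable_scale)
  from ell2_summable_add[OF ell2_summable[of "X M"] this]
  have "summable (\<lambda>n. (cmod (v n))\<^sup>2)" by simp
  then obtain V where V: "ell2_coord V = v"
    using Ell2_inverse[of v] by auto
  have "X \<longlonglongrightarrow> V"
  proof (rule LIMSEQ_I)
    fix r :: real assume "0 < r"
    then obtain M where M: "\<And>j k. M \<le> j \<Longrightarrow> M \<le> k \<Longrightarrow> norm (X j - X k) < r / 2"
      using X by (meson CauchyD half_gt_zero)
    show "\<exists>M. \<forall>j\<ge>M. norm (X j - V) < r"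
    proof (intro exI[of _ M] allI impI)
      fix j assume "M \<le> j"
      from tail[OF M this] have "(norm (X j - V))\<^sup>2 \<le> (r / 2)\<^sup>2"
        by (simp add: norm_ell2_sq minus_ell2.rep_eq V)
      then have "norm (X j - V) \<le> r / 2"
        by (rule power2_le_imp_le) (use \<open>0 < r\<close> in simp)
      then show "norm (X j - V) < r" using \<open>0 < r\<close> by simp
    qed
  qed
  then show "convergent X" by (auto simp: convergent_def)
qed

instantiation ell2 :: complex_hilbert
begin

lift_definition scaleC_ell2 :: "complex \<Rightarrow> ell2 \<Rightarrow> ell2" is "\<lambda>c x n. c * x n"
  by (rule ell2_summable_scale)

definition cinner_ell2 :: "ell2 \<Rightarrow> ell2 \<Rightarrow> complex"
  where "cinner_ell2 x y = (\<Sum>n. ell2_coord x n * cnj (ell2_coord y n))"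

instance
proof
  have summ: "summable (\<lambda>n. ell2_coord x n * cnj (ell2_coord y n))" for x y
    by (rule ell2_summable_mult[OF ell2_summable ell2_summable])
  fix x y z :: ell2 and a b :: complex and r :: real
  show "a *\<^sub>C (x + y) = a *\<^sub>C x + a *\<^sub>C y" by transfer (simp add: algebra_simps)
  show "(a + b) *\<^sub>C x = a *\<^sub>C x + b *\<^sub>C x" by transfer (simp add: algebra_simps)
  show "a *\<^sub>C b *\<^sub>C x = (a * b) *\<^sub>C x" by transfer (simp add: algebra_simps)
  show "complex_of_real r *\<^sub>C x = r *\<^sub>R x" by transfer simp
  show "cinner x y = cnj (cinner y x)"
  proof -
    have "(\<lambda>n. cnj (ell2_coord y n * cnj (ell2_coord x n))) sums cnj (cinner y x)"
      unfolding sums_cnj cinner_ell2_def by (rule summable_sums[OF summ])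
    then show ?thesis
      by (simp add: cinner_ell2_def sums_iff mult.commute)
  qed
  show "cinner (x + y) z = cinner x z + cinner y z"
    unfolding cinner_ell2_def suminf_add[OF summ summ]
    by (rule arg_cong[where f = suminf], rule ext) (simp add: plus_ell2.rep_eq algebra_simps)
  show "cinner (a *\<^sub>C x) y = a * cinner x y"
    unfolding cinner_ell2_def suminf_mult[OF summ, symmetric]
    by (rule arg_cong[where f = suminf], rule ext) (simp add: scaleC_ell2.rep_eq algebra_simps)
  show "inner x y = Re (cinner x y)"
    by (simp add: inner_ell2_def cinner_ell2_def)
qed

end

text \<open>Operator convexity of \<open>f\<close> on \<open>(0,\<infinity>)\<close>: convexity with respect to the operator order on the
  positive invertible operators of an infinite-dimensional Hilbert space, here \<open>\<ell>\<^sup>2(\<nat>)\<close>. Only the values of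
  \<open>f\<close> on \<open>(0,\<infinity>)\<close> matter. Scalar operators give ordinary convexity, hence continuity, so \<open>cfc_on\<close> is
  always applied to a continuous function when the condition holds.\<close>

definition operator_convex :: "(real \<Rightarrow> real) \<Rightarrow> bool"
  where "operator_convex f \<longleftrightarrow>
    (\<forall>(X :: ell2 bop) (Y :: ell2 bop) (t :: real).
      positive_op X \<and> invertible_on 1 X \<and> positive_op Y \<and> invertible_on 1 Y \<and> 0 \<le> t \<and> t \<le> 1 \<longrightarrow>
      cfc_on 1 f ((1 - t) *\<^sub>R X + t *\<^sub>R Y) \<le>\<^sub>B (1 - t) *\<^sub>R cfc_on 1 f X + t *\<^sub>R cfc_on 1 f Y)"


section \<open>Trace class operators and normal functionals\<close>

definition is_onb :: "'a::complex_hilbert set \<Rightarrow> bool"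
  where "is_onb E \<longleftrightarrow> (\<forall>e\<in>E. \<forall>e'\<in>E. cinner e e' = (if e = e' then 1 else 0)) \<and>
    (\<forall>x. (\<forall>e\<in>E. cinner x e = 0) \<longrightarrow> x = 0)"

definition some_onb :: "'a::complex_hilbert set"
  where "some_onb = (SOME E. is_onb E)"

definition abs_op :: "'a::complex_hilbert bop \<Rightarrow> 'a bop"
  where "abs_op T = sqrt_op (adj_op T * T)"

definition trace_class :: "'a::complex_hilbert bop \<Rightarrow> bool"
  where "trace_class T \<longleftrightarrow> (\<exists>E. is_onb E \<and> (\<lambda>e. cinner (abs_op T e) e) summable_on E)"

text \<open>The trace does not depend on the chosen basis.\<close>

definition op_trace :: "'a::complex_hilbert bop \<Rightarrow> complex"
  where "op_trace T = (\<Sum>\<^sub>\<infinity>e\<in>some_onb. cinner (T e) e)"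

definition normal_pos :: "('a::complex_hilbert bop \<Rightarrow>\<^sub>L complex) set"
  where "normal_pos = {\<rho> :: 'a bop \<Rightarrow>\<^sub>L complex. \<exists>D. positive_op D \<and> trace_class D \<and>
    (\<forall>X. \<rho> X = op_trace (X * D))}"

lift_definition vector_functional :: "'a::complex_hilbert \<Rightarrow> ('a bop \<Rightarrow>\<^sub>L complex)"
  is "\<lambda>\<xi> (X :: 'a bop). cinner (X \<xi>) \<xi>"
proof -
  fix \<xi> :: 'a
  have "bounded_linear (\<lambda>X :: 'a bop. X \<xi>)"
  proof (rule bounded_linear_intro[where K = "norm \<xi>"])
    fix X :: "'a bop"
    show "norm (X \<xi>) \<le> norm X * norm \<xi>"
      by transfer (simp add: onorm)
  qed (simp_all add: plus_bop.rep_eq scaleR_bop.rep_eq)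
  then show "bounded_linear (\<lambda>X :: 'a bop. cinner (X \<xi>) \<xi>)"
    by (rule bounded_linear_compose[OF bounded_linear_cinner_left])
qed


section \<open>Extended lower bounded operators\<close>

text \<open>The maps \<open>m\<close> live on \<open>normal_pos\<close> only; \<open>extensional\<close> fixes a dummy value elsewhere.
  In \<^typ>\<open>ereal\<close>, \<open>0 * \<infinity> = 0\<close>. The topology on functionals is that of the norm.\<close>

definition hatB_lb :: "(('a::complex_hilbert bop \<Rightarrow>\<^sub>L complex) \<Rightarrow> ereal) set"
  where "hatB_lb = {m \<in> extensional normal_pos.
    (\<forall>\<rho>\<in>normal_pos. m \<rho> \<noteq> - \<infinity>) \<and>
    (\<forall>c\<ge>0. \<forall>\<rho>\<in>normal_pos. m (c *\<^sub>R \<rho>) = ereal c * m \<rho>) \<and>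
    (\<forall>\<rho>\<in>normal_pos. \<forall>\<sigma>\<in>normal_pos. m (\<rho> + \<sigma>) = m \<rho> + m \<sigma>) \<and>
    (\<forall>\<rho>\<in>normal_pos. m \<rho> \<le> Liminf (at \<rho> within normal_pos) m) \<and>
    (\<exists>l\<ge>0. \<forall>\<rho>\<in>normal_pos. 0 \<le> m \<rho> + ereal (l * Re (\<rho> 1)))}"

definition hatB_pos :: "(('a::complex_hilbert bop \<Rightarrow>\<^sub>L complex) \<Rightarrow> ereal) set"
  where "hatB_pos = {m \<in> hatB_lb. \<forall>\<rho>\<in>normal_pos. 0 \<le> m \<rho>}"

definition C1_sa :: "'a::complex_hilbert bop set"
  where "C1_sa = {X. selfadjoint_op X \<and> trace_class X}"

text \<open>The pointwise sum \<open>T + X\<close>, with self-adjoint \<open>X\<close> identified with \<open>\<rho> \<mapsto> \<rho>(X)\<close>, which is real on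
  positive functionals.\<close>

definition ext_plus ::
    "(('a::complex_hilbert bop \<Rightarrow>\<^sub>L complex) \<Rightarrow> ereal) \<Rightarrow> 'a bop \<Rightarrow> ('a bop \<Rightarrow>\<^sub>L complex) \<Rightarrow> ereal"
  where "ext_plus T X = (\<lambda>\<rho>\<in>normal_pos. T \<rho> + ereal (Re (\<rho> X)))"

definition hatB_pos_plus_C1_sa :: "(('a::complex_hilbert bop \<Rightarrow>\<^sub>L complex) \<Rightarrow> ereal) set"
  where "hatB_pos_plus_C1_sa = {ext_plus T X | T X. T \<in> hatB_pos \<and> X \<in> C1_sa}"

definition trace_hatB_pos :: "(('a::complex_hilbert bop \<Rightarrow>\<^sub>L complex) \<Rightarrow> ereal) \<Rightarrow> ereal"
  where "trace_hatB_pos T = (\<Sum>\<^sub>\<infinity>e\<in>some_onb. T (vector_functional e))"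

text \<open>\<open>Tr (T + X) = Tr T + Tr X\<close>, which does not depend on the decomposition.\<close>

definition ext_trace :: "(('a::complex_hilbert bop \<Rightarrow>\<^sub>L complex) \<Rightarrow> ereal) \<Rightarrow> ereal"
  where "ext_trace m = (THE v. \<exists>T\<in>hatB_pos. \<exists>X\<in>C1_sa.
    m = ext_plus T X \<and> v = trace_hatB_pos T + ereal (Re (op_trace X)))"


section \<open>The extended operator perspective\<close>

definition slope_at_inf :: "(real \<Rightarrow> real) \<Rightarrow> ereal"
  where "slope_at_inf f = Lim at_top (\<lambda>t. ereal (f t / t))"

definition value_at_0 :: "(real \<Rightarrow> real) \<Rightarrow> ereal"
  where "value_at_0 f = Lim (at_right 0) (\<lambda>t. ereal (f t))"

text \<open>Meant for \<open>x, y \<ge> 0\<close>.\<close>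

definition perspective :: "(real \<Rightarrow> real) \<Rightarrow> real \<Rightarrow> real \<Rightarrow> ereal"
  where "perspective f x y =
    (if 0 < x \<and> 0 < y then ereal (y * f (x / y))
     else if y = 0 then slope_at_inf f * ereal x
     else value_at_0 f * ereal y)"

text \<open>Projection-valued Borel measures on the real line with values in the projections of
  \<open>B(PH)\<close>; countable additivity is in the strong operator topology.\<close>

definition pvm_on :: "'a::complex_hilbert bop \<Rightarrow> (real set \<Rightarrow> 'a bop) \<Rightarrow> bool"
  where "pvm_on P E \<longleftrightarrow>
    (\<forall>\<Delta>\<in>sets borel. projection_op (E \<Delta>)) \<and> E UNIV = P \<and>
    (\<forall>D :: nat \<Rightarrow> real set. range D \<subseteq> sets borel \<and> disjoint_family D \<longrightarrow>
      (\<forall>x. (\<lambda>n. E (D n) x) sums E (\<Union>n. D n) x))"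

definition pvm_measure :: "(real set \<Rightarrow> 'a::complex_hilbert bop) \<Rightarrow> 'a \<Rightarrow> real measure"
  where "pvm_measure E x = measure_of UNIV (sets borel) (\<lambda>\<Delta>. ennreal (Re (cinner (E \<Delta> x) x)))"

text \<open>The spectral measure \<open>E\<close> of a self-adjoint \<open>T\<close> in \<open>B(PH)\<close>, i.e. \<open>T = \<integral> t dE(t)\<close> weakly. It is
  determined on Borel sets, and only its values there are used.\<close>

definition spectral_measure_on :: "'a::complex_hilbert bop \<Rightarrow> 'a bop \<Rightarrow> real set \<Rightarrow> 'a bop"
  where "spectral_measure_on P T = (SOME E. pvm_on P E \<and>
    (\<forall>x. integrable (pvm_measure E x) (\<lambda>t. t) \<and>
         cinner (T x) x = complex_of_real (\<integral>t. t \<partial>pvm_measure E x)))"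

text \<open>With \<open>P\<close> the projection onto \<open>H\<^sub>A\<^sub>,\<^sub>B\<close>, the closed range of \<open>A + B\<close>, the map \<open>T\<^sub>A\<^sub>,\<^sub>B\<close> is \<open>(A + B)\<^sup>1\<^sup>/\<^sup>2\<close>
  with codomain \<open>H\<^sub>A\<^sub>,\<^sub>B\<close>. Its adjoint is the restriction of \<open>(A + B)\<^sup>1\<^sup>/\<^sup>2\<close> to \<open>H\<^sub>A\<^sub>,\<^sub>B\<close>, so that for \<open>Z\<close> in the
  corner of \<open>P\<close> the operator \<open>T\<^sub>A\<^sub>,\<^sub>B\<^sup>* Z T\<^sub>A\<^sub>,\<^sub>B\<close> is \<open>compress A B Z\<close>.\<close>

definition compress :: "'a::complex_hilbert bop \<Rightarrow> 'a bop \<Rightarrow> 'a bop \<Rightarrow> 'a bop"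
  where "compress A B Z = sqrt_op (A + B) * Z * sqrt_op (A + B)"

definition RS_pair :: "'a::complex_hilbert bop \<Rightarrow> 'a bop \<Rightarrow> 'a bop \<times> 'a bop"
  where "RS_pair A B = (let P = support_proj (A + B) in
    THE (R, S). R \<in> corner P \<and> S \<in> corner P \<and> positive_op R \<and> positive_op S \<and>
      norm R \<le> 1 \<and> norm S \<le> 1 \<and> R + S = P \<and> A = compress A B R \<and> B = compress A B S)"

text \<open>The Borel measure \<open>\<Delta> \<mapsto> \<rho>(T\<^sub>A\<^sub>,\<^sub>B\<^sup>* E\<^sub>R(\<Delta>) T\<^sub>A\<^sub>,\<^sub>B)\<close> on \<open>[0,1]\<close>.\<close>

definition RS_measure ::
    "'a::complex_hilbert bop \<Rightarrow> 'a bop \<Rightarrow> ('a bop \<Rightarrow>\<^sub>L complex) \<Rightarrow> real measure"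
  where "RS_measure A B \<rho> = measure_of {0..1} (sets (restrict_space borel {0..1}))
    (\<lambda>\<Delta>. ennreal (Re (\<rho> (compress A B
      (spectral_measure_on (support_proj (A + B)) (fst (RS_pair A B)) \<Delta>)))))"

text \<open>The integral of an extended real function whose negative part is integrable; \<^const>\<open>e2ennreal\<close> sends
  negative arguments to 0.\<close>

definition ereal_integral :: "'b measure \<Rightarrow> ('b \<Rightarrow> ereal) \<Rightarrow> ereal"
  where "ereal_integral M g =
    enn2ereal (\<integral>\<^sup>+ x. e2ennreal (g x) \<partial>M) - enn2ereal (\<integral>\<^sup>+ x. e2ennreal (- g x) \<partial>M)"

definition op_perspective ::
    "(real \<Rightarrow> real) \<Rightarrow> 'a::complex_hilbert bop \<Rightarrow> 'a bop \<Rightarrow> ('a bop \<Rightarrow>\<^sub>L complex) \<Rightarrow> ereal"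
  where "op_perspective f A B =
    (\<lambda>\<rho>\<in>normal_pos. ereal_integral (RS_measure A B \<rho>) (\<lambda>r. perspective f r (1 - r)))"


section \<open>The maximal f-divergence\<close>

definition comparable_ops :: "'a::complex_hilbert bop \<Rightarrow> 'a bop \<Rightarrow> bool"
  where "comparable_ops A B \<longleftrightarrow> (\<exists>l>0. inverse l *\<^sub>R B \<le>\<^sub>B A \<and> A \<le>\<^sub>B l *\<^sub>R B)"

definition rel_op :: "'a::complex_hilbert bop \<Rightarrow> 'a bop \<Rightarrow> 'a bop"
  where "rel_op A B = (let P = support_proj B in
    THE W. W \<in> corner P \<and> positive_op W \<and> invertible_on P W \<and> A = sqrt_op B * W * sqrt_op B)"

definition max_f_div_comparable ::
    "(real \<Rightarrow> real) \<Rightarrow> 'a::complex_hilbert bop \<Rightarrow> 'a bop \<Rightarrow> real"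
  where "max_f_div_comparable f A B = Re (op_trace (B * cfc_on (support_proj B) f (rel_op A B)))"

definition max_f_div :: "(real \<Rightarrow> real) \<Rightarrow> 'a::complex_hilbert bop \<Rightarrow> 'a bop \<Rightarrow> ereal"
  where "max_f_div f A B =
    (if comparable_ops A B then ereal (max_f_div_comparable f A B)
     else Lim (at_right 0) (\<lambda>\<epsilon>. ereal (max_f_div_comparable f
       (A + \<epsilon> *\<^sub>R (A + B)) (B + \<epsilon> *\<^sub>R (A + B)))))"

end

theory Submission
  imports Defs
begin

text \<open>Put \<open>C = A + B\<close> and \<open>K = C\<^sup>1\<^sup>/\<^sup>2\<close>, so that \<open>A = K R K\<close> and \<open>B = K S K\<close> with \<open>R + S\<close> the support projection \<open>P\<close> of \<open>C\<close>;
  let \<open>E\<close> be the spectral measure of \<open>R\<close> and \<open>\<mu> x = \<langle>E(\<cdot>) x, x\<rangle>\<close>. The function \<open>g(r) = \<phi>\<^sub>f(r, 1 - r)\<close> is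
  bounded below by some \<open>- l\<close>, so \<open>\<phi>\<^sub>f(A, B)\<close> is a positive extended operator minus the trace class
  operator \<open>l C\<close>, and its trace is the sum of \<open>\<integral> g d\<mu>(K e)\<close> over an orthonormal basis.

  If \<open>A\<close> and \<open>B\<close> are comparable, then \<open>B\<^sup>1\<^sup>/\<^sup>2\<close> and \<open>S\<^sup>1\<^sup>/\<^sup>2 K\<close> differ by a unitary of \<open>B(PH)\<close>, which carries \<open>W\<close> to
  \<open>R S\<^sup>-\<^sup>1\<close>; hence \<open>Tr B f(W)\<close> is the same sum of integrals. In general, subadditivity of the perspective
  makes \<open>\<phi>\<^sub>f(r + \<epsilon>, 1 - r + \<epsilon>) - \<epsilon> f(1)\<close> increase to \<open>g(r)\<close> as \<open>\<epsilon>\<close> decreases to \<open>0\<close>, and monotone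
  convergence applies.\<close>

section \<open>Complex Hilbert spaces\<close>

text \<open>The two sides live in different pictures: W is built from B^(1/2), the operator R from
  C^(1/2). Everything is carried over to functions of R. Since C = K P K, the operators A +
  \<epsilon> C and B + \<epsilon> C are K (R + \<epsilon> P) K and K (S + \<epsilon> P) K, so one K,
  one spectral measure and one basis sum serve for every \<epsilon>, without dividing by 1 + 2
  \<epsilon>. The correction \<epsilon> f(1) is the perspective at (\<epsilon>, \<epsilon>), and l
  comes from a supporting line of f at 1. Operator convexity, tested on scalar operators, supplies
  the convexity behind these estimates.

  Two obstacles shape the rest. The spectral measure is chosen by its weak integral formula alone,
  so commutation with R, the moments and the agreement with the norm limit in \<open>cfc_on\<close>
  have to be derived from that formula. The basis may be uncountable and the integrals infinite, so
  sums are exchanged in \<open>ennreal\<close> after a shift, and the finite shift is removed at the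
  end.\<close>

instance complex_hilbert \<subseteq> banach ..

lemma cinner_add_right: "cinner x (y + z) = cinner x y + cinner x (z :: 'a::complex_hilbert)"
  by (metis cinner_add_left cinner_commute complex_cnj_add)

lemma cinner_scaleC_right: "cinner x (a *\<^sub>C y) = cnj a * cinner x (y :: 'a::complex_hilbert)"
  by (metis cinner_scaleC_left cinner_commute complex_cnj_mult)

lemma cinner_scaleR_left: "cinner (r *\<^sub>R x) y = of_real r * cinner x (y :: 'a::complex_hilbert)"
  by (simp add: scaleC_of_real[symmetric] cinner_scaleC_left)

lemma cinner_scaleR_right: "cinner x (r *\<^sub>R y) = of_real r * cinner x (y :: 'a::complex_hilbert)"
  by (simp add: scaleC_of_real[symmetric] cinner_scaleC_right)

lemma cinner_zero_left [simp]: "cinner 0 (y :: 'a::complex_hilbert) = 0"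
  using cinner_scaleR_left[of 0 0 y] by simp

lemma cinner_zero_right [simp]: "cinner (y :: 'a::complex_hilbert) 0 = 0"
  using cinner_scaleR_right[of y 0 0] by simp

lemma cinner_minus_left: "cinner (- x) (y :: 'a::complex_hilbert) = - cinner x y"
  using cinner_scaleR_left[of "-1" x y] by simp

lemma cinner_minus_right: "cinner x (- y :: 'a::complex_hilbert) = - cinner x y"
  using cinner_scaleR_right[of x "-1" y] by simp

lemma cinner_diff_left: "cinner (x - z) (y :: 'a::complex_hilbert) = cinner x y - cinner z y"
  using cinner_add_left[of x "- z" y] by (simp add: cinner_minus_left)

lemma cinner_diff_right: "cinner x (y - z :: 'a::complex_hilbert) = cinner x y - cinner x z"
  using cinner_add_right[of x y "- z"] by (simp add: cinner_minus_right)

lemma cinner_sum_left: "cinner (sum f A) (y :: 'a::complex_hilbert) = (\<Sum>i\<in>A. cinner (f i) y)"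
  by (induction A rule: infinite_finite_induct) (auto simp: cinner_add_left)

lemma cinner_sum_right: "cinner (y :: 'a::complex_hilbert) (sum f A) = (\<Sum>i\<in>A. cinner y (f i))"
  by (induction A rule: infinite_finite_induct) (auto simp: cinner_add_right)

lemmas cinner_simps = cinner_add_left cinner_add_right cinner_scaleC_left cinner_scaleC_right
  cinner_scaleR_left cinner_scaleR_right cinner_minus_left cinner_minus_right
  cinner_diff_left cinner_diff_right

lemma Im_cinner': "Im (cinner x y) = - inner (\<i> *\<^sub>C x) (y :: 'a::complex_hilbert)"
  by (simp add: inner_eq_Re_cinner cinner_scaleC_left)

lemma cinner_self: "cinner x (x :: 'a::complex_hilbert) = complex_of_real ((norm x)\<^sup>2)"
proof -
  have "Im (cinner x x) = 0"
    using arg_cong[OF cinner_commute[of x x], of Im] by simp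
  moreover have "Re (cinner x x) = (norm x)\<^sup>2"
    by (simp add: inner_eq_Re_cinner[symmetric] power2_norm_eq_inner)
  ultimately show ?thesis by (simp add: complex_eq_iff)
qed

text \<open>The unimodular factor \<open>c\<close> rotates x so that the complex inner product
  becomes a nonnegative real one; the real Cauchy-Schwarz inequality then loses no factor.\<close>

lemma norm_cinner_le: "cmod (cinner x y) \<le> norm x * norm (y :: 'a::complex_hilbert)"
proof (cases "cinner x y = 0")
  case False
  define c where "c = cnj (cinner x y) / of_real (cmod (cinner x y))"
  have c: "cmod c = 1" using False by (simp add: c_def norm_divide)
  have "c * cinner x y = of_real (cmod (cinner x y))"
    using False complex_norm_square[of "cinner x y"]
    by (simp add: c_def field_simps power2_eq_square)
  then have "cmod (cinner x y) = inner (c *\<^sub>C x) y"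
    by (simp add: inner_eq_Re_cinner cinner_scaleC_left)
  also have "\<dots> \<le> norm (c *\<^sub>C x) * norm y" by (rule norm_cauchy_schwarz)
  finally show ?thesis by (simp add: norm_scaleC c)
qed simp

text \<open>The imaginary part of \<open>cinner x w\<close> is, up to sign, the real inner product
  of \<open>\<i> *\<^sub>C x\<close> with w. Hence real orthogonality to a set stable under complex
  scalars is complex orthogonality, and Riesz representation can be done over the reals.\<close>

lemma cinner_eq_zero_if_inner:
  fixes w :: "'a::complex_hilbert"
  assumes "\<And>x. x \<in> M \<Longrightarrow> inner x w = 0" "\<And>x c. x \<in> M \<Longrightarrow> c *\<^sub>C x \<in> M" "x \<in> M"
  shows "cinner x w = 0"
  using assms by (simp add: complex_eq_iff inner_eq_Re_cinner[symmetric] Im_cinner')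

lemma tendsto_cinner:
  fixes x y :: "'a::complex_hilbert"
  assumes "(f \<longlongrightarrow> x) F" "(g \<longlongrightarrow> y) F"
  shows "((\<lambda>i. cinner (f i) (g i)) \<longlongrightarrow> cinner x y) F"
proof -
  have eq: "cinner u v = Complex (inner u v) (- inner (\<i> *\<^sub>C u) v)" for u v :: 'a
    by (simp add: complex_eq_iff Im_cinner' inner_eq_Re_cinner[symmetric])
  have "((\<lambda>i. \<i> *\<^sub>C f i) \<longlongrightarrow> \<i> *\<^sub>C x) F"
    using bounded_linear.tendsto[OF bounded_linear_scaleC_right assms(1)] .
  then show ?thesis
    unfolding eq using assms by (intro tendsto_intros)
qed

section \<open>Bounded operators\<close>

lemma bounded_linear_bop: "bounded_linear (bop_apply T)"
  using bop_apply[of T] by simp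

lemma bop_scaleC: "bop_apply T (c *\<^sub>C x) = c *\<^sub>C bop_apply T x"
  using bop_apply[of T] by simp

lemma bop_add: "bop_apply T (x + y) = bop_apply T x + bop_apply T y"
  by (simp add: bounded_linear_bop linear_add bounded_linear.linear)

lemma bop_diff: "bop_apply T (x - y) = bop_apply T x - bop_apply T y"
  by (simp add: bounded_linear_bop linear_diff bounded_linear.linear)

lemma bop_minus: "bop_apply T (- x) = - bop_apply T x"
  by (simp add: bounded_linear_bop linear_neg bounded_linear.linear)

lemma bop_scaleR: "bop_apply T (r *\<^sub>R x) = r *\<^sub>R bop_apply T x"
  by (simp add: bounded_linear_bop linear_scale bounded_linear.linear)

lemma bop_zero [simp]: "bop_apply T 0 = 0"
  by (simp add: bounded_linear_bop linear_0 bounded_linear.linear)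

lemma bop_sum: "bop_apply T (sum f A) = (\<Sum>i\<in>A. bop_apply T (f i))"
  by (simp add: bounded_linear_bop linear_sum bounded_linear.linear)

lemma norm_bop_apply: "norm (bop_apply T x) \<le> norm T * norm x"
  by (simp add: norm_bop.rep_eq onorm bounded_linear_bop)

lemma norm_bop_le:
  assumes "\<And>x. norm (bop_apply T x) \<le> c * norm x" "0 \<le> c"
  shows "norm T \<le> c"
  using assms by (simp add: norm_bop.rep_eq onorm_bound)

lemma bop_eqI: "(\<And>x. bop_apply S x = bop_apply T x) \<Longrightarrow> S = T"
  using bop_apply_inject by blast

lemmas bop_rep_eq = plus_bop.rep_eq minus_bop.rep_eq uminus_bop.rep_eq scaleR_bop.rep_eq
  scaleC_bop.rep_eq zero_bop.rep_eq one_bop.rep_eq times_bop.rep_eq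

lemmas bop_linear = bop_scaleC bop_add bop_diff bop_minus bop_scaleR

lemma sum_bop_apply: "bop_apply (sum f A) x = (\<Sum>i\<in>A. bop_apply (f i) x)"
  by (induction A rule: infinite_finite_induct) (auto simp: bop_rep_eq)

text \<open>Turns maps given pointwise, as limits or as representing vectors, into operators. Real
  homogeneity is complex homogeneity at \<open>of_real r\<close>.\<close>

lemma bop_construct:
  fixes L :: "'a::complex_hilbert \<Rightarrow> 'a"
  assumes "\<And>x y. L (x + y) = L x + L y" "\<And>c x. L (c *\<^sub>C x) = c *\<^sub>C L x"
    "\<And>x. norm (L x) \<le> K * norm x"
  obtains T where "\<And>x. bop_apply T x = L x"
proof -
  have "bounded_linear L"
  proof (rule bounded_linear_intro[where K = K])
    show "L (r *\<^sub>R x) = r *\<^sub>R L x" for r x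
      using assms(2)[of "of_real r" x] by (simp add: scaleC_of_real)
  qed (use assms in \<open>simp_all add: mult.commute\<close>)
  then have "bop_apply (Bop L) = L" using assms by (simp add: Bop_inverse)
  then show thesis using that by metis
qed

lemma tendsto_bop_apply:
  assumes "(f \<longlongrightarrow> x) F"
  shows "((\<lambda>i. bop_apply T (f i)) \<longlongrightarrow> bop_apply T x) F"
  using bounded_linear.tendsto[OF bounded_linear_bop assms] .

lemma bounded_linear_eval: "bounded_linear (\<lambda>T :: 'a::complex_hilbert bop. bop_apply T x)"
  by (rule bounded_linear_intro[where K = "norm x"]) (simp_all add: bop_rep_eq norm_bop_apply)

lemma tendsto_eval:
  assumes "(f \<longlongrightarrow> T) F"
  shows "((\<lambda>i. bop_apply (f i) x) \<longlongrightarrow> bop_apply T x) F"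
  using bounded_linear.tendsto[OF bounded_linear_eval assms] .

text \<open>Pointwise limits define the limit operator. Letting n tend to infinity in the Cauchy
  estimate for \<open>X m - X n\<close> at each vector gives a bound uniform over vectors, hence
  norm convergence.\<close>

instance bop :: (complex_hilbert) banach
proof
  fix X :: "nat \<Rightarrow> 'a bop" assume X: "Cauchy X"
  have "Cauchy (\<lambda>n. bop_apply (X n) x)" for x
    using bounded_linear.Cauchy[OF bounded_linear_eval X] .
  then have L: "(\<lambda>n. bop_apply (X n) x) \<longlonglongrightarrow> lim (\<lambda>n. bop_apply (X n) x)" for x
    by (simp add: Cauchy_convergent_iff convergent_LIMSEQ_iff)
  define L where "L x = lim (\<lambda>n. bop_apply (X n) x)" for x
  note L = L[folded L_def]
  obtain K where K: "\<And>n. norm (X n) \<le> K"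
    using Cauchy_Bseq[OF X] by (meson BseqE)
  obtain T where T: "\<And>x. bop_apply T x = L x"
  proof (rule bop_construct)
    show "L (x + y) = L x + L y" for x y
      using LIMSEQ_unique[OF L[of "x + y"]] tendsto_add[OF L[of x] L[of y]] by (simp add: bop_add)
    show "L (c *\<^sub>C x) = c *\<^sub>C L x" for c x
      using LIMSEQ_unique[OF L[of "c *\<^sub>C x"]]
        bounded_linear.tendsto[OF bounded_linear_scaleC_right L[of x], of c] by (simp add: bop_scaleC)
    show "norm (L x) \<le> K * norm x" for x
    proof (rule LIMSEQ_le_const2[OF tendsto_norm[OF L]])
      have "norm (bop_apply (X n) x) \<le> K * norm x" for n
        by (rule order_trans[OF norm_bop_apply]) (simp add: K mult_right_mono)
      then show "\<exists>N. \<forall>n\<ge>N. norm (bop_apply (X n) x) \<le> K * norm x" by auto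
    qed
  qed (rule that)
  have "X \<longlonglongrightarrow> T"
  proof (rule LIMSEQ_I)
    fix r :: real assume "0 < r"
    then obtain M where M: "\<And>m n. M \<le> m \<Longrightarrow> M \<le> n \<Longrightarrow> norm (X m - X n) < r / 2"
      using X by (meson CauchyD half_gt_zero)
    have "norm (X m - T) < r" if "M \<le> m" for m
    proof -
      have "norm (bop_apply (X m - T) x) \<le> r / 2 * norm x" for x
      proof (rule LIMSEQ_le_const2)
        show "(\<lambda>n. norm (bop_apply (X m - X n) x)) \<longlonglongrightarrow> norm (bop_apply (X m - T) x)"
          unfolding bop_rep_eq T by (intro tendsto_intros L)
        have "norm (bop_apply (X m - X n) x) \<le> r / 2 * norm x" if "M \<le> n" for n
          by (rule order_trans[OF norm_bop_apply], rule mult_right_mono)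
            (use M[OF \<open>M \<le> m\<close> that] in auto)
        then show "\<exists>N. \<forall>n\<ge>N. norm (bop_apply (X m - X n) x) \<le> r / 2 * norm x" by blast
      qed
      then have "norm (X m - T) \<le> r / 2" using \<open>0 < r\<close> by (intro norm_bop_le) auto
      then show ?thesis using \<open>0 < r\<close> by simp
    qed
    then show "\<exists>M. \<forall>m\<ge>M. norm (X m - T) < r" by blast
  qed
  then show "convergent X" by (auto simp: convergent_def)
qed

section \<open>Riesz representation, projections and adjoints\<close>

text \<open>The vector \<open>u\<close> minimizes \<open>\<parallel>x\<parallel>\<^sup>2 - 2 l x\<close> over the closure of \<open>D\<close>.\<close>

lemma riesz_subspace:
  fixes D :: "'a::{real_inner,complete_space} set" and l :: "'a \<Rightarrow> real"
  assumes D: "subspace D"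
    and add: "\<And>x y. x \<in> D \<Longrightarrow> y \<in> D \<Longrightarrow> l (x + y) = l x + l y"
    and scale: "\<And>r x. x \<in> D \<Longrightarrow> l (r *\<^sub>R x) = r * l x"
    and bound: "\<And>x. x \<in> D \<Longrightarrow> \<bar>l x\<bar> \<le> c * norm x"
  obtains u where "u \<in> closure D" "\<And>x. x \<in> D \<Longrightarrow> l x = inner x u"
proof -
  define J where "J x = inner x x - 2 * l x" for x
  have bdd: "- c\<^sup>2 \<le> J x" if "x \<in> D" for x
  proof -
    have "0 \<le> (norm x - c)\<^sup>2" by simp
    then have "- c\<^sup>2 \<le> (norm x)\<^sup>2 - 2 * (c * norm x)" by (simp add: power2_diff algebra_simps)
    then show ?thesis using bound[OF that] by (simp add: J_def power2_norm_eq_inner)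
  qed
  define m where "m = Inf (J ` D)"
  have "bdd_below (J ` D)" using bdd by (intro bdd_belowI[where m = "- c\<^sup>2"]) auto
  then have m: "m \<le> J x" if "x \<in> D" for x
    unfolding m_def using that by (intro cInf_lower) auto
  have "\<exists>x\<in>D. J x < m + inverse (real (Suc n))" for n
  proof -
    have "J ` D \<noteq> {}" using subspace_0[OF D] by auto
    moreover have "Inf (J ` D) < m + inverse (real (Suc n))" by (simp add: m_def)
    ultimately obtain z where "z \<in> J ` D" "z < m + inverse (real (Suc n))" by (rule cInf_lessD[THEN bexE])
    then show ?thesis by blast
  qed
  then obtain x where xD: "\<And>n. x n \<in> D" and xJ: "\<And>n. J (x n) < m + inverse (real (Suc n))"
    by metis
  \<comment> \<open>Parallelogram law: the midpoint lies in D, so J is at least m there, and the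
    distance of x i and x j is controlled by their excess over the infimum.\<close>
  have par: "inner (x i - x j) (x i - x j) \<le> 2 * inverse (real (Suc i)) + 2 * inverse (real (Suc j))"
    for i j
  proof -
    let ?h = "(1/2) *\<^sub>R (x i + x j)"
    have "?h \<in> D" using D xD by (meson subspace_add subspace_scale)
    then have "m \<le> J ?h" by (rule m)
    moreover have "l ?h = (l (x i) + l (x j)) / 2"
      using scale[OF subspace_add[OF D xD xD], of "1/2" i j] add[OF xD xD, of i j] by simp
    then have "J (x i) + J (x j) = 2 * J ?h + (1/2) * inner (x i - x j) (x i - x j)"
      by (simp add: J_def inner_add_left inner_add_right inner_diff_left inner_diff_right
          inner_commute field_simps)
    ultimately show ?thesis using xJ[of i] xJ[of j] by linarith
  qed
  have "Cauchy x"
  proof (rule CauchyI)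
    fix e :: real assume e: "0 < e"
    obtain M where M: "inverse (real (Suc M)) < e\<^sup>2 / 4"
      using reals_Archimedean[of "e\<^sup>2/4"] e by auto
    have "norm (x i - x j) < e" if "M \<le> i" "M \<le> j" for i j
    proof -
      have "inverse (real (Suc i)) \<le> inverse (real (Suc M))"
        "inverse (real (Suc j)) \<le> inverse (real (Suc M))"
        using that by (simp_all add: le_imp_inverse_le)
      then have "(norm (x i - x j))\<^sup>2 < e\<^sup>2"
        unfolding power2_norm_eq_inner using par[of i j] M by linarith
      then show ?thesis using e by (intro power2_less_imp_less[of _ e]) auto
    qed
    then show "\<exists>M. \<forall>i\<ge>M. \<forall>j\<ge>M. norm (x i - x j) < e" by blast
  qed
  then obtain u where u: "x \<longlonglongrightarrow> u" by (auto simp: Cauchy_convergent_iff convergent_def)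
  have "u \<in> closure D" using u xD closure_sequential by blast
  moreover have "l v = inner v u" if v: "v \<in> D" for v
  proof -
    have Jm: "(\<lambda>n. J (x n)) \<longlonglongrightarrow> m"
    proof (rule tendsto_sandwich[OF _ _ tendsto_const LIMSEQ_inverse_real_of_nat_add])
      show "\<forall>\<^sub>F n in sequentially. m \<le> J (x n)" using m xD by simp
      show "\<forall>\<^sub>F n in sequentially. J (x n) \<le> m + inverse (real (Suc n))"
        by (rule always_eventually) (use xJ less_imp_le in blast)
    qed
    \<comment> \<open>The functional l is controlled on D only, whereas u lies in the closure. The
      first variation is therefore computed at x n and passed to the limit, using that
      \<open>J (x n)\<close> tends to m.\<close>
    have key: "0 \<le> 2 * t * (inner u v - l v) + t\<^sup>2 * inner v v" for t
    proof -
      have "J (x n) + (2 * t * (inner (x n) v - l v) + t\<^sup>2 * inner v v) - m \<ge> 0" for n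
      proof -
        have tv: "t *\<^sub>R v \<in> D" using D v by (rule subspace_scale)
        then have "x n + t *\<^sub>R v \<in> D" using D xD by (meson subspace_add)
        then have "m \<le> J (x n + t *\<^sub>R v)" by (rule m)
        also have "J (x n + t *\<^sub>R v) = J (x n) + (2 * t * (inner (x n) v - l v) + t\<^sup>2 * inner v v)"
          using add[OF xD tv] scale[OF v]
          by (simp add: J_def inner_add_left inner_add_right inner_commute algebra_simps
              power2_eq_square)
        finally show ?thesis by simp
      qed
      moreover have "(\<lambda>n. J (x n) + (2 * t * (inner (x n) v - l v) + t\<^sup>2 * inner v v) - m)
          \<longlonglongrightarrow> m + (2 * t * (inner u v - l v) + t\<^sup>2 * inner v v) - m"
        by (intro tendsto_intros Jm u)
      ultimately show ?thesis by (smt (verit) LIMSEQ_le_const)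
    qed
    define d where "d = inner u v - l v"
    have d0: "d = 0"
    proof (cases "inner v v = 0")
      case True
      have "0 \<le> 2 * (- d) * d" using key[of "- d"] unfolding d_def[symmetric] True by simp
      then have "d\<^sup>2 \<le> 0" by (simp add: power2_eq_square)
      then show ?thesis by simp
    next
      case False
      then have pos: "inner v v > 0" by (simp add: inner_gt_zero_iff)
      \<comment> \<open>This is \<open>key\<close> at the minimizer t = - d / <v, v> of the
        quadratic.\<close>
      have "0 \<le> - 2 * (d / inner v v) * d + (d / inner v v)\<^sup>2 * inner v v"
        using key[of "- d / inner v v"] by (simp add: d_def[symmetric])
      also have "\<dots> = - (d\<^sup>2 / inner v v)"
        using pos by (simp add: field_simps power2_eq_square)
      finally have "d\<^sup>2 / inner v v \<le> 0" by simp
      then have "d\<^sup>2 \<le> 0" using pos by (simp add: divide_le_0_iff) 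
      then show ?thesis by simp
    qed
    then show ?thesis by (simp add: d_def inner_commute)
  qed
  ultimately show thesis by (rule that)
qed

lemma closure_orthogonal:
  fixes u :: "'a::real_inner"
  assumes "\<And>x. x \<in> D \<Longrightarrow> inner x u = 0" "v \<in> closure D"
  shows "inner v u = 0"
proof -
  have "closed {x. inner x u = 0}" by (intro closed_Collect_eq continuous_intros)
  then have "closure D \<subseteq> {x. inner x u = 0}" using assms(1) by (intro closure_minimal) auto
  then show ?thesis using assms(2) by auto
qed

lemma subspace_range_bop: "subspace (range (bop_apply T))"
proof (rule subspaceI)
  show "0 \<in> range (bop_apply T)" by (rule range_eqI[of _ _ 0]) simp
qed (auto simp: bop_add[symmetric] bop_scaleR[symmetric])

lemma closure_subspace:
  fixes S :: "'a::real_normed_vector set"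
  assumes "subspace S"
  shows "subspace (closure S)"
proof (rule subspaceI)
  show "0 \<in> closure S" using subspace_0[OF assms] closure_subset by blast
  show "x + y \<in> closure S" if xy: "x \<in> closure S" "y \<in> closure S" for x y
  proof -
    obtain f g where "\<And>n. f n \<in> S" "f \<longlonglongrightarrow> x" "\<And>n. g n \<in> S" "g \<longlonglongrightarrow> y"
      using xy unfolding closure_sequential by blast
    then have "(\<lambda>n. f n + g n) \<longlonglongrightarrow> x + y" "\<And>n. f n + g n \<in> S"
      using subspace_add[OF assms] by (auto intro: tendsto_add)
    then show ?thesis unfolding closure_sequential by (intro exI[of _ "\<lambda>n. f n + g n"]) auto
  qed
  show "c *\<^sub>R x \<in> closure S" if x: "x \<in> closure S" for c x
  proof -
    obtain f where "\<And>n. f n \<in> S" "f \<longlonglongrightarrow> x" using x unfolding closure_sequential by blast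
    then have "(\<lambda>n. c *\<^sub>R f n) \<longlonglongrightarrow> c *\<^sub>R x" "\<And>n. c *\<^sub>R f n \<in> S"
      using subspace_scale[OF assms] by (auto intro: tendsto_scaleR)
    then show ?thesis unfolding closure_sequential by (intro exI[of _ "\<lambda>n. c *\<^sub>R f n"]) auto
  qed
qed

lemma scaleC_closure_range:
  assumes "u \<in> closure (range (bop_apply T))"
  shows "c *\<^sub>C u \<in> closure (range (bop_apply T))"
proof -
  have "(\<lambda>x. c *\<^sub>C x) ` closure (range (bop_apply T)) \<subseteq> closure (range (bop_apply T))"
  proof (rule image_closure_subset)
    show "continuous_on (closure (range (bop_apply T))) (\<lambda>x. c *\<^sub>C x)"
      by (rule linear_continuous_on[OF bounded_linear_scaleC_right])
    show "(\<lambda>x. c *\<^sub>C x) ` range (bop_apply T) \<subseteq> closure (range (bop_apply T))"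
      using closure_subset by (force simp: bop_scaleC[symmetric])
  qed simp
  then show ?thesis using assms by auto
qed

text \<open>Douglas' factorization \<open>L\<^sup>* = M\<^sup>* Y\<close>.\<close>

lemma douglas:
  fixes L M :: "'a::complex_hilbert bop"
  assumes c: "0 \<le> c" and le: "\<And>x. norm (L x) \<le> c * norm (M x)"
  obtains Y where "\<And>x w. cinner (L x) w = cinner (M x) (bop_apply Y w)"
    "\<And>w. bop_apply Y w \<in> closure (range (bop_apply M))"
proof -
  let ?D = "range (bop_apply M)"
  have sub: "subspace (closure ?D)" by (rule closure_subspace[OF subspace_range_bop])
  have ex: "\<exists>u\<in>closure ?D. \<forall>x. inner (L x) w = inner (M x) u" for w
  proof -
    \<comment> \<open>\<open>pre\<close> picks a preimage under M. The bound gives L x = L y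
      whenever M x = M y, so \<open>l\<close> does not depend on the choice and is linear on the
      range of M.\<close>
    define pre where "pre v = (SOME x. M x = v)" for v
    have pre: "M (pre v) = v" if "v \<in> ?D" for v
      unfolding pre_def by (rule someI_ex) (use that in auto)
    have Leq: "L x = L y" if "M x = M y" for x y
      using le[of "x - y"] that by (simp add: bop_diff)
    have lM: "L (pre (M x)) = L x" for x by (rule Leq) (simp add: pre)
    define l where "l v = inner (L (pre v)) w" for v
    have l: "l (M x) = inner (L x) w" for x by (simp add: l_def lM)
    obtain u where u: "u \<in> closure ?D" "\<And>x. x \<in> ?D \<Longrightarrow> l x = inner x u"
    proof (rule riesz_subspace[of ?D l "c * norm w"])
      show "subspace ?D" by (rule subspace_range_bop)
      show "l (x + y) = l x + l y" if "x \<in> ?D" "y \<in> ?D" for x y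
        using that by (auto simp: bop_add[symmetric] l) (simp add: bop_add inner_add_left)
      show "l (r *\<^sub>R x) = r * l x" if "x \<in> ?D" for r x
        using that by (auto simp: bop_scaleR[symmetric] l) (simp add: bop_scaleR)
      show "\<bar>l x\<bar> \<le> c * norm w * norm x" if x: "x \<in> ?D" for x
      proof -
        obtain y where y: "x = M y" using x by auto
        have "\<bar>l x\<bar> \<le> norm (L y) * norm w" unfolding y l by (rule Cauchy_Schwarz_ineq2)
        also have "\<dots> \<le> (c * norm (M y)) * norm w" by (intro mult_right_mono le) auto
        finally show ?thesis by (simp add: y algebra_simps)
      qed
    qed (rule that)
    then show ?thesis using l by (metis rangeI)
  qed
  then obtain Y where Y: "\<And>w. Y w \<in> closure ?D" "\<And>w x. inner (L x) w = inner (M x) (Y w)"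
    by metis
  have cY: "cinner (L x) w = cinner (M x) (Y w)" for x w
    using Y(2)[of x w] Y(2)[of "\<i> *\<^sub>C x" w]
    by (simp add: complex_eq_iff Im_cinner' bop_scaleC inner_eq_Re_cinner[symmetric])
  have uniq: "u = v" if "u \<in> closure ?D" "v \<in> closure ?D" "\<And>x. cinner (M x) u = cinner (M x) v" for u v
  proof -
    have "u - v \<in> closure ?D" using sub that by (simp add: subspace_diff)
    moreover have "inner x (u - v) = 0" if "x \<in> ?D" for x
      using that \<open>\<And>x. cinner (M x) u = cinner (M x) v\<close> by (auto simp: inner_eq_Re_cinner cinner_simps)
    ultimately have "inner (u - v) (u - v) = 0" by (rule closure_orthogonal[rotated])
    then show ?thesis by simp
  qed
  obtain T where T: "\<And>w. bop_apply T w = Y w"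
  proof (rule bop_construct)
    show "Y (x + y) = Y x + Y y" for x y
      by (rule uniq) (use sub Y(1) in \<open>simp_all add: subspace_add cinner_simps cY[symmetric]\<close>)
    show "Y (a *\<^sub>C x) = a *\<^sub>C Y x" for a x
      by (rule uniq) (use scaleC_closure_range[of _ M] Y(1) in \<open>simp_all add: cinner_simps cY[symmetric]\<close>)
    show "norm (Y w) \<le> c * norm w" for w
    proof -
      \<comment> \<open>The estimate holds for v in the range of M. Closedness carries it to v = Y
        w, where cancelling the norm of Y w leaves the bound.\<close>
      have "closed {v. inner v (Y w) \<le> c * norm w * norm v}"
        by (intro closed_Collect_le continuous_intros)
      moreover have "inner (M x) (Y w) \<le> c * norm w * norm (M x)" for x
      proof -
        have "inner (M x) (Y w) \<le> norm (L x) * norm w"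
          unfolding Y(2)[symmetric] by (rule norm_cauchy_schwarz)
        also have "\<dots> \<le> (c * norm (M x)) * norm w" by (intro mult_right_mono le) auto
        finally show ?thesis by (simp add: algebra_simps)
      qed
      ultimately have "closure ?D \<subseteq> {v. inner v (Y w) \<le> c * norm w * norm v}"
        by (intro closure_minimal) auto
      then have "inner (Y w) (Y w) \<le> c * norm w * norm (Y w)" using Y(1) by blast
      then have "norm (Y w) * norm (Y w) \<le> (c * norm w) * norm (Y w)"
        by (simp add: power2_norm_eq_inner[symmetric] power2_eq_square)
      then show ?thesis
        using c by (cases "norm (Y w) = 0") (auto simp: mult_le_cancel_right)
    qed
  qed (rule that)
  show thesis by (rule that[of T]) (simp_all add: T cY Y(1))
qed

section \<open>Adjoints\<close>

lemma adj_op_eqI: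
  fixes T :: "'a::complex_hilbert bop"
  assumes "\<And>x y. cinner (T x) y = cinner x (bop_apply S y)"
  shows "adj_op T = S"
  unfolding adj_op_def
proof (rule the_equality)
  fix S' assume S': "\<forall>x y. cinner (T x) y = cinner x (bop_apply S' y)"
  show "S' = S"
  proof (rule bop_eqI)
    fix y
    have "cinner (S' y - S y) (S' y - S y) = 0"
      using assms S' by (metis cinner_diff_right right_minus_eq)
    then show "S' y = S y" by (simp add: cinner_self)
  qed
qed (use assms in simp)

text \<open>Existence of the adjoint is the factorization \<open>douglas\<close> with M = 1, whose
  hypothesis is the operator norm inequality.\<close>

lemma cinner_adj: "cinner (bop_apply T x) y = cinner x (bop_apply (adj_op T) y)"
proof -
  obtain S where "\<And>x w. cinner (T x) w = cinner (bop_apply 1 x) (bop_apply S w)"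
    using douglas[of "norm T" T 1] norm_bop_apply[of T] by (auto simp: bop_rep_eq)
  then have S: "\<And>x w. cinner (T x) w = cinner x (bop_apply S w)" by (simp add: bop_rep_eq)
  then show ?thesis using adj_op_eqI[of T S] by simp
qed

lemma cinner_adj': "cinner (bop_apply (adj_op T) x) y = cinner x (bop_apply T y)"
  by (metis cinner_adj cinner_commute)

lemma adj_selfadjoint: "selfadjoint_op T \<Longrightarrow> adj_op T = T"
  by (rule adj_op_eqI) (simp add: selfadjoint_op_def)

section \<open>Orthogonal projections and support projections\<close>

lemma projection_apply_apply: "projection_op P \<Longrightarrow> bop_apply P (P x) = P x"
  by (metis projection_op_def times_bop.rep_eq)

lemma projection_range_iff: "projection_op P \<Longrightarrow> x \<in> range (bop_apply P) \<longleftrightarrow> P x = x"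
  by (metis projection_apply_apply rangeE rangeI)

lemma projection_cinner: "projection_op P \<Longrightarrow> cinner (P x) x = complex_of_real ((norm (P x))\<^sup>2)"
  by (metis cinner_self projection_apply_apply projection_op_def selfadjoint_op_def)

lemma projection_pythagoras:
  assumes "projection_op P"
  shows "(norm x)\<^sup>2 = (norm (P x))\<^sup>2 + (norm (x - P x))\<^sup>2"
proof -
  have "cinner x (P x) = of_real ((norm (P x))\<^sup>2)"
    using projection_cinner[OF assms, of x] cinner_commute[of x "P x"] by simp
  then have "complex_of_real ((norm x)\<^sup>2) = of_real ((norm (P x))\<^sup>2 + (norm (x - P x))\<^sup>2)"
    unfolding of_real_add cinner_self[symmetric]
    using projection_cinner[OF assms, of x] by (simp add: cinner_simps cinner_self[of "P x"])
  then show ?thesis using of_real_eq_iff by blast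
qed

lemma projection_norm_le: "projection_op P \<Longrightarrow> norm (P x) \<le> norm x"
  using projection_pythagoras[of P x] zero_le_power2[of "norm (x - P x)"]
  by (intro power2_le_imp_le[OF _ norm_ge_zero]) linarith

lemma projection_eqI:
  assumes P: "projection_op P" and Q: "projection_op Q" and eq: "range (bop_apply P) = range (bop_apply Q)"
  shows "P = Q"
proof (rule bop_eqI)
  fix x
  have QP: "Q (P y) = P y" for y using projection_range_iff[OF Q] eq by blast
  have PQ: "P (Q y) = Q y" for y using projection_range_iff[OF P] eq by blast
  have "cinner (P x) y = cinner (Q x) y" for y
    using P Q PQ QP by (metis projection_op_def selfadjoint_op_def)
  then have "cinner (P x - Q x) (P x - Q x) = 0" by (metis cinner_diff_left right_minus_eq)
  then show "P x = Q x" by (simp add: cinner_self)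
qed

text \<open>Representing the functional x -> <x, z> on M by a vector p z of M gives the candidate.
  It is linear because a vector of M is determined by its inner products with M.\<close>

lemma projection_exists:
  fixes M :: "'a::complex_hilbert set"
  assumes "closed M" "subspace M" and sc: "\<And>c x. x \<in> M \<Longrightarrow> c *\<^sub>C x \<in> M"
  obtains P where "projection_op P" "range (bop_apply P) = M"
proof -
  have "\<exists>u\<in>M. \<forall>x\<in>M. inner x z = inner x u" for z
  proof -
    obtain u where "u \<in> closure M" "\<And>x. x \<in> M \<Longrightarrow> inner x z = inner x u"
      by (rule riesz_subspace[of M "\<lambda>x. inner x z" "norm z"])
        (use assms Cauchy_Schwarz_ineq2 in \<open>auto simp: inner_add_left mult.commute\<close>)
    then show ?thesis using \<open>closed M\<close> by auto
  qed
  then obtain p where pM: "\<And>z. p z \<in> M" and p: "\<And>z x. x \<in> M \<Longrightarrow> inner x z = inner x (p z)" by metis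
  have cp: "cinner x z = cinner x (p z)" if "x \<in> M" for x z
  proof -
    have "cinner x (z - p z) = 0"
      by (rule cinner_eq_zero_if_inner[of M]) (use sc that in \<open>simp_all add: inner_diff_right p[symmetric]\<close>)
    then show ?thesis by (simp add: cinner_diff_right)
  qed
  have uniq: "u = v" if "u \<in> M" "v \<in> M" "\<And>x. x \<in> M \<Longrightarrow> cinner x u = cinner x v" for u v
  proof -
    have "cinner (u - v) (u - v) = 0"
      using that subspace_diff[OF assms(2)] by (metis cinner_diff_right right_minus_eq)
    then show ?thesis by (simp add: cinner_self)
  qed
  obtain P where P: "\<And>z. bop_apply P z = p z"
  proof (rule bop_construct)
    show "p (x + y) = p x + p y" for x y
      by (rule uniq) (use assms(2) pM in \<open>simp_all add: subspace_add cinner_simps cp[symmetric]\<close>)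
    show "p (a *\<^sub>C x) = a *\<^sub>C p x" for a x
      by (rule uniq) (use sc pM in \<open>simp_all add: cinner_simps cp[symmetric]\<close>)
    show "norm (p z) \<le> 1 * norm z" for z
    proof -
      have "norm (p z) * norm (p z) = inner (p z) z"
        using p[OF pM, of z z] by (simp add: power2_norm_eq_inner[symmetric] power2_eq_square)
      also have "\<dots> \<le> norm (p z) * norm z" by (rule norm_cauchy_schwarz)
      finally show ?thesis by (cases "norm (p z) = 0") auto
    qed
  qed (rule that)
  have pp: "p x = x" if "x \<in> M" for x by (rule uniq[OF pM that cp[symmetric]])
  have "projection_op P"
    unfolding projection_op_def selfadjoint_op_def
  proof safe
    show "P * P = P" by (rule bop_eqI) (simp add: bop_rep_eq P pp pM)
    show "cinner (P x) y = cinner x (P y)" for x y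
      using cp[OF pM, of x y] cp[OF pM, of y x] by (metis P cinner_commute)
  qed
  moreover have "range (bop_apply P) = M"
  proof
    show "M \<subseteq> range (bop_apply P)" using pp P by (metis rangeI subsetI)
  qed (auto simp: P pM)
  ultimately show thesis by (rule that)
qed

lemma support_proj:
  "projection_op (support_proj T)" "range (bop_apply (support_proj T)) = closure (range (bop_apply T))"
proof -
  obtain P where P: "projection_op P" "range (bop_apply P) = closure (range (bop_apply T))"
    using projection_exists[of "closure (range (bop_apply T))"]
      closure_subspace[OF subspace_range_bop] scaleC_closure_range by (metis closed_closure)
  then have "support_proj T = P"
    unfolding support_proj_def by (intro the_equality conjI projection_eqI[of _ P]) auto
  then show "projection_op (support_proj T)"
    "range (bop_apply (support_proj T)) = closure (range (bop_apply T))" using P by auto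
qed

lemma projection_ker_iff:
  assumes "projection_op P"
  shows "P x = 0 \<longleftrightarrow> (\<forall>y. cinner (P y) x = 0)"
proof
  assume "P x = 0"
  then show "\<forall>y. cinner (P y) x = 0" using assms by (metis projection_op_def selfadjoint_op_def cinner_zero_right)
next
  assume "\<forall>y. cinner (P y) x = 0"
  then have "cinner (P x) x = 0" by blast
  then show "P x = 0" using projection_cinner[OF assms, of x] by simp
qed

text \<open>The kernel of a self-adjoint operator is the orthogonal complement of its range, hence
  of the closure. This is how support projections get identified later: through kernels.\<close>

lemma support_proj_zero_iff:
  assumes "selfadjoint_op T"
  shows "support_proj T x = 0 \<longleftrightarrow> T x = 0"
proof
  assume 0: "support_proj T x = 0"
  have "T (T x) \<in> closure (range (bop_apply T))" by (rule closure_subset[THEN subsetD]) simp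
  then obtain y where "T (T x) = support_proj T y" using support_proj(2)[of T] by (metis imageE)
  then have "cinner (T (T x)) x = 0" using projection_ker_iff[OF support_proj(1), of T x] 0 by auto
  then have "cinner (T x) (T x) = 0" using assms by (metis selfadjoint_op_def)
  then show "T x = 0" by (simp add: cinner_self)
next
  assume 0: "T x = 0"
  have "inner y x = 0" if "y \<in> closure (range (bop_apply T))" for y
  proof (rule closure_orthogonal[OF _ that])
    fix z assume "z \<in> range (bop_apply T)"
    then show "inner z x = 0" using assms 0
      by (metis (no_types, lifting) cinner_zero_right imageE inner_eq_Re_cinner selfadjoint_op_def zero_complex.sel(1))
  qed
  then have "inner (support_proj T x) x = 0" using support_proj(2)[of T] by blast
  then show "support_proj T x = 0"
    using projection_cinner[OF support_proj(1), of T x] by (simp add: inner_eq_Re_cinner)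
qed

lemma support_proj_apply_range: "support_proj T (T x) = T x"
  unfolding projection_range_iff[OF support_proj(1), symmetric] support_proj(2)
  by (rule closure_subset[THEN subsetD]) simp

lemma support_proj_apply_range': "selfadjoint_op T \<Longrightarrow> T (support_proj T x) = T x"
  using support_proj_zero_iff[of T "x - support_proj T x"]
  by (simp add: bop_diff projection_apply_apply support_proj(1))

section \<open>Positive operators and square roots\<close>

lemma selfadjoint_cinner: "selfadjoint_op T \<Longrightarrow> cinner (bop_apply T x) y = cinner x (bop_apply T y)"
  by (simp add: selfadjoint_op_def)

lemma selfadjoint_inner: "selfadjoint_op T \<Longrightarrow> inner (bop_apply T x) y = inner x (bop_apply T y)"
  by (simp add: selfadjoint_op_def inner_eq_Re_cinner)

lemma selfadjoint_cinner_self: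
  assumes "selfadjoint_op T"
  shows "cinner (bop_apply T x) x = complex_of_real (inner (bop_apply T x) x)"
proof -
  have "Im (cinner (T x) x) = 0"
    using cinner_commute[of "T x" x] assms by (simp add: selfadjoint_op_def complex_eq_iff)
  then show ?thesis by (simp add: complex_eq_iff inner_eq_Re_cinner)
qed

text \<open>Polarization: the form is real at x + y and at x + \<i> y, which determines the
  imaginary and the real part of <T x, y> from <T y, x>.\<close>

lemma positive_selfadjoint:
  assumes "positive_op T"
  shows "selfadjoint_op T"
  unfolding selfadjoint_op_def
proof (intro allI)
  fix x y
  have Im0: "Im (cinner (T z) z) = 0" for z using assms by (simp add: positive_op_def)
  have "Im (cinner (T x) y) = - Im (cinner (T y) x)"
    using Im0[of "x + y"] Im0[of x] Im0[of y] by (simp add: bop_linear cinner_simps)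
  moreover have "Re (cinner (T x) y) = Re (cinner (T y) x)"
    using Im0[of "x + \<i> *\<^sub>C y"] Im0[of x] Im0[of y] by (simp add: bop_linear cinner_simps)
  ultimately have "cinner (T x) y = cnj (cinner (T y) x)" by (simp add: complex_eq_iff)
  then show "cinner (T x) y = cinner x (T y)" by (metis cinner_commute)
qed

lemma positive_iff: "positive_op T \<longleftrightarrow> selfadjoint_op T \<and> (\<forall>x. 0 \<le> inner (bop_apply T x) x)"
proof
  assume "positive_op T"
  then show "selfadjoint_op T \<and> (\<forall>x. 0 \<le> inner (bop_apply T x) x)"
    using positive_selfadjoint by (auto simp: positive_op_def inner_eq_Re_cinner)
next
  assume "selfadjoint_op T \<and> (\<forall>x. 0 \<le> inner (bop_apply T x) x)"
  then show "positive_op T"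
    unfolding positive_op_def by (metis Im_complex_of_real Re_complex_of_real selfadjoint_cinner_self)
qed

lemma positive_op_inner: "positive_op T \<Longrightarrow> 0 \<le> inner (bop_apply T x) x"
  by (simp add: positive_iff)

lemma selfadjoint_intros:
  "selfadjoint_op S \<Longrightarrow> selfadjoint_op T \<Longrightarrow> selfadjoint_op (S + T)"
  "selfadjoint_op S \<Longrightarrow> selfadjoint_op T \<Longrightarrow> selfadjoint_op (S - T)"
  "selfadjoint_op S \<Longrightarrow> selfadjoint_op (r *\<^sub>R S)"
  "selfadjoint_op 1" "selfadjoint_op 0"
  by (auto simp: selfadjoint_op_def bop_rep_eq cinner_simps)

lemma selfadjoint_mult:
  "selfadjoint_op S \<Longrightarrow> selfadjoint_op T \<Longrightarrow> S * T = T * S \<Longrightarrow> selfadjoint_op (S * T)"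
  unfolding selfadjoint_op_def by (metis times_bop.rep_eq)

lemma selfadjoint_power: "selfadjoint_op T \<Longrightarrow> selfadjoint_op (T ^ n)"
  by (induction n) (auto intro!: selfadjoint_intros selfadjoint_mult simp: power_commutes)

lemma selfadjoint_sum: "(\<And>i. i \<in> A \<Longrightarrow> selfadjoint_op (f i)) \<Longrightarrow> selfadjoint_op (sum f A)"
  by (induction A rule: infinite_finite_induct) (auto intro: selfadjoint_intros)

lemma selfadjoint_limit:
  assumes "f \<longlonglongrightarrow> T" "\<And>n. selfadjoint_op (f n)"
  shows "selfadjoint_op T"
  unfolding selfadjoint_op_def
proof (intro allI)
  fix x y
  have "(\<lambda>n. cinner (f n x) y) \<longlonglongrightarrow> cinner (T x) y"
    by (intro tendsto_cinner tendsto_eval assms tendsto_const)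
  moreover have "(\<lambda>n. cinner (f n x) y) \<longlonglongrightarrow> cinner x (T y)"
    unfolding selfadjoint_cinner[OF assms(2)]
    by (intro tendsto_cinner tendsto_eval assms tendsto_const)
  ultimately show "cinner (T x) y = cinner x (T y)" by (rule LIMSEQ_unique)
qed

lemma positive_op_add: "positive_op S \<Longrightarrow> positive_op T \<Longrightarrow> positive_op (S + T)"
  by (simp add: positive_op_def bop_rep_eq cinner_simps)

lemma positive_op_scaleR: "positive_op S \<Longrightarrow> 0 \<le> r \<Longrightarrow> positive_op (r *\<^sub>R S)"
  by (simp add: positive_op_def bop_rep_eq cinner_simps)

lemma positive_op_one: "positive_op 1"
  by (simp add: positive_op_def bop_rep_eq cinner_self)

lemma positive_op_sandwich: "selfadjoint_op S \<Longrightarrow> positive_op T \<Longrightarrow> positive_op (S * T * S)"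
  by (simp add: positive_op_def bop_rep_eq selfadjoint_cinner[of S])

lemma positive_op_square: "selfadjoint_op S \<Longrightarrow> positive_op (S * S)"
  by (simp add: positive_op_def bop_rep_eq selfadjoint_cinner cinner_self)

lemma projection_positive: "projection_op P \<Longrightarrow> positive_op P"
  by (simp add: positive_op_def projection_cinner)

lemma projection_inner: "projection_op P \<Longrightarrow> inner (bop_apply P x) x = (norm (bop_apply P x))\<^sup>2"
  by (simp add: inner_eq_Re_cinner projection_cinner)

lemma projection_selfadjoint: "projection_op P \<Longrightarrow> selfadjoint_op P"
  by (simp add: projection_op_def)

text \<open>At x + T x the form has the cross term 2 |T x|^2, while its other two terms vanish by
  assumption.\<close>

lemma op_eq_zeroI:
  assumes "selfadjoint_op T" "\<And>x. inner (bop_apply T x) x = 0"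
  shows "T = 0"
proof (rule bop_eqI)
  fix x
  have "inner (T (x + T x)) (x + T x) = inner (T x) x + inner (T (T x)) (T x) + 2 * inner (T x) (T x)"
    using selfadjoint_inner[OF assms(1), of "T x" x]
    by (simp add: bop_add inner_add_left inner_add_right inner_commute)
  then show "T x = bop_apply 0 x" by (simp add: assms(2) bop_rep_eq)
qed

lemma op_eqI:
  assumes "selfadjoint_op S" "selfadjoint_op T" "\<And>x. inner (bop_apply S x) x = inner (bop_apply T x) x"
  shows "S = T"
  using op_eq_zeroI[of "S - T"] assms by (simp add: selfadjoint_intros bop_rep_eq inner_diff_left)

lemma positive_op_cauchy_schwarz:
  assumes "positive_op T"
  shows "(inner (bop_apply T x) y)\<^sup>2 \<le> inner (bop_apply T x) x * inner (bop_apply T y) y"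
proof -
  define a b c where abc: "a = inner (T x) x" "b = inner (T x) y" "c = inner (T y) y"
  have sa: "inner (T y) x = b"
    using selfadjoint_inner[OF positive_selfadjoint[OF assms], of y x] by (simp add: abc inner_commute)
  have q: "0 \<le> a + 2 * t * b + t\<^sup>2 * c" for t
    using positive_op_inner[OF assms, of "x + t *\<^sub>R y"]
    by (simp add: bop_linear inner_add_left inner_add_right sa abc[symmetric] algebra_simps power2_eq_square)
  have "0 \<le> c" "0 \<le> a" using positive_op_inner[OF assms] by (simp_all add: abc)
  show ?thesis
  proof (cases "c = 0")
    case True
    have "b = 0"
    proof (rule ccontr)
      assume "b \<noteq> 0"
      \<comment> \<open>With c = 0 this t gives the quadratic in \<open>q\<close> the value
        -1.\<close>
      then show False using q[of "- (a + 1) / (2 * b)"] True \<open>0 \<le> a\<close> by (simp add: field_simps)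
    qed
    then show ?thesis by (simp add: abc[symmetric] True)
  next
    case False
    then have "0 < c" using \<open>0 \<le> c\<close> by simp
    have "a + 2 * (- b / c) * b + (- b / c)\<^sup>2 * c = a - b\<^sup>2 / c"
      using \<open>0 < c\<close> by (simp add: field_simps power2_eq_square)
    then have "b\<^sup>2 / c \<le> a" using q[of "- b / c"] by simp
    then show ?thesis using \<open>0 < c\<close> by (simp add: abc[symmetric] pos_divide_le_eq)
  qed
qed

text \<open>Cauchy-Schwarz for the form of T with y = T x; the factor at y is at most c |T x|^2, and
  |T x|^2 cancels.\<close>

lemma positive_op_norm_apply_le:
  assumes T: "positive_op T" and le: "\<And>x. inner (bop_apply T x) x \<le> c * (norm x)\<^sup>2"
  shows "(norm (bop_apply T x))\<^sup>2 \<le> c * inner (bop_apply T x) x"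
proof (cases "T x = 0")
  case False
  have "(norm (T x))\<^sup>2 * (norm (T x))\<^sup>2 \<le> inner (T x) x * inner (T (T x)) (T x)"
    using positive_op_cauchy_schwarz[OF T, of x "T x"] unfolding power2_norm_eq_inner by (simp add: power2_eq_square)
  also have "\<dots> \<le> inner (T x) x * (c * (norm (T x))\<^sup>2)"
    by (rule mult_left_mono[OF le positive_op_inner[OF T]])
  finally have "(norm (T x))\<^sup>2 * (norm (T x))\<^sup>2 \<le> (c * inner (T x) x) * (norm (T x))\<^sup>2"
    by (simp add: mult.assoc mult.left_commute)
  then show ?thesis by (rule mult_right_le_imp_le) (use False in simp)
qed simp

lemma inner_bop_le_norm: "inner (bop_apply T x) x \<le> norm T * (norm x)\<^sup>2"
proof -
  have "inner (T x) x \<le> norm (T x) * norm x" by (rule norm_cauchy_schwarz)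
  also have "\<dots> \<le> (norm T * norm x) * norm x" by (intro mult_right_mono norm_bop_apply) simp
  finally show ?thesis by (simp add: power2_eq_square mult.assoc)
qed

lemma positive_op_kernel: "positive_op T \<Longrightarrow> inner (bop_apply T x) x = 0 \<Longrightarrow> bop_apply T x = 0"
  using positive_op_norm_apply_le[of T "norm T" x] inner_bop_le_norm by fastforce

lemma positive_op_norm_le:
  assumes T: "positive_op T" and le: "\<And>x. inner (bop_apply T x) x \<le> c * (norm x)\<^sup>2" and c: "0 \<le> c"
  shows "norm T \<le> c"
proof (rule norm_bop_le[OF _ c])
  fix x
  have "(norm (T x))\<^sup>2 \<le> c * inner (T x) x" by (rule positive_op_norm_apply_le[OF T le])
  also have "\<dots> \<le> c * (c * (norm x)\<^sup>2)" by (intro mult_left_mono le c)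
  finally have "(norm (T x))\<^sup>2 \<le> (c * norm x)\<^sup>2" by (simp add: power_mult_distrib power2_eq_square algebra_simps)
  then show "norm (T x) \<le> c * norm x" by (rule power2_le_imp_le) (use c in simp)
qed

text \<open>The iteration \<open>Y \<mapsto> (X + Y\<^sup>2)/2\<close> converges to \<open>1 - (1 - X)\<^sup>1\<^sup>/\<^sup>2\<close>; its increments are dominated by those
  of the scalar iteration with \<open>X = 1\<close>.\<close>

lemma sqrt_iteration:
  fixes X :: "'a::complex_hilbert bop"
  assumes X: "selfadjoint_op X" and X1: "norm X \<le> 1"
  obtains Y where "selfadjoint_op Y" "norm Y \<le> 1" "Y * Y = 2 *\<^sub>R Y - X"
    "\<And>Z. Z * X = X * Z \<Longrightarrow> Z * Y = Y * Z"
proof -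
  define Y where "Y = rec_nat (0 :: 'a bop) (\<lambda>_ T. (1/2) *\<^sub>R (X + T * T))"
  define y where "y = rec_nat (0 :: real) (\<lambda>_ t. (1 + t * t) / 2)"
  have Y0: "Y 0 = 0" and YS: "Y (Suc n) = (1/2) *\<^sub>R (X + Y n * Y n)" for n by (simp_all add: Y_def)
  have y0: "y 0 = 0" and yS: "y (Suc n) = (1 + y n * y n) / 2" for n by (simp_all add: y_def)
  have y01: "0 \<le> y n \<and> y n \<le> 1" for n
  proof (induction n)
    case (Suc n)
    then have "y n * y n \<le> 1" by (simp add: mult_le_one)
    then show ?case using Suc by (simp add: yS)
  qed (simp add: y0)
  have comm: "Z * Y n = Y n * Z" if "Z * X = X * Z" for Z n
  proof (induction n)
    case (Suc n)
    then have "Z * (Y n * Y n) = Y n * Y n * Z" by (metis mult.assoc)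
    then show ?case by (simp add: YS distrib_left distrib_right that)
  qed (simp add: Y0)
  have YX: "Y n * X = X * Y n" for n using comm[of X n] by simp
  have YY: "Y n * Y m = Y m * Y n" for n m by (rule comm[OF YX])
  have sa: "selfadjoint_op (Y n)" for n
    by (induction n) (auto simp: Y0 YS X intro!: selfadjoint_intros selfadjoint_mult)
  have nY: "norm (Y n) \<le> y n" for n
  proof (induction n)
    case (Suc n)
    have "norm (X + Y n * Y n) \<le> norm X + norm (Y n) * norm (Y n)"
      by (rule order_trans[OF norm_triangle_ineq]) (simp add: norm_mult_ineq)
    also have "\<dots> \<le> 1 + y n * y n" using Suc X1 y01[of n] by (intro add_mono mult_mono) auto
    finally show ?case by (simp add: YS yS)
  qed (simp add: Y0 y0)
  \<comment> \<open>The iterates commute, so the difference of two successive squares factors into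
    sum and difference, and each factor is dominated by its scalar counterpart.\<close>
  have step: "norm (Y (Suc n) - Y n) \<le> y (Suc n) - y n" for n
  proof (induction n)
    case 0
    then show ?case using X1 by (simp add: Y0 y0 YS yS)
  next
    case (Suc n)
    have "Y (Suc (Suc n)) - Y (Suc n) = (1/2) *\<^sub>R (X + Y (Suc n) * Y (Suc n)) - (1/2) *\<^sub>R (X + Y n * Y n)"
      by (rule arg_cong2[where f = "(-)", OF YS YS])
    also have "\<dots> = (1/2) *\<^sub>R ((Y (Suc n) + Y n) * (Y (Suc n) - Y n))"
      using YY[of n "Suc n"] by (simp add: algebra_simps)
    finally have "Y (Suc (Suc n)) - Y (Suc n) = (1/2) *\<^sub>R ((Y (Suc n) + Y n) * (Y (Suc n) - Y n))" .
    then have "norm (Y (Suc (Suc n)) - Y (Suc n)) \<le> (1/2) * (norm (Y (Suc n) + Y n) * norm (Y (Suc n) - Y n))"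
      by (simp add: norm_mult_ineq)
    also have "\<dots> \<le> (1/2) * ((y (Suc n) + y n) * (y (Suc n) - y n))"
    proof -
      have "norm (Y (Suc n) + Y n) \<le> y (Suc n) + y n"
        using norm_triangle_ineq[of "Y (Suc n)" "Y n"] nY[of n] nY[of "Suc n"] by linarith
      then show ?thesis using Suc y01 by (intro mult_left_mono mult_mono) (auto simp: add_nonneg_nonneg)
    qed
    also have "\<dots> = y (Suc (Suc n)) - y (Suc n)"
      by (simp add: yS[of "Suc n"] yS[of n] field_simps)
    finally show ?case .
  qed
  have mono: "y n \<le> y (Suc n)" for n using order_trans[OF norm_ge_zero step[of n]] by simp
  have dist: "norm (Y (n + k) - Y n) \<le> y (n + k) - y n" for n k
  proof (induction k)
    case (Suc k)
    have "norm (Y (n + Suc k) - Y n) \<le> norm (Y (Suc (n + k)) - Y (n + k)) + norm (Y (n + k) - Y n)"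
      using norm_triangle_ineq[of "Y (Suc (n + k)) - Y (n + k)" "Y (n + k) - Y n"] by simp
    then show ?case using Suc step[of "n + k"] by simp
  qed simp
  have inc: "incseq y" using mono by (rule incseq_SucI)
  have "convergent y"
    by (rule Bseq_monoseq_convergent) (use y01 inc in \<open>auto intro!: BseqI'[of _ 1] simp: incseq_imp_monoseq abs_le_iff\<close>)
  then have "Cauchy y" by (simp add: Cauchy_convergent_iff)
  have "Cauchy Y"
  proof (rule CauchyI')
    fix e :: real assume "0 < e"
    then obtain M where M: "\<And>m n. M \<le> m \<Longrightarrow> M \<le> n \<Longrightarrow> norm (y m - y n) < e"
      using CauchyD[OF \<open>Cauchy y\<close>] by meson
    have "dist (Y m) (Y n) < e" if "M \<le> m" "m < n" for m n
    proof -
      have "dist (Y m) (Y n) = norm (Y (m + (n - m)) - Y m)"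
        using that by (simp add: dist_norm norm_minus_commute)
      also have "\<dots> \<le> y (m + (n - m)) - y m" by (rule dist)
      also have "\<dots> < e" using M[of n m] that by simp
      finally show ?thesis .
    qed
    then show "\<exists>M. \<forall>m\<ge>M. \<forall>n>m. dist (Y m) (Y n) < e" by blast
  qed
  then obtain L where L: "Y \<longlonglongrightarrow> L" by (auto simp: Cauchy_convergent_iff convergent_def)
  show thesis
  proof (rule that[of L])
    show "selfadjoint_op L" by (rule selfadjoint_limit[OF L sa])
    show "norm L \<le> 1"
      by (rule LIMSEQ_le_const2[OF tendsto_norm[OF L]]) (use nY y01 order_trans in blast)
    have "(\<lambda>n. Y (Suc n)) \<longlonglongrightarrow> (1/2) *\<^sub>R (X + L * L)"
      unfolding YS by (intro tendsto_intros L)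
    then have "L = (1/2) *\<^sub>R (X + L * L)" using LIMSEQ_Suc[OF L] LIMSEQ_unique by blast
    then have "2 *\<^sub>R L = X + L * L" by (metis scaleR_half_double scaleR_2 scaleR_add_right)
    then show "L * L = 2 *\<^sub>R L - X" by simp
    show "Z * L = L * Z" if "Z * X = X * Z" for Z
    proof -
      have "(\<lambda>n. Z * Y n) \<longlonglongrightarrow> Z * L" by (intro tendsto_intros L)
      moreover have "(\<lambda>n. Z * Y n) \<longlonglongrightarrow> L * Z" unfolding comm[OF that] by (intro tendsto_intros L)
      ultimately show ?thesis by (rule LIMSEQ_unique)
    qed
  qed
qed

text \<open>X = 1 - A / c has norm at most 1, and the iteration gives (1 - Y)^2 = 1 - X = A / c,
  with 1 - Y positive because Y has norm at most 1. Adding 1 to the norm of A keeps c positive for A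
  = 0.\<close>

lemma sqrt_exists:
  fixes A :: "'a::complex_hilbert bop"
  assumes A: "positive_op A"
  obtains B where "positive_op B" "B * B = A" "\<And>Z. Z * A = A * Z \<Longrightarrow> Z * B = B * Z"
proof -
  define c where "c = norm A + 1"
  have c: "0 < c" by (simp add: c_def add_nonneg_pos)
  define X where "X = 1 - (1 / c) *\<^sub>R A"
  have saA: "selfadjoint_op A" by (rule positive_selfadjoint[OF A])
  have iX: "inner (X x) x = (norm x)\<^sup>2 - inner (A x) x / c" for x
    by (simp add: X_def bop_rep_eq inner_diff_left power2_norm_eq_inner)
  have "inner (A x) x \<le> c * (norm x)\<^sup>2" for x
    using inner_bop_le_norm[of A x] by (rule order_trans) (simp add: c_def mult_right_mono)
  then have "0 \<le> inner (X x) x" for x using c by (simp add: iX pos_divide_le_eq mult.commute)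
  moreover have saX: "selfadjoint_op X" unfolding X_def by (intro selfadjoint_intros saA)
  ultimately have "positive_op X" by (simp add: positive_iff)
  then have "norm X \<le> 1"
    using positive_op_inner[OF A] c by (intro positive_op_norm_le) (auto simp: iX)
  then obtain Y where Y: "selfadjoint_op Y" "norm Y \<le> 1" "Y * Y = 2 *\<^sub>R Y - X"
    "\<And>Z. Z * X = X * Z \<Longrightarrow> Z * Y = Y * Z"
    using sqrt_iteration[OF saX] by metis
  have scX: "c *\<^sub>R (1 - X) = A" using c by (simp add: X_def)
  show thesis
  proof (rule that[of "sqrt c *\<^sub>R (1 - Y)"])
    have "0 \<le> inner ((1 - Y) x) x" for x
    proof -
      have "inner (Y x) x \<le> norm Y * (norm x)\<^sup>2" by (rule inner_bop_le_norm)
      also have "\<dots> \<le> 1 * (norm x)\<^sup>2" using Y(2) by (intro mult_right_mono) auto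
      finally show ?thesis by (simp add: bop_rep_eq inner_diff_left power2_norm_eq_inner)
    qed
    then have "positive_op (1 - Y)" using Y(1) by (simp add: positive_iff selfadjoint_intros)
    then show "positive_op (sqrt c *\<^sub>R (1 - Y))" using c by (intro positive_op_scaleR) auto
    have "(1 - Y) * (1 - Y) = 1 - X"
      by (simp add: algebra_simps Y(3) scaleR_2)
    then show "sqrt c *\<^sub>R (1 - Y) * sqrt c *\<^sub>R (1 - Y) = A"
      using c scX by simp
    show "Z * (sqrt c *\<^sub>R (1 - Y)) = sqrt c *\<^sub>R (1 - Y) * Z" if "Z * A = A * Z" for Z
    proof -
      have "Z * X = X * Z" using that by (simp add: X_def algebra_simps)
      then show ?thesis using Y(4) by (simp add: algebra_simps)
    qed
  qed
qed

text \<open>S commutes with A = S^2 and hence with B, so (S + B)(S - B) = 0. On the range of D = S -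
  B the two positive forms add up to 0, so S and B both vanish there; then D^2 = 0 and D =
  0.\<close>

lemma sqrt_unique:
  assumes B: "positive_op B" "B * B = A" "\<And>Z. Z * A = A * Z \<Longrightarrow> Z * B = B * Z"
    and S: "positive_op S" "S * S = A"
  shows "S = B"
proof -
  have "S * A = A * S" using S(2) by (metis mult.assoc)
  then have SB: "S * B = B * S" by (rule B(3))
  define D where "D = S - B"
  have D: "selfadjoint_op D" unfolding D_def using B S by (intro selfadjoint_intros positive_selfadjoint)
  have SBD: "(S + B) * D = 0" using SB B(2) S(2) by (simp add: D_def algebra_simps)
  have "D x = 0" for x
  proof -
    have "inner (S (D x)) (D x) + inner (B (D x)) (D x) = inner (((S + B) * D) x) (D x)"
      by (simp add: bop_rep_eq inner_add_left)
    then have "inner (S (D x)) (D x) = 0" "inner (B (D x)) (D x) = 0"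
      using positive_op_inner[OF S(1), of "D x"] positive_op_inner[OF B(1), of "D x"]
      by (simp_all add: SBD bop_rep_eq)
    then have "S (D x) = 0" "B (D x) = 0" using positive_op_kernel[OF S(1)] positive_op_kernel[OF B(1)] by auto
    then have "D (D x) = 0" by (simp add: D_def bop_rep_eq)
    then have "inner (D x) (D x) = 0" using selfadjoint_inner[OF D, of "D x" x] by simp
    then show ?thesis by simp
  qed
  then show "S = B" by (intro bop_eqI) (simp add: D_def bop_rep_eq)
qed

lemma sqrt_op:
  assumes "positive_op A"
  shows "positive_op (sqrt_op A)" "sqrt_op A * sqrt_op A = A"
    "\<And>Z. Z * A = A * Z \<Longrightarrow> Z * sqrt_op A = sqrt_op A * Z"
    "\<And>S. positive_op S \<Longrightarrow> S * S = A \<Longrightarrow> sqrt_op A = S"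
proof -
  obtain B where B: "positive_op B" "B * B = A" "\<And>Z. Z * A = A * Z \<Longrightarrow> Z * B = B * Z"
    using sqrt_exists[OF assms] by metis
  have uniq: "S = B" if "positive_op S" "S * S = A" for S
    by (rule sqrt_unique[OF B that])
  have eq: "sqrt_op A = B"
    unfolding sqrt_op_def by (rule the_equality) (use B(1,2) uniq in blast)+
  show "positive_op (sqrt_op A)" "sqrt_op A * sqrt_op A = A"
    unfolding eq by (rule B(1), rule B(2))
  show "Z * sqrt_op A = sqrt_op A * Z" if "Z * A = A * Z" for Z
    unfolding eq by (rule B(3)[OF that])
  show "sqrt_op A = S" if "positive_op S" "S * S = A" for S
    unfolding eq by (rule uniq[OF that, symmetric])
qed

lemma sqrt_op_selfadjoint: "positive_op A \<Longrightarrow> selfadjoint_op (sqrt_op A)"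
  by (rule positive_selfadjoint[OF sqrt_op(1)])

lemma sqrt_op_apply_twice: "positive_op A \<Longrightarrow> sqrt_op A (sqrt_op A x) = A x"
  by (metis sqrt_op(2) times_bop.rep_eq)

lemma norm_sqrt_op: "positive_op A \<Longrightarrow> (norm (bop_apply (sqrt_op A) x))\<^sup>2 = inner (bop_apply A x) x"
  by (metis power2_norm_eq_inner selfadjoint_inner sqrt_op_apply_twice sqrt_op_selfadjoint)

lemma sqrt_op_zero_iff: "positive_op A \<Longrightarrow> sqrt_op A x = 0 \<longleftrightarrow> A x = 0"
  by (metis bop_zero norm_sqrt_op inner_zero_left norm_eq_zero power_zero_numeral sqrt_op_apply_twice
      zero_eq_power2)

text \<open>x - Q x lies in the kernel of Q, hence of P, so P Q = P, and symmetrically Q P = Q. As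
  projections contract, P x and Q x have the same norm.\<close>

lemma projection_eq_if_kernel_eq:
  assumes P: "projection_op P" and Q: "projection_op Q" and eq: "\<And>x. P x = 0 \<longleftrightarrow> Q x = 0"
  shows "P = Q"
proof (rule op_eqI)
  fix x
  have 1: "P (Q x) = P x" for x
    using eq[of "x - Q x"] by (simp add: bop_diff projection_apply_apply[OF Q])
  have 2: "Q (P x) = Q x" for x
    using eq[of "x - P x"] by (simp add: bop_diff projection_apply_apply[OF P])
  have "norm (P x) \<le> norm (Q x)" using projection_norm_le[OF P, of "Q x"] 1 by simp
  moreover have "norm (Q x) \<le> norm (P x)" using projection_norm_le[OF Q, of "P x"] 2 by simp
  ultimately show "inner (P x) x = inner (Q x) x" by (simp add: projection_inner P Q)
qed (use P Q projection_selfadjoint in auto)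

lemma support_proj_eqI:
  assumes "selfadjoint_op S" "projection_op P" "\<And>x. P x = 0 \<longleftrightarrow> S x = 0"
  shows "support_proj S = P"
  by (rule projection_eq_if_kernel_eq[OF support_proj(1) assms(2)])
    (simp add: support_proj_zero_iff[OF assms(1)] assms(3))

lemma support_proj_sqrt: "positive_op A \<Longrightarrow> support_proj (sqrt_op A) = support_proj A"
  by (rule support_proj_eqI)
    (auto simp: sqrt_op_selfadjoint support_proj support_proj_zero_iff positive_selfadjoint sqrt_op_zero_iff)

text \<open>Z preserves the kernel of N, which says Q Z = Q Z Q for the support projection Q; taking
  adjoints gives Z Q = Q Z Q as well.\<close>

lemma support_proj_commute:
  assumes N: "selfadjoint_op N" and Z: "selfadjoint_op Z" and comm: "Z * N = N * Z"
  shows "Z * support_proj N = support_proj N * Z"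
proof (rule bop_eqI)
  fix x
  let ?Q = "support_proj N"
  have Q: "projection_op ?Q" "selfadjoint_op ?Q" by (rule support_proj(1), rule projection_selfadjoint[OF support_proj(1)])
  have QZ: "?Q (Z x) = ?Q (Z (?Q x))" for x
  proof -
    have "N (Z (x - ?Q x)) = Z (N (x - ?Q x))" using comm by (metis times_bop.rep_eq)
    also have "N (x - ?Q x) = 0" by (simp add: bop_diff support_proj_apply_range'[OF N])
    finally have "?Q (Z (x - ?Q x)) = 0" by (simp add: support_proj_zero_iff[OF N])
    then show ?thesis by (simp add: bop_diff)
  qed
  have "cinner (Z (?Q x)) y = cinner (?Q (Z (?Q x))) y" for y
  proof -
    have "cinner (Z (?Q x)) y = cinner x (?Q (Z y))" using Q(2) Z by (simp add: selfadjoint_op_def)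
    also have "\<dots> = cinner x (?Q (Z (?Q y)))" by (simp only: QZ[of y])
    also have "\<dots> = cinner (?Q (Z (?Q x))) y" using Q(2) Z by (simp add: selfadjoint_op_def)
    finally show ?thesis .
  qed
  then have "cinner (Z (?Q x) - ?Q (Z (?Q x))) (Z (?Q x) - ?Q (Z (?Q x))) = 0"
    by (simp add: cinner_diff_left)
  then have "Z (?Q x) = ?Q (Z (?Q x))" by (simp add: cinner_self)
  then show "(Z * ?Q) x = (?Q * Z) x" using QZ[of x] by (simp add: bop_rep_eq)
qed

text \<open>\<open>F\<close> is the projection onto the kernel of the positive part of \<open>V\<close>.\<close>

lemma negative_projection:
  fixes V :: "'a::complex_hilbert bop"
  assumes V: "selfadjoint_op V"
  defines "G \<equiv> sqrt_op (V * V)"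
  defines "F \<equiv> 1 - support_proj (G + V)"
  shows "positive_op G" "projection_op F"
    "\<And>x. F x = x \<Longrightarrow> V x = - G x" "\<And>x. F x = 0 \<Longrightarrow> V x = G x"
    "\<And>x. V x = 0 \<Longrightarrow> F x = x"
    "\<And>Z. selfadjoint_op Z \<Longrightarrow> Z * V = V * Z \<Longrightarrow> Z * F = F * Z"
    "G * V = V * G"
proof -
  have VV: "positive_op (V * V)" by (rule positive_op_square[OF V])
  show G: "positive_op G" unfolding G_def by (rule sqrt_op(1)[OF VV])
  have GG: "G * G = V * V" unfolding G_def by (rule sqrt_op(2)[OF VV])
  have comm: "Z * G = G * Z" if "Z * V = V * Z" for Z
    unfolding G_def by (rule sqrt_op(3)[OF VV]) (metis mult.assoc that)
  show GV: "G * V = V * G" using comm[of V] by simp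
  have N: "selfadjoint_op (G + V)" by (intro selfadjoint_intros V positive_selfadjoint[OF G])
  let ?Q = "support_proj (G + V)"
  have Q: "projection_op ?Q" by (rule support_proj(1))
  show "projection_op F"
    using Q by (simp add: projection_op_def F_def selfadjoint_intros algebra_simps)
  have Fx: "F x = x - ?Q x" for x by (simp add: F_def bop_rep_eq)
  show "V x = - G x" if "F x = x" for x
  proof -
    have "(G + V) x = 0" using that support_proj_zero_iff[OF N, of x] by (simp add: Fx)
    then show ?thesis by (simp add: bop_rep_eq add_eq_0_iff)
  qed
  show "V x = G x" if "F x = 0" for x
  proof -
    have "?Q x = x" using that by (simp add: Fx)
    then have x: "x \<in> closure (range (bop_apply (G + V)))" using support_proj(2)[of "G + V"] by (metis rangeI)
    \<comment> \<open>G - V annihilates the range of G + V and therefore its closure, which consists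
      of the vectors killed by F.\<close>
    have "(G - V) * (G + V) = 0" using GG GV by (simp add: algebra_simps)
    then have "range (bop_apply (G + V)) \<subseteq> {x. (G - V) x = 0}" by (auto simp: fun_eq_iff bop_rep_eq dest!: arg_cong[where f = bop_apply])
    moreover have "closed {x. (G - V) x = 0}"
      by (intro closed_Collect_eq linear_continuous_on bounded_linear_bop continuous_on_const)
    ultimately have "(G - V) x = 0" using x closure_minimal by blast
    then show ?thesis by (simp add: bop_rep_eq)
  qed
  \<comment> \<open>Kernel vectors of V are assigned to F. For V = T - l these are the eigenvectors
    at l, and this convention makes the spectral resolution continuous from the right.\<close>
  show "F x = x" if "V x = 0" for x
  proof -
    have "(norm (G x))\<^sup>2 = inner ((G * G) x) x"
      using selfadjoint_inner[OF positive_selfadjoint[OF G], of "G x" x]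
      by (simp add: bop_rep_eq power2_norm_eq_inner)
    then have "(G + V) x = 0" using that by (simp add: GG bop_rep_eq)
    then show ?thesis using support_proj_zero_iff[OF N, of x] by (simp add: Fx)
  qed
  show "Z * F = F * Z" if Z: "selfadjoint_op Z" "Z * V = V * Z" for Z
  proof -
    have "Z * (G + V) = (G + V) * Z" using comm[OF Z(2)] Z(2) by (simp add: algebra_simps)
    then show ?thesis using support_proj_commute[OF N Z(1)] by (simp add: F_def algebra_simps)
  qed
qed

lemma abs_op_selfadjoint: "selfadjoint_op T \<Longrightarrow> abs_op T = sqrt_op (T * T)"
  by (simp add: abs_op_def adj_selfadjoint)

lemma abs_op_positive: "positive_op T \<Longrightarrow> abs_op T = T"
  by (simp add: abs_op_selfadjoint positive_selfadjoint sqrt_op(4) positive_op_square)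

text \<open>G commutes with F, so the decomposition x = y + z by F has no cross terms: the forms of
  V and of its absolute value are the difference and the sum of the same two nonnegative
  numbers.\<close>

lemma inner_le_abs_op:
  assumes V: "selfadjoint_op V"
  shows "\<bar>inner (V x) x\<bar> \<le> inner (abs_op V x) x"
proof -
  define G F where "G = sqrt_op (V * V)" and "F = 1 - support_proj (G + V)"
  note F = negative_projection[OF V, folded G_def, folded F_def]
  define y z where "y = F x" and "z = x - F x"
  have Fy: "F y = y" and Fz: "F z = 0" by (simp_all add: y_def z_def bop_diff projection_apply_apply[OF F(2)])
  have x: "x = y + z" by (simp add: y_def z_def)
  have GF: "G * F = F * G" by (rule F(6)) (use F(7) positive_selfadjoint[OF F(1)] in auto)
  have Gy: "F (G y) = G y" using arg_cong[OF GF, of "\<lambda>T. bop_apply T y"] Fy by (simp add: bop_rep_eq)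
  have Gz: "F (G z) = 0" using arg_cong[OF GF, of "\<lambda>T. bop_apply T z"] Fz by (simp add: bop_rep_eq)
  have "inner (G y) z = 0"
    using selfadjoint_inner[OF projection_selfadjoint[OF F(2)], of "G y" z] by (simp add: Gy Fz)
  moreover have "inner (G z) y = 0"
    using selfadjoint_inner[OF projection_selfadjoint[OF F(2)], of "G z" y] by (simp add: Gz Fy)
  ultimately have "inner (V x) x = inner (G z) z - inner (G y) y" "inner (G x) x = inner (G z) z + inner (G y) y"
    using F(3)[OF Fy] F(4)[OF Fz] by (simp_all add: x bop_add inner_add_left inner_add_right inner_diff_left)
  moreover have "0 \<le> inner (G z) z" "0 \<le> inner (G y) y" by (rule positive_op_inner[OF F(1)])+
  ultimately show ?thesis by (simp add: abs_op_selfadjoint[OF V] G_def[symmetric])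
qed

section \<open>The spectral theorem\<close>

lemma projection_one_minus: "projection_op P \<Longrightarrow> projection_op (1 - P)"
  by (simp add: projection_op_def selfadjoint_intros algebra_simps)

lemma projection_mult:
  "projection_op P \<Longrightarrow> projection_op Q \<Longrightarrow> P * Q = Q * P \<Longrightarrow> projection_op (P * Q)"
  unfolding projection_op_def by (metis mult.assoc selfadjoint_mult)

lemma projection_chain_norm:
  assumes "projection_op P" "P (bop_apply Q x) = P x"
  shows "(norm (bop_apply Q x - P x))\<^sup>2 = (norm (bop_apply Q x))\<^sup>2 - (norm (P x))\<^sup>2"
  using projection_pythagoras[OF assms(1), of "bop_apply Q x"] by (simp add: assms(2))

text \<open>Made for monotone chains of projections: g n is the squared norm of the n-th projected
  vector, a bounded monotone sequence, and Pythagoras gives the hypothesis.\<close>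

lemma convergent_if_norm_diff_le:
  fixes f :: "nat \<Rightarrow> 'a::banach"
  assumes g: "convergent g" and le: "\<And>m n. m \<le> n \<Longrightarrow> (norm (f n - f m))\<^sup>2 \<le> \<bar>g n - g m :: real\<bar>"
  shows "convergent f"
proof -
  have "Cauchy g" using g by (simp add: Cauchy_convergent_iff)
  have "Cauchy f"
  proof (rule CauchyI')
    fix e :: real assume e: "0 < e"
    then obtain M where M: "\<And>m n. M \<le> m \<Longrightarrow> M \<le> n \<Longrightarrow> norm (g m - g n) < e\<^sup>2"
      using CauchyD[OF \<open>Cauchy g\<close>, of "e\<^sup>2"] by auto
    have "dist (f m) (f n) < e" if "M \<le> m" "m < n" for m n
    proof -
      have "(norm (f n - f m))\<^sup>2 < e\<^sup>2" using le[of m n] M[of n m] that by simp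
      then have "norm (f n - f m) < e" using e by (intro power2_less_imp_less[of _ e]) auto
      then show ?thesis by (simp add: dist_norm norm_minus_commute)
    qed
    then show "\<exists>M. \<forall>m\<ge>M. \<forall>n>m. dist (f m) (f n) < e" by blast
  qed
  then show ?thesis by (simp add: Cauchy_convergent_iff)
qed

text \<open>The partial sums form an increasing chain of projections, so the squared norms of their
  increments telescope against a bounded monotone sequence, and the sums converge strongly.\<close>

lemma orthogonal_projections_sum:
  fixes Q :: "nat \<Rightarrow> 'a::complex_hilbert bop"
  assumes Q: "\<And>n. projection_op (Q n)" and orth: "\<And>m n x. m \<noteq> n \<Longrightarrow> Q m (Q n x) = 0"
  obtains R where "projection_op R" "\<And>x. (\<lambda>n. Q n x) sums R x"
proof -
  have Q1: "Q m (Q n x) = (if m = n then Q n x else 0)" for m n x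
    using orth projection_apply_apply[OF Q] by simp
  define R where "R n = (\<Sum>k<n. Q k)" for n
  have QR: "Q k (R n x) = (if k < n then Q k x else 0)" for k n x
    by (simp add: R_def sum_bop_apply bop_sum Q1)
  have RR: "R m (R n x) = R (min m n) x" for m n x
  proof -
    have "R m (R n x) = (\<Sum>k<m. if k < n then Q k x else 0)"
      by (subst R_def) (simp add: sum_bop_apply QR)
    also have "\<dots> = (\<Sum>k<min m n. Q k x)"
      by (rule sum.mono_neutral_cong_right) auto
    finally show ?thesis by (simp add: R_def sum_bop_apply)
  qed
  have R: "projection_op (R n)" for n
    unfolding projection_op_def
  proof
    show "selfadjoint_op (R n)"
      unfolding R_def by (intro selfadjoint_sum projection_selfadjoint Q)
    show "R n * R n = R n" by (rule bop_eqI) (simp add: bop_rep_eq RR)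
  qed
  have conv: "convergent (\<lambda>n. R n x)" for x
  proof (rule convergent_if_norm_diff_le)
    have le: "(norm (R n x - R m x))\<^sup>2 = (norm (R n x))\<^sup>2 - (norm (R m x))\<^sup>2" if "m \<le> n" for m n
      by (rule projection_chain_norm[OF R]) (use that in \<open>simp add: RR min_absorb1\<close>)
    then show "(norm (R n x - R m x))\<^sup>2 \<le> \<bar>(norm (R n x))\<^sup>2 - (norm (R m x))\<^sup>2\<bar>" if "m \<le> n" for m n
      using that by simp
    have "incseq (\<lambda>n. (norm (R n x))\<^sup>2)"
    proof (rule monoI)
      fix m n :: nat assume "m \<le> n"
      then show "(norm (R m x))\<^sup>2 \<le> (norm (R n x))\<^sup>2"
        using le[of m n] zero_le_power2[of "norm (R n x - R m x)"] by linarith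
    qed
    moreover have "norm ((norm (R n x))\<^sup>2) \<le> (norm x)\<^sup>2" for n
      using projection_norm_le[OF R] by (simp add: power_mono)
    ultimately show "convergent (\<lambda>n. (norm (R n x))\<^sup>2)"
      by (intro Bseq_monoseq_convergent BseqI'[where K = "(norm x)\<^sup>2"] incseq_imp_monoseq)
  qed
  define L where "L x = lim (\<lambda>n. R n x)" for x
  have L: "(\<lambda>n. R n x) \<longlonglongrightarrow> L x" for x
    using conv unfolding L_def by (simp add: convergent_LIMSEQ_iff)
  obtain S where S: "\<And>x. bop_apply S x = L x"
  proof (rule bop_construct)
    show "L (x + y) = L x + L y" for x y
      using LIMSEQ_unique[OF L[of "x + y"]] tendsto_add[OF L[of x] L[of y]] by (simp add: bop_add)
    show "L (c *\<^sub>C x) = c *\<^sub>C L x" for c x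
      using LIMSEQ_unique[OF L[of "c *\<^sub>C x"]]
        bounded_linear.tendsto[OF bounded_linear_scaleC_right L[of x], of c] by (simp add: bop_scaleC)
    show "norm (L x) \<le> 1 * norm x" for x
      by (rule LIMSEQ_le_const2[OF tendsto_norm[OF L]]) (use projection_norm_le[OF R] in auto)
  qed (rule that)
  have sums: "(\<lambda>n. Q n x) sums S x" for x
    using L by (simp add: sums_def S R_def sum_bop_apply)
  have QS: "Q k (S x) = Q k x" for k x
  proof (rule LIMSEQ_unique)
    show "(\<lambda>n. Q k (R n x)) \<longlonglongrightarrow> Q k (S x)"
      unfolding S by (rule tendsto_bop_apply[OF L])
    have "eventually (\<lambda>n. Q k (R n x) = Q k x) sequentially"
      using eventually_gt_at_top[of k] by eventually_elim (simp add: QR)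
    then show "(\<lambda>n. Q k (R n x)) \<longlonglongrightarrow> Q k x" by (rule tendsto_eventually)
  qed
  have "projection_op S"
    unfolding projection_op_def
  proof
    show "selfadjoint_op S" unfolding selfadjoint_op_def
    proof (intro allI)
      fix x y
      have "(\<lambda>n. cinner (R n x) y) \<longlonglongrightarrow> cinner (S x) y"
        unfolding S by (intro tendsto_cinner L tendsto_const)
      moreover have "(\<lambda>n. cinner (R n x) y) \<longlonglongrightarrow> cinner x (S y)"
        unfolding S selfadjoint_cinner[OF projection_selfadjoint[OF R]]
        by (intro tendsto_cinner L tendsto_const)
      ultimately show "cinner (S x) y = cinner x (S y)" by (rule LIMSEQ_unique)
    qed
    show "S * S = S"
    proof (rule bop_eqI)
      fix x
      have "(\<lambda>n. Q n x) sums S (S x)" using sums[of "S x"] by (simp add: QS)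
      then show "(S * S) x = S x" using sums sums_unique2 by (simp add: bop_rep_eq) blast
    qed
  qed
  then show thesis using sums by (rule that)
qed

text \<open>The projection E((-\<infinity>, l]) of T. It is the projection \<open>F\<close> of
  \<open>negative_projection\<close> for V = T - l, written out.\<close>

definition spec_res :: "'a::complex_hilbert bop \<Rightarrow> real \<Rightarrow> 'a bop"
  where "spec_res T l = 1 - support_proj (sqrt_op ((T - l *\<^sub>R 1) * (T - l *\<^sub>R 1)) + (T - l *\<^sub>R 1))"

context
  fixes T :: "'a::complex_hilbert bop"
  assumes T: "selfadjoint_op T"
begin

lemma shift_selfadjoint: "selfadjoint_op (T - l *\<^sub>R 1)"
  by (intro selfadjoint_intros T)

lemma inner_shift: "inner ((T - l *\<^sub>R 1) x) x = inner (T x) x - l * (norm x)\<^sup>2"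
  by (simp add: bop_rep_eq inner_diff_left power2_norm_eq_inner)

lemma spec_res_proj: "projection_op (spec_res T l)"
  using negative_projection(2)[OF shift_selfadjoint[of l]] unfolding spec_res_def .

lemma spec_res_le:
  assumes "spec_res T l x = x"
  shows "inner (T x) x \<le> l * (norm x)\<^sup>2"
proof -
  note F = negative_projection[OF shift_selfadjoint[of l], folded spec_res_def]
  have "inner ((T - l *\<^sub>R 1) x) x \<le> 0"
    using F(3)[OF assms] positive_op_inner[OF F(1), of x] by simp
  then show ?thesis by (simp add: inner_shift)
qed

text \<open>If the inequality failed, the form of the positive operator \<open>?G\<close> would
  vanish at x, so x would be an eigenvector at l. Such vectors belong to the range of
  \<open>spec_res T l\<close>, not to its kernel.\<close>

lemma spec_res_gt:
  assumes x: "spec_res T l x = 0" "x \<noteq> 0"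
  shows "l * (norm x)\<^sup>2 < inner (T x) x"
proof (rule ccontr)
  note F = negative_projection[OF shift_selfadjoint[of l], folded spec_res_def]
  let ?G = "sqrt_op ((T - l *\<^sub>R 1) * (T - l *\<^sub>R 1))"
  assume "\<not> ?thesis"
  then have "inner (?G x) x \<le> 0" using F(4)[OF x(1)] inner_shift[of l x] by simp
  then have "?G x = 0" using positive_op_inner[OF F(1), of x] positive_op_kernel[OF F(1)] by force
  then have "(T - l *\<^sub>R 1) x = 0" using F(4)[OF x(1)] by simp
  then have "spec_res T l x = x" by (rule F(5))
  then show False using x by simp
qed

lemma spec_res_commute:
  assumes "selfadjoint_op Z" "Z * T = T * Z"
  shows "Z * spec_res T l = spec_res T l * Z"
  unfolding spec_res_def
  by (rule negative_projection(6)[OF shift_selfadjoint])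
    (use assms in \<open>simp_all add: algebra_simps\<close>)

lemma spec_res_commute_T: "spec_res T l (T x) = T (spec_res T l x)"
  using spec_res_commute[OF T refl, of l] by (metis times_bop.rep_eq)

lemma spec_res_commute_spec_res: "spec_res T l (spec_res T m x) = spec_res T m (spec_res T l x)"
proof -
  have "spec_res T l * T = T * spec_res T l" using spec_res_commute[OF T refl, of l] by simp
  then show ?thesis
    using spec_res_commute[OF projection_selfadjoint[OF spec_res_proj], of l m] by (metis times_bop.rep_eq)
qed

text \<open>A nonzero y in the range of the projection at l and in the kernel of the one at m would
  satisfy m |y|^2 < <T y, y> \<le> l |y|^2.\<close>

lemma spec_res_chain:
  assumes "l \<le> m"
  shows "spec_res T m (spec_res T l x) = spec_res T l x" "spec_res T l (spec_res T m x) = spec_res T l x"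
proof -
  let ?x = "spec_res T l x"
  define y where "y = ?x - spec_res T m ?x"
  have 0: "spec_res T m y = 0"
    by (simp add: y_def bop_diff projection_apply_apply[OF spec_res_proj])
  have 1: "spec_res T l y = y"
    using spec_res_commute_spec_res[of l m ?x] by (simp add: y_def bop_diff projection_apply_apply[OF spec_res_proj])
  have "y = 0"
  proof (rule ccontr)
    assume "y \<noteq> 0"
    then have "m * (norm y)\<^sup>2 < l * (norm y)\<^sup>2"
      by (rule less_le_trans[OF spec_res_gt[OF 0] spec_res_le[OF 1]])
    then show False using assms mult_right_mono[OF assms, of "(norm y)\<^sup>2"] by simp
  qed
  then show a: "spec_res T m ?x = ?x" by (simp add: y_def)
  then show "spec_res T l (spec_res T m x) = ?x" by (simp add: spec_res_commute_spec_res[of l m])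
qed

lemma spec_res_diff_norm:
  assumes "l \<le> m"
  shows "(norm (spec_res T m x - spec_res T l x))\<^sup>2 = (norm (spec_res T m x))\<^sup>2 - (norm (spec_res T l x))\<^sup>2"
  by (rule projection_chain_norm[OF spec_res_proj spec_res_chain(2)[OF assms]])

lemma spec_res_mono: "l \<le> m \<Longrightarrow> (norm (spec_res T l x))\<^sup>2 \<le> (norm (spec_res T m x))\<^sup>2"
  using spec_res_diff_norm[of l m x] zero_le_power2[of "norm (spec_res T m x - spec_res T l x)"] by linarith

text \<open>Let w be the limit along a decreasing sequence s n, and y = w -
  \<open>spec_res T l x\<close>. Then y lies in every range at s n, so <T y, y> \<le> l |y|^2 in the
  limit, and it lies in the kernel at l, where the reverse inequality is strict unless y =
  0.\<close>

lemma spec_res_right_cont: "continuous (at_right l) (\<lambda>l. (norm (spec_res T l x))\<^sup>2)"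
  unfolding continuous_within
proof (rule tendsto_at_right_sequentially[of l "l + 1"])
  show "l < l + 1" by simp
  fix s assume s: "\<And>n. l < s n" "decseq s" "s \<longlonglongrightarrow> l"
  have s_le: "s n \<le> s m" if "m \<le> n" for m n using s(2) that by (rule decseqD)
  let ?S = "spec_res T"
  have "convergent (\<lambda>n. ?S (s n) x)"
  proof (rule convergent_if_norm_diff_le)
    show "(norm (?S (s n) x - ?S (s m) x))\<^sup>2 \<le> \<bar>(norm (?S (s n) x))\<^sup>2 - (norm (?S (s m) x))\<^sup>2\<bar>" if "m \<le> n" for m n
      using spec_res_diff_norm[OF s_le[OF that], of x] by (simp add: norm_minus_commute)
    have "decseq (\<lambda>n. (norm (?S (s n) x))\<^sup>2)"
      by (rule decseq_SucI) (use s_le spec_res_mono in auto)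
    moreover have "norm ((norm (?S (s n) x))\<^sup>2) \<le> (norm x)\<^sup>2" for n
      using projection_norm_le[OF spec_res_proj] by (simp add: power_mono)
    ultimately show "convergent (\<lambda>n. (norm (?S (s n) x))\<^sup>2)"
      by (intro Bseq_monoseq_convergent BseqI'[where K = "(norm x)\<^sup>2"] decseq_imp_monoseq)
  qed
  then obtain w where w: "(\<lambda>n. ?S (s n) x) \<longlonglongrightarrow> w" by (auto simp: convergent_def)
  define y where "y = w - ?S l x"
  have "?S l w = ?S l x"
  proof (rule LIMSEQ_unique[OF tendsto_bop_apply[OF w]])
    show "(\<lambda>n. ?S l (?S (s n) x)) \<longlonglongrightarrow> ?S l x"
      using spec_res_chain(2)[OF less_imp_le[OF s(1)]] by simp
  qed
  then have y0: "?S l y = 0" by (simp add: y_def bop_diff projection_apply_apply[OF spec_res_proj])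
  have ym: "?S (s m) y = y" for m
  proof -
    have "?S (s m) w = w"
    proof (rule LIMSEQ_unique[OF tendsto_bop_apply[OF w]])
      have "eventually (\<lambda>n. ?S (s n) x = ?S (s m) (?S (s n) x)) sequentially"
        using eventually_ge_at_top[of m] by eventually_elim (simp add: spec_res_chain(1)[OF s_le])
      then show "(\<lambda>n. ?S (s m) (?S (s n) x)) \<longlonglongrightarrow> w" using w tendsto_cong by fast
    qed
    then show ?thesis by (simp add: y_def bop_diff spec_res_chain(1)[OF less_imp_le[OF s(1)]])
  qed
  have "inner (T y) y \<le> l * (norm y)\<^sup>2"
    by (rule LIMSEQ_le_const[OF tendsto_mult_right[OF s(3)]]) (use spec_res_le[OF ym] in auto)
  then have "y = 0" using spec_res_gt[OF y0] by force
  then have "w = ?S l x" by (simp add: y_def)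
  then show "(\<lambda>n. (norm (?S (s n) x))\<^sup>2) \<longlonglongrightarrow> (norm (?S l x))\<^sup>2"
    using w by (intro tendsto_power tendsto_norm) simp
qed

lemma spec_res_top:
  assumes "norm T \<le> l"
  shows "spec_res T l x = x"
proof -
  define y where "y = x - spec_res T l x"
  have y: "spec_res T l y = 0" by (simp add: y_def bop_diff projection_apply_apply[OF spec_res_proj])
  have "inner (T y) y \<le> l * (norm y)\<^sup>2"
    using inner_bop_le_norm[of T y] mult_right_mono[OF assms, of "(norm y)\<^sup>2"] by simp
  then have "y = 0" using spec_res_gt[OF y] by force
  then show ?thesis by (simp add: y_def)
qed

lemma spec_res_bot:
  assumes "l < - norm T"
  shows "spec_res T l x = 0"
proof -
  define y where "y = spec_res T l x"
  have y: "spec_res T l y = y" by (simp add: y_def projection_apply_apply[OF spec_res_proj])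
  have "- norm T * (norm y)\<^sup>2 \<le> inner (T y) y" using inner_bop_le_norm[of "- T" y] by (simp add: bop_rep_eq)
  then have le: "- norm T * (norm y)\<^sup>2 \<le> l * (norm y)\<^sup>2" using spec_res_le[OF y] by simp
  have "y = 0"
  proof (rule ccontr)
    assume "y \<noteq> 0"
    then have "l * (norm y)\<^sup>2 < - norm T * (norm y)\<^sup>2" using assms by (intro mult_strict_right_mono) auto
    then show False using le by linarith
  qed
  then show ?thesis by (simp add: y_def)
qed

definition "spec_meas x = interval_measure (\<lambda>l. (norm (spec_res T l x))\<^sup>2)"

lemma sets_spec_meas [simp]: "sets (spec_meas x) = sets borel" and space_spec_meas [simp]: "space (spec_meas x) = UNIV"
  by (simp_all add: spec_meas_def)

lemma emeasure_spec_meas_Ioc: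
  "a \<le> b \<Longrightarrow> emeasure (spec_meas x) {a<..b} = ennreal ((norm (spec_res T b x - spec_res T a x))\<^sup>2)"
  unfolding spec_meas_def spec_res_diff_norm
  by (rule emeasure_interval_measure_Ioc[OF _ spec_res_mono spec_res_right_cont])

lemma emeasure_spec_meas_UNIV: "emeasure (spec_meas x) UNIV = ennreal ((norm x)\<^sup>2)"
proof -
  have "(\<lambda>n. emeasure (spec_meas x) {- real n<..real n}) \<longlonglongrightarrow> emeasure (spec_meas x) (\<Union>n. {- real n<..real n})"
  proof (rule Lim_emeasure_incseq)
    show "incseq (\<lambda>n. {- real n<..real n})" by (rule incseq_SucI) auto
  qed auto
  moreover have "(\<Union>n. {- real n<..real n}) = UNIV"
  proof -
    have "\<exists>n. r \<in> {- real n<..real n}" for r :: real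
    proof -
      obtain n where "\<bar>r\<bar> < real n" using reals_Archimedean2 by blast
      then show ?thesis by (intro exI[of _ n]) auto
    qed
    then show ?thesis by auto
  qed
  moreover have "(\<lambda>n. emeasure (spec_meas x) {- real n<..real n}) \<longlonglongrightarrow> ennreal ((norm x)\<^sup>2)"
  proof (rule tendsto_eventually)
    obtain N where N: "norm T < real N" using reals_Archimedean2 by blast
    show "eventually (\<lambda>n. emeasure (spec_meas x) {- real n<..real n} = ennreal ((norm x)\<^sup>2)) sequentially"
      using eventually_ge_at_top[of N]
    proof eventually_elim
      case (elim n)
      then have "norm T < real n" using N by simp
      then show ?case by (simp add: emeasure_spec_meas_Ioc spec_res_top spec_res_bot)
    qed
  qed
  ultimately show ?thesis using LIMSEQ_unique by fastforce
qed

lemma finite_spec_meas: "finite_measure (spec_meas x)"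
  by (rule finite_measureI) (simp add: emeasure_spec_meas_UNIV)

lemma AE_spec_meas:
  assumes "norm T < K"
  shows "AE t in spec_meas x. t \<in> {- K<..K}"
proof (rule AE_I')
  have "0 < K" using assms norm_ge_zero[of T] by linarith
  interpret finite_measure "spec_meas x" by (rule finite_spec_meas)
  have "emeasure (spec_meas x) (UNIV - {- K<..K}) = 0"
    using emeasure_compl[of "{- K<..K}" "spec_meas x"] assms \<open>0 < K\<close>
    by (simp add: emeasure_spec_meas_UNIV emeasure_spec_meas_Ioc spec_res_top spec_res_bot Compl_eq_Diff_UNIV)
  then show "UNIV - {- K<..K} \<in> null_sets (spec_meas x)" by (simp add: null_sets_def)
qed auto

lemma integrable_spec_meas: "integrable (spec_meas x) (\<lambda>t. t)"
proof (rule finite_measure.integrable_const_bound[OF finite_spec_meas])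
  show "AE t in spec_meas x. norm t \<le> norm T + 1"
    using AE_spec_meas[of "norm T + 1" x] by auto
  show "(\<lambda>t. t) \<in> borel_measurable (spec_meas x)" by (simp add: measurable_cong_sets[OF sets_spec_meas refl])
qed

text \<open>A Riemann-Stieltjes estimate. \<open>d b\<close> compares the form of T on the part of x
  up to b with the integral up to b. Over (a, b] both change by an amount between a (F b - F a) and
  b (F b - F a), so d changes by at most the mesh times the increment of F. Summing over a uniform
  partition of (-K, K] and refining it gives d K = d (-K).\<close>

lemma integral_spec_meas: "(\<integral>t. t \<partial>spec_meas x) = inner (T x) x"
proof -
  interpret finite_measure "spec_meas x" by (rule finite_spec_meas)
  define K where "K = norm T + 1"
  have K: "0 < K" "norm T < K" by (simp_all add: K_def add_nonneg_pos)
  define F where "F b = (norm (spec_res T b x))\<^sup>2" for b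
  define i where "i b = (\<integral>t. indicat_real {- K<..b} t * t \<partial>spec_meas x)" for b
  define d where "d b = inner (T (spec_res T b x)) x - i b" for b
  have int: "integrable (spec_meas x) (\<lambda>t. indicat_real {a<..b} t * t)" for a b
    using integrable_real_mult_indicator[OF _ integrable_spec_meas, of "{a<..b}" x] by (simp add: mult.commute)
  have intc: "integrable (spec_meas x) (\<lambda>t. indicat_real {a<..b} t * c)" for a b c
    by (intro integrable_mult_left integrable_real_indicator) (auto simp: less_top[symmetric])
  have step: "\<bar>d b - d a\<bar> \<le> (b - a) * (F b - F a)" if ab: "- K \<le> a" "a \<le> b" for a b
  proof -
    define z where "z = spec_res T b x - spec_res T a x"
    have nz: "(norm z)\<^sup>2 = F b - F a" unfolding z_def F_def by (rule spec_res_diff_norm[OF ab(2)])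
    have "spec_res T b z = z" "spec_res T a z = 0"
      using spec_res_chain[OF ab(2), of x] by (simp_all add: z_def bop_diff projection_apply_apply[OF spec_res_proj])
    then have 1: "inner (T z) z \<le> b * (F b - F a)" "a * (F b - F a) \<le> inner (T z) z"
      using spec_res_le[of b z] spec_res_gt[of a z] unfolding nz[symmetric]
      by (auto intro: less_imp_le elim!: allE) (cases "z = 0"; auto intro: less_imp_le)
    have "inner (T z) z = inner (T (spec_res T b z)) x - inner (T (spec_res T a z)) x"
      using selfadjoint_inner[OF projection_selfadjoint[OF spec_res_proj], of b "T z" x]
        selfadjoint_inner[OF projection_selfadjoint[OF spec_res_proj], of a "T z" x]
      by (subst (2) z_def) (simp add: inner_diff_right spec_res_commute_T)
    also have "\<dots> = inner (T z) x" using \<open>spec_res T b z = z\<close> \<open>spec_res T a z = 0\<close> by simp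
    finally have 2: "inner (T z) z = inner (T (spec_res T b x)) x - inner (T (spec_res T a x)) x"
      by (simp add: z_def bop_diff inner_diff_left)
    have ind: "indicat_real {- K<..b} t * t - indicat_real {- K<..a} t * t = indicat_real {a<..b} t * t" for t
      using ab by (auto simp: indicator_def)
    have "i b - i a = (\<integral>t. indicat_real {a<..b} t * t \<partial>spec_meas x)"
      unfolding i_def by (subst Bochner_Integration.integral_diff[symmetric]) (simp_all add: int ind)
    moreover have m: "measure (spec_meas x) {a<..b} = F b - F a"
      unfolding nz[symmetric] by (simp add: measure_def emeasure_spec_meas_Ioc ab z_def)
    have "(\<integral>t. indicat_real {a<..b} t * t \<partial>spec_meas x) \<le> (\<integral>t. indicat_real {a<..b} t * b \<partial>spec_meas x)"
      by (rule integral_mono[OF int intc]) (auto simp: indicator_def)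
    moreover have "(\<integral>t. indicat_real {a<..b} t * a \<partial>spec_meas x) \<le> (\<integral>t. indicat_real {a<..b} t * t \<partial>spec_meas x)"
      by (rule integral_mono[OF intc int]) (auto simp: indicator_def)
    ultimately have 3: "i b - i a \<le> b * (F b - F a)" "a * (F b - F a) \<le> i b - i a"
      using m by (simp_all add: mult.commute)
    show ?thesis using 1 2 3 by (simp add: d_def left_diff_distrib abs_le_iff)
  qed
  have "\<bar>d K - d (- K)\<bar> \<le> (2 * K / real (Suc n)) * (F K - F (- K))" for n
  proof -
    define h where "h = 2 * K / real (Suc n)"
    define t where "t k = - K + real k * h" for k
    have h: "0 \<le> h" "real (Suc n) * h = 2 * K" using K by (simp_all add: h_def del: of_nat_Suc)
    have t: "t 0 = - K" "t (Suc n) = K" by (simp add: t_def, simp only: t_def h(2))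
    have t': "t (Suc k) - t k = h" "- K \<le> t k" for k
      using h by (simp_all add: t_def algebra_simps)
    have "d K - d (- K) = (\<Sum>k<Suc n. d (t (Suc k)) - d (t k))"
      by (subst sum_lessThan_telescope) (simp add: t)
    then have "\<bar>d K - d (- K)\<bar> \<le> (\<Sum>k<Suc n. \<bar>d (t (Suc k)) - d (t k)\<bar>)" by (simp only: sum_abs)
    also have "\<dots> \<le> (\<Sum>k<Suc n. h * (F (t (Suc k)) - F (t k)))"
    proof (rule sum_mono)
      fix k
      show "\<bar>d (t (Suc k)) - d (t k)\<bar> \<le> h * (F (t (Suc k)) - F (t k))"
        using step[OF t'(2), of k "t (Suc k)"] t'(1)[of k] h(1) by simp
    qed
    also have "\<dots> = h * (F K - F (- K))"
      by (subst sum_distrib_left[symmetric], subst sum_lessThan_telescope) (simp add: t)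
    finally show ?thesis by (simp only: h_def)
  qed
  moreover have "(\<lambda>n. (2 * K / real (Suc n)) * (F K - F (- K))) \<longlonglongrightarrow> 0 * (F K - F (- K))"
    by (intro tendsto_mult tendsto_const lim_const_over_n[THEN LIMSEQ_Suc])
  ultimately have "\<bar>d K - d (- K)\<bar> \<le> 0" by (metis (no_types, lifting) LIMSEQ_le_const mult_zero_left)
  then have "d K = d (- K)" by simp
  moreover have "i (- K) = 0" by (simp add: i_def)
  moreover have "i K = (\<integral>t. t \<partial>spec_meas x)"
    unfolding i_def using AE_spec_meas[OF K(2), of x]
    by (intro integral_cong_AE) (auto simp: measurable_cong_sets[OF sets_spec_meas refl])
  moreover have "spec_res T K x = x" "spec_res T (- K) x = 0" using K by (simp_all add: spec_res_top spec_res_bot)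
  ultimately show ?thesis by (simp add: d_def)
qed

text \<open>For y = Q' x the set D' already carries the total mass |y|^2 of
  \<open>spec_meas y\<close>, which leaves nothing for the disjoint set D.\<close>

lemma spec_proj_orthogonal:
  assumes "D \<in> sets borel" "D' \<in> sets borel" "D \<inter> D' = {}" "projection_op Q'"
    and Q: "\<And>x. emeasure (spec_meas x) D = ennreal ((norm (bop_apply Q x))\<^sup>2)"
    and Q': "\<And>x. emeasure (spec_meas x) D' = ennreal ((norm (bop_apply Q' x))\<^sup>2)"
  shows "bop_apply Q (bop_apply Q' x) = 0"
proof -
  let ?y = "Q' x"
  have "emeasure (spec_meas ?y) D + emeasure (spec_meas ?y) D' = emeasure (spec_meas ?y) (D \<union> D')"
    by (rule plus_emeasure) (use assms in auto)
  also have "\<dots> \<le> emeasure (spec_meas ?y) UNIV" by (rule emeasure_mono) auto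
  finally have "ennreal ((norm (Q ?y))\<^sup>2 + (norm ?y)\<^sup>2) \<le> ennreal ((norm ?y)\<^sup>2)"
    by (simp add: Q Q' emeasure_spec_meas_UNIV projection_apply_apply assms(4))
  then show ?thesis by simp
qed

text \<open>Induction over the Dynkin system of the half-open intervals: differences of the
  resolution for intervals, 1 - Q for complements, strong sums for disjoint unions. Commutation is
  carried along so that the projections can afterwards be multiplied by P.\<close>

lemma spec_proj_exists:
  assumes "\<Delta> \<in> sets borel"
  shows "\<exists>Q. projection_op Q \<and> (\<forall>x. emeasure (spec_meas x) \<Delta> = ennreal ((norm (Q x))\<^sup>2)) \<and>
    (\<forall>Z. selfadjoint_op Z \<longrightarrow> Z * T = T * Z \<longrightarrow> Z * Q = Q * Z)"
proof -
  let ?good = "\<lambda>\<Delta> Q. projection_op Q \<and> (\<forall>x. emeasure (spec_meas x) \<Delta> = ennreal ((norm (Q x))\<^sup>2)) \<and>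
    (\<forall>Z. selfadjoint_op Z \<longrightarrow> Z * T = T * Z \<longrightarrow> Z * Q = Q * Z)"
  let ?G = "range (\<lambda>(a, b). {a<..b::real})"
  have "Int_stable ?G"
  proof (rule Int_stableI)
    fix A B assume "A \<in> ?G" "B \<in> ?G"
    then obtain a b c d where AB: "A = {a<..b}" "B = {c<..d}" by auto
    have "A \<inter> B = (\<lambda>(a, b). {a<..b}) (max a c, min b d)" unfolding AB by auto
    then show "A \<inter> B \<in> ?G" by (rule range_eqI)
  qed
  moreover have "?G \<subseteq> Pow UNIV" by simp
  moreover have "\<Delta> \<in> sigma_sets UNIV ?G" using assms unfolding borel_sigma_sets_Ioc by simp
  ultimately show ?thesis
  proof (induction rule: sigma_sets_induct_disjoint)
    case (basic A)
    then obtain a b where A: "A = {a<..b}" by auto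
    show ?case
    proof (cases "a \<le> b")
      case True
      have ab: "spec_res T b * spec_res T a = spec_res T a" "spec_res T a * spec_res T b = spec_res T a"
        by (rule bop_eqI, simp add: bop_rep_eq spec_res_chain[OF True])+
      have "projection_op (spec_res T b - spec_res T a)"
        using spec_res_proj[of a] spec_res_proj[of b] ab
        by (simp add: projection_op_def selfadjoint_intros algebra_simps)
      moreover have "Z * (spec_res T b - spec_res T a) = (spec_res T b - spec_res T a) * Z"
        if "selfadjoint_op Z" "Z * T = T * Z" for Z
        using spec_res_commute[OF that] by (simp add: algebra_simps)
      ultimately show ?thesis
        by (intro exI[of _ "spec_res T b - spec_res T a"]) (simp add: A emeasure_spec_meas_Ioc[OF True] bop_rep_eq)
    next
      case False
      then have "A = {}" by (simp add: A)
      then show ?thesis by (intro exI[of _ 0]) (simp add: projection_op_def selfadjoint_intros bop_rep_eq)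
    qed
  next
    case empty
    show ?case by (intro exI[of _ 0]) (simp add: projection_op_def selfadjoint_intros bop_rep_eq)
  next
    case (compl A)
    then obtain Q where Q: "?good A Q" by blast
    have A: "A \<in> sets borel" using compl(1) unfolding borel_sigma_sets_Ioc by simp
    interpret finite_measure "spec_meas x" for x by (rule finite_spec_meas)
    have "emeasure (spec_meas x) (UNIV - A) = ennreal ((norm ((1 - Q) x))\<^sup>2)" for x
    proof -
      have "emeasure (spec_meas x) (UNIV - A) = ennreal ((norm x)\<^sup>2) - ennreal ((norm (Q x))\<^sup>2)"
        using emeasure_compl[of A "spec_meas x"] A Q by (simp add: emeasure_spec_meas_UNIV Compl_eq_Diff_UNIV)
      also have "\<dots> = ennreal ((norm ((1 - Q) x))\<^sup>2)"
        using projection_pythagoras[of Q x] Q by (simp add: ennreal_minus bop_rep_eq)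
      finally show ?thesis .
    qed
    then show ?case using Q by (intro exI[of _ "1 - Q"]) (auto simp: projection_one_minus algebra_simps)
  next
    case (union A)
    then have "\<forall>n. \<exists>Q. ?good (A n) Q" by blast
    then obtain Q where Q: "\<And>n. ?good (A n) (Q n)" by metis
    have A: "A n \<in> sets borel" for n using union(2) unfolding borel_sigma_sets_Ioc by auto
    have "Q m (Q n x) = 0" if "m \<noteq> n" for m n x
      by (rule spec_proj_orthogonal[of "A m" "A n"])
        (use A Q union(1) that in \<open>auto simp: disjoint_family_on_def\<close>)
    then obtain R where R: "projection_op R" "\<And>x. (\<lambda>n. Q n x) sums R x"
      using orthogonal_projections_sum[of Q] Q by metis
    have sq: "(\<lambda>n. (norm (Q n x))\<^sup>2) sums (norm (R x))\<^sup>2" for x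
    proof -
      have "(\<lambda>n. inner (Q n x) x) sums inner (R x) x"
        by (rule bounded_linear.sums[OF bounded_linear_inner_left R(2)])
      then show ?thesis using Q R(1) by (simp add: projection_inner)
    qed
    have "emeasure (spec_meas x) (\<Union>n. A n) = ennreal ((norm (R x))\<^sup>2)" for x
    proof -
      have "(\<Sum>n. emeasure (spec_meas x) (A n)) = emeasure (spec_meas x) (\<Union>n. A n)"
        by (rule suminf_emeasure) (use A union(1) in auto)
      moreover have "(\<Sum>n. ennreal ((norm (Q n x))\<^sup>2)) = ennreal ((norm (R x))\<^sup>2)"
        using sq[of x] by (simp add: suminf_ennreal2 sums_iff)
      ultimately show ?thesis using Q by simp
    qed
    moreover have "Z * R = R * Z" if Z: "selfadjoint_op Z" "Z * T = T * Z" for Z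
    proof (rule bop_eqI)
      fix x
      have "(\<lambda>n. Z (Q n x)) sums Z (R x)" by (rule bounded_linear.sums[OF bounded_linear_bop R(2)])
      moreover have "Z (Q n x) = Q n (Z x)" for n using Q Z by (metis times_bop.rep_eq)
      ultimately show "(Z * R) x = (R * Z) x" using R(2)[of "Z x"] sums_unique2 by (simp add: bop_rep_eq) blast
    qed
    ultimately show ?case using R(1) by blast
  qed
qed

end

text \<open>\<open>measure_of\<close> has the intended values only once countable additivity is
  established; strong convergence of E on disjoint unions, paired with x, yields it.\<close>

lemma pvm_measure:
  assumes E: "pvm_on P E"
  shows "sets (pvm_measure E x) = sets borel" "space (pvm_measure E x) = UNIV"
    "\<Delta> \<in> sets borel \<Longrightarrow> emeasure (pvm_measure E x) \<Delta> = ennreal ((norm (E \<Delta> x))\<^sup>2)"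
proof -
  have eq: "Re (cinner (E \<Delta> x) x) = (norm (E \<Delta> x))\<^sup>2" if "\<Delta> \<in> sets borel" for \<Delta>
    using E that by (simp add: pvm_on_def projection_cinner)
  have sums: "(\<lambda>n. E (D n) x) sums E (\<Union>n. D n) x" if "range D \<subseteq> sets borel" "disjoint_family D" for D
    using E that unfolding pvm_on_def by blast
  \<comment> \<open>The constant sequence of empty sets is a disjoint family, and a constant series
    converges only if its term is 0.\<close>
  have E0: "E {} x = 0"
    using sums[of "\<lambda>_. {}"] by (auto simp: disjoint_family_on_def sums_iff summable_const_iff)
  show "sets (pvm_measure E x) = sets borel" "space (pvm_measure E x) = UNIV"
    by (simp_all add: pvm_measure_def space_measure_of_conv sets_measure_of_conv sets.sigma_sets_eq[of borel, simplified])
  assume \<Delta>: "\<Delta> \<in> sets borel"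
  have "emeasure (pvm_measure E x) \<Delta> = ennreal (Re (cinner (E \<Delta> x) x))"
    unfolding pvm_measure_def
  proof (rule emeasure_measure_of_sigma[OF _ _ _ \<Delta>])
    show "sigma_algebra UNIV (sets borel)" using sets.sigma_algebra_axioms[of borel] by simp
    show "positive (sets borel) (\<lambda>\<Delta>. ennreal (Re (cinner (E \<Delta> x) x)))" by (simp add: positive_def E0)
    show "countably_additive (sets borel) (\<lambda>\<Delta>. ennreal (Re (cinner (E \<Delta> x) x)))"
      unfolding countably_additive_def
    proof (intro allI impI)
      fix D :: "nat \<Rightarrow> real set"
      assume D: "range D \<subseteq> sets borel" "disjoint_family D" "\<Union> (range D) \<in> sets borel"
      have "(\<lambda>n. inner (E (D n) x) x) sums inner (E (\<Union> (range D)) x) x"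
        by (rule bounded_linear.sums[OF bounded_linear_inner_left sums[OF D(1,2)]])
      then have s: "(\<lambda>n. Re (cinner (E (D n) x) x)) sums Re (cinner (E (\<Union> (range D)) x) x)"
        by (simp add: inner_eq_Re_cinner)
      moreover have "0 \<le> Re (cinner (E (D n) x) x)" for n using D(1) by (subst eq) auto
      ultimately show "(\<Sum>i. ennreal (Re (cinner (E (D i) x) x))) = ennreal (Re (cinner (E (\<Union> (range D)) x) x))"
        by (simp add: suminf_ennreal2 sums_iff)
    qed
  qed
  then show "emeasure (pvm_measure E x) \<Delta> = ennreal ((norm (E \<Delta> x))\<^sup>2)" by (simp add: eq[OF \<Delta>])
qed

text \<open>The projections of \<open>spec_proj_exists\<close> have unit 1. Since P commutes with T,
  they can be multiplied by P, and the measure of x for E becomes \<open>spec_meas T (P x)\<close>.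
  The form of T agrees at x and P x, so the integral formula survives.\<close>

theorem spectral_theorem:
  fixes T P :: "'a::complex_hilbert bop"
  assumes T: "selfadjoint_op T" and P: "projection_op P" and PT: "P * T = T" "T * P = T"
  obtains E where "pvm_on P E" "\<And>x. integrable (pvm_measure E x) (\<lambda>t. t)"
    "\<And>x. cinner (T x) x = complex_of_real (\<integral>t. t \<partial>pvm_measure E x)"
proof -
  obtain Q where Q: "\<And>\<Delta>. \<Delta> \<in> sets borel \<Longrightarrow> projection_op (Q \<Delta>)"
    "\<And>\<Delta> x. \<Delta> \<in> sets borel \<Longrightarrow> emeasure (spec_meas T x) \<Delta> = ennreal ((norm (Q \<Delta> x))\<^sup>2)"
    "\<And>\<Delta> Z. \<Delta> \<in> sets borel \<Longrightarrow> selfadjoint_op Z \<Longrightarrow> Z * T = T * Z \<Longrightarrow> Z * Q \<Delta> = Q \<Delta> * Z"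
    using spec_proj_exists[OF T] by metis
  define E where "E \<Delta> = Q \<Delta> * P" for \<Delta>
  have PQ: "P * Q \<Delta> = Q \<Delta> * P" if "\<Delta> \<in> sets borel" for \<Delta>
    using Q(3)[OF that projection_selfadjoint[OF P]] PT by simp
  have E: "projection_op (E \<Delta>)" if "\<Delta> \<in> sets borel" for \<Delta>
    unfolding E_def by (rule projection_mult) (use Q(1) P PQ that in auto)
  have "Q UNIV = 1"
  proof (rule op_eqI)
    show "inner (Q UNIV x) x = inner (bop_apply 1 x) x" for x
      using Q(2)[of UNIV x] by (simp add: emeasure_spec_meas_UNIV[OF T] projection_inner Q(1) bop_rep_eq power2_norm_eq_inner)
  qed (simp_all add: selfadjoint_intros projection_selfadjoint Q(1))
  moreover have "(\<lambda>n. E (D n) x) sums E (\<Union>n. D n) x"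
    if D: "range D \<subseteq> sets borel" "disjoint_family D" for D :: "nat \<Rightarrow> real set" and x
  proof -
    have A: "D n \<in> sets borel" for n using D by auto
    have "Q (D m) (Q (D n) x) = 0" if "m \<noteq> n" for m n x
      by (rule spec_proj_orthogonal[OF T, of "D m" "D n"])
        (use A Q(1,2) D(2) that in \<open>auto simp: disjoint_family_on_def\<close>)
    then obtain R where R: "projection_op R" "\<And>x. (\<lambda>n. Q (D n) x) sums R x"
      using orthogonal_projections_sum[of "\<lambda>n. Q (D n)"] Q(1) A by metis
    have "R = Q (\<Union>n. D n)"
    proof (rule op_eqI)
      fix x
      have "(\<lambda>n. inner (Q (D n) x) x) sums inner (R x) x"
        by (rule bounded_linear.sums[OF bounded_linear_inner_left R(2)])
      then have "(\<lambda>n. (norm (Q (D n) x))\<^sup>2) sums (norm (R x))\<^sup>2" using Q(1) A R(1) by (simp add: projection_inner)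
      then have "(\<Sum>n. ennreal ((norm (Q (D n) x))\<^sup>2)) = ennreal ((norm (R x))\<^sup>2)"
        by (simp add: suminf_ennreal2 sums_iff)
      moreover have "(\<Sum>n. emeasure (spec_meas T x) (D n)) = emeasure (spec_meas T x) (\<Union>n. D n)"
        by (rule suminf_emeasure) (use D in \<open>auto simp: sets_spec_meas[OF T]\<close>)
      ultimately show "inner (R x) x = inner (Q (\<Union>n. D n) x) x"
        using A Q R(1) by (simp add: projection_inner)
    qed (use R(1) Q(1) A in \<open>auto intro!: projection_selfadjoint\<close>)
    then show ?thesis using R(2)[of "P x"] by (simp add: E_def bop_rep_eq)
  qed
  ultimately have pvm: "pvm_on P E" unfolding pvm_on_def using E by (auto simp: E_def)
  have eq: "pvm_measure E x = spec_meas T (P x)" for x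
    by (rule measure_eqI)
      (auto simp: pvm_measure[OF pvm] sets_spec_meas[OF T] Q(2) E_def bop_rep_eq)
  have TP: "inner (T (P x)) (P x) = inner (T x) x" for x
    using selfadjoint_inner[OF projection_selfadjoint[OF P], of "T (P x)" x] PT by (metis times_bop.rep_eq)
  show thesis
  proof (rule that[OF pvm])
    show "integrable (pvm_measure E x) (\<lambda>t. t)" for x
      unfolding eq by (rule integrable_spec_meas[OF T])
    show "cinner (T x) x = complex_of_real (\<integral>t. t \<partial>pvm_measure E x)" for x
      unfolding eq integral_spec_meas[OF T] TP by (rule selfadjoint_cinner_self[OF T])
  qed
qed

section \<open>Functional calculus of a spectral measure\<close>

text \<open>Addition of measures is expressed through values on sets. It serves both the
  polarization of \<mu> in the vector and the additivity of \<nu> in the functional.\<close>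

lemma nn_integral_add_measure:
  assumes sets: "sets N = sets M" "sets K = sets M"
    and add: "\<And>A. A \<in> sets M \<Longrightarrow> emeasure M A = emeasure N A + emeasure K A"
    and f: "f \<in> borel_measurable M"
  shows "(\<integral>\<^sup>+t. f t \<partial>M) = (\<integral>\<^sup>+t. f t \<partial>N) + (\<integral>\<^sup>+t. f t \<partial>K)"
  using f
proof (induction rule: borel_measurable_induct)
  case (cong f g)
  then show ?case
    using nn_integral_cong[of M f g] nn_integral_cong[of N f g] nn_integral_cong[of K f g]
      sets_eq_imp_space_eq[OF sets(1)] sets_eq_imp_space_eq[OF sets(2)] by simp
next
  case (set A)
  then show ?case by (simp add: sets add)
next
  case (mult u c)
  then show ?case
    by (simp add: nn_integral_cmult measurable_cong_sets[OF sets(1) refl] measurable_cong_sets[OF sets(2) refl] distrib_left)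
next
  case (add u v)
  then show ?case
    by (simp add: nn_integral_add measurable_cong_sets[OF sets(1) refl] measurable_cong_sets[OF sets(2) refl] algebra_simps)
next
  case (seq U)
  have U: "U i \<in> borel_measurable N" "U i \<in> borel_measurable K" for i
    using seq(1) by (simp_all add: measurable_cong_sets[OF sets(1) refl] measurable_cong_sets[OF sets(2) refl])
  have incU: "incseq U" by fact
  have inc: "incseq (\<lambda>i. \<integral>\<^sup>+t. U i t \<partial>L)" for L
    using incU by (intro monoI nn_integral_mono) (auto simp: mono_def le_fun_def)
  have sup: "(\<integral>\<^sup>+t. (SUP i. U i t) \<partial>L) = (SUP i. \<integral>\<^sup>+t. U i t \<partial>L)" if "\<And>i. U i \<in> borel_measurable L" for L
    by (rule nn_integral_monotone_convergence_SUP[OF incU that])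
  have "(\<integral>\<^sup>+t. (SUP i. U i) t \<partial>M) = (SUP i. (\<integral>\<^sup>+t. U i t \<partial>N) + (\<integral>\<^sup>+t. U i t \<partial>K))"
    unfolding SUP_apply using seq by (simp add: sup)
  also have "\<dots> = (SUP i. (\<integral>\<^sup>+t. U i t \<partial>N)) + (SUP i. (\<integral>\<^sup>+t. U i t \<partial>K))"
    by (rule ennreal_SUP_add[OF inc inc])
  also have "\<dots> = (\<integral>\<^sup>+t. (SUP i. U i) t \<partial>N) + (\<integral>\<^sup>+t. (SUP i. U i) t \<partial>K)"
    unfolding SUP_apply by (simp add: sup U)
  finally show ?case .
qed

section \<open>Polynomials of an operator and polynomial approximation\<close>

lemma poly_op_alt:
  assumes "degree p \<le> n"
  shows "poly_op P p T = (\<Sum>i\<le>n. coeff p i *\<^sub>R (P * T ^ i))"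
  unfolding poly_op_def by (rule sum.mono_neutral_left) (use assms in \<open>auto simp: coeff_eq_0\<close>)

lemma poly_op_add: "poly_op P (p + q) T = poly_op P p T + poly_op P q T"
proof -
  define n where "n = max (degree p) (degree q)"
  have "degree (p + q) \<le> n" "degree p \<le> n" "degree q \<le> n"
    by (auto simp: n_def degree_add_le_max)
  then show ?thesis by (simp add: poly_op_alt[of _ n] sum.distrib scaleR_add_left)
qed

lemma poly_op_smult: "poly_op P (smult c p) T = c *\<^sub>R poly_op P p T"
  by (subst poly_op_alt[of _ "degree p"]) (auto simp: poly_op_def scaleR_sum_right)

lemma poly_op_minus: "poly_op P (p - q) T = poly_op P p T - poly_op P q T"
  using poly_op_add[of P p "smult (-1) q" T] poly_op_smult[of P "-1" q T] by simp

lemma poly_op_pCons: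
  assumes "P * T = T" "T * P = T"
  shows "poly_op P (pCons a p) T = a *\<^sub>R P + T * poly_op P p T"
proof -
  have PT: "P * (T * Z) = T * (P * Z)" for Z using assms by (simp add: mult.assoc[symmetric])
  have "poly_op P (pCons a p) T = (\<Sum>i\<le>Suc (degree p). coeff (pCons a p) i *\<^sub>R (P * T ^ i))"
    by (rule poly_op_alt) (simp add: degree_pCons_le)
  also have "\<dots> = a *\<^sub>R P + T * poly_op P p T"
    by (subst sum.atMost_Suc_shift) (simp add: poly_op_def sum_distrib_left PT)
  finally show ?thesis .
qed

lemma poly_op_mult:
  assumes "P * T = T" "T * P = T" "P * P = P"
  shows "poly_op P (p * q) T = poly_op P p T * poly_op P q T"
proof (induction p)
  case 0
  then show ?case by (simp add: poly_op_def)
next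
  case (pCons a p)
  have "P * poly_op P q T = poly_op P q T"
    by (simp add: poly_op_def sum_distrib_left mult.assoc[symmetric] assms(3))
  then have "poly_op P (smult a q + pCons 0 (p * q)) T = (a *\<^sub>R P + T * poly_op P p T) * poly_op P q T"
    using pCons by (simp add: poly_op_add poly_op_smult poly_op_pCons[OF assms(1,2)] distrib_right mult.assoc)
  then show ?case by (simp add: poly_op_pCons[OF assms(1,2)])
qed

lemma polynomial_approximation:
  fixes g :: "real \<Rightarrow> real"
  assumes "continuous_on {lo..hi} g"
  obtains p :: "nat \<Rightarrow> real poly" where "uniform_limit {lo..hi} (\<lambda>n. poly (p n)) g sequentially"
proof -
  have "\<exists>p. \<forall>t\<in>{lo..hi}. \<bar>poly p t - g t\<bar> < inverse (real (Suc n))" for n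
  proof -
    obtain q where q: "real_polynomial_function q" "\<And>t. t \<in> {lo..hi} \<Longrightarrow> \<bar>g t - q t\<bar> < inverse (real (Suc n))"
      using Stone_Weierstrass_real_polynomial_function[OF _ assms, of "inverse (real (Suc n))"] by auto
    obtain a m where "q = (\<lambda>x. \<Sum>i\<le>m. a i * x ^ i)"
      using q(1) real_polynomial_function_iff_sum by blast
    then have "poly (\<Sum>i\<le>m. monom (a i) i) t = q t" for t by (simp add: poly_sum poly_monom)
    then show ?thesis using q(2) by (intro exI[of _ "\<Sum>i\<le>m. monom (a i) i"]) (simp add: abs_minus_commute)
  qed
  then obtain p where p: "\<And>n t. t \<in> {lo..hi} \<Longrightarrow> \<bar>poly (p n) t - g t\<bar> < inverse (real (Suc n))" by metis
  have "uniform_limit {lo..hi} (\<lambda>n. poly (p n)) g sequentially"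
  proof (rule uniform_limitI)
    fix e :: real assume "0 < e"
    then obtain N where N: "inverse (real (Suc N)) < e" using reals_Archimedean by blast
    show "\<forall>\<^sub>F n in sequentially. \<forall>t\<in>{lo..hi}. dist (poly (p n) t) (g t) < e"
      using eventually_ge_at_top[of N]
    proof eventually_elim
      case (elim n)
      then have "inverse (real (Suc n)) \<le> inverse (real (Suc N))" by (simp add: le_imp_inverse_le)
      then have "inverse (real (Suc n)) < e" by (rule le_less_trans[OF _ N])
      then show ?case using less_trans[OF p] by (simp only: dist_real_def) blast
    qed
  qed
  then show thesis by (rule that)
qed

lemma corner_proj_iff: "projection_op P \<Longrightarrow> T \<in> corner P \<longleftrightarrow> P * T = T \<and> T * P = T"
proof -
  assume "projection_op P"
  then have PP: "P * P = P" by (simp add: projection_op_def)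
  show ?thesis
  proof
    assume "T \<in> corner P"
    then have T: "P * T * P = T" by (simp add: corner_def)
    have "P * (P * T * P) = P * T * P" "P * T * P * P = P * T * P"
      using PP by (simp_all add: mult.assoc[symmetric], simp add: mult.assoc)
    then show "P * T = T \<and> T * P = T" unfolding T by blast
  qed (simp add: corner_def)
qed

text \<open>\<open>lo\<close> and \<open>hi\<close> are form bounds for T on PH, not necessarily
  sharp. One E may be interpreted with several pairs of bounds, so that functions continuous only on
  a smaller interval become accessible. A nonnegative \<open>lo\<close> allows work with nonnegative
  integrals.\<close>

locale spectral_pvm =
  fixes P T :: "'a::complex_hilbert bop" and E :: "real set \<Rightarrow> 'a bop" and lo hi :: real
  assumes pvm: "pvm_on P E" and selfadjoint: "selfadjoint_op T"
    and PT: "P * T = T" "T * P = T"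
    and int: "\<And>x. integrable (pvm_measure E x) (\<lambda>t. t)"
    and eq: "\<And>x. cinner (T x) x = complex_of_real (\<integral>t. t \<partial>pvm_measure E x)"
    and lo0: "0 \<le> lo"
    and lo: "\<And>x. lo * (norm (P x))\<^sup>2 \<le> inner (T x) x"
    and hi: "\<And>x. inner (T x) x \<le> hi * (norm (P x))\<^sup>2"
begin

lemma E_UNIV: "E UNIV = P" and E_proj: "A \<in> sets borel \<Longrightarrow> projection_op (E A)"
  using pvm by (auto simp: pvm_on_def)

lemma P: "projection_op P"
  using E_proj[of UNIV] by (simp add: E_UNIV)

abbreviation "\<mu> \<equiv> pvm_measure E"

lemma sets_mu [simp, measurable_cong]: "sets (\<mu> x) = sets borel"
  by (rule pvm_measure(1)[OF pvm])

lemma space_mu [simp]: "space (\<mu> x) = UNIV"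
  by (rule pvm_measure(2)[OF pvm])

lemma emeasure_mu: "A \<in> sets borel \<Longrightarrow> emeasure (\<mu> x) A = ennreal ((norm (E A x))\<^sup>2)"
  by (rule pvm_measure(3)[OF pvm])

lemma finite_mu: "finite_measure (\<mu> x)"
  by (rule finite_measureI) (simp add: emeasure_mu)

lemma measure_mu: "A \<in> sets borel \<Longrightarrow> measure (\<mu> x) A = (norm (E A x))\<^sup>2"
  by (simp add: measure_def emeasure_mu)

lemma E_Un:
  assumes "A \<in> sets borel" "B \<in> sets borel" "A \<inter> B = {}"
  shows "E (A \<union> B) = E A + E B"
proof (rule op_eqI)
  fix x
  have "emeasure (\<mu> x) A + emeasure (\<mu> x) B = emeasure (\<mu> x) (A \<union> B)"
    by (rule plus_emeasure) (use assms in auto)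
  then have "ennreal ((norm (E A x))\<^sup>2 + (norm (E B x))\<^sup>2) = ennreal ((norm (E (A \<union> B) x))\<^sup>2)"
    using assms by (simp add: emeasure_mu)
  then have "(norm (E A x))\<^sup>2 + (norm (E B x))\<^sup>2 = (norm (E (A \<union> B) x))\<^sup>2"
    by (subst (asm) ennreal_inj) auto
  then show "inner (E (A \<union> B) x) x = inner ((E A + E B) x) x"
    using assms E_proj by (simp add: projection_inner bop_rep_eq inner_add_left)
next
  show "selfadjoint_op (E (A \<union> B))" using assms by (intro projection_selfadjoint E_proj sets.Un)
  show "selfadjoint_op (E A + E B)" using assms by (intro selfadjoint_intros projection_selfadjoint E_proj)
qed


lemma E_disjoint:
  assumes "A \<in> sets borel" "B \<in> sets borel" "A \<inter> B = {}"
  shows "E A (E B x) = 0"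
proof -
  let ?y = "E B x"
  have "emeasure (\<mu> ?y) A + emeasure (\<mu> ?y) B = emeasure (\<mu> ?y) (A \<union> B)"
    by (rule plus_emeasure) (use assms in auto)
  then have "ennreal ((norm (E A ?y))\<^sup>2 + (norm ?y)\<^sup>2) = ennreal ((norm (E (A \<union> B) ?y))\<^sup>2)"
    using assms by (simp add: emeasure_mu projection_apply_apply E_proj)
  then have "(norm (E A ?y))\<^sup>2 + (norm ?y)\<^sup>2 = (norm (E (A \<union> B) ?y))\<^sup>2"
    by (subst (asm) ennreal_inj) auto
  also have "\<dots> \<le> (norm ?y)\<^sup>2"
    using projection_norm_le[OF E_proj, of "A \<union> B" ?y] assms by (simp add: power_mono)
  finally show ?thesis by simp
qed

lemma E_Int:
  assumes "A \<in> sets borel" "B \<in> sets borel"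
  shows "E A (E B x) = E (A \<inter> B) x"
proof -
  have "A \<inter> B \<union> (B - A) = B" "A \<inter> B \<inter> (B - A) = {}" "A \<inter> B \<union> (A - B) = A" "A \<inter> B \<inter> (A - B) = {}" by auto
  then have "E B = E (A \<inter> B) + E (B - A)" and EA: "E A = E (A \<inter> B) + E (A - B)"
    using E_Un[of "A \<inter> B" "B - A"] E_Un[of "A \<inter> B" "A - B"] assms by (metis sets.Int sets.Diff)+
  then have "E A (E B x) = E A (E (A \<inter> B) x) + E A (E (B - A) x)" by (simp add: bop_rep_eq bop_add)
  also have "E A (E (B - A) x) = 0" by (rule E_disjoint) (use assms in auto)
  also have "E A (E (A \<inter> B) x) = E (A \<inter> B) (E (A \<inter> B) x) + E (A - B) (E (A \<inter> B) x)"
    by (subst (1) EA) (simp add: bop_rep_eq)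
  also have "E (A - B) (E (A \<inter> B) x) = 0" by (rule E_disjoint) (use assms in auto)
  finally show ?thesis using assms by (simp add: projection_apply_apply E_proj)
qed

lemma PE: "A \<in> sets borel \<Longrightarrow> P (E A x) = E A x" "A \<in> sets borel \<Longrightarrow> E A (P x) = E A x"
  using E_Int[of UNIV A x] E_Int[of A UNIV x] by (simp_all add: E_UNIV)

lemma inner_T: "inner (T x) x = (\<integral>t. t \<partial>\<mu> x)"
  using eq[of x] by (simp add: inner_eq_Re_cinner)

text \<open>For y in the range of \<open>E A\<close> the measure lives on A, where s (t - c) is
  strictly positive, while the form bound makes its integral at most 0; so y = 0. The sign s treats
  both ends at once: s = -1 with c = lo, and s = 1 with c = hi.\<close>

lemma AE_bounds: "AE t in \<mu> x. t \<in> {lo..hi}"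
proof -
  have zero: "E A = 0" if A: "A \<in> sets borel" and s: "\<And>t. t \<in> A \<Longrightarrow> 0 < s * (t - c)"
    and le: "\<And>y. s * inner (T y) y \<le> s * c * (norm (P y))\<^sup>2" for A s c
  proof (rule bop_eqI)
    fix x
    define y where "y = E A x"
    interpret finite_measure "\<mu> y" by (rule finite_mu)
    have Ey: "E A y = y" using A by (simp add: y_def projection_apply_apply E_proj)
    have "E (UNIV - A) y = 0" unfolding y_def by (rule E_disjoint) (use A in auto)
    then have "emeasure (\<mu> y) (UNIV - A) = 0" using A by (simp add: emeasure_mu)
    then have AE: "AE t in \<mu> y. t \<in> A" by (intro AE_I'[of "UNIV - A"]) (use A in \<open>auto simp: null_sets_def\<close>)
    have i: "integrable (\<mu> y) (\<lambda>t. s * (t - c))" using int[of y] by simp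
    have "P y = y" using PE A by (simp add: y_def)
    moreover have "measure (\<mu> y) UNIV = (norm y)\<^sup>2" using \<open>P y = y\<close> by (simp add: measure_mu E_UNIV)
    ultimately have "(\<integral>t. s * (t - c) \<partial>\<mu> y) \<le> 0"
      using le[of y] int[of y] by (simp add: inner_T algebra_simps)
    moreover have nn: "AE t in \<mu> y. 0 \<le> s * (t - c)" using AE by eventually_elim (use s in \<open>auto intro: less_imp_le\<close>)
    then have "0 \<le> (\<integral>t. s * (t - c) \<partial>\<mu> y)" by (rule integral_nonneg_AE)
    ultimately have "(\<integral>t. s * (t - c) \<partial>\<mu> y) = 0" by simp
    then have "AE t in \<mu> y. s * (t - c) = 0" using integral_nonneg_eq_0_iff_AE[OF i nn] by simp
    then have "AE t in \<mu> y. False" using AE by eventually_elim (use s in force)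
    then have "emeasure (\<mu> y) UNIV = 0" by (simp add: AE_iff_measurable[OF _ refl])
    then show "E A x = bop_apply 0 x" using \<open>P y = y\<close> by (simp add: emeasure_mu E_UNIV y_def bop_rep_eq)
  qed
  have "E {..<lo} = 0" by (rule zero[of _ "-1" lo]) (use lo in auto)
  moreover have "E {hi<..} = 0" by (rule zero[of _ 1 hi]) (use hi in auto)
  ultimately have "{..<lo} \<in> null_sets (\<mu> x)" "{hi<..} \<in> null_sets (\<mu> x)"
    by (simp_all add: null_sets_def emeasure_mu bop_rep_eq)
  then have "{..<lo} \<union> {hi<..} \<in> null_sets (\<mu> x)" by (rule null_sets.Un)
  then show ?thesis by (rule AE_I') auto
qed

lemma AE_nonneg: "AE t in \<mu> x. 0 \<le> t"
  using AE_bounds[of x] by eventually_elim (use lo0 in auto)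

lemma integrable_bounded:
  fixes g :: "real \<Rightarrow> real"
  assumes g: "g \<in> borel_measurable borel" and b: "\<And>t. t \<in> {lo..hi} \<Longrightarrow> \<bar>g t\<bar> \<le> B"
  shows "integrable (\<mu> x) g"
proof (rule finite_measure.integrable_const_bound[OF finite_mu])
  show "AE t in \<mu> x. norm (g t) \<le> B" using AE_bounds[of x] by eventually_elim (use b in auto)
qed (use g in simp)

lemma nn_inner_T: "ennreal (inner (T x) x) = (\<integral>\<^sup>+t. ennreal t \<partial>\<mu> x)"
  unfolding inner_T by (rule nn_integral_eq_integral[OF int AE_nonneg, symmetric])

lemma T_positive: "positive_op T"
  unfolding positive_iff
proof (intro conjI selfadjoint allI)
  fix x
  show "0 \<le> inner (T x) x" using lo[of x] lo0 by (meson mult_nonneg_nonneg order_trans zero_le_power2)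
qed

text \<open>The choice of E does not include commutation, so it is derived. For u and v in the
  ranges of complementary projections, \<mu> is additive at u + v, hence the form of T has no cross
  term. So T maps the range of \<open>E A\<close> into itself, and self-adjointness turns invariance
  into commutation.\<close>

lemma T_commute_E:
  assumes A: "A \<in> sets borel"
  shows "E A (T x) = T (E A x)"
proof -
  have cA: "UNIV - A \<in> sets borel" using A by auto
  have orth: "inner (T (E A x)) (E (UNIV - A) y) = 0" for x y
  proof -
    define u v where "u = E A x" and "v = E (UNIV - A) y"
    have "emeasure (\<mu> (u + v)) D = emeasure (\<mu> u) D + emeasure (\<mu> v) D" if D: "D \<in> sets borel" for D
    proof -
      have "inner (E D u) (E D v) = inner (E (D \<inter> A) x) (E (D \<inter> (UNIV - A)) y)"
        using A cA D by (simp add: u_def v_def E_Int)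
      also have "\<dots> = inner x (E (D \<inter> A) (E (D \<inter> (UNIV - A)) y))"
        by (rule selfadjoint_inner[OF projection_selfadjoint[OF E_proj]]) (use A D in auto)
      also have "\<dots> = 0" using A D cA by (subst E_disjoint) auto
      finally have "(norm (E D (u + v)))\<^sup>2 = (norm (E D u))\<^sup>2 + (norm (E D v))\<^sup>2"
        by (simp add: bop_add power2_norm_eq_inner inner_add_left inner_add_right inner_commute)
      then show ?thesis using D by (simp add: emeasure_mu)
    qed
    then have "(\<integral>\<^sup>+t. ennreal t \<partial>\<mu> (u + v)) = (\<integral>\<^sup>+t. ennreal t \<partial>\<mu> u) + (\<integral>\<^sup>+t. ennreal t \<partial>\<mu> v)"
      by (intro nn_integral_add_measure) auto
    then have "ennreal (inner (T (u + v)) (u + v)) = ennreal (inner (T u) u + inner (T v) v)"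
      by (simp add: nn_inner_T[symmetric] positive_op_inner[OF T_positive])
    then have "inner (T (u + v)) (u + v) = inner (T u) u + inner (T v) v"
      by (subst (asm) ennreal_inj) (auto simp: positive_op_inner[OF T_positive])
    then have "inner (T u) v + inner (T v) u = 0"
      by (simp add: bop_add inner_add_left inner_add_right)
    then show ?thesis using selfadjoint_inner[OF selfadjoint, of v u] by (simp add: u_def v_def inner_commute)
  qed
  have TA: "E A (T (E A x)) = T (E A x)" for x
  proof -
    define w where "w = E (UNIV - A) (T (E A x))"
    have "inner w w = inner (T (E A x)) (E (UNIV - A) w)"
      unfolding w_def by (rule selfadjoint_inner[OF projection_selfadjoint[OF E_proj[OF cA]]])
    then have "w = 0" by (simp add: orth)
    moreover have "P (T (E A x)) = E A (T (E A x)) + w"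
      using E_Un[OF A cA] by (simp add: E_UNIV w_def bop_rep_eq)
    moreover have "P (T (E A x)) = T (E A x)" using PT by (metis times_bop.rep_eq)
    ultimately show ?thesis by simp
  qed
  have EA: "selfadjoint_op (E A)" by (rule projection_selfadjoint[OF E_proj[OF A]])
  have "inner (E A (T x) - T (E A x)) y = 0" for y
  proof -
    have "inner (E A (T x)) y = inner x (T (E A y))"
      by (simp add: selfadjoint_inner[OF EA] selfadjoint_inner[OF selfadjoint])
    also have "\<dots> = inner x (E A (T (E A y)))" by (simp add: TA)
    also have "\<dots> = inner (E A (T (E A x))) y"
      by (simp add: selfadjoint_inner[OF EA] selfadjoint_inner[OF selfadjoint])
    finally show ?thesis by (simp add: TA inner_diff_left)
  qed
  from this[of "E A (T x) - T (E A x)"] show ?thesis by simp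
qed

lemma power_PT: "P * T ^ Suc n = T ^ Suc n"
  by (simp add: mult.assoc[symmetric] PT)

text \<open>Polarization: \<open>\<mu> (T z + z) - \<mu> (T z - z)\<close> has density \<open>4 t\<close> with respect to \<open>\<mu> z\<close>.\<close>

lemma moments:
  "0 \<le> inner ((P * T ^ n) z) z \<and> (\<integral>\<^sup>+t. ennreal (t ^ n) \<partial>\<mu> z) = ennreal (inner ((P * T ^ n) z) z)"
proof (induction n arbitrary: z)
  case 0
  then show ?case using emeasure_mu[of UNIV z] by (simp add: projection_inner[OF P] E_UNIV)
next
  case (Suc n)
  define q where "q y = inner ((P * T ^ n) y) y" for y
  have q0: "0 \<le> q y" and q: "(\<integral>\<^sup>+t. ennreal (t ^ n) \<partial>\<mu> y) = ennreal (q y)" for y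
    using Suc by (simp_all add: q_def)
  define D where "D = density (\<mu> z) (\<lambda>t. ennreal (4 * t))"
  have "emeasure (\<mu> (T z + z)) A = emeasure (\<mu> (T z - z)) A + emeasure D A" if A: "A \<in> sets borel" for A
  proof -
    have EA: "selfadjoint_op (E A)" by (rule projection_selfadjoint[OF E_proj[OF A]])
    \<comment> \<open>Applying \<open>E A\<close> to z restricts the measure to A, so the form of T
      at \<open>E A z\<close> is the integral of t over A.\<close>
    have "\<mu> (E A z) = density (\<mu> z) (indicator A)"
    proof (rule measure_eqI)
      fix B assume "B \<in> sets (\<mu> (E A z))"
      then have B: "B \<in> sets borel" by simp
      then show "emeasure (\<mu> (E A z)) B = emeasure (density (\<mu> z) (indicator A)) B"
        using A by (simp add: emeasure_mu E_Int emeasure_density indicator_inter_arith[symmetric] Int_commute)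
    qed simp
    then have "ennreal (inner (T (E A z)) (E A z)) = (\<integral>\<^sup>+t. ennreal t * indicator A t \<partial>\<mu> z)"
      using A by (simp add: nn_inner_T nn_integral_density mult.commute)
    then have "ennreal (4 * inner (T (E A z)) (E A z)) = 4 * (\<integral>\<^sup>+t. ennreal t * indicator A t \<partial>\<mu> z)"
      by (simp add: ennreal_mult positive_op_inner[OF T_positive])
    also have "\<dots> = emeasure D A"
      using A by (simp add: D_def emeasure_density nn_integral_cmult[symmetric] ennreal_mult' mult.assoc)
    finally have D: "emeasure D A = ennreal (4 * inner (T (E A z)) (E A z))" by simp
    \<comment> \<open>Since T commutes with \<open>E A\<close>, the two expansions differ only in
      their cross terms.\<close>
    have "(norm (E A (T z + z)))\<^sup>2 = (norm (E A (T z - z)))\<^sup>2 + 4 * inner (T (E A z)) (E A z)"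
      by (simp add: bop_add bop_diff T_commute_E[OF A] power2_norm_eq_inner inner_add_left inner_add_right
          inner_diff_left inner_diff_right inner_commute)
    then show ?thesis using A by (simp add: D emeasure_mu positive_op_inner[OF T_positive])
  qed
  then have "(\<integral>\<^sup>+t. ennreal (t ^ n) \<partial>\<mu> (T z + z)) = (\<integral>\<^sup>+t. ennreal (t ^ n) \<partial>\<mu> (T z - z)) + (\<integral>\<^sup>+t. ennreal (t ^ n) \<partial>D)"
    by (intro nn_integral_add_measure) (auto simp: D_def)
  moreover have "(\<integral>\<^sup>+t. ennreal (t ^ n) \<partial>D) = 4 * (\<integral>\<^sup>+t. ennreal (t ^ Suc n) \<partial>\<mu> z)"
  proof -
    have "AE t in \<mu> z. ennreal (4 * t) * ennreal (t ^ n) = 4 * ennreal (t ^ Suc n)"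
      using AE_nonneg[of z]
    proof eventually_elim
      case (elim t)
      have "ennreal (4 * t) * ennreal (t ^ n) = ennreal (4 * t * t ^ n)"
        by (rule ennreal_mult[symmetric]) (use elim in auto)
      also have "\<dots> = ennreal 4 * ennreal (t ^ Suc n)"
        by (subst ennreal_mult[symmetric]) (use elim in \<open>auto simp: mult.assoc\<close>)
      finally show ?case by simp
    qed
    then have "(\<integral>\<^sup>+t. ennreal (t ^ n) \<partial>D) = (\<integral>\<^sup>+t. 4 * ennreal (t ^ Suc n) \<partial>\<mu> z)"
      unfolding D_def by (subst nn_integral_density) (auto intro!: nn_integral_cong_AE)
    then show ?thesis by (simp add: nn_integral_cmult)
  qed
  ultimately have main: "ennreal (q (T z + z)) = ennreal (q (T z - z)) + 4 * (\<integral>\<^sup>+t. ennreal (t ^ Suc n) \<partial>\<mu> z)"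
    by (simp add: q)
  have sa: "selfadjoint_op (P * T ^ n)"
  proof (cases n)
    case 0
    then show ?thesis using projection_selfadjoint[OF P] by simp
  next
    case (Suc m)
    then show ?thesis using power_PT[of m] selfadjoint_power[OF selfadjoint, of n] by simp
  qed
  have PTT: "(P * T ^ n) (T z) = (P * T ^ Suc n) z"
    by (simp add: times_bop.rep_eq power_Suc2 del: power_Suc)
  have diff: "q (T z + z) = q (T z - z) + 4 * inner ((P * T ^ Suc n) z) z"
    using selfadjoint_inner[OF sa, of z "T z"]
    by (simp only: q_def bop_add bop_diff inner_add_left inner_add_right inner_diff_left inner_diff_right PTT)
      (simp add: inner_commute)
  \<comment> \<open>By \<open>main\<close> the two values of q differ by a nonnegative amount, which
    is four times the next moment; finiteness of q then permits cancellation in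
    \<open>ennreal\<close>.\<close>
  have "ennreal (q (T z - z)) \<le> ennreal (q (T z + z))" by (simp add: main)
  then have "q (T z - z) \<le> q (T z + z)" by (simp only: ennreal_le_iff[OF q0])
  then have nn: "0 \<le> inner ((P * T ^ Suc n) z) z" using diff by linarith
  have "ennreal (q (T z - z)) + 4 * ennreal (inner ((P * T ^ Suc n) z) z)
      = ennreal (q (T z - z)) + 4 * (\<integral>\<^sup>+t. ennreal (t ^ Suc n) \<partial>\<mu> z)"
    using main nn q0 by (simp add: diff ennreal_mult)
  then have "4 * ennreal (inner ((P * T ^ Suc n) z) z) = 4 * (\<integral>\<^sup>+t. ennreal (t ^ Suc n) \<partial>\<mu> z)"
    by (simp add: ennreal_add_left_cancel)
  then show ?case using nn by (simp add: ennreal_mult_cancel_left)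
qed

section \<open>Polynomial and continuous functional calculus as integrals\<close>

lemma integrable_poly: "integrable (\<mu> x) (\<lambda>t. poly p t)"
proof -
  have "compact ((\<lambda>t. \<bar>poly p t\<bar>) ` {lo..hi})"
    by (intro compact_continuous_image continuous_intros) simp
  then obtain B where "\<forall>t\<in>{lo..hi}. \<bar>poly p t\<bar> \<le> B"
    by (auto dest!: compact_imp_bounded simp: bounded_iff simp del: atLeastAtMost_iff)
  then show ?thesis
    by (intro integrable_bounded[of _ B] borel_measurable_continuous_onI continuous_intros) auto
qed

lemma integral_power: "(\<integral>t. t ^ n \<partial>\<mu> z) = inner ((P * T ^ n) z) z"
  using moments[of n z] AE_nonneg[of z]
  by (subst integral_eq_nn_integral) (auto elim!: eventually_mono)

lemma inner_poly_op: "inner (poly_op P p T z) z = (\<integral>t. poly p t \<partial>\<mu> z)"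
proof -
  have "integrable (\<mu> z) (\<lambda>t. t ^ n)" for n using integrable_poly[of z "monom 1 n"] by (simp add: poly_monom)
  then show ?thesis
    unfolding poly_op_def poly_altdef
    by (simp add: sum_bop_apply inner_sum_left scaleR_bop.rep_eq integral_power)
qed

lemma P_poly_op: "P * poly_op P p T = poly_op P p T" "poly_op P p T * P = poly_op P p T"
proof -
  show "P * poly_op P p T = poly_op P p T"
    using P by (simp add: poly_op_def sum_distrib_left mult.assoc[symmetric] projection_op_def)
  have "P * T ^ i * P = P * T ^ i" for i
    by (cases i) (use P in \<open>simp_all add: projection_op_def mult.assoc power_Suc2 PT del: power_Suc\<close>)
  then show "poly_op P p T * P = poly_op P p T"
    by (simp add: poly_op_def sum_distrib_right)
qed

lemma selfadjoint_poly_op: "selfadjoint_op (poly_op P p T)"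
proof -
  have "selfadjoint_op (P * T ^ n)" for n
    by (cases n) (use power_PT selfadjoint_power[OF selfadjoint] projection_selfadjoint[OF P] in \<open>simp_all del: power_Suc\<close>)
  then show ?thesis unfolding poly_op_def by (intro selfadjoint_sum selfadjoint_intros)
qed

lemma norm_poly_op_apply: "(norm (poly_op P p T z))\<^sup>2 = (\<integral>t. (poly p t)\<^sup>2 \<partial>\<mu> z)"
proof -
  have "(norm (poly_op P p T z))\<^sup>2 = inner ((poly_op P p T * poly_op P p T) z) z"
    by (simp add: power2_norm_eq_inner bop_rep_eq selfadjoint_inner[OF selfadjoint_poly_op])
  also have "\<dots> = (\<integral>t. poly (p * p) t \<partial>\<mu> z)"
    using poly_op_mult[OF PT, of p p] P by (simp only: inner_poly_op[symmetric] projection_op_def)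
  finally show ?thesis by (simp add: power2_eq_square)
qed

text \<open>S may be any set of full measure. It is {lo..hi} when operators are constructed and the
  real spectrum when they are compared with \<open>cfc_on\<close>.\<close>

lemma norm_poly_op_le:
  assumes S: "\<And>x. AE t in \<mu> x. t \<in> S" and le: "\<And>t. t \<in> S \<Longrightarrow> \<bar>poly p t\<bar> \<le> c" and c: "0 \<le> c"
  shows "norm (poly_op P p T) \<le> c"
proof (rule norm_bop_le[OF _ c])
  fix x
  interpret finite_measure "\<mu> x" by (rule finite_mu)
  have "(norm (poly_op P p T x))\<^sup>2 \<le> (\<integral>t. c\<^sup>2 \<partial>\<mu> x)"
    unfolding norm_poly_op_apply
  proof (rule integral_mono_AE)
    show "integrable (\<mu> x) (\<lambda>t. (poly p t)\<^sup>2)" using integrable_poly[of x "p * p"] by (simp add: power2_eq_square)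
    show "AE t in \<mu> x. (poly p t)\<^sup>2 \<le> c\<^sup>2"
      using S[of x] by eventually_elim (use le c in \<open>auto simp: abs_le_square_iff[symmetric]\<close>)
  qed simp
  also have "\<dots> = (c * norm (P x))\<^sup>2" by (simp add: measure_mu E_UNIV power_mult_distrib)
  also have "\<dots> \<le> (c * norm x)\<^sup>2" using c projection_norm_le[OF P] by (intro power_mono mult_left_mono) auto
  finally show "norm (poly_op P p T x) \<le> c * norm x" by (rule power2_le_imp_le) (use c in simp)
qed

text \<open>In contrast to \<open>cfc_on\<close>, approximation is uniform on the whole interval
  {lo..hi} instead of the spectrum. As a relation it keeps existence, which rests on continuity,
  apart from uniqueness.\<close>

definition fcalc :: "(real \<Rightarrow> real) \<Rightarrow> 'a bop \<Rightarrow> bool"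
  where "fcalc g X \<longleftrightarrow> (\<exists>p. uniform_limit {lo..hi} (\<lambda>n. poly (p n)) g sequentially \<and>
    (\<lambda>n. poly_op P (p n) T) \<longlonglongrightarrow> X)"

lemma uniform_limit_diff_bound:
  fixes g :: "real \<Rightarrow> real"
  assumes "uniform_limit S (\<lambda>n. poly (p n)) g sequentially" "uniform_limit S (\<lambda>n. poly (q n)) g sequentially" "0 < e"
  shows "\<exists>N. \<forall>m\<ge>N. \<forall>n\<ge>N. \<forall>t\<in>S. \<bar>poly (p m - q n) t\<bar> \<le> e"
proof -
  have "0 < e / 2" using assms by simp
  from uniform_limitD[OF assms(1) this] uniform_limitD[OF assms(2) this]
  have "eventually (\<lambda>n. (\<forall>t\<in>S. dist (poly (p n) t) (g t) < e / 2) \<and> (\<forall>t\<in>S. dist (poly (q n) t) (g t) < e / 2)) sequentially"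
    by eventually_elim auto
  then obtain N where N: "\<And>n t. N \<le> n \<Longrightarrow> t \<in> S \<Longrightarrow> \<bar>poly (p n) t - g t\<bar> < e / 2 \<and> \<bar>poly (q n) t - g t\<bar> < e / 2"
    by (auto simp: eventually_sequentially dist_real_def)
  have "\<bar>poly (p m - q n) t\<bar> \<le> e" if "N \<le> m" "N \<le> n" "t \<in> S" for m n t
    using N[OF that(1,3), THEN conjunct1] N[OF that(2,3), THEN conjunct2] unfolding poly_diff by linarith
  then show ?thesis by blast
qed

lemma poly_op_limit_unique:
  assumes "uniform_limit S (\<lambda>n. poly (p n)) g sequentially" "uniform_limit S (\<lambda>n. poly (q n)) g sequentially"
    and "(\<lambda>n. poly_op P (p n) T) \<longlonglongrightarrow> X" "(\<lambda>n. poly_op P (q n) T) \<longlonglongrightarrow> Y"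
    and S: "\<And>x. AE t in \<mu> x. t \<in> S"
  shows "X = Y"
proof -
  have "norm (X - Y) \<le> e" if e: "0 < e" for e
  proof -
    obtain N where N: "\<And>n t. N \<le> n \<Longrightarrow> t \<in> S \<Longrightarrow> \<bar>poly (p n - q n) t\<bar> \<le> e"
      using uniform_limit_diff_bound[OF assms(1,2) e] by blast
    have "(\<lambda>n. norm (poly_op P (p n) T - poly_op P (q n) T)) \<longlonglongrightarrow> norm (X - Y)"
      by (intro tendsto_intros assms)
    moreover have "norm (poly_op P (p n) T - poly_op P (q n) T) \<le> e" if "N \<le> n" for n
      unfolding poly_op_minus[symmetric] by (rule norm_poly_op_le[OF S N[OF that]]) (use e in auto)
    ultimately show ?thesis by (intro LIMSEQ_le_const2) auto
  qed
  then have "norm (X - Y) \<le> 0" by (metis dense not_le)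
  then show ?thesis by simp
qed

lemma fcalc_exists:
  assumes "continuous_on {lo..hi} g"
  shows "\<exists>X. fcalc g X"
proof -
  obtain p where p: "uniform_limit {lo..hi} (\<lambda>n. poly (p n)) g sequentially"
    using polynomial_approximation[OF assms] by metis
  have "Cauchy (\<lambda>n. poly_op P (p n) T)"
  proof (rule metric_CauchyI)
    fix e :: real assume e: "0 < e"
    then obtain N where N: "\<And>m n t. N \<le> m \<Longrightarrow> N \<le> n \<Longrightarrow> t \<in> {lo..hi} \<Longrightarrow> \<bar>poly (p m - p n) t\<bar> \<le> e / 2"
      using uniform_limit_diff_bound[OF p p, of "e / 2"] by (metis half_gt_zero)
    have "dist (poly_op P (p m) T) (poly_op P (p n) T) < e" if "N \<le> m" "N \<le> n" for m n
    proof -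
      have "norm (poly_op P (p m - p n) T) \<le> e / 2"
        by (rule norm_poly_op_le[OF AE_bounds N[OF that]]) (use e in auto)
      then show ?thesis using e by (simp add: poly_op_minus dist_norm)
    qed
    then show "\<exists>M. \<forall>m\<ge>M. \<forall>n\<ge>M. dist (poly_op P (p m) T) (poly_op P (p n) T) < e" by blast
  qed
  then show ?thesis using p unfolding fcalc_def by (meson Cauchy_convergent_iff convergent_def)
qed

lemma fcalc_unique: "fcalc g X \<Longrightarrow> fcalc g Y \<Longrightarrow> X = Y"
  unfolding fcalc_def using poly_op_limit_unique[OF _ _ _ _ AE_bounds] by blast

lemma fcalc_cong: "fcalc g X \<Longrightarrow> (\<And>t. t \<in> {lo..hi} \<Longrightarrow> g t = h t) \<Longrightarrow> fcalc h X"
  unfolding fcalc_def using uniform_limit_cong'[of "{lo..hi}" _ _ g h] by metis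

lemma fcalc_poly: "fcalc (poly p) (poly_op P p T)"
  unfolding fcalc_def by (intro exI[of _ "\<lambda>_. p"]) (simp add: uniform_limit_const)

lemma fcalc_affine: "fcalc (\<lambda>t. a + b * t) (a *\<^sub>R P + b *\<^sub>R T)"
proof -
  have "poly_op P [:a, b:] T = a *\<^sub>R P + b *\<^sub>R T"
    by (simp add: poly_op_pCons[OF PT] poly_op_def[of P 0] PT)
  moreover have "poly [:a, b:] = (\<lambda>t. a + b * t)" by (auto simp: mult.commute)
  ultimately show ?thesis using fcalc_poly[of "[:a, b:]"] by simp
qed

lemma fcalc_mult:
  assumes X: "fcalc g X" and Y: "fcalc h Y" and cont: "continuous_on {lo..hi} g" "continuous_on {lo..hi} h"
  shows "fcalc (\<lambda>t. g t * h t) (X * Y)"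
proof -
  obtain p q where p: "uniform_limit {lo..hi} (\<lambda>n. poly (p n)) g sequentially" "(\<lambda>n. poly_op P (p n) T) \<longlonglongrightarrow> X"
    and q: "uniform_limit {lo..hi} (\<lambda>n. poly (q n)) h sequentially" "(\<lambda>n. poly_op P (q n) T) \<longlonglongrightarrow> Y"
    using X Y unfolding fcalc_def by blast
  have b: "bounded (g ` {lo..hi})" "bounded (h ` {lo..hi})"
    by (intro compact_imp_bounded compact_continuous_image cont compact_Icc)+
  have "uniform_limit {lo..hi} (\<lambda>n t. poly (p n) t * poly (q n) t) (\<lambda>t. g t * h t) sequentially"
    by (rule uniform_lim_mult[OF p(1) q(1) b])
  moreover have "(\<lambda>n. poly_op P (p n) T * poly_op P (q n) T) \<longlonglongrightarrow> X * Y"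
    by (intro tendsto_mult p q)
  ultimately show ?thesis
    unfolding fcalc_def using P
    by (intro exI[of _ "\<lambda>n. p n * q n"]) (simp add: poly_op_mult[OF PT] projection_op_def poly_mult[abs_def])
qed

lemma fcalc_corner: "fcalc g X \<Longrightarrow> P * X = X \<and> X * P = X"
proof -
  assume "fcalc g X"
  then obtain p where p: "(\<lambda>n. poly_op P (p n) T) \<longlonglongrightarrow> X" unfolding fcalc_def by blast
  have "(\<lambda>n. P * poly_op P (p n) T) \<longlonglongrightarrow> P * X" "(\<lambda>n. poly_op P (p n) T * P) \<longlonglongrightarrow> X * P"
    by (intro tendsto_intros p)+
  then show ?thesis using p LIMSEQ_unique by (simp add: P_poly_op) blast
qed

lemma fcalc_selfadjoint: "fcalc g X \<Longrightarrow> selfadjoint_op X"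
  unfolding fcalc_def using selfadjoint_limit[OF _ selfadjoint_poly_op] by blast

text \<open>The indicator makes the integrand Borel although g is controlled on the interval only;
  by \<open>AE_bounds\<close> the complement of the interval is null.\<close>

lemma fcalc_inner:
  assumes X: "fcalc g X" and cont: "continuous_on {lo..hi} g"
  shows "inner (X z) z = (\<integral>t. indicat_real {lo..hi} t * g t \<partial>\<mu> z)"
proof -
  obtain p where p: "uniform_limit {lo..hi} (\<lambda>n. poly (p n)) g sequentially" "(\<lambda>n. poly_op P (p n) T) \<longlonglongrightarrow> X"
    using X unfolding fcalc_def by blast
  have meas: "(\<lambda>t. indicat_real {lo..hi} t * g t) \<in> borel_measurable borel"
    using borel_measurable_continuous_on_indicator[OF _ cont] by simp
  have "bounded (g ` {lo..hi})"
    by (intro compact_imp_bounded compact_continuous_image cont compact_Icc)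
  then obtain B where B: "\<And>t. t \<in> {lo..hi} \<Longrightarrow> \<bar>g t\<bar> \<le> B" by (auto simp: bounded_iff simp del: atLeastAtMost_iff)
  interpret finite_measure "\<mu> z" by (rule finite_mu)
  have intg: "integrable (\<mu> z) (\<lambda>t. indicat_real {lo..hi} t * g t)"
    by (rule integrable_bounded[OF meas, of B]) (use B in auto)
  have "(\<lambda>n. inner (poly_op P (p n) T z) z) \<longlonglongrightarrow> (\<integral>t. indicat_real {lo..hi} t * g t \<partial>\<mu> z)"
  proof (rule LIMSEQ_I)
    fix r :: real assume r: "0 < r"
    define e where "e = r / (measure (\<mu> z) UNIV + 1)"
    have e: "0 < e" using r by (simp add: e_def add_nonneg_pos)
    obtain N where N: "\<And>n t. N \<le> n \<Longrightarrow> t \<in> {lo..hi} \<Longrightarrow> \<bar>poly (p n) t - g t\<bar> < e"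
      using uniform_limitD[OF p(1) e]
      by (auto simp: eventually_sequentially dist_real_def simp del: atLeastAtMost_iff)
    have "norm (inner (poly_op P (p n) T z) z - (\<integral>t. indicat_real {lo..hi} t * g t \<partial>\<mu> z)) < r" if n: "N \<le> n" for n
    proof -
      have "norm (inner (poly_op P (p n) T z) z - (\<integral>t. indicat_real {lo..hi} t * g t \<partial>\<mu> z))
          = norm (\<integral>t. poly (p n) t - indicat_real {lo..hi} t * g t \<partial>\<mu> z)"
        by (simp add: inner_poly_op Bochner_Integration.integral_diff[OF integrable_poly intg])
      also have "\<dots> \<le> (\<integral>t. norm (poly (p n) t - indicat_real {lo..hi} t * g t) \<partial>\<mu> z)"
        by (rule integral_norm_bound)
      also have "\<dots> \<le> (\<integral>t. e \<partial>\<mu> z)"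
      proof (rule integral_mono_AE)
        show "integrable (\<mu> z) (\<lambda>t. norm (poly (p n) t - indicat_real {lo..hi} t * g t))"
          by (intro integrable_norm Bochner_Integration.integrable_diff integrable_poly intg)
        show "AE t in \<mu> z. norm (poly (p n) t - indicat_real {lo..hi} t * g t) \<le> e"
          using AE_bounds[of z] by eventually_elim (use N[OF n] in \<open>auto intro: less_imp_le\<close>)
      qed simp
      also have "\<dots> = e * measure (\<mu> z) UNIV" by simp
      also have "\<dots> < r" using r by (simp add: e_def pos_divide_less_eq add_pos_nonneg algebra_simps)
      finally show ?thesis .
    qed
    then show "\<exists>N. \<forall>n\<ge>N. norm (inner (poly_op P (p n) T z) z - (\<integral>t. indicat_real {lo..hi} t * g t \<partial>\<mu> z)) < r" by blast
  qed
  moreover have "(\<lambda>n. inner (poly_op P (p n) T z) z) \<longlonglongrightarrow> inner (X z) z"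
    by (intro tendsto_inner tendsto_eval p tendsto_const)
  ultimately show ?thesis by (rule LIMSEQ_unique[rotated])
qed

lemma fcalc_positive:
  assumes X: "fcalc g X" and cont: "continuous_on {lo..hi} g" and g: "\<And>t. t \<in> {lo..hi} \<Longrightarrow> 0 \<le> g t"
  shows "positive_op X"
  unfolding positive_iff fcalc_inner[OF X cont]
  using g by (auto simp: fcalc_selfadjoint[OF X] indicator_def intro!: Bochner_Integration.integral_nonneg)

lemma fcalc_inverse:
  assumes g: "continuous_on {lo..hi} g" and nz: "\<And>t. t \<in> {lo..hi} \<Longrightarrow> g t \<noteq> 0" and X: "fcalc g X"
  obtains Y where "fcalc (\<lambda>t. 1 / g t) Y" "X * Y = P" "Y * X = P"
proof -
  have c: "continuous_on {lo..hi} (\<lambda>t. 1 / g t)" using g nz by (intro continuous_intros) auto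
  obtain Y where Y: "fcalc (\<lambda>t. 1 / g t) Y" using fcalc_exists[OF c] by blast
  have one: "fcalc (\<lambda>t. 1) P" using fcalc_affine[of 1 0] by simp
  have "X * Y = P"
    by (rule fcalc_unique[OF fcalc_cong[OF fcalc_mult[OF X Y g c]] one]) (use nz in auto)
  moreover have "Y * X = P"
    by (rule fcalc_unique[OF fcalc_cong[OF fcalc_mult[OF Y X c g]] one]) (use nz in auto)
  ultimately show thesis using Y that by blast
qed

section \<open>The real spectrum and agreement with \<open>cfc_on\<close>\<close>

lemma invertible_shift:
  assumes "r \<notin> {lo..hi}"
  shows "invertible_on P (T - of_real r *\<^sub>C P)"
proof -
  have eq: "T - of_real r *\<^sub>C P = (- r) *\<^sub>R P + 1 *\<^sub>R T"
    by (rule bop_eqI) (simp add: bop_rep_eq scaleC_of_real)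
  have c: "continuous_on {lo..hi} (\<lambda>t. - r + 1 * t)" by (intro continuous_intros)
  have nz: "- r + 1 * t \<noteq> 0" if "t \<in> {lo..hi}" for t using that assms by auto
  obtain Y where Y: "fcalc (\<lambda>t. 1 / (- r + 1 * t)) Y"
      "((- r) *\<^sub>R P + 1 *\<^sub>R T) * Y = P" "Y * ((- r) *\<^sub>R P + 1 *\<^sub>R T) = P"
    using fcalc_inverse[OF c nz fcalc_affine] by blast
  have "Y \<in> corner P" using fcalc_corner[OF Y(1)] by (simp add: corner_proj_iff[OF P])
  then show ?thesis using Y(2,3) unfolding invertible_on_def eq by blast
qed

text \<open>Let S invert T - r on PH. On the range of E over an interval within distance d of r, T -
  r has norm at most d, whereas |u| \<le> |S| |(T - r) u|; as |S| d < 1, this range is 0. Rational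
  end points make the cover of the resolvent set countable, hence null.\<close>

lemma AE_spectrum: "AE t in \<mu> x. complex_of_real t \<in> spectrum_on P T"
proof -
  let ?I = "\<lambda>(a, b). {real_of_rat a<..<real_of_rat b}"
  define J where "J = {i. E (?I i) = 0}"
  have "(\<Union>i\<in>J. ?I i) \<in> null_sets (\<mu> x)"
    by (rule null_sets_UN') (auto simp: J_def null_sets_def emeasure_mu bop_rep_eq)
  moreover have "{t. complex_of_real t \<notin> spectrum_on P T} \<subseteq> (\<Union>i\<in>J. ?I i)"
  proof
    fix r assume "r \<in> {t. complex_of_real t \<notin> spectrum_on P T}"
    then obtain S where S: "S * (T - of_real r *\<^sub>C P) = P" by (auto simp: spectrum_on_def invertible_on_def)
    define d where "d = 1 / (norm S + 1)"
    have d: "0 < d" "norm S * d < 1" by (simp_all add: d_def add_nonneg_pos add_pos_nonneg pos_divide_less_eq)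
    obtain a where a: "r - d < real_of_rat a" "real_of_rat a < r" using of_rat_dense[of "r - d" r] d by auto
    obtain b where b: "r < real_of_rat b" "real_of_rat b < r + d" using of_rat_dense[of r "r + d"] d by auto
    let ?A = "{real_of_rat a<..<real_of_rat b}"
    have "E ?A x = 0" for x
    proof (rule ccontr)
      define u where "u = E ?A x"
      assume "E ?A x \<noteq> 0"
      then have u0: "0 < norm u" by (simp add: u_def)
      have Pu: "P u = u" by (simp add: u_def PE)
      interpret finite_measure "\<mu> u" by (rule finite_mu)
      have "E (UNIV - ?A) u = 0" unfolding u_def by (rule E_disjoint) auto
      then have "emeasure (\<mu> u) (UNIV - ?A) = 0" by (simp add: emeasure_mu)
      then have AE: "AE t in \<mu> u. t \<in> ?A" by (intro AE_I'[of "UNIV - ?A"]) (auto simp: null_sets_def)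
      have "(norm (poly_op P [:- r, 1:] T u))\<^sup>2 \<le> (\<integral>t. d\<^sup>2 \<partial>\<mu> u)"
        unfolding norm_poly_op_apply
      proof (rule integral_mono_AE)
        show "integrable (\<mu> u) (\<lambda>t. (poly [:- r, 1:] t)\<^sup>2)"
          using integrable_poly[of u "[:- r, 1:] * [:- r, 1:]"] by (simp only: poly_mult power2_eq_square)
        show "AE t in \<mu> u. (poly [:- r, 1:] t)\<^sup>2 \<le> d\<^sup>2"
          using AE
        proof eventually_elim
          case (elim t)
          then have "\<bar>- r + t\<bar> \<le> \<bar>d\<bar>" using a b d by auto
          then show ?case by (simp add: abs_le_square_iff)
        qed
      qed simp
      also have "\<dots> = (d * norm u)\<^sup>2" using Pu by (simp add: measure_mu E_UNIV power_mult_distrib)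
      finally have le: "norm (poly_op P [:- r, 1:] T u) \<le> d * norm u" by (rule power2_le_imp_le) (use d in simp)
      have "poly_op P [:- r, 1:] T = T - of_real r *\<^sub>C P"
        by (rule bop_eqI) (simp add: poly_op_pCons[OF PT] poly_op_def[of P 0] PT bop_rep_eq scaleC_of_real)
      then have "u = S (poly_op P [:- r, 1:] T u)" using S Pu by (metis times_bop.rep_eq)
      then have "norm u \<le> norm S * norm (poly_op P [:- r, 1:] T u)" using norm_bop_apply by metis
      also have "\<dots> \<le> norm S * (d * norm u)" by (rule mult_left_mono[OF le]) simp
      finally have "1 * norm u \<le> (norm S * d) * norm u" by simp
      then have "1 \<le> norm S * d" using u0 by (simp only: mult_le_cancel_right_pos)
      then show False using d by simp
    qed
    then have "E ?A = 0" by (intro bop_eqI) (simp add: bop_rep_eq)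
    then have "(a, b) \<in> J" by (simp add: J_def)
    moreover have "r \<in> ?I (a, b)" using a b by simp
    ultimately show "r \<in> (\<Union>i\<in>J. ?I i)" by blast
  qed
  ultimately show ?thesis by (intro AE_I'[of "\<Union>i\<in>J. ?I i"]) auto
qed

text \<open>Polynomials that approximate g on {lo..hi} do so on the spectrum, which provides a
  witness for the description. Uniqueness has to start from approximation on the spectrum alone;
  this controls operator norms because the spectrum carries every \<mu> x.\<close>

lemma cfc_on_eq:
  assumes X: "fcalc g X"
  shows "cfc_on P g T = X"
proof -
  let ?S = "{t. complex_of_real t \<in> spectrum_on P T}"
  obtain p where p: "uniform_limit {lo..hi} (\<lambda>n. poly (p n)) g sequentially" "(\<lambda>n. poly_op P (p n) T) \<longlonglongrightarrow> X"
    using X unfolding fcalc_def by blast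
  have "?S \<subseteq> {lo..hi}"
  proof
    fix t assume "t \<in> ?S"
    then show "t \<in> {lo..hi}" using invertible_shift[of t] by (auto simp: spectrum_on_def simp del: atLeastAtMost_iff)
  qed
  then have pS: "uniform_limit ?S (\<lambda>n. poly (p n)) g sequentially"
    using uniform_limit_on_subset[OF p(1)] by blast
  have AE: "AE t in \<mu> x. t \<in> ?S" for x using AE_spectrum by simp
  show ?thesis
    unfolding cfc_on_def
  proof (rule the_equality)
    show "\<exists>p. uniform_limit ?S (\<lambda>n. poly (p n)) g sequentially \<and> (\<lambda>n. poly_op P (p n) T) \<longlonglongrightarrow> X"
      using pS p(2) by blast
    show "Y = X" if "\<exists>p. uniform_limit ?S (\<lambda>n. poly (p n)) g sequentially \<and> (\<lambda>n. poly_op P (p n) T) \<longlonglongrightarrow> Y" for Y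
      using that poly_op_limit_unique[OF _ pS _ p(2) AE] by blast
  qed
qed

end

section \<open>Orthonormal bases and traces\<close>

lemma summable_ennreal [simp]: "(f :: 'b \<Rightarrow> ennreal) summable_on A"
  by (rule nonneg_summable_on_complete) simp

lemma infsum_ennreal_SUP:
  "infsum (f :: 'b \<Rightarrow> ennreal) A = (SUP F\<in>{F. finite F \<and> F \<subseteq> A}. sum f F)"
  by (rule nonneg_infsum_complete) simp

lemma infsum_ennreal_finite_sum:
  fixes g :: "'b \<Rightarrow> 'c \<Rightarrow> ennreal"
  assumes "finite F"
  shows "infsum (\<lambda>y. \<Sum>x\<in>F. g x y) B = (\<Sum>x\<in>F. infsum (g x) B)"
  using assms by (induction F rule: finite_induct) (simp_all add: infsum_add)

lemma infsum_ennreal_sum_le: "F \<subseteq> A \<Longrightarrow> finite F \<Longrightarrow> sum f F \<le> infsum (f :: 'b \<Rightarrow> ennreal) A"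
  unfolding infsum_ennreal_SUP by (rule SUP_upper) auto

text \<open>One inequality is proved for arbitrary index sets, by moving finite partial sums inside;
  exchanging the roles of the index sets gives the other.\<close>

lemma infsum_ennreal_swap:
  fixes g :: "'b \<Rightarrow> 'c \<Rightarrow> ennreal"
  shows "infsum (\<lambda>x. infsum (g x) B) A = infsum (\<lambda>y. infsum (\<lambda>x. g x y) A) B"
proof -
  have le: "infsum (\<lambda>x. infsum (g x) B) A \<le> infsum (\<lambda>y. infsum (\<lambda>x. g x y) A) B"
    for g :: "'b1 \<Rightarrow> 'c1 \<Rightarrow> ennreal" and A B
    by (subst infsum_ennreal_SUP, rule SUP_least)
      (auto simp: infsum_ennreal_finite_sum[symmetric] intro!: infsum_mono infsum_ennreal_sum_le)
  show ?thesis by (rule antisym) (rule le)+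
qed

text \<open>Monotone convergence over a possibly uncountable index set: for finite index sets the
  supremum passes through the sum, and then two suprema are exchanged.\<close>

lemma infsum_ennreal_SUP_nat:
  fixes g :: "nat \<Rightarrow> 'b \<Rightarrow> ennreal"
  assumes "\<And>x. x \<in> A \<Longrightarrow> incseq (\<lambda>n. g n x)"
  shows "infsum (\<lambda>x. SUP n. g n x) A = (SUP n. infsum (g n) A)"
proof -
  have "sum (\<lambda>x. SUP n. g n x) F = (SUP n. sum (g n) F)" if "F \<subseteq> A" "finite F" for F
    using that(2,1)
  proof (induction F rule: finite_induct)
    case (insert x F)
    have "incseq (\<lambda>n. sum (g n) F)"
      using assms insert.prems by (auto simp: mono_def intro!: sum_mono)
    then have "(SUP n. g n x + sum (g n) F) = (SUP n. g n x) + (SUP n. sum (g n) F)"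
      by (intro ennreal_SUP_add) (use assms insert.prems in auto)
    then show ?case using insert by simp
  qed (simp add: bot_ennreal)
  then show ?thesis unfolding infsum_ennreal_SUP
    by (subst SUP_commute) (auto intro!: SUP_cong)
qed

lemma infsum_ennreal_cmult: "infsum (\<lambda>x. c * f x) A = c * infsum (f :: 'b \<Rightarrow> ennreal) A"
  unfolding infsum_ennreal_SUP sum_distrib_left[symmetric]
  by (subst SUP_mult_left_ennreal) auto

lemma has_sum_ennreal:
  assumes "(f has_sum s) A" "\<And>x. x \<in> A \<Longrightarrow> 0 \<le> f x"
  shows "((\<lambda>x. ennreal (f x)) has_sum ennreal s) A"
  unfolding has_sum_def
proof (rule Lim_transform_eventually)
  show "((\<lambda>F. ennreal (sum f F)) \<longlongrightarrow> ennreal s) (finite_subsets_at_top A)"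
    using assms(1) unfolding has_sum_def by (rule tendsto_ennrealI)
  show "\<forall>\<^sub>F F in finite_subsets_at_top A. ennreal (sum f F) = (\<Sum>x\<in>F. ennreal (f x))"
    by (rule eventually_finite_subsets_at_top_weakI) (use assms(2) in \<open>auto simp: sum_ennreal subset_iff\<close>)
qed

lemma infsum_ennreal:
  assumes "f summable_on A" "\<And>x. x \<in> A \<Longrightarrow> 0 \<le> f x"
  shows "infsum (\<lambda>x. ennreal (f x)) A = ennreal (infsum f A)"
  using has_sum_ennreal[OF has_sum_infsum[OF assms(1)] assms(2)] by (rule infsumI)

lemma summable_on_if_ennreal:
  fixes f :: "'b \<Rightarrow> real"
  assumes "infsum (\<lambda>x. ennreal (f x)) A < \<infinity>" "\<And>x. x \<in> A \<Longrightarrow> 0 \<le> f x"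
  shows "f summable_on A"
proof (rule nonneg_bdd_above_summable_on[OF assms(2)])
  obtain r where r: "infsum (\<lambda>x. ennreal (f x)) A = ennreal r" "0 \<le> r"
    using assms(1) by (cases "infsum (\<lambda>x. ennreal (f x)) A") (auto simp: top_unique less_top)
  have "sum f F \<le> r" if "F \<subseteq> A" "finite F" for F
  proof -
    have "ennreal (sum f F) = (\<Sum>x\<in>F. ennreal (f x))" using assms(2) that by (subst sum_ennreal) auto
    also have "\<dots> \<le> ennreal r" using infsum_ennreal_sum_le[OF that] r by metis
    finally show ?thesis using r by (simp add: ennreal_le_iff)
  qed
  then show "bdd_above (sum f ` {F. F \<subseteq> A \<and> finite F})" by (intro bdd_aboveI[of _ r]) auto
qed auto

section \<open>Orthonormal bases and Parseval's identity\<close>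

definition fourier_sum :: "'a::complex_hilbert set \<Rightarrow> 'a \<Rightarrow> 'a"
  where "fourier_sum F x = (\<Sum>e\<in>F. cinner x e *\<^sub>C e)"

definition orthonormal :: "'a::complex_hilbert set \<Rightarrow> bool"
  where "orthonormal E \<longleftrightarrow> (\<forall>e\<in>E. \<forall>e'\<in>E. cinner e e' = (if e = e' then 1 else 0))"

lemma fourier_sum_norm:
  assumes "orthonormal F" "finite F"
  shows "(norm (x - fourier_sum F x))\<^sup>2 = (norm x)\<^sup>2 - (\<Sum>e\<in>F. (cmod (cinner x e))\<^sup>2)"
proof -
  have 1: "cinner (fourier_sum F x) e = cinner x e" if e: "e \<in> F" for e
  proof -
    have "cinner (fourier_sum F x) e = (\<Sum>e'\<in>F. if e' = e then cinner x e' else 0)"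
      unfolding fourier_sum_def cinner_sum_left
      by (rule sum.cong) (use e assms in \<open>auto simp: cinner_scaleC_left orthonormal_def\<close>)
    then show ?thesis using e assms(2) by simp
  qed
  have sq: "cnj z * z = complex_of_real ((cmod z)\<^sup>2)" for z by (metis complex_norm_square mult.commute)
  have 2: "cinner x (fourier_sum F x) = of_real (\<Sum>e\<in>F. (cmod (cinner x e))\<^sup>2)"
    by (simp add: fourier_sum_def cinner_sum_right cinner_scaleC_right sq del: of_real_power)
  have 3: "cinner (fourier_sum F x) (fourier_sum F x) = of_real (\<Sum>e\<in>F. (cmod (cinner x e))\<^sup>2)"
    by (subst (2) fourier_sum_def) (simp add: cinner_sum_right cinner_scaleC_right 1 sq del: of_real_power)
  show ?thesis
    using arg_cong[OF 2, of Re] arg_cong[OF 3, of Re]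
    by (simp add: power2_norm_eq_inner inner_diff_left inner_diff_right inner_commute
        inner_eq_Re_cinner[symmetric])
qed

lemma scaleC_diff_left: "(a - b) *\<^sub>C x = a *\<^sub>C x - b *\<^sub>C (x :: 'a::complex_hilbert)"
  using scaleC_add_left[of "a - b" b x] by simp

lemma fourier_sum_linear:
  "fourier_sum F (x + y) = fourier_sum F x + fourier_sum F y"
  "fourier_sum F (x - y) = fourier_sum F x - fourier_sum F y"
  "fourier_sum F (c *\<^sub>C x) = c *\<^sub>C fourier_sum F x"
  "fourier_sum F (r *\<^sub>R x) = r *\<^sub>R fourier_sum F x"
proof -
  show "fourier_sum F (x + y) = fourier_sum F x + fourier_sum F y"
    by (simp add: fourier_sum_def cinner_simps scaleC_add_left sum.distrib)
  have sc: "c *\<^sub>C sum f F = (\<Sum>e\<in>F. c *\<^sub>C f e)" for c and f :: "'a \<Rightarrow> 'a"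
    by (induction F rule: infinite_finite_induct) (auto simp: scaleC_zero_right scaleC_add_right)
  show c: "fourier_sum F (c *\<^sub>C x) = c *\<^sub>C fourier_sum F x" for c x
    by (simp add: fourier_sum_def cinner_simps sc scaleC_scaleC)
  show r: "fourier_sum F (r *\<^sub>R x) = r *\<^sub>R fourier_sum F x" for r x
    using c[of "of_real r" x] by (simp add: scaleC_of_real)
  show "fourier_sum F (x - y) = fourier_sum F x - fourier_sum F y"
    by (simp add: fourier_sum_def cinner_simps scaleC_diff_left sum_subtractf)
qed

text \<open>A maximal orthonormal set, obtained from Zorn's lemma, is complete: a nonzero vector
  orthogonal to it could be normalized and adjoined.\<close>

lemma onb_exists: "\<exists>E :: 'a::complex_hilbert set. is_onb E"
proof -
  have "\<exists>M\<in>{E :: 'a set. orthonormal E}. \<forall>X\<in>{E. orthonormal E}. M \<subseteq> X \<longrightarrow> X = M"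
  proof (rule subset_Zorn_nonempty)
    show "{E :: 'a set. orthonormal E} \<noteq> {}" by (auto intro!: exI[of _ "{}"] simp: orthonormal_def)
    fix C :: "'a set set" assume C: "C \<noteq> {}" "subset.chain {E. orthonormal E} C"
    have "cinner e e' = (if e = e' then 1 else 0)" if "e \<in> X" "X \<in> C" "e' \<in> Y" "Y \<in> C" for e e' X Y
    proof -
      have "X \<subseteq> Y \<or> Y \<subseteq> X" "orthonormal X" "orthonormal Y"
        using C(2) that by (auto simp: subset_chain_def)
      then show ?thesis using that unfolding orthonormal_def by blast
    qed
    then show "\<Union> C \<in> {E. orthonormal E}" by (auto simp: orthonormal_def)
  qed
  then obtain M :: "'a set" where M: "orthonormal M" "\<And>X. orthonormal X \<Longrightarrow> M \<subseteq> X \<Longrightarrow> X = M" by auto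
  have complete: "x = 0" if x: "\<And>e. e \<in> M \<Longrightarrow> cinner x e = 0" for x
  proof (rule ccontr)
    assume x0: "x \<noteq> 0"
    define u where "u = (1 / norm x) *\<^sub>R x"
    have "norm u = 1" using x0 by (simp add: u_def)
    then have uu: "cinner u u = 1" by (simp add: cinner_self)
    have ue: "cinner u e = 0" "cinner e u = 0" if "e \<in> M" for e
      using x[OF that] cinner_commute[of e x] by (simp_all add: u_def cinner_simps)
    have uM: "u \<notin> M" using ue(1)[of u] uu by auto
    have "orthonormal (insert u M)"
      unfolding orthonormal_def
    proof (intro ballI)
      fix e e' assume "e \<in> insert u M" "e' \<in> insert u M"
      then consider "e = u" "e' = u" | "e = u" "e' \<in> M" | "e \<in> M" "e' = u" | "e \<in> M" "e' \<in> M" by blast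
      then show "cinner e e' = (if e = e' then 1 else 0)"
      proof cases
        case 1
        then show ?thesis using uu by simp
      next
        case 2
        then have "e \<noteq> e'" using uM by blast
        then show ?thesis using ue(1)[OF 2(2)] 2(1) by simp
      next
        case 3
        then have "e \<noteq> e'" using uM by blast
        then show ?thesis using ue(2)[OF 3(1)] 3(2) by simp
      next
        case 4
        then show ?thesis using M(1) unfolding orthonormal_def by blast
      qed
    qed
    then have "insert u M = M" by (rule M(2)) auto
    then show False using uM by blast
  qed
  have "is_onb M"
    unfolding is_onb_def
  proof (intro conjI allI impI)
    show "\<forall>e\<in>M. \<forall>e'\<in>M. cinner e e' = (if e = e' then 1 else 0)"
      using M(1) unfolding orthonormal_def .
  qed (rule complete, blast)
  then show ?thesis ..
qed

lemma some_onb: "is_onb some_onb"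
  unfolding some_onb_def by (rule someI_ex[OF onb_exists])

text \<open>M collects the vectors approximable by their finite Fourier sums. It is a closed complex
  subspace containing E, so x minus its projection onto M is orthogonal to E and vanishes by
  completeness. Thus x is in M, which gives one inequality; the other is Bessel's.\<close>

lemma parseval:
  fixes x :: "'a::complex_hilbert"
  assumes E: "is_onb E"
  shows "infsum (\<lambda>e. ennreal ((cmod (cinner x e))\<^sup>2)) E = ennreal ((norm x)\<^sup>2)"
proof -
  have ortho: "orthonormal F" if "F \<subseteq> E" for F
  proof -
    have "orthonormal E" using E by (simp add: is_onb_def orthonormal_def)
    then show ?thesis using that unfolding orthonormal_def by blast
  qed
  note fs = fourier_sum_norm[OF ortho]
  define M where "M = {x. \<forall>d>0. \<exists>F. F \<subseteq> E \<and> finite F \<and> norm (x - fourier_sum F x) < d}"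
  have mono: "norm (x - fourier_sum G x) \<le> norm (x - fourier_sum F x)" if "F \<subseteq> G" "G \<subseteq> E" "finite G" for F G x
  proof (rule power2_le_imp_le)
    have "(\<Sum>e\<in>F. (cmod (cinner x e))\<^sup>2) \<le> (\<Sum>e\<in>G. (cmod (cinner x e))\<^sup>2)"
      by (rule sum_mono2) (use that in auto)
    then show "(norm (x - fourier_sum G x))\<^sup>2 \<le> (norm (x - fourier_sum F x))\<^sup>2"
      using that by (simp add: fs finite_subset)
  qed simp
  have M0: "0 \<in> M" by (auto simp: M_def fourier_sum_def intro!: exI[of _ "{}"])
  have Madd: "x + y \<in> M" if "x \<in> M" "y \<in> M" for x y
    unfolding M_def
  proof (intro CollectI allI impI)
    fix d :: real assume "0 < d"
    then have d2: "0 < d / 2" by simp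
    obtain F where F: "F \<subseteq> E" "finite F" "norm (x - fourier_sum F x) < d / 2"
      using \<open>x \<in> M\<close> d2 unfolding M_def by blast
    obtain G where G: "G \<subseteq> E" "finite G" "norm (y - fourier_sum G y) < d / 2"
      using \<open>y \<in> M\<close> d2 unfolding M_def by blast
    have "norm (x + y - fourier_sum (F \<union> G) (x + y)) \<le>
        norm (x - fourier_sum (F \<union> G) x) + norm (y - fourier_sum (F \<union> G) y)"
      by (simp add: fourier_sum_linear add_diff_add norm_triangle_ineq)
    also have "\<dots> < d"
      using mono[of F "F \<union> G" x] mono[of G "F \<union> G" y] F G by auto
    finally show "\<exists>F. F \<subseteq> E \<and> finite F \<and> norm (x + y - fourier_sum F (x + y)) < d"
      using F G by (intro exI[of _ "F \<union> G"]) auto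
  qed
  have MscC: "c *\<^sub>C x \<in> M" if x: "x \<in> M" for c x
    unfolding M_def
  proof (intro CollectI allI impI)
    fix d :: real assume "0 < d"
    then have "0 < d / (cmod c + 1)" by (simp add: add_nonneg_pos)
    then obtain F where F: "F \<subseteq> E" "finite F" "norm (x - fourier_sum F x) < d / (cmod c + 1)"
      using x unfolding M_def by blast
    have "norm (c *\<^sub>C x - fourier_sum F (c *\<^sub>C x)) = cmod c * norm (x - fourier_sum F x)"
      by (simp add: fourier_sum_linear scaleC_diff_right[symmetric] norm_scaleC)
    also have "\<dots> \<le> (cmod c + 1) * norm (x - fourier_sum F x)" by (simp add: mult_right_mono)
    also have "\<dots> < d" using F(3) by (simp add: pos_less_divide_eq add_nonneg_pos mult.commute)
    finally show "\<exists>F. F \<subseteq> E \<and> finite F \<and> norm (c *\<^sub>C x - fourier_sum F (c *\<^sub>C x)) < d" using F by blast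
  qed
  have "subspace M"
    using M0 Madd MscC[of _ "complex_of_real _"] by (auto intro!: subspaceI simp: scaleC_of_real)
  moreover have "closed M"
    unfolding closure_subset_eq[symmetric]
  proof
    fix x assume x: "x \<in> closure M"
    show "x \<in> M"
      unfolding M_def
    proof (intro CollectI allI impI)
      fix d :: real assume "0 < d"
      then obtain y where y: "y \<in> M" "dist y x < d / 2"
        using x closure_approachable[of x M] half_gt_zero by blast
      obtain F where F: "F \<subseteq> E" "finite F" "norm (y - fourier_sum F y) < d / 2"
        using y(1) half_gt_zero[OF \<open>0 < d\<close>] unfolding M_def by blast
      have "norm ((x - y) - fourier_sum F (x - y)) \<le> norm (x - y)"
        using mono[of "{}" F "x - y"] F by (simp add: fourier_sum_def)
      moreover have "norm (x - fourier_sum F x) \<le> norm ((x - y) - fourier_sum F (x - y)) + norm (y - fourier_sum F y)"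
        using norm_triangle_ineq[of "(x - y) - fourier_sum F (x - y)" "y - fourier_sum F y"]
        by (simp add: fourier_sum_linear algebra_simps)
      ultimately have "norm (x - fourier_sum F x) < d" using F(3) y(2) by (simp add: dist_norm norm_minus_commute)
      then show "\<exists>F. F \<subseteq> E \<and> finite F \<and> norm (x - fourier_sum F x) < d" using F by blast
    qed
  qed
  ultimately obtain P where P: "projection_op P" "range (bop_apply P) = M"
    using projection_exists[of M] MscC by metis
  have "e \<in> M" if e: "e \<in> E" for e
  proof -
    have "cinner e e = 1" using E e unfolding is_onb_def by simp
    then have "e - fourier_sum {e} e = 0" using scaleC_of_real[of 1 e] by (simp add: fourier_sum_def)
    then show ?thesis unfolding M_def using e by (intro CollectI allI impI exI[of _ "{e}"]) simp
  qed
  then have Pe: "P e = e" if "e \<in> E" for e using that P projection_range_iff by blast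
  have "cinner (x - P x) e = 0" if "e \<in> E" for e
    using selfadjoint_cinner[OF projection_selfadjoint[OF P(1)], of x e] Pe[OF that] by (simp add: cinner_diff_left)
  then have "x - P x = 0" using E unfolding is_onb_def by blast
  then have xM: "x \<in> M" using P(2) by (metis eq_iff_diff_eq_0 rangeI)
  show ?thesis
  proof (rule antisym)
    show "infsum (\<lambda>e. ennreal ((cmod (cinner x e))\<^sup>2)) E \<le> ennreal ((norm x)\<^sup>2)"
      unfolding infsum_ennreal_SUP
    proof (rule SUP_least)
      fix F assume "F \<in> {F. finite F \<and> F \<subseteq> E}"
      then show "(\<Sum>e\<in>F. ennreal ((cmod (cinner x e))\<^sup>2)) \<le> ennreal ((norm x)\<^sup>2)"
        using fs[of F x] zero_le_power2[of "norm (x - fourier_sum F x)"]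
        by (simp add: sum_ennreal ennreal_le_iff sum_nonneg)
    qed
    show "ennreal ((norm x)\<^sup>2) \<le> infsum (\<lambda>e. ennreal ((cmod (cinner x e))\<^sup>2)) E"
    proof (rule ennreal_le_epsilon)
      fix d :: real assume "0 < d"
      \<comment> \<open>The tolerance sqrt d becomes d in the squared identity
        \<open>fourier_sum_norm\<close>.\<close>
      then have "0 < sqrt d" by simp
      then obtain F where F: "F \<subseteq> E" "finite F" "norm (x - fourier_sum F x) < sqrt d"
        using xM unfolding M_def by blast
      have "(norm (x - fourier_sum F x))\<^sup>2 \<le> (sqrt d)\<^sup>2" using F(3) by (intro power_mono) auto
      then have "(norm x)\<^sup>2 \<le> (\<Sum>e\<in>F. (cmod (cinner x e))\<^sup>2) + d" using fs[OF F(1,2), of x] \<open>0 < d\<close> by simp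
      then have "ennreal ((norm x)\<^sup>2) \<le> ennreal ((\<Sum>e\<in>F. (cmod (cinner x e))\<^sup>2) + d)" by (rule ennreal_leI)
      also have "\<dots> = (\<Sum>e\<in>F. ennreal ((cmod (cinner x e))\<^sup>2)) + ennreal d"
        using \<open>0 < d\<close> by (simp add: sum_nonneg sum_ennreal)
      also have "\<dots> \<le> infsum (\<lambda>e. ennreal ((cmod (cinner x e))\<^sup>2)) E + ennreal d"
        by (intro add_right_mono infsum_ennreal_sum_le F)
      finally show "ennreal ((norm x)\<^sup>2) \<le> infsum (\<lambda>e. ennreal ((cmod (cinner x e))\<^sup>2)) E + ennreal d" .
    qed
  qed
qed

section \<open>Hilbert-Schmidt operators\<close>

definition hs_sum :: "'a::complex_hilbert set \<Rightarrow> 'a bop \<Rightarrow> ennreal"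
  where "hs_sum E L = infsum (\<lambda>e. ennreal ((norm (L e))\<^sup>2)) E"

text \<open>Parseval expands both sides into the double sum of |<L e, e'>|^2, and nonnegative sums
  may be exchanged. Applied to L and then to its adjoint, this yields independence of the
  basis.\<close>

lemma hs_sum_adj:
  assumes "is_onb E" "is_onb E'"
  shows "hs_sum E L = hs_sum E' (adj_op L)"
proof -
  have "hs_sum E L = infsum (\<lambda>e. infsum (\<lambda>e'. ennreal ((cmod (cinner (L e) e'))\<^sup>2)) E') E"
    unfolding hs_sum_def by (simp add: parseval[OF assms(2)])
  also have "\<dots> = infsum (\<lambda>e'. infsum (\<lambda>e. ennreal ((cmod (cinner (L e) e'))\<^sup>2)) E) E'"
    by (rule infsum_ennreal_swap)
  also have "\<dots> = infsum (\<lambda>e'. infsum (\<lambda>e. ennreal ((cmod (cinner (adj_op L e') e))\<^sup>2)) E) E'"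
  proof -
    have "cmod (cinner (L e) e') = cmod (cinner (adj_op L e') e)" for e e'
      by (metis cinner_adj cinner_commute complex_mod_cnj)
    then show ?thesis by simp
  qed
  also have "\<dots> = hs_sum E' (adj_op L)"
    unfolding hs_sum_def by (simp add: parseval[OF assms(1)])
  finally show ?thesis .
qed

lemma adj_adj: "adj_op (adj_op L) = L"
  by (rule adj_op_eqI) (rule cinner_adj')

lemma hs_sum_indep: "is_onb E \<Longrightarrow> is_onb E' \<Longrightarrow> hs_sum E L = hs_sum E' L"
  using hs_sum_adj[of E E' L] hs_sum_adj[of E' E' "adj_op L"] by (simp add: adj_adj)

definition hs :: "'a::complex_hilbert bop \<Rightarrow> bool"
  where "hs L \<longleftrightarrow> hs_sum some_onb L < \<infinity>"

lemma hs_summable: "hs L \<Longrightarrow> (\<lambda>e. (norm (L e))\<^sup>2) summable_on some_onb"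
  unfolding hs_def hs_sum_def by (rule summable_on_if_ennreal) auto

lemma hs_adj: "hs L \<Longrightarrow> hs (adj_op L)"
  unfolding hs_def using hs_sum_adj[OF some_onb some_onb, of L] by simp

lemma hs_le:
  fixes L M N :: "'a::complex_hilbert bop"
  assumes "\<And>e. (norm (L e))\<^sup>2 \<le> c * (norm (M e))\<^sup>2 + d * (norm (N e))\<^sup>2" "0 \<le> c" "0 \<le> d" "hs M" "hs N"
  shows "hs L"
proof -
  have "hs_sum some_onb L \<le> infsum (\<lambda>e. ennreal c * ennreal ((norm (M e))\<^sup>2) + ennreal d * ennreal ((norm (N e))\<^sup>2)) some_onb"
    unfolding hs_sum_def
    by (rule infsum_mono)
      (use assms in \<open>simp_all add: ennreal_mult[symmetric] ennreal_plus[symmetric] ennreal_leI del: ennreal_plus\<close>)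
  also have "\<dots> = ennreal c * hs_sum some_onb M + ennreal d * hs_sum some_onb N"
    by (simp add: infsum_add infsum_ennreal_cmult hs_sum_def)
  also have "\<dots> < \<infinity>"
    using assms(4,5) by (simp add: hs_def ennreal_mult_less_top)
  finally show ?thesis by (simp add: hs_def)
qed

lemma norm_add_square_le: "(norm (x + y))\<^sup>2 \<le> 2 * (norm x)\<^sup>2 + 2 * (norm (y :: 'b::real_inner))\<^sup>2"
proof -
  have "0 \<le> inner (x - y) (x - y)" by simp
  then show ?thesis
    by (simp add: power2_norm_eq_inner inner_add_left inner_add_right inner_diff_left inner_diff_right inner_commute)
qed

lemma hs_add: "hs L \<Longrightarrow> hs M \<Longrightarrow> hs (L + M)" and hs_diff: "hs L \<Longrightarrow> hs M \<Longrightarrow> hs (L - M)"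
  by (rule hs_le[of _ 2 L 2 M], use norm_add_square_le in \<open>auto simp: bop_rep_eq\<close>)
    (rule hs_le[of _ 2 L 2 M], use norm_add_square_le[of _ "- _"] in \<open>auto simp: bop_rep_eq\<close>)

lemma hs_mult_left:
  assumes "hs L"
  shows "hs (X * L)"
proof (rule hs_le[of _ "(norm X)\<^sup>2" L 0 L])
  show "(norm ((X * L) e))\<^sup>2 \<le> (norm X)\<^sup>2 * (norm (L e))\<^sup>2 + 0 * (norm (L e))\<^sup>2" for e
    using norm_bop_apply[of X "L e"] by (simp add: bop_rep_eq power_mult_distrib[symmetric] power_mono)
qed (use assms in auto)

lemma adj_mult: "adj_op (X * Y) = adj_op Y * adj_op X"
  by (rule adj_op_eqI) (simp add: bop_rep_eq cinner_adj)

lemma hs_mult_right: "hs L \<Longrightarrow> hs (L * X)"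
  using hs_adj[OF hs_mult_left[OF hs_adj, of L "adj_op X"]] by (simp add: adj_mult adj_adj)

lemma summable_inner_hs:
  assumes "hs L" "hs M"
  shows "(\<lambda>e. norm (cinner (L e) (M e))) summable_on some_onb"
proof (rule summable_on_comparison_test)
  show "(\<lambda>e. (norm (L e))\<^sup>2 + (norm (M e))\<^sup>2) summable_on some_onb"
    by (intro summable_on_add hs_summable assms)
  fix e :: 'a
  have "2 * (norm (L e) * norm (M e)) \<le> (norm (L e))\<^sup>2 + (norm (M e))\<^sup>2"
    using sum_squares_bound[of "norm (L e)" "norm (M e)"] by simp
  moreover have "0 \<le> norm (L e) * norm (M e)" by simp
  ultimately show "norm (cinner (L e) (M e)) \<le> (norm (L e))\<^sup>2 + (norm (M e))\<^sup>2"
    using norm_cinner_le[of "L e" "M e"] by linarith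
qed simp

text \<open>Polarization of \<open>hs_sum_adj\<close>. Taking adjoints preserves the real
  Hilbert-Schmidt inner product, which is the form of cyclicity used for traces.\<close>

lemma infsum_inner_adj:
  assumes L: "hs L" and M: "hs M"
  shows "infsum (\<lambda>e. inner (L e) (M e)) some_onb = infsum (\<lambda>e. inner (adj_op L e) (adj_op M e)) some_onb"
proof -
  have pol: "infsum (\<lambda>e. inner (L e) (M e)) some_onb = (enn2real (hs_sum some_onb (L + M)) - enn2real (hs_sum some_onb (L - M))) / 4"
    if "hs L" "hs M" for L M :: "'a bop"
  proof -
    have e: "enn2real (hs_sum some_onb N) = infsum (\<lambda>e. (norm (N e))\<^sup>2) some_onb" if "hs N" for N :: "'a bop"
      unfolding hs_sum_def by (subst infsum_ennreal[OF hs_summable[OF that]]) (auto simp: infsum_nonneg)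
    have "infsum (\<lambda>e. inner (L e) (M e)) some_onb
        = infsum (\<lambda>e. ((norm ((L + M) e))\<^sup>2 + (- 1) * (norm ((L - M) e))\<^sup>2) * (1/4)) some_onb"
      by (rule infsum_cong) (simp add: bop_rep_eq power2_norm_eq_inner inner_add_left inner_add_right
          inner_diff_left inner_diff_right inner_commute)
    also have "\<dots> = (infsum (\<lambda>e. (norm ((L + M) e))\<^sup>2) some_onb + (- 1) * infsum (\<lambda>e. (norm ((L - M) e))\<^sup>2) some_onb) * (1/4)"
      by (simp only: infsum_cmult_left' infsum_cmult_right'
          infsum_add[OF hs_summable[OF hs_add[OF that]] summable_on_cmult_right[OF hs_summable[OF hs_diff[OF that]]]])
    finally show ?thesis by (simp add: e hs_add hs_diff that)
  qed
  have "adj_op (L + M) = adj_op L + adj_op M" "adj_op (L - M) = adj_op L - adj_op M"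
    by (rule adj_op_eqI, simp add: bop_rep_eq cinner_simps cinner_adj)+
  then show ?thesis
    unfolding pol[OF L M] pol[OF hs_adj[OF L] hs_adj[OF M]]
    using hs_sum_adj[OF some_onb some_onb, of "L + M"] hs_sum_adj[OF some_onb some_onb, of "L - M"] by simp
qed

section \<open>Trace class operators and traces\<close>

lemma trace_class_positive_iff:
  assumes D: "positive_op D"
  shows "trace_class D \<longleftrightarrow> hs (sqrt_op D)"
proof
  have c: "cinner (D e) e = complex_of_real ((norm (sqrt_op D e))\<^sup>2)" for e
    using selfadjoint_cinner_self[OF positive_selfadjoint[OF D], of e] by (simp add: norm_sqrt_op[OF D])
  show "hs (sqrt_op D)" if "trace_class D"
  proof -
    obtain E where E: "is_onb E" "(\<lambda>e. cinner (D e) e) summable_on E"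
      using \<open>trace_class D\<close> unfolding trace_class_def abs_op_positive[OF D] by blast
    then have "(\<lambda>e. (norm (sqrt_op D e))\<^sup>2) summable_on E"
      using summable_on_Re[OF E(2)] by (simp add: c)
    then have "hs_sum E (sqrt_op D) < \<infinity>"
      unfolding hs_sum_def by (subst infsum_ennreal) auto
    \<comment> \<open>Trace class speaks of some basis; basis independence moves the sum to
      \<open>some_onb\<close>.\<close>
    then show ?thesis using hs_sum_indep[OF E(1) some_onb, of "sqrt_op D"] by (simp add: hs_def)
  qed
  show "trace_class D" if "hs (sqrt_op D)"
    unfolding trace_class_def abs_op_positive[OF D] c
    using hs_summable[OF that] some_onb summable_on_of_real by blast
qed

lemma hs_sum_sqrt: "positive_op D \<Longrightarrow> hs_sum E (sqrt_op D) = infsum (\<lambda>e. ennreal (inner (D e) e)) E"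
  by (simp add: hs_sum_def norm_sqrt_op)

lemma trace_class_positive_iff':
  "positive_op D \<Longrightarrow> trace_class D \<longleftrightarrow> infsum (\<lambda>e. ennreal (inner (D e) e)) some_onb < \<infinity>"
  by (simp add: trace_class_positive_iff hs_def hs_sum_sqrt)

lemma trace_class_positive_add:
  assumes "positive_op A" "trace_class A" "positive_op B" "trace_class B"
  shows "trace_class (A + B)"
  using assms
  by (simp add: trace_class_positive_iff' positive_op_add bop_rep_eq inner_add_left positive_op_inner infsum_add)

lemma trace_class_positive_scaleR:
  assumes "positive_op A" "trace_class A" "0 \<le> r"
  shows "trace_class (r *\<^sub>R A)"
  using assms
  by (simp add: trace_class_positive_iff' positive_op_scaleR bop_rep_eq positive_op_inner ennreal_mult infsum_ennreal_cmult
      ennreal_mult_less_top)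

text \<open>With G the square root of D, each diagonal entry of X D is an inner product of G e with
  another Hilbert-Schmidt operator applied to e.\<close>

lemma trace_summable:
  assumes D: "positive_op D" "trace_class D"
  shows "(\<lambda>e. cinner ((X * D) e) e) summable_on some_onb"
proof -
  let ?G = "sqrt_op D"
  have hs: "hs ?G" using D by (simp add: trace_class_positive_iff)
  have "(\<lambda>e. norm (cinner (?G e) ((?G * adj_op X) e))) summable_on some_onb"
    by (rule summable_inner_hs[OF hs hs_mult_right[OF hs]])
  moreover have "cinner (?G e) ((?G * adj_op X) e) = cinner ((X * D) e) e" for e
    using selfadjoint_cinner[OF sqrt_op_selfadjoint[OF D(1)], of "?G e"]
    by (simp add: bop_rep_eq sqrt_op_apply_twice[OF D(1)] cinner_adj)
  ultimately show ?thesis by (simp add: abs_summable_summable)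
qed

text \<open>Both traces are Hilbert-Schmidt inner products of G with G X. They need not agree term
  by term with the sum of <X G e, G e>, only in total, and invariance under adjoints provides this
  cyclicity.\<close>

lemma trace_sandwich:
  fixes X D :: "'a::complex_hilbert bop"
  assumes D: "positive_op D" "trace_class D" and X: "selfadjoint_op X"
  defines "G \<equiv> sqrt_op D"
  shows "Re (op_trace (X * D)) = infsum (\<lambda>e. inner (X (G e)) (G e)) some_onb"
    "Re (op_trace (D * X)) = infsum (\<lambda>e. inner (X (G e)) (G e)) some_onb"
    "(\<lambda>e. inner (X (G e)) (G e)) summable_on some_onb"
proof -
  have hs: "hs G" unfolding G_def using D by (simp add: trace_class_positive_iff)
  have G: "selfadjoint_op G" unfolding G_def by (rule sqrt_op_selfadjoint[OF D(1)])
  have GG: "G (G x) = D x" for x unfolding G_def by (rule sqrt_op_apply_twice[OF D(1)])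
  have adj: "adj_op G = G" "adj_op (G * X) = X * G" by (simp_all add: adj_mult adj_selfadjoint G X)
  have c1: "cinner ((X * D) e) e = cinner (G e) ((G * X) e)" for e
    by (simp add: bop_rep_eq GG[symmetric] selfadjoint_cinner[OF X] selfadjoint_cinner[OF G])
  have c2: "cinner ((D * X) e) e = cinner ((G * X) e) (G e)" for e
    by (simp add: bop_rep_eq GG[symmetric] selfadjoint_cinner[OF G, of "G _"])
  have Re: "Re (infsum f some_onb) = infsum (\<lambda>e. Re (f e)) some_onb" if "(\<lambda>e. norm (f e)) summable_on some_onb" for f :: "'a \<Rightarrow> complex"
    using has_sum_Re[OF has_sum_infsum[OF abs_summable_summable[OF that]]] by (simp add: infsumI)
  have sw: "infsum (\<lambda>e. inner (G e) ((G * X) e)) some_onb = infsum (\<lambda>e. inner (X (G e)) (G e)) some_onb"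
    using infsum_inner_adj[OF hs hs_mult_right[OF hs], of X] by (simp add: adj bop_rep_eq inner_commute)
  show "Re (op_trace (X * D)) = infsum (\<lambda>e. inner (X (G e)) (G e)) some_onb"
    unfolding op_trace_def c1 sw[symmetric]
    by (subst Re[OF summable_inner_hs[OF hs hs_mult_right[OF hs]]]) (simp add: inner_eq_Re_cinner)
  show "Re (op_trace (D * X)) = infsum (\<lambda>e. inner (X (G e)) (G e)) some_onb"
    unfolding op_trace_def c2 sw[symmetric]
    by (subst Re[OF summable_inner_hs[OF hs_mult_right[OF hs] hs]])
      (simp add: inner_eq_Re_cinner[symmetric] inner_commute)
  show "(\<lambda>e. inner (X (G e)) (G e)) summable_on some_onb"
    using summable_on_Re[OF abs_summable_summable[OF summable_inner_hs[OF hs_mult_left[OF hs, of X] hs]]]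
    by (simp add: inner_eq_Re_cinner bop_rep_eq)
qed

text \<open>The form of X is dominated by that of \<open>abs_op X\<close>, whose sum is finite. So
  Tr X is a finite sum of reals that can be moved around when decompositions are compared.\<close>

lemma C1_sa_summable:
  assumes "X \<in> C1_sa"
  shows "(\<lambda>e. \<bar>inner (X e) e\<bar>) summable_on some_onb"
    "Re (op_trace X) = infsum (\<lambda>e. inner (X e) e) some_onb"
proof -
  have X: "selfadjoint_op X" "trace_class X" using assms by (auto simp: C1_sa_def)
  let ?A = "abs_op X"
  have A: "positive_op ?A" by (simp add: abs_op_selfadjoint X sqrt_op(1) positive_op_square)
  have "trace_class ?A" using X(2) unfolding trace_class_def abs_op_positive[OF A] .
  then have "(\<lambda>e. inner (?A e) e) summable_on some_onb"
    by (intro summable_on_if_ennreal) (use A in \<open>auto simp: trace_class_positive_iff' positive_op_inner\<close>)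
  then show s: "(\<lambda>e. \<bar>inner (X e) e\<bar>) summable_on some_onb"
    by (rule summable_on_comparison_test) (use inner_le_abs_op[OF X(1)] in auto)
  then have "(\<lambda>e. inner (X e) e) summable_on some_onb"
    using abs_summable_summable[of "\<lambda>e. inner (bop_apply X e) e"] by simp
  then have "((\<lambda>e. cinner (X e) e) has_sum complex_of_real (infsum (\<lambda>e. inner (X e) e) some_onb)) some_onb"
    unfolding selfadjoint_cinner_self[OF X(1)] by (intro has_sum_of_real has_sum_infsum)
  then show "Re (op_trace X) = infsum (\<lambda>e. inner (X e) e) some_onb"
    unfolding op_trace_def by (simp add: infsumI)
qed

section \<open>The operators \<open>R\<close> and \<open>S\<close>\<close>

lemma range_support_sqrt:
  "positive_op C \<Longrightarrow> range (bop_apply (support_proj C)) = closure (range (bop_apply (sqrt_op C)))"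
  using support_proj(2)[of "sqrt_op C"] by (simp add: support_proj_sqrt)

lemma support_sqrt_apply:
  assumes "positive_op C"
  shows "support_proj C (sqrt_op C x) = sqrt_op C x" "sqrt_op C (support_proj C x) = sqrt_op C x"
  using support_proj_apply_range[of "sqrt_op C" x] support_proj_apply_range'[OF sqrt_op_selfadjoint[OF assms], of x]
  by (simp_all add: support_proj_sqrt[OF assms])

lemma support_sqrt_mult:
  assumes "positive_op C"
  shows "support_proj C * sqrt_op C = sqrt_op C" "sqrt_op C * support_proj C = sqrt_op C"
  by (rule bop_eqI, simp add: bop_rep_eq support_sqrt_apply[OF assms])+

text \<open>The range of the square root of C is dense in PH, and nonnegativity of a form is a
  closed condition; outside PH an operator of the corner sees only P x.\<close>

lemma corner_positive_density:
  assumes C: "positive_op C" and T: "T \<in> corner (support_proj C)"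
    and le: "\<And>y. 0 \<le> inner (T (sqrt_op C y)) (sqrt_op C y)"
  shows "0 \<le> inner (T x) x"
proof -
  let ?P = "support_proj C"
  have P: "projection_op ?P" by (rule support_proj(1))
  have "closed {x. 0 \<le> inner (T x) x}"
    by (intro closed_Collect_le continuous_intros linear_continuous_on bounded_linear_bop)
  then have "closure (range (bop_apply (sqrt_op C))) \<subseteq> {x. 0 \<le> inner (T x) x}"
    using le by (intro closure_minimal) auto
  then have "0 \<le> inner (T (?P x)) (?P x)" using range_support_sqrt[OF C] by blast
  also have "\<dots> = inner (?P (T (?P x))) x" by (rule selfadjoint_inner[OF projection_selfadjoint[OF P], symmetric])
  also have "?P (T (?P x)) = T x" using T unfolding corner_def by (metis (mono_tags, lifting) mem_Collect_eq times_bop.rep_eq)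
  finally show ?thesis .
qed

lemma corner_diff: "S \<in> corner P \<Longrightarrow> T \<in> corner P \<Longrightarrow> S - T \<in> corner P"
  by (simp add: corner_def algebra_simps)

text \<open>Both S - T and T - S have nonnegative form on the dense range. This gives uniqueness of
  R and S, and later of W.\<close>

lemma corner_unique:
  assumes C: "positive_op C" and S: "S \<in> corner (support_proj C)" "selfadjoint_op S"
    and T: "T \<in> corner (support_proj C)" "selfadjoint_op T"
    and eq: "sqrt_op C * S * sqrt_op C = sqrt_op C * T * sqrt_op C"
  shows "S = T"
proof (rule op_eqI[OF S(2) T(2)])
  fix x
  have i: "inner (S (sqrt_op C y)) (sqrt_op C y) = inner (T (sqrt_op C y)) (sqrt_op C y)" for y
    using arg_cong[OF eq, of "\<lambda>Z. inner (bop_apply Z y) y"]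
    by (simp add: bop_rep_eq selfadjoint_inner[OF sqrt_op_selfadjoint[OF C]])
  have "0 \<le> inner ((S - T) x) x" "0 \<le> inner ((T - S) x) x"
    by (rule corner_positive_density[OF C], use S T corner_diff in blast,
        simp add: bop_rep_eq inner_diff_left i)+
  then show "inner (S x) x = inner (T x) x" by (simp add: bop_rep_eq inner_diff_left)
qed

text \<open>The hypothesis says that the square root of A is dominated by sqrt c K, so
  \<open>douglas\<close> writes it as \<open>adj_op Y * K\<close>. Then R = Y
  \<open>adj_op Y\<close> works; Y maps into the closed range of K, so R lies in the corner. The
  final bound is tested on the dense range.\<close>

lemma form_factor:
  assumes A: "positive_op A" and C: "positive_op C" and c: "0 \<le> c"
    and le: "\<And>x. inner (A x) x \<le> c * inner (C x) x"
  obtains R where "R \<in> corner (support_proj C)" "positive_op R" "A = sqrt_op C * R * sqrt_op C"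
    "\<And>x. inner (R x) x \<le> c * (norm (support_proj C x))\<^sup>2"
proof -
  let ?K = "sqrt_op C" and ?P = "support_proj C"
  have P: "projection_op ?P" by (rule support_proj(1))
  have "norm (sqrt_op A x) \<le> sqrt c * norm (?K x)" for x
  proof (rule power2_le_imp_le)
    show "(norm (sqrt_op A x))\<^sup>2 \<le> (sqrt c * norm (?K x))\<^sup>2"
      using le[of x] c by (simp add: power_mult_distrib norm_sqrt_op A C)
  qed (use c in simp)
  then obtain Y where Y: "\<And>x w. cinner (sqrt_op A x) w = cinner (?K x) (bop_apply Y w)"
      "\<And>w. bop_apply Y w \<in> closure (range (bop_apply ?K))"
    using douglas[of "sqrt c" "sqrt_op A" ?K] c by (metis real_sqrt_ge_zero)
  have PY: "?P * Y = Y"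
    using Y(2) range_support_sqrt[OF C] projection_range_iff[OF P]
    by (intro bop_eqI) (simp add: bop_rep_eq)
  have YK: "adj_op Y (?K x) = sqrt_op A x" for x
  proof -
    have "cinner (adj_op Y (?K x) - sqrt_op A x) (adj_op Y (?K x) - sqrt_op A x) = 0"
      by (simp add: cinner_diff_left cinner_adj' Y(1))
    then show ?thesis by (simp add: cinner_self)
  qed
  define R where "R = Y * adj_op Y"
  have iR: "cinner (R x) y = cinner (adj_op Y x) (adj_op Y y)" for x y
    by (simp add: R_def bop_rep_eq cinner_adj)
  have posR: "positive_op R" by (simp add: positive_op_def iR cinner_self)
  have PR: "?P * R = R" by (simp add: R_def mult.assoc[symmetric] PY)
  have RP: "R * ?P = R"
  proof (rule bop_eqI)
    fix x
    have "cinner (R (?P x)) y = cinner (R x) y" for y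
      using positive_selfadjoint[OF posR] projection_selfadjoint[OF P] PR
      by (metis selfadjoint_op_def times_bop.rep_eq)
    then have "cinner (R (?P x) - R x) (R (?P x) - R x) = 0" by (metis cinner_diff_left right_minus_eq)
    then show "(R * ?P) x = R x" by (simp add: cinner_self bop_rep_eq)
  qed
  have corner: "R \<in> corner ?P" using PR RP by (simp add: corner_def)
  have AK: "A = ?K * R * ?K"
  proof (rule bop_eqI)
    fix x
    have "cinner ((?K * R * ?K) x) y = cinner (A x) y" for y
      by (simp add: bop_rep_eq selfadjoint_cinner[OF sqrt_op_selfadjoint[OF C]] iR YK
          selfadjoint_cinner[OF sqrt_op_selfadjoint[OF A], symmetric] sqrt_op_apply_twice[OF A])
    then have "cinner (A x - (?K * R * ?K) x) (A x - (?K * R * ?K) x) = 0" by (simp add: cinner_diff_left)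
    then show "A x = (?K * R * ?K) x" by (simp add: cinner_self)
  qed
  have "0 \<le> inner ((c *\<^sub>R ?P - R) x) x" for x
  proof (rule corner_positive_density[OF C])
    show "c *\<^sub>R ?P - R \<in> corner ?P"
      using corner P by (simp add: corner_def projection_op_def algebra_simps)
    fix y
    have "inner (R (?K y)) (?K y) = inner (A y) y"
      by (subst AK) (simp add: bop_rep_eq selfadjoint_inner[OF sqrt_op_selfadjoint[OF C]])
    also have "\<dots> \<le> c * (norm (?K y))\<^sup>2" using le[of y] by (simp add: norm_sqrt_op C)
    finally show "0 \<le> inner ((c *\<^sub>R ?P - R) (?K y)) (?K y)"
      by (simp add: bop_rep_eq inner_diff_left support_sqrt_apply[OF C] power2_norm_eq_inner)
  qed
  then have "inner (R x) x \<le> c * (norm (?P x))\<^sup>2" for x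
    by (simp add: bop_rep_eq inner_diff_left projection_inner[OF P])
  with corner posR AK show thesis by (rule that)
qed

text \<open>\<open>form_factor\<close> with c = 1 applies to A \<le> C and B \<le> C. Both R0 + S0
  and P compress to C, so they coincide, and the second component is P - R.\<close>

lemma RS_pair:
  assumes A: "positive_op A" and B: "positive_op B"
  defines "P \<equiv> support_proj (A + B)" and "R \<equiv> fst (RS_pair A B)"
  shows "R \<in> corner P" "positive_op R" "\<And>x. inner (R x) x \<le> (norm (P x))\<^sup>2"
    "A = compress A B R" "B = compress A B (P - R)"
proof -
  let ?C = "A + B" let ?K = "sqrt_op ?C"
  have C: "positive_op ?C" by (rule positive_op_add[OF A B])
  have P: "projection_op P" unfolding P_def by (rule support_proj(1))
  obtain R0 where R0: "R0 \<in> corner P" "positive_op R0" "A = ?K * R0 * ?K" "\<And>x. inner (R0 x) x \<le> 1 * (norm (P x))\<^sup>2"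
    using form_factor[OF A C, of 1] positive_op_inner[OF B] unfolding P_def by (auto simp: bop_rep_eq inner_add_left)
  obtain S0 where S0: "S0 \<in> corner P" "positive_op S0" "B = ?K * S0 * ?K" "\<And>x. inner (S0 x) x \<le> 1 * (norm (P x))\<^sup>2"
    using form_factor[OF B C, of 1] positive_op_inner[OF A] unfolding P_def by (auto simp: bop_rep_eq inner_add_left)
  have PC: "P \<in> corner P" using P by (simp add: corner_def projection_op_def)
  have KPK: "?K * P * ?K = ?C" unfolding P_def by (simp add: support_sqrt_mult[OF C] sqrt_op(2)[OF C])
  have RS: "R0 + S0 = P"
  proof (rule corner_unique[OF C])
    show "R0 + S0 \<in> corner (support_proj ?C)" "P \<in> corner (support_proj ?C)"
      using R0(1) S0(1) PC unfolding P_def by (simp_all add: corner_def algebra_simps)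
    show "selfadjoint_op (R0 + S0)" by (intro selfadjoint_intros positive_selfadjoint R0 S0)
    show "selfadjoint_op P" by (rule projection_selfadjoint[OF P])
    show "?K * (R0 + S0) * ?K = ?K * P * ?K"
      unfolding KPK using R0(3) S0(3) by (simp add: algebra_simps)
  qed
  have le1: "norm Z \<le> 1" if "positive_op Z" "\<And>x. inner (Z x) x \<le> 1 * (norm (P x))\<^sup>2" for Z
  proof (rule positive_op_norm_le[OF that(1)])
    show "inner (Z x) x \<le> 1 * (norm x)\<^sup>2" for x
      using that(2)[of x] projection_norm_le[OF P, of x] by (smt (verit) norm_ge_zero power_mono)
  qed simp
  have "RS_pair A B = (R0, S0)"
    unfolding RS_pair_def Let_def P_def[symmetric]
  proof (rule the_equality)
    show "case (R0, S0) of (R, S) \<Rightarrow> R \<in> corner P \<and> S \<in> corner P \<and> positive_op R \<and> positive_op S \<and>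
      norm R \<le> 1 \<and> norm S \<le> 1 \<and> R + S = P \<and> A = compress A B R \<and> B = compress A B S"
      using R0 S0 RS le1 by (simp add: compress_def)
    fix Z assume Z: "case Z of (R, S) \<Rightarrow> R \<in> corner P \<and> S \<in> corner P \<and> positive_op R \<and> positive_op S \<and>
      norm R \<le> 1 \<and> norm S \<le> 1 \<and> R + S = P \<and> A = compress A B R \<and> B = compress A B S"
    obtain R1 S1 where Z1: "Z = (R1, S1)" by (cases Z)
    have "R1 = R0"
      by (rule corner_unique[OF C])
        (use Z R0 in \<open>simp_all add: Z1 P_def[symmetric] positive_selfadjoint compress_def\<close>)
    moreover have "S1 = S0"
      by (rule corner_unique[OF C])
        (use Z S0 in \<open>simp_all add: Z1 P_def[symmetric] positive_selfadjoint compress_def\<close>)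
    ultimately show "Z = (R0, S0)" by (simp add: Z1)
  qed
  then have R: "R = R0" by (simp add: R_def)
  have "P - R0 = S0" using RS by (simp add: algebra_simps)
  then show "R \<in> corner P" "positive_op R" "\<And>x. inner (R x) x \<le> (norm (P x))\<^sup>2"
    "A = compress A B R" "B = compress A B (P - R)"
    using R0 S0(3) by (simp_all add: R compress_def)
qed

text \<open>\<open>spectral_theorem\<close> shows that the choice is made from a nonempty set. The
  chosen measure does not mention the bounds, so the same one serves for every admissible
  pair.\<close>

lemma spectral_measure_on:
  assumes T: "positive_op T" "T \<in> corner P" and P: "projection_op P" and lo0: "0 \<le> lo"
    and lo: "\<And>x. lo * (norm (P x))\<^sup>2 \<le> inner (T x) x" and hi: "\<And>x. inner (T x) x \<le> hi * (norm (P x))\<^sup>2"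
  shows "spectral_pvm P T (spectral_measure_on P T) lo hi"
proof -
  have PT: "P * T = T" "T * P = T" using T(2) corner_proj_iff[OF P] by auto
  let ?Q = "\<lambda>E. pvm_on P E \<and> (\<forall>x. integrable (pvm_measure E x) (\<lambda>t. t) \<and>
         cinner (T x) x = complex_of_real (\<integral>t. t \<partial>pvm_measure E x))"
  obtain E where "?Q E" using spectral_theorem[OF positive_selfadjoint[OF T(1)] P PT] by metis
  then have "?Q (spectral_measure_on P T)" unfolding spectral_measure_on_def by (rule someI[of ?Q])
  then show ?thesis
    unfolding spectral_pvm_def using PT T lo0 lo hi positive_selfadjoint by blast
qed

section \<open>Normal functionals\<close>

lemma normal_posE:
  assumes "\<rho> \<in> normal_pos"
  obtains D where "positive_op D" "trace_class D" "\<And>X. \<rho> X = op_trace (X * D)"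
  using assms unfolding normal_pos_def by blast

lemma normal_pos_add:
  assumes "\<rho> \<in> normal_pos" "\<sigma> \<in> normal_pos"
  shows "\<rho> + \<sigma> \<in> normal_pos"
proof -
  obtain D where D: "positive_op D" "trace_class D" "\<And>X. \<rho> X = op_trace (X * D)"
    using normal_posE[OF assms(1)] by blast
  obtain D' where D': "positive_op D'" "trace_class D'" "\<And>X. \<sigma> X = op_trace (X * D')"
    using normal_posE[OF assms(2)] by blast
  have "(\<rho> + \<sigma>) X = op_trace (X * (D + D'))" for X
    using infsum_add[OF trace_summable[OF D(1,2), of X] trace_summable[OF D'(1,2), of X]]
    by (simp add: blinfun.add_left D(3) D'(3) op_trace_def distrib_left plus_bop.rep_eq cinner_add_left)
  then show ?thesis
    unfolding normal_pos_def using positive_op_add[OF D(1) D'(1)] trace_class_positive_add[OF D(1,2) D'(1,2)] by blast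
qed

lemma normal_pos_scaleR:
  assumes "\<rho> \<in> normal_pos" "0 \<le> c"
  shows "c *\<^sub>R \<rho> \<in> normal_pos"
proof -
  obtain D where D: "positive_op D" "trace_class D" "\<And>X. \<rho> X = op_trace (X * D)"
    using normal_posE[OF assms(1)] by blast
  have "(c *\<^sub>R \<rho>) X = op_trace (X * (c *\<^sub>R D))" for X
    by (simp add: blinfun.scaleR_left D(3) op_trace_def scaleR_bop.rep_eq cinner_scaleR_left infsum_cmult_right'
        scaleR_conv_of_real)
  then show ?thesis
    unfolding normal_pos_def using positive_op_scaleR[OF D(1) assms(2)] trace_class_positive_scaleR[OF D(1,2) assms(2)] by blast
qed

text \<open>The density operator is the rank one projection onto e. Since e belongs to the basis,
  its trace and the trace of X D each reduce to one term.\<close>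

lemma vector_functional_normal:
  fixes e :: "'a::complex_hilbert"
  assumes e: "e \<in> some_onb"
  shows "vector_functional e \<in> normal_pos"
proof -
  have on: "cinner x y = (if x = y then 1 else 0)" if "x \<in> some_onb" "y \<in> some_onb" for x y :: 'a
    using some_onb that unfolding is_onb_def by blast
  obtain D where D: "\<And>x. bop_apply D x = cinner x e *\<^sub>C e"
  proof (rule bop_construct)
    show "norm (cinner x e *\<^sub>C e) \<le> (norm e * norm e) * norm x" for x
      using mult_right_mono[OF norm_cinner_le[of x e], of "norm e"] by (simp add: norm_scaleC algebra_simps)
  qed (simp_all add: cinner_simps scaleC_add_left scaleC_scaleC, rule that)
  have cD: "cinner (D x) x = complex_of_real ((cmod (cinner x e))\<^sup>2)" for x
  proof -
    have "cinner (D x) x = cinner x e * cnj (cinner x e)"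
      using cinner_commute[of e x] by (simp add: D cinner_scaleC_left)
    then show ?thesis by (simp only: complex_norm_square)
  qed
  have pos: "positive_op D" by (simp add: positive_op_def cD)
  have "infsum (\<lambda>x. ennreal (inner (D x) x)) some_onb = infsum (\<lambda>x. 1) {e}"
    by (rule infsum_cong_neutral) (use e in \<open>auto simp: inner_eq_Re_cinner cD on\<close>)
  then have tc: "trace_class D" by (simp add: trace_class_positive_iff'[OF pos])
  have "vector_functional e X = op_trace (X * D)" for X
  proof -
    have "op_trace (X * D) = infsum (\<lambda>x. cinner (X e) e) {e}"
      unfolding op_trace_def
      by (rule infsum_cong_neutral)
        (use e on scaleC_of_real[of 1 e] in \<open>auto simp: bop_rep_eq D bop_scaleC cinner_scaleC_left\<close>)
    then show ?thesis by (simp add: vector_functional.rep_eq)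
  qed
  then show ?thesis unfolding normal_pos_def using pos tc by blast
qed

text \<open>With G the square root of the density operator, \<rho> becomes the sum of the vector
  functionals at G e on self-adjoint operators, so properties of \<nu> reduce to those of
  \<mu>.\<close>

lemma normal_pos_Re:
  assumes "\<rho> \<in> normal_pos"
  obtains G where "selfadjoint_op G" "hs G"
    "\<And>X. selfadjoint_op X \<Longrightarrow> Re (\<rho> X) = infsum (\<lambda>e. inner (X (bop_apply G e)) (bop_apply G e)) some_onb"
    "\<And>X. selfadjoint_op X \<Longrightarrow> (\<lambda>e. inner (X (bop_apply G e)) (bop_apply G e)) summable_on some_onb"
proof -
  obtain D where D: "positive_op D" "trace_class D" "\<And>X. \<rho> X = op_trace (X * D)"
    using normal_posE[OF assms] by blast
  show thesis
  proof (rule that[of "sqrt_op D"])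
    show "selfadjoint_op (sqrt_op D)" by (rule sqrt_op_selfadjoint[OF D(1)])
    show "hs (sqrt_op D)" using D by (simp add: trace_class_positive_iff)
  qed (use trace_sandwich[OF D(1,2)] D(3) in auto)
qed

lemma normal_pos_nonneg:
  assumes "\<rho> \<in> normal_pos" "positive_op X"
  shows "0 \<le> Re (\<rho> X)"
proof -
  obtain G where "Re (\<rho> X) = infsum (\<lambda>e. inner (X (bop_apply G e)) (bop_apply G e)) some_onb"
    using normal_pos_Re[OF assms(1)] positive_selfadjoint[OF assms(2)] by metis
  then show ?thesis using positive_op_inner[OF assms(2)] by (simp add: infsum_nonneg)
qed

section \<open>Independence of the extended trace from the decomposition\<close>

lemma infsum_enn2ereal: "infsum (\<lambda>x. enn2ereal (f x)) A = enn2ereal (infsum f A)"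
proof (rule infsumI)
  have "((\<lambda>F. \<Sum>x\<in>F. enn2ereal (f x)) \<longlongrightarrow> enn2ereal (infsum f A)) (finite_subsets_at_top A)"
    using has_sum_infsum[OF summable_ennreal, of f A] by (simp add: has_sum_def)
  then show "((\<lambda>x. enn2ereal (f x)) has_sum enn2ereal (infsum f A)) A" by (simp only: has_sum_def)
qed

lemma e2ennreal_add: "0 \<le> a \<Longrightarrow> 0 \<le> b \<Longrightarrow> e2ennreal (a + b) = e2ennreal a + e2ennreal b"
  by (metis e2ennreal_enn2ereal enn2ereal_e2ennreal plus_ennreal.rep_eq)

text \<open>If T + X = T' + X', adding y e = |<X e, e>| + |<X' e, e>| to the term at e makes every
  part nonnegative on both sides. The sums then split in \<open>ennreal\<close>, and the finite sum
  of y cancels.\<close>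

lemma ext_trace_ext_plus:
  assumes T: "T \<in> hatB_pos" and X: "X \<in> C1_sa"
  shows "ext_trace (ext_plus T X) = trace_hatB_pos T + ereal (Re (op_trace X))"
  unfolding ext_trace_def
proof (rule the_equality)
  show "\<exists>T'\<in>hatB_pos. \<exists>X'\<in>C1_sa. ext_plus T X = ext_plus T' X' \<and>
      trace_hatB_pos T + ereal (Re (op_trace X)) = trace_hatB_pos T' + ereal (Re (op_trace X'))"
    using T X by blast
  fix v
  assume "\<exists>T'\<in>hatB_pos. \<exists>X'\<in>C1_sa. ext_plus T X = ext_plus T' X' \<and> v = trace_hatB_pos T' + ereal (Re (op_trace X'))"
  then obtain T' X' where T': "T' \<in> hatB_pos" and X': "X' \<in> C1_sa" and eq: "ext_plus T X = ext_plus T' X'"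
    and v: "v = trace_hatB_pos T' + ereal (Re (op_trace X'))" by blast
  define x x' y where "x e = inner (X e) e" and "x' e = inner (X' e) e" and "y e = \<bar>x e\<bar> + \<bar>x' e\<bar>" for e
  have sx: "(\<lambda>e. \<bar>x e\<bar>) summable_on some_onb" "(\<lambda>e. \<bar>x' e\<bar>) summable_on some_onb"
    unfolding x_def x'_def using C1_sa_summable(1)[OF X] C1_sa_summable(1)[OF X'] by auto
  have sy: "y summable_on some_onb" unfolding y_def by (rule summable_on_add[OF sx])
  have sx': "x summable_on some_onb" "x' summable_on some_onb"
    using sx abs_summable_summable[of x some_onb] abs_summable_summable[of x' some_onb] by auto
  have key: "trace_hatB_pos T + ereal (Re (op_trace X)) + ereal (infsum y some_onb)
      = enn2ereal (infsum (\<lambda>e. e2ennreal (T (vector_functional e) + ereal (x e + y e))) some_onb)"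
    if T: "T \<in> hatB_pos" and X: "X \<in> C1_sa" and x: "\<And>e. x e = inner (X e) e" "x summable_on some_onb" "\<And>e. 0 \<le> x e + y e"
    for T x and X :: "'a bop"
  proof -
    have Tn: "0 \<le> T (vector_functional e)" if "e \<in> some_onb" for e
      using T vector_functional_normal[OF that] unfolding hatB_pos_def by blast
    have "infsum (\<lambda>e. e2ennreal (T (vector_functional e) + ereal (x e + y e))) some_onb
        = infsum (\<lambda>e. e2ennreal (T (vector_functional e)) + ennreal (x e + y e)) some_onb"
      by (rule infsum_cong) (use Tn x(3) in \<open>simp add: e2ennreal_add\<close>)
    also have "\<dots> = infsum (\<lambda>e. e2ennreal (T (vector_functional e))) some_onb + ennreal (infsum (\<lambda>e. x e + y e) some_onb)"
      using x(3) by (simp add: infsum_add infsum_ennreal summable_on_add x(2) sy)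
    finally have "enn2ereal (infsum (\<lambda>e. e2ennreal (T (vector_functional e) + ereal (x e + y e))) some_onb)
        = infsum (\<lambda>e. enn2ereal (e2ennreal (T (vector_functional e)))) some_onb + ereal (infsum (\<lambda>e. x e + y e) some_onb)"
      using x(3) by (simp add: plus_ennreal.rep_eq infsum_enn2ereal enn2ereal_ennreal infsum_nonneg)
    also have "infsum (\<lambda>e. enn2ereal (e2ennreal (T (vector_functional e)))) some_onb = trace_hatB_pos T"
      unfolding trace_hatB_pos_def by (rule infsum_cong) (simp add: Tn enn2ereal_e2ennreal)
    also have "infsum (\<lambda>e. x e + y e) some_onb = Re (op_trace X) + infsum y some_onb"
      using C1_sa_summable(2)[OF X] by (simp add: infsum_add x(2) sy x(1)[symmetric])
    finally show ?thesis by (simp add: add.assoc)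
  qed
  have "T (vector_functional e) + ereal (x e + y e) = T' (vector_functional e) + ereal (x' e + y e)" if "e \<in> some_onb" for e
  proof -
    have "T (vector_functional e) + ereal (x e) = T' (vector_functional e) + ereal (x' e)"
      using fun_cong[OF eq, of "vector_functional e"] vector_functional_normal[OF that]
      by (simp add: ext_plus_def vector_functional.rep_eq inner_eq_Re_cinner x_def x'_def)
    then have "(T (vector_functional e) + ereal (x e)) + ereal (y e) = (T' (vector_functional e) + ereal (x' e)) + ereal (y e)"
      by simp
    then show ?thesis by (simp add: add.assoc)
  qed
  then have "infsum (\<lambda>e. e2ennreal (T (vector_functional e) + ereal (x e + y e))) some_onb
      = infsum (\<lambda>e. e2ennreal (T' (vector_functional e) + ereal (x' e + y e))) some_onb"
    by (intro infsum_cong) simp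
  then have "trace_hatB_pos T + ereal (Re (op_trace X)) + ereal (infsum y some_onb)
      = trace_hatB_pos T' + ereal (Re (op_trace X')) + ereal (infsum y some_onb)"
    using key[OF T X x_def sx'(1)] key[OF T' X' x'_def sx'(2)] by (simp add: y_def)
  then show "v = trace_hatB_pos T + ereal (Re (op_trace X))"
    unfolding v by (simp add: ereal_add_cancel_right)
qed

section \<open>The extended operator perspective\<close>

lemma infsum_ennreal_suminf:
  fixes g :: "nat \<Rightarrow> 'b \<Rightarrow> ennreal"
  shows "(\<Sum>n. infsum (g n) A) = infsum (\<lambda>x. \<Sum>n. g n x) A"
proof -
  have "infsum (\<lambda>x. \<Sum>n. g n x) A = infsum (\<lambda>x. SUP n. \<Sum>i<n. g i x) A"
    by (simp add: suminf_eq_SUP)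
  also have "\<dots> = (SUP n. infsum (\<lambda>x. \<Sum>i<n. g i x) A)"
    by (rule infsum_ennreal_SUP_nat) (auto intro!: incseq_SucI)
  also have "\<dots> = (\<Sum>n. infsum (g n) A)"
    by (simp add: infsum_ennreal_finite_sum suminf_eq_SUP)
  finally show ?thesis by simp
qed

locale positive_pair =
  fixes A B :: "'a::complex_hilbert bop"
  assumes A: "positive_op A" and B: "positive_op B"
begin

abbreviation "C \<equiv> A + B"
abbreviation "K \<equiv> sqrt_op C"
abbreviation "P \<equiv> support_proj C"
abbreviation "R \<equiv> fst (RS_pair A B)"
abbreviation "E \<equiv> spectral_measure_on P R"
abbreviation "\<nu> \<equiv> RS_measure A B"

lemma C: "positive_op C"
  by (rule positive_op_add[OF A B])

lemma P_proj: "projection_op P"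
  by (rule support_proj(1))

lemma K: "selfadjoint_op K"
  by (rule sqrt_op_selfadjoint[OF C])

lemma spectral_pvm_bounds:
  assumes "0 \<le> lo" "\<And>x. lo * (norm (P x))\<^sup>2 \<le> inner (R x) x" "\<And>x. inner (R x) x \<le> hi * (norm (P x))\<^sup>2"
  shows "spectral_pvm P R E lo hi"
  using RS_pair[OF A B] assms by (intro spectral_measure_on P_proj) auto

text \<open>R lies between 0 and P, so the bounds 0 and 1 are always valid; sharper ones are
  interpreted separately for comparable operators.\<close>

sublocale spectral_pvm P R E 0 1
  by (rule spectral_pvm_bounds) (use RS_pair[OF A B] positive_op_inner in auto)

section \<open>The measures \<nu> and their relation to \<mu>\<close>

lemma compress_positive: "\<Delta> \<in> sets borel \<Longrightarrow> positive_op (compress A B (E \<Delta>))"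
  unfolding compress_def by (intro positive_op_sandwich K projection_positive E_proj)

lemma inner_compress:
  assumes "\<Delta> \<in> sets borel"
  shows "inner (compress A B (E \<Delta>) x) x = (norm (E \<Delta> (K x)))\<^sup>2"
  using E_proj[OF assms] by (simp add: compress_def bop_rep_eq selfadjoint_inner[OF K] projection_inner)

text \<open>The set function behind \<nu> is a possibly uncountable sum of measures \<mu>, which is
  where its countable additivity comes from.\<close>

lemma nu_infsum:
  assumes "\<rho> \<in> normal_pos"
  obtains G where "\<And>\<Delta>. \<Delta> \<in> sets borel \<Longrightarrow>
    ennreal (Re (\<rho> (compress A B (E \<Delta>)))) = infsum (\<lambda>e. emeasure (\<mu> (K (bop_apply G e))) \<Delta>) some_onb"
proof -
  obtain G where G: "\<And>X. selfadjoint_op X \<Longrightarrow> Re (\<rho> X) = infsum (\<lambda>e. inner (X (bop_apply G e)) (bop_apply G e)) some_onb"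
    "\<And>X. selfadjoint_op X \<Longrightarrow> (\<lambda>e. inner (X (bop_apply G e)) (bop_apply G e)) summable_on some_onb"
    using normal_pos_Re[OF assms] by metis
  show thesis
  proof (rule that[of G])
    fix \<Delta> :: "real set" assume \<Delta>: "\<Delta> \<in> sets borel"
    note X = positive_selfadjoint[OF compress_positive[OF \<Delta>]]
    show "ennreal (Re (\<rho> (compress A B (E \<Delta>)))) = infsum (\<lambda>e. emeasure (\<mu> (K (G e))) \<Delta>) some_onb"
      using infsum_ennreal[OF G(2)[OF X]] by (simp add: G(1)[OF X] inner_compress[OF \<Delta>] emeasure_mu[OF \<Delta>])
  qed
qed

lemma sets_nu: "sets (\<nu> \<rho>) = sets (restrict_space borel {0..1})" and space_nu: "space (\<nu> \<rho>) = {0..1}"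
proof -
  have "sets (restrict_space borel {0..1 :: real}) \<subseteq> Pow {0..1}" by (auto simp: sets_restrict_space)
  moreover have "sigma_sets {0..1} (sets (restrict_space borel {0..1 :: real})) = sets (restrict_space borel {0..1})"
    using sets.sigma_sets_eq[of "restrict_space borel {0..1 :: real}"] by (simp add: space_restrict_space)
  ultimately show "sets (\<nu> \<rho>) = sets (restrict_space borel {0..1})" "space (\<nu> \<rho>) = {0..1}"
    by (simp_all add: RS_measure_def sets_measure_of_conv space_measure_of_conv)
qed

lemma sets_unit_interval: "\<Delta> \<in> sets (restrict_space borel {0..1 :: real}) \<Longrightarrow> \<Delta> \<in> sets borel"
  by (auto simp: sets_restrict_space_iff)

lemma emeasure_nu:
  assumes \<rho>: "\<rho> \<in> normal_pos" and \<Delta>: "\<Delta> \<in> sets (\<nu> \<rho>)"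
  shows "emeasure (\<nu> \<rho>) \<Delta> = ennreal (Re (\<rho> (compress A B (E \<Delta>))))"
  unfolding RS_measure_def
proof (rule emeasure_measure_of_sigma)
  let ?m = "\<lambda>\<Delta>. ennreal (Re (\<rho> (compress A B (E \<Delta>))))"
  obtain G where G: "\<And>\<Delta>. \<Delta> \<in> sets borel \<Longrightarrow> ?m \<Delta> = infsum (\<lambda>e. emeasure (\<mu> (K (bop_apply G e))) \<Delta>) some_onb"
    using nu_infsum[OF \<rho>] by blast
  show "sigma_algebra {0..1} (sets (restrict_space borel {0..1 :: real}))"
    using sets.sigma_algebra_axioms[of "restrict_space borel {0..1 :: real}"] by (simp add: space_restrict_space)
  show "positive (sets (restrict_space borel {0..1})) ?m"
    by (simp add: positive_def G)
  show "countably_additive (sets (restrict_space borel {0..1})) ?m"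
    unfolding countably_additive_def
  proof (intro allI impI)
    fix D :: "nat \<Rightarrow> real set"
    assume D: "range D \<subseteq> sets (restrict_space borel {0..1})" "disjoint_family D"
      "\<Union> (range D) \<in> sets (restrict_space borel {0..1})"
    have b: "D n \<in> sets borel" for n using D(1) sets_unit_interval by blast
    have "(\<Sum>n. ?m (D n)) = infsum (\<lambda>e. \<Sum>n. emeasure (\<mu> (K (G e))) (D n)) some_onb"
      by (simp add: G b infsum_ennreal_suminf)
    also have "\<dots> = infsum (\<lambda>e. emeasure (\<mu> (K (G e))) (\<Union> (range D))) some_onb"
      by (rule infsum_cong, rule suminf_emeasure) (use b D(2) in auto)
    also have "\<dots> = ?m (\<Union> (range D))" by (rule G[symmetric]) (use b in auto)
    finally show "(\<Sum>n. ?m (D n)) = ?m (\<Union> (range D))" .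
  qed
qed (use \<Delta> sets_nu in auto)

lemma measurable_nu: "h \<in> borel_measurable borel \<Longrightarrow> h \<in> borel_measurable (\<nu> \<rho>)"
  unfolding measurable_cong_sets[OF sets_nu refl] by (rule measurable_restrict_space1)

text \<open>For a vector functional, \<nu> is the restriction to [0, 1] of the measure \<mu> at K e,
  and [0, 1] carries all of that measure.\<close>

lemma nu_vector_functional:
  assumes e: "e \<in> some_onb" and h: "h \<in> borel_measurable borel"
  shows "(\<integral>\<^sup>+t. h t \<partial>\<nu> (vector_functional e)) = (\<integral>\<^sup>+t. h t \<partial>\<mu> (K e))"
proof -
  have "\<nu> (vector_functional e) = restrict_space (\<mu> (K e)) {0..1}"
  proof (rule measure_eqI)
    show "sets (\<nu> (vector_functional e)) = sets (restrict_space (\<mu> (K e)) {0..1})"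
      unfolding sets_nu by (rule sets_restrict_space_cong) simp
    fix \<Delta> assume \<Delta>: "\<Delta> \<in> sets (\<nu> (vector_functional e))"
    then have b: "\<Delta> \<in> sets borel" "\<Delta> \<subseteq> {0..1}" unfolding sets_nu by (auto simp: sets_restrict_space_iff)
    have "emeasure (\<nu> (vector_functional e)) \<Delta> = ennreal (inner (compress A B (E \<Delta>) e) e)"
      by (simp add: emeasure_nu[OF vector_functional_normal[OF e] \<Delta>] vector_functional.rep_eq inner_eq_Re_cinner)
    then show "emeasure (\<nu> (vector_functional e)) \<Delta> = emeasure (restrict_space (\<mu> (K e)) {0..1}) \<Delta>"
      using b by (simp add: inner_compress emeasure_restrict_space emeasure_mu)
  qed
  then have "(\<integral>\<^sup>+t. h t \<partial>\<nu> (vector_functional e)) = (\<integral>\<^sup>+t. h t * indicator {0..1} t \<partial>\<mu> (K e))"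
    by (simp add: nn_integral_restrict_space)
  also have "\<dots> = (\<integral>\<^sup>+t. h t \<partial>\<mu> (K e))"
  proof (rule nn_integral_cong_AE)
    show "AE t in \<mu> (K e). h t * indicator {0..1} t = h t"
      using AE_bounds[of "K e"] by eventually_elim simp
  qed
  finally show ?thesis .
qed

text \<open>The function h is to be g + l, so this is the positive summand in the decomposition of
  the perspective.\<close>

definition persp_op :: "(real \<Rightarrow> ennreal) \<Rightarrow> ('a bop \<Rightarrow>\<^sub>L complex) \<Rightarrow> ereal"
  where "persp_op h = (\<lambda>\<rho>\<in>normal_pos. enn2ereal (\<integral>\<^sup>+t. h t \<partial>\<nu> \<rho>))"

text \<open>Lower semicontinuity: the integral is a supremum of integrals of simple functions, which are
  norm continuous in \<open>\<rho>\<close>.\<close>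

lemma persp_op_lsc:
  assumes \<rho>: "\<rho> \<in> normal_pos" and h: "h \<in> borel_measurable borel"
  shows "persp_op h \<rho> \<le> Liminf (at \<rho> within normal_pos) (persp_op h)"
  unfolding le_Liminf_iff
proof (intro allI impI)
  fix y assume y: "y < persp_op h \<rho>"
  define N :: "real measure" where "N = restrict_space borel {0..1}"
  have hN: "h \<in> borel_measurable N" unfolding N_def by (rule measurable_restrict_space1[OF h])
  have spN: "space N = {0..1}" by (simp add: N_def space_restrict_space)
  obtain s where s: "\<And>i. simple_function N (s i)" "incseq s" "\<And>i x. s i x < top" "\<And>x. (SUP i. s i x) = h x"
    using borel_measurable_implies_simple_function_sequence'[OF hN] by metis
  have sM: "s i \<in> borel_measurable (\<nu> \<sigma>)" for i \<sigma>
    unfolding measurable_cong_sets[OF sets_nu refl] N_def[symmetric]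
    by (rule borel_measurable_simple_function[OF s(1)])
  have "(\<integral>\<^sup>+t. h t \<partial>\<nu> \<rho>) = (SUP i. \<integral>\<^sup>+t. s i t \<partial>\<nu> \<rho>)"
    unfolding s(4)[symmetric] by (rule nn_integral_monotone_convergence_SUP[OF s(2) sM])
  \<comment> \<open>A negative y is kept apart, since \<open>e2ennreal\<close> would send it to 0
    and lose the strict inequality.\<close>
  moreover have "e2ennreal y < (\<integral>\<^sup>+t. h t \<partial>\<nu> \<rho>) \<or> y < 0"
    using y \<rho> unfolding persp_op_def
    by (cases "0 \<le> y") (auto simp: less_ennreal.rep_eq enn2ereal_e2ennreal)
  ultimately obtain i where i: "y < enn2ereal (\<integral>\<^sup>+t. s i t \<partial>\<nu> \<rho>)"
  proof (cases "y < 0")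
    case True
    then show ?thesis using less_le_trans[OF True enn2ereal_nonneg] that by blast
  next
    case False
    with \<open>e2ennreal y < (\<integral>\<^sup>+t. h t \<partial>\<nu> \<rho>) \<or> y < 0\<close> \<open>(\<integral>\<^sup>+t. h t \<partial>\<nu> \<rho>) = _\<close>
    obtain i where "e2ennreal y < (\<integral>\<^sup>+t. s i t \<partial>\<nu> \<rho>)" by (auto simp: less_SUP_iff)
    then have "y < enn2ereal (\<integral>\<^sup>+t. s i t \<partial>\<nu> \<rho>)" using False by (simp add: less_ennreal.rep_eq enn2ereal_e2ennreal)
    then show ?thesis by (rule that)
  qed
  define \<Delta> where "\<Delta> c = s i -` {c} \<inter> {0..1}" for c
  have fin: "finite (s i ` {0..1})" using simple_functionD(1)[OF s(1)] by (simp add: spN)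
  have \<Delta>N: "\<Delta> c \<in> sets N" for c using simple_functionD(2)[OF s(1), of i "{c}"] by (simp add: spN \<Delta>_def)
  then have \<Delta>b: "\<Delta> c \<in> sets borel" for c unfolding N_def by (rule sets_unit_interval)
  have int: "(\<integral>\<^sup>+t. s i t \<partial>\<nu> \<sigma>) = ennreal (\<Sum>c\<in>s i ` {0..1}. enn2real c * Re (\<sigma> (compress A B (E (\<Delta> c)))))"
    if \<sigma>: "\<sigma> \<in> normal_pos" for \<sigma>
  proof -
    have "simple_function (\<nu> \<sigma>) (s i)"
      using s(1)[of i] simple_function_cong_algebra[of N "\<nu> \<sigma>" "s i"] by (simp add: sets_nu space_nu spN N_def)
    then have "(\<integral>\<^sup>+t. s i t \<partial>\<nu> \<sigma>) = (\<Sum>c\<in>s i ` {0..1}. c * emeasure (\<nu> \<sigma>) (\<Delta> c))"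
      by (simp add: nn_integral_eq_simple_integral simple_integral_def space_nu \<Delta>_def)
    also have "\<dots> = (\<Sum>c\<in>s i ` {0..1}. ennreal (enn2real c * Re (\<sigma> (compress A B (E (\<Delta> c))))))"
    proof (rule sum.cong[OF refl])
      fix c assume "c \<in> s i ` {0..1}"
      then have "c < top" using s(3) by auto
      then have c: "ennreal (enn2real c) = c" by simp
      have "emeasure (\<nu> \<sigma>) (\<Delta> c) = ennreal (Re (\<sigma> (compress A B (E (\<Delta> c)))))"
        by (rule emeasure_nu[OF \<sigma>]) (use \<Delta>N sets_nu N_def in simp)
      then show "c * emeasure (\<nu> \<sigma>) (\<Delta> c) = ennreal (enn2real c * Re (\<sigma> (compress A B (E (\<Delta> c)))))"
        using c normal_pos_nonneg[OF \<sigma> compress_positive[OF \<Delta>b]] by (simp add: ennreal_mult)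
    qed
    also have "\<dots> = ennreal (\<Sum>c\<in>s i ` {0..1}. enn2real c * Re (\<sigma> (compress A B (E (\<Delta> c)))))"
      using normal_pos_nonneg[OF \<sigma> compress_positive[OF \<Delta>b]] by (intro sum_ennreal) simp
    finally show ?thesis .
  qed
  define L where "L \<sigma> = (\<Sum>c\<in>s i ` {0..1}. enn2real c * Re (\<sigma> (compress A B (E (\<Delta> c)))))" for \<sigma> :: "'a bop \<Rightarrow>\<^sub>L complex"
  have L: "enn2ereal (\<integral>\<^sup>+t. s i t \<partial>\<nu> \<sigma>) = ereal (L \<sigma>)" if "\<sigma> \<in> normal_pos" for \<sigma>
    unfolding int[OF that] L_def[symmetric]
    by (rule enn2ereal_ennreal) (auto simp: L_def intro!: sum_nonneg mult_nonneg_nonneg normal_pos_nonneg that compress_positive \<Delta>b)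
  have "((\<lambda>\<sigma>. blinfun_apply \<sigma> X) \<longlongrightarrow> blinfun_apply \<rho> X) (at \<rho> within normal_pos)" for X :: "'a bop"
    by (intro blinfun.tendsto tendsto_ident_at tendsto_const)
  then have "((\<lambda>\<sigma>. ereal (L \<sigma>)) \<longlongrightarrow> ereal (L \<rho>)) (at \<rho> within normal_pos)"
    unfolding L_def by (intro tendsto_intros)
  then have "eventually (\<lambda>\<sigma>. y < ereal (L \<sigma>)) (at \<rho> within normal_pos)"
    using i L[OF \<rho>] by (intro order_tendstoD) simp_all
  moreover have "eventually (\<lambda>\<sigma>. \<sigma> \<in> normal_pos) (at \<rho> within normal_pos)"
    by (simp add: eventually_at_filter)
  ultimately show "eventually (\<lambda>\<sigma>. y < persp_op h \<sigma>) (at \<rho> within normal_pos)"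
  proof eventually_elim
    case (elim \<sigma>)
    have "(\<integral>\<^sup>+t. s i t \<partial>\<nu> \<sigma>) \<le> (\<integral>\<^sup>+t. h t \<partial>\<nu> \<sigma>)"
      by (rule nn_integral_mono, simp only: s(4)[symmetric], rule SUP_upper[OF UNIV_I])
    then have "ereal (L \<sigma>) \<le> persp_op h \<sigma>"
      using elim by (simp add: L[symmetric] persp_op_def less_eq_ennreal.rep_eq)
    then show ?case using elim by simp
  qed
qed

lemma persp_op_hatB_pos:
  assumes h: "h \<in> borel_measurable borel"
  shows "persp_op h \<in> hatB_pos"
proof -
  have nn: "0 \<le> persp_op h \<rho>" if "\<rho> \<in> normal_pos" for \<rho> using that by (simp add: persp_op_def)
  have scale: "persp_op h (c *\<^sub>R \<rho>) = ereal c * persp_op h \<rho>" if "0 \<le> c" "\<rho> \<in> normal_pos" for c \<rho>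
  proof -
    have c\<rho>: "c *\<^sub>R \<rho> \<in> normal_pos" by (rule normal_pos_scaleR[OF that(2,1)])
    have "\<nu> (c *\<^sub>R \<rho>) = scale_measure (ennreal c) (\<nu> \<rho>)"
      by (rule measure_eqI)
        (use that c\<rho> normal_pos_nonneg[OF that(2) compress_positive[OF sets_unit_interval]] in
          \<open>auto simp: sets_nu emeasure_nu blinfun.scaleR_left ennreal_mult\<close>)
    then have "(\<integral>\<^sup>+t. h t \<partial>\<nu> (c *\<^sub>R \<rho>)) = ennreal c * (\<integral>\<^sup>+t. h t \<partial>\<nu> \<rho>)"
      by (simp add: nn_integral_scale_measure measurable_nu[OF h])
    then show ?thesis using that c\<rho> by (simp add: persp_op_def times_ennreal.rep_eq)
  qed
  have add: "persp_op h (\<rho> + \<sigma>) = persp_op h \<rho> + persp_op h \<sigma>" if "\<rho> \<in> normal_pos" "\<sigma> \<in> normal_pos" for \<rho> \<sigma>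
  proof -
    have s: "\<rho> + \<sigma> \<in> normal_pos" by (rule normal_pos_add[OF that])
    have "(\<integral>\<^sup>+t. h t \<partial>\<nu> (\<rho> + \<sigma>)) = (\<integral>\<^sup>+t. h t \<partial>\<nu> \<rho>) + (\<integral>\<^sup>+t. h t \<partial>\<nu> \<sigma>)"
    proof (rule nn_integral_add_measure)
      fix \<Delta> assume \<Delta>: "\<Delta> \<in> sets (\<nu> (\<rho> + \<sigma>))"
      then have b: "\<Delta> \<in> sets borel" unfolding sets_nu by (rule sets_unit_interval)
      show "emeasure (\<nu> (\<rho> + \<sigma>)) \<Delta> = emeasure (\<nu> \<rho>) \<Delta> + emeasure (\<nu> \<sigma>) \<Delta>"
        using \<Delta> that s normal_pos_nonneg[OF that(1) compress_positive[OF b]] normal_pos_nonneg[OF that(2) compress_positive[OF b]]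
        by (simp add: emeasure_nu sets_nu blinfun.add_left)
    qed (use measurable_nu[OF h] in \<open>simp_all add: sets_nu\<close>)
    then show ?thesis using that s by (simp add: persp_op_def plus_ennreal.rep_eq)
  qed
  have "\<exists>l\<ge>0. \<forall>\<rho>\<in>normal_pos. 0 \<le> persp_op h \<rho> + ereal (l * Re (\<rho> 1))"
    using nn by (intro exI[of _ 0]) (auto simp: zero_ereal_def[symmetric])
  moreover have "persp_op h \<in> extensional normal_pos" unfolding persp_op_def by simp
  ultimately show ?thesis
    unfolding hatB_pos_def hatB_lb_def using nn scale add persp_op_lsc[OF _ h] by (force simp del: ereal_infty_less_eq)
qed

lemma E_unit: "E {0..1} = P"
proof -
  have "emeasure (\<mu> x) (UNIV - {0..1}) = 0" for x
    using AE_bounds[of x] by (subst (asm) AE_iff_measurable[of "UNIV - {0..1}"]) auto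
  then have "E (UNIV - {0..1}) = 0" by (intro bop_eqI) (simp add: emeasure_mu bop_rep_eq)
  then show ?thesis using E_Un[of "{0..1}" "UNIV - {0..1}"] by (simp add: E_UNIV)
qed

lemma compress_P: "compress A B P = C"
  by (simp add: compress_def support_sqrt_mult[OF C] sqrt_op(2)[OF C])

text \<open>Pointwise, the positive part of g plus l equals g + l plus the negative part of g.
  Integrating this identity stays within \<open>ennreal\<close>; the negative part has integral at
  most l \<rho>(C), because \<nu> has total mass \<rho>(C), so the difference can be formed.\<close>

lemma ereal_integral_shift:
  assumes \<rho>: "\<rho> \<in> normal_pos" and g: "g \<in> borel_measurable borel" and l: "0 \<le> l"
    and le: "\<And>r. r \<in> {0..1} \<Longrightarrow> ereal (- l) \<le> g r"
  shows "ereal_integral (\<nu> \<rho>) g = enn2ereal (\<integral>\<^sup>+t. e2ennreal (g t + ereal l) \<partial>\<nu> \<rho>) + ereal (- l * Re (\<rho> C))"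
proof -
  have m: "(\<lambda>t. e2ennreal (g t + ereal l)) \<in> borel_measurable (\<nu> \<rho>)" "(\<lambda>t. e2ennreal (g t)) \<in> borel_measurable (\<nu> \<rho>)"
    "(\<lambda>t. e2ennreal (- g t)) \<in> borel_measurable (\<nu> \<rho>)"
    by (rule measurable_nu, use g in measurable)+
  have \<rho>C: "0 \<le> Re (\<rho> C)" by (rule normal_pos_nonneg[OF \<rho> C])
  have "{0..1} \<in> sets (\<nu> \<rho>)" using sets.top[of "\<nu> \<rho>"] by (simp add: space_nu)
  then have const: "(\<integral>\<^sup>+t. ennreal l \<partial>\<nu> \<rho>) = ennreal (l * Re (\<rho> C))"
    by (simp add: space_nu emeasure_nu[OF \<rho>] E_unit compress_P ennreal_mult l \<rho>C)
  have "(\<integral>\<^sup>+t. e2ennreal (g t + ereal l) + e2ennreal (- g t) \<partial>\<nu> \<rho>) = (\<integral>\<^sup>+t. e2ennreal (g t) + ennreal l \<partial>\<nu> \<rho>)"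
  proof (rule nn_integral_cong)
    fix t assume "t \<in> space (\<nu> \<rho>)"
    then have "ereal (- l) \<le> g t" using le by (simp add: space_nu)
    then show "e2ennreal (g t + ereal l) + e2ennreal (- g t) = e2ennreal (g t) + ennreal l"
    proof (cases "g t")
      case (real r)
      show ?thesis
      proof (cases "0 \<le> r")
        case True
        then show ?thesis using l real by (simp add: ennreal_neg)
      next
        case False
        then show ?thesis using l real \<open>ereal (- l) \<le> g t\<close> by (simp add: ennreal_neg ennreal_plus[symmetric] del: ennreal_plus)
      qed
    qed (auto simp: e2ennreal_neg)
  qed
  then have eq: "(\<integral>\<^sup>+t. e2ennreal (g t + ereal l) \<partial>\<nu> \<rho>) + (\<integral>\<^sup>+t. e2ennreal (- g t) \<partial>\<nu> \<rho>)
      = (\<integral>\<^sup>+t. e2ennreal (g t) \<partial>\<nu> \<rho>) + ennreal (l * Re (\<rho> C))"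
    by (simp add: nn_integral_add m const del: nn_integral_const)
  have "(\<integral>\<^sup>+t. e2ennreal (- g t) \<partial>\<nu> \<rho>) \<le> (\<integral>\<^sup>+t. ennreal l \<partial>\<nu> \<rho>)"
  proof (rule nn_integral_mono)
    fix t assume "t \<in> space (\<nu> \<rho>)"
    then have "- g t \<le> ereal l" using le[of t] by (simp add: space_nu ereal_uminus_le_reorder)
    then show "e2ennreal (- g t) \<le> ennreal l" using e2ennreal_mono[of "- g t" "ereal l"] by simp
  qed
  then have "(\<integral>\<^sup>+t. e2ennreal (- g t) \<partial>\<nu> \<rho>) < top" unfolding const using ennreal_less_top le_less_trans by blast
  then obtain b where b: "(\<integral>\<^sup>+t. e2ennreal (- g t) \<partial>\<nu> \<rho>) = ennreal b" "0 \<le> b"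
    by (cases "\<integral>\<^sup>+t. e2ennreal (- g t) \<partial>\<nu> \<rho>") auto
  have "enn2ereal (\<integral>\<^sup>+t. e2ennreal (g t + ereal l) \<partial>\<nu> \<rho>) + ereal b
      = enn2ereal (\<integral>\<^sup>+t. e2ennreal (g t) \<partial>\<nu> \<rho>) + ereal (l * Re (\<rho> C))"
    using arg_cong[OF eq, of enn2ereal] b l \<rho>C by (simp add: plus_ennreal.rep_eq)
  then show ?thesis
    unfolding ereal_integral_def b(1) using b(2)
    by (cases "enn2ereal (\<integral>\<^sup>+t. e2ennreal (g t + ereal l) \<partial>\<nu> \<rho>)";
        cases "enn2ereal (\<integral>\<^sup>+t. e2ennreal (g t) \<partial>\<nu> \<rho>)") auto
qed

lemma perspective_decomposition:
  assumes tc: "trace_class A" "trace_class B" and g: "g \<in> borel_measurable borel" and l: "0 \<le> l"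
    and le: "\<And>r. r \<in> {0..1} \<Longrightarrow> ereal (- l) \<le> g r"
  defines "m \<equiv> \<lambda>\<rho>\<in>normal_pos. ereal_integral (\<nu> \<rho>) g"
  shows "m \<in> hatB_pos_plus_C1_sa"
    "ext_trace m = enn2ereal (infsum (\<lambda>e. \<integral>\<^sup>+t. e2ennreal (g t + ereal l) \<partial>\<mu> (K e)) some_onb)
      + ereal (- l * infsum (\<lambda>e. inner (C e) e) some_onb)"
proof -
  define h where "h t = e2ennreal (g t + ereal l)" for t
  have h: "h \<in> borel_measurable borel" unfolding h_def using g by measurable
  have tcC: "trace_class C" by (rule trace_class_positive_add[OF A tc(1) B tc(2)])
  define X where "X = (- l) *\<^sub>R C"
  have saC: "selfadjoint_op C" by (rule positive_selfadjoint[OF C])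
  have saX: "selfadjoint_op X" unfolding X_def by (intro selfadjoint_intros saC)
  have "abs_op X = l *\<^sub>R C"
  proof -
    have "sqrt_op (X * X) = l *\<^sub>R C"
      by (rule sqrt_op(4)[OF positive_op_square[OF saX] positive_op_scaleR[OF C l]]) (simp add: X_def)
    then show ?thesis by (simp add: abs_op_selfadjoint[OF saX])
  qed
  moreover have "trace_class (l *\<^sub>R C)" by (rule trace_class_positive_scaleR[OF C tcC l])
  ultimately have "trace_class X" unfolding trace_class_def abs_op_positive[OF positive_op_scaleR[OF C l]] by simp
  then have X: "X \<in> C1_sa" unfolding C1_sa_def using saX by simp
  have T: "persp_op h \<in> hatB_pos" by (rule persp_op_hatB_pos[OF h])
  have m: "m = ext_plus (persp_op h) X"
  proof
    fix \<rho>
    show "m \<rho> = ext_plus (persp_op h) X \<rho>"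
      using ereal_integral_shift[OF _ g l le, of \<rho>]
      by (cases "\<rho> \<in> normal_pos")
        (simp_all add: m_def ext_plus_def persp_op_def h_def X_def blinfun.scaleR_right blinfun.minus_right)
  qed
  show "m \<in> hatB_pos_plus_C1_sa" unfolding hatB_pos_plus_C1_sa_def m using T X by blast
  have "trace_hatB_pos (persp_op h) = infsum (\<lambda>e. enn2ereal (\<integral>\<^sup>+t. h t \<partial>\<mu> (K e))) some_onb"
    unfolding trace_hatB_pos_def
    by (rule infsum_cong) (simp add: persp_op_def vector_functional_normal nu_vector_functional[OF _ h])
  then have "trace_hatB_pos (persp_op h) = enn2ereal (infsum (\<lambda>e. \<integral>\<^sup>+t. h t \<partial>\<mu> (K e)) some_onb)"
    by (simp add: infsum_enn2ereal)
  moreover have "Re (op_trace X) = - l * infsum (\<lambda>e. inner (C e) e) some_onb"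
    unfolding C1_sa_summable(2)[OF X] by (simp add: X_def bop_rep_eq infsum_cmult_right' infsum_uminus)
  ultimately show "ext_trace m = enn2ereal (infsum (\<lambda>e. \<integral>\<^sup>+t. e2ennreal (g t + ereal l) \<partial>\<mu> (K e)) some_onb)
      + ereal (- l * infsum (\<lambda>e. inner (C e) e) some_onb)"
    unfolding m ext_trace_ext_plus[OF T X] h_def by simp
qed

end

section \<open>The maximal f-divergence of comparable operators\<close>

context spectral_pvm
begin

lemma fcalc_linear:
  assumes X: "fcalc g X" and Y: "fcalc h Y"
  shows "fcalc (\<lambda>t. r * g t + s * h t) (r *\<^sub>R X + s *\<^sub>R Y)"
proof -
  obtain p q where p: "uniform_limit {lo..hi} (\<lambda>n. poly (p n)) g sequentially" "(\<lambda>n. poly_op P (p n) T) \<longlonglongrightarrow> X"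
    and q: "uniform_limit {lo..hi} (\<lambda>n. poly (q n)) h sequentially" "(\<lambda>n. poly_op P (q n) T) \<longlonglongrightarrow> Y"
    using X Y unfolding fcalc_def by blast
  have "uniform_limit {lo..hi} (\<lambda>n t. r * poly (p n) t + s * poly (q n) t) (\<lambda>t. r * g t + s * h t) sequentially"
    by (intro uniform_limit_add bounded_linear.uniform_limit[OF bounded_linear_mult_right] p q)
  moreover have "(\<lambda>n. r *\<^sub>R poly_op P (p n) T + s *\<^sub>R poly_op P (q n) T) \<longlonglongrightarrow> r *\<^sub>R X + s *\<^sub>R Y"
    by (intro tendsto_intros p q)
  moreover have "poly (smult r (p n) + smult s (q n)) = (\<lambda>t. r * poly (p n) t + s * poly (q n) t)" for n
    by (simp add: fun_eq_iff)
  ultimately show ?thesis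
    unfolding fcalc_def
    by (intro exI[of _ "\<lambda>n. smult r (p n) + smult s (q n)"]) (simp only: poly_op_add poly_op_smult simp_thms)
qed

lemma fcalc_const: "fcalc (\<lambda>t. c) (c *\<^sub>R P)"
  using fcalc_affine[of c 0] by simp

lemma fcalc_bounds:
  assumes X: "fcalc g X" and cont: "continuous_on {lo..hi} g"
  shows "(\<And>t. t \<in> {lo..hi} \<Longrightarrow> c \<le> g t) \<Longrightarrow> c * (norm (P z))\<^sup>2 \<le> inner (X z) z"
    and "(\<And>t. t \<in> {lo..hi} \<Longrightarrow> g t \<le> c) \<Longrightarrow> inner (X z) z \<le> c * (norm (P z))\<^sup>2"
proof -
  have i: "inner ((r *\<^sub>R X + s *\<^sub>R (c *\<^sub>R P)) z) z = r * inner (X z) z + s * c * (norm (P z))\<^sup>2" for r s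
    by (simp add: bop_rep_eq inner_add_left projection_inner[OF P])
  have c: "continuous_on {lo..hi} (\<lambda>t. r * g t + s * c)" for r s by (intro continuous_intros cont)
  show "c * (norm (P z))\<^sup>2 \<le> inner (X z) z" if "\<And>t. t \<in> {lo..hi} \<Longrightarrow> c \<le> g t"
    using positive_op_inner[OF fcalc_positive[OF fcalc_linear[OF X fcalc_const, of 1 "-1" c] c], of z] that
    unfolding i by simp
  show "inner (X z) z \<le> c * (norm (P z))\<^sup>2" if "\<And>t. t \<in> {lo..hi} \<Longrightarrow> g t \<le> c"
    using positive_op_inner[OF fcalc_positive[OF fcalc_linear[OF X fcalc_const, of "-1" 1 c] c], of z] that
    unfolding i by simp
qed

lemma fcalc_norm_le:
  assumes X: "fcalc g X" and cont: "continuous_on {lo..hi} g" and le: "\<And>t. t \<in> {lo..hi} \<Longrightarrow> \<bar>g t\<bar> \<le> c" and c: "0 \<le> c"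
  shows "norm X \<le> c"
proof (rule norm_bop_le[OF _ c])
  fix z
  have "(norm (X z))\<^sup>2 = inner ((X * X) z) z"
    by (simp add: power2_norm_eq_inner bop_rep_eq selfadjoint_inner[OF fcalc_selfadjoint[OF X]])
  also have "\<dots> \<le> c\<^sup>2 * (norm (P z))\<^sup>2"
  proof (rule fcalc_bounds(2)[OF fcalc_mult[OF X X cont cont]])
    show "continuous_on {lo..hi} (\<lambda>t. g t * g t)" by (intro continuous_intros cont)
    show "g t * g t \<le> c\<^sup>2" if "t \<in> {lo..hi}" for t
      using le[OF that] c by (metis abs_le_square_iff abs_of_nonneg power2_eq_square)
  qed
  also have "\<dots> \<le> (c * norm z)\<^sup>2"
    using projection_norm_le[OF P, of z] by (simp add: power_mult_distrib mult_left_mono power_mono)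
  finally show "norm (X z) \<le> c * norm z" by (rule power2_le_imp_le) (use c in simp)
qed

lemma fcalc_poly_comp:
  assumes Z: "fcalc g Z" and cont: "continuous_on {lo..hi} g"
  shows "fcalc (\<lambda>t. poly p (g t)) (poly_op P p Z)"
proof (induction p)
  case 0
  then show ?case using fcalc_const[of 0] by (simp add: poly_op_def)
next
  case (pCons a p)
  have PZ: "P * Z = Z" "Z * P = Z" using fcalc_corner[OF Z] by auto
  have "continuous_on {lo..hi} (\<lambda>t. poly p (g t))" by (intro continuous_intros cont)
  then have "fcalc (\<lambda>t. g t * poly p (g t)) (Z * poly_op P p Z)"
    by (rule fcalc_mult[OF Z pCons(2) cont])
  from fcalc_linear[OF fcalc_const[of a] this, of 1 1] show ?case
    by (simp add: poly_op_pCons[OF PZ])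
qed

text \<open>The composition rule for f(g(T)): both p(Z) and F are values of the calculus of T, at
  the functions p o g and f o g, so their distance is bounded by the uniform distance of p and f on
  S.\<close>

lemma poly_op_comp_tendsto:
  assumes Z: "fcalc g Z" and cont: "continuous_on {lo..hi} g" and F: "fcalc (\<lambda>t. f (g t)) F"
    and contf: "continuous_on {lo..hi} (\<lambda>t. f (g t))"
    and p: "uniform_limit S (\<lambda>n. poly (p n)) f sequentially" and S: "\<And>t. t \<in> {lo..hi} \<Longrightarrow> g t \<in> S"
  shows "(\<lambda>n. poly_op P (p n) Z) \<longlonglongrightarrow> F"
proof (rule LIMSEQ_I)
  fix r :: real assume r: "0 < r"
  then have "0 < r / 2" by simp
  from uniform_limitD[OF p this] obtain N where N: "\<And>n s. N \<le> n \<Longrightarrow> s \<in> S \<Longrightarrow> \<bar>poly (p n) s - f s\<bar> < r / 2"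
    by (auto simp: eventually_sequentially dist_real_def)
  have "norm (poly_op P (p n) Z - F) < r" if "N \<le> n" for n
  proof -
    have fc: "fcalc (\<lambda>t. 1 * poly (p n) (g t) + (- 1) * f (g t)) (1 *\<^sub>R poly_op P (p n) Z + (- 1) *\<^sub>R F)"
      by (rule fcalc_linear[OF fcalc_poly_comp[OF Z cont] F])
    have "norm (1 *\<^sub>R poly_op P (p n) Z + (- 1) *\<^sub>R F) \<le> r / 2"
    proof (rule fcalc_norm_le[OF fc])
      show "continuous_on {lo..hi} (\<lambda>t. 1 * poly (p n) (g t) + (- 1) * f (g t))"
        by (intro continuous_intros cont contf)
      show "\<bar>1 * poly (p n) (g t) + (- 1) * f (g t)\<bar> \<le> r / 2" if "t \<in> {lo..hi}" for t
        using N[OF \<open>N \<le> n\<close> S[OF that]] by simp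
    qed (use r in simp)
    then show ?thesis using r by simp
  qed
  then show "\<exists>N. \<forall>n\<ge>N. norm (poly_op P (p n) Z - F) < r" by blast
qed

end

text \<open>Y and U are mutually inverse in the corner, so inner factors U Y = P are absorbed by Z.
  The factor P in front covers the power n = 0, which is the identity of the whole space.\<close>

lemma poly_op_conj:
  assumes YU: "Y * U = P" and UY: "U * Y = P" and PY: "P * Y = Y" and UP: "U * P = U"
    and PZ: "P * Z = Z" "Z * P = Z" and PP: "P * P = P"
  shows "poly_op P p (Y * Z * U) = Y * poly_op P p Z * U"
proof -
  have PU: "P * U = U" using UY YU UP by (metis mult.assoc)
  have "P * (Y * Z * U) ^ n = Y * (P * Z ^ n) * U" for n
  proof (induction n)
    case 0
    then show ?case using PU YU by (simp add: mult.assoc)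
  next
    case (Suc n)
    have "P * (Y * Z * U) ^ Suc n = (P * (Y * Z * U) ^ n) * (Y * Z * U)"
      by (simp add: power_Suc2 mult.assoc del: power_Suc)
    also have "\<dots> = Y * (P * Z ^ n) * (U * Y) * Z * U" unfolding Suc by (simp add: mult.assoc)
    also have "\<dots> = Y * (P * Z ^ n) * (P * Z) * U" by (simp add: UY mult.assoc)
    also have "\<dots> = Y * (P * Z ^ Suc n) * U" by (simp add: PZ power_Suc2 mult.assoc del: power_Suc)
    finally show ?case .
  qed
  then show ?thesis by (simp add: poly_op_def sum_distrib_left sum_distrib_right)
qed

text \<open>Two factorizations of \<open>B\<close> with the same modulus differ by a unitary of \<open>B(PH)\<close>.\<close>

lemma polar_unitary:
  fixes B H K P :: "'a::complex_hilbert bop"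
  assumes B: "positive_op B" and H: "selfadjoint_op H" and K: "selfadjoint_op K" and P: "projection_op P"
    and BK: "B = K * (H * H) * K" and PK: "P * K = K" and HP: "P * H = H" "H * P = H"
    and inv: "Hi * H = P" and kerK: "\<And>x. K x = 0 \<longleftrightarrow> P x = 0"
  obtains Y where "Y * adj_op Y = P" "adj_op Y * Y = P" "P * Y = Y" "adj_op Y * P = adj_op Y"
    "support_proj B = P" "\<And>x. adj_op Y (sqrt_op B x) = H (K x)"
proof -
  let ?M = "sqrt_op B"
  have M: "selfadjoint_op ?M" by (rule sqrt_op_selfadjoint[OF B])
  have Hker: "H x = 0 \<longleftrightarrow> P x = 0" for x
    using inv HP(2) by (metis bop_zero times_bop.rep_eq)
  have B_HK: "cinner (B x) y = cinner (H (K x)) (H (K y))" for x y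
    by (simp add: BK bop_rep_eq selfadjoint_cinner[OF K] selfadjoint_cinner[OF H])
  have Bker: "B x = 0 \<longleftrightarrow> P x = 0" for x
  proof -
    have PKx: "P (K x) = K x" using PK by (metis times_bop.rep_eq)
    have "B x = 0 \<longleftrightarrow> H (K x) = 0"
      using B_HK[of x x] by (auto simp: BK bop_rep_eq cinner_self)
    then show ?thesis using Hker[of "K x"] kerK[of x] PKx by simp
  qed
  have supp: "support_proj B = P"
    by (rule support_proj_eqI[OF positive_selfadjoint[OF B] P]) (simp add: Bker)
  \<comment> \<open>Equal moduli: H K and the square root of B have the same norm at each x, so
    \<open>douglas\<close> applies with constant 1.\<close>
  have norm_eq: "norm ((H * K) x) = norm (?M x)" for x
  proof -
    have "complex_of_real ((norm (?M x))\<^sup>2) = of_real ((norm ((H * K) x))\<^sup>2)"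
      unfolding norm_sqrt_op[OF B] selfadjoint_cinner_self[OF positive_selfadjoint[OF B], symmetric]
      by (simp only: B_HK cinner_self times_bop.rep_eq)
    then show ?thesis by (simp add: power2_eq_iff_nonneg del: of_real_power)
  qed
  obtain Y where Y: "\<And>x w. cinner ((H * K) x) w = cinner (?M x) (bop_apply Y w)"
      "\<And>w. bop_apply Y w \<in> closure (range (bop_apply ?M))"
    using douglas[of 1 "H * K" ?M] norm_eq by auto
  have PY: "P * Y = Y"
    using Y(2) range_support_sqrt[OF B] projection_range_iff[OF P]
    by (intro bop_eqI) (simp add: bop_rep_eq supp)
  have UP: "adj_op Y * P = adj_op Y"
    using arg_cong[OF PY, of adj_op] by (simp add: adj_mult adj_selfadjoint projection_selfadjoint P)
  have UM: "adj_op Y (?M x) = H (K x)" for x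
  proof -
    have "cinner (adj_op Y (?M x) - (H * K) x) (adj_op Y (?M x) - (H * K) x) = 0"
      by (simp add: cinner_diff_left cinner_adj' Y(1))
    then show ?thesis by (simp add: cinner_self bop_rep_eq)
  qed
  have sa: "selfadjoint_op (Y * adj_op Y)" "selfadjoint_op (adj_op Y * Y)"
    by (simp_all add: selfadjoint_op_def bop_rep_eq cinner_adj cinner_adj' adj_adj)
  have YU: "Y * adj_op Y = P"
  proof (rule corner_unique[OF B])
    show "Y * adj_op Y \<in> corner (support_proj B)"
      using PY UP by (simp add: corner_def supp mult.assoc) (simp add: mult.assoc[symmetric])
    show "P \<in> corner (support_proj B)" using P by (simp add: corner_def supp projection_op_def)
    show "?M * (Y * adj_op Y) * ?M = ?M * P * ?M"
    proof (rule bop_eqI)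
      fix x
      have "cinner ((?M * (Y * adj_op Y) * ?M) x) y = cinner ((?M * P * ?M) x) y" for y
      proof -
        have "cinner ((?M * (Y * adj_op Y) * ?M) x) y = cinner (H (K x)) (H (K y))"
          by (simp add: bop_rep_eq selfadjoint_cinner[OF M] cinner_adj[of Y] UM)
        also have "\<dots> = cinner ((?M * P * ?M) x) y"
          using support_sqrt_mult(2)[OF B] by (simp add: supp B_HK[symmetric] sqrt_op(2)[OF B])
        finally show ?thesis .
      qed
      then have "cinner ((?M * (Y * adj_op Y) * ?M) x - (?M * P * ?M) x) ((?M * (Y * adj_op Y) * ?M) x - (?M * P * ?M) x) = 0"
        by (simp add: cinner_diff_left)
      then show "(?M * (Y * adj_op Y) * ?M) x = (?M * P * ?M) x" by (simp add: cinner_self)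
    qed
  qed (use sa projection_selfadjoint[OF P] in auto)
  \<comment> \<open>\<open>adj_op Y * Y\<close> is idempotent because Y \<open>adj_op Y\<close> = P
    and P Y = Y. It is identified with P by its kernel, which is traced through K H to that of
    P.\<close>
  have "adj_op Y * Y * (adj_op Y * Y) = adj_op Y * (Y * adj_op Y) * Y" by (simp add: mult.assoc)
  then have "projection_op (adj_op Y * Y)" using sa PY by (simp add: projection_op_def YU mult.assoc)
  moreover have "(adj_op Y * Y) w = 0 \<longleftrightarrow> P w = 0" for w
  proof -
    have "(adj_op Y * Y) w = 0 \<longleftrightarrow> Y w = 0"
    proof
      assume "(adj_op Y * Y) w = 0"
      then have "cinner (Y w) (Y w) = 0" using cinner_adj'[of Y "Y w" w] by (simp add: bop_rep_eq)
      then show "Y w = 0" by (simp add: cinner_self)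
    qed (simp add: bop_rep_eq)
    also have "\<dots> \<longleftrightarrow> K (H w) = 0"
    proof
      assume "Y w = 0"
      then have "cinner (K (H w)) (K (H w)) = 0"
        using Y(1)[of "K (H w)" w] by (simp add: bop_rep_eq selfadjoint_cinner[OF K, of "H w"] selfadjoint_cinner[OF H, of w])
          (metis cinner_commute complex_cnj_zero)
      then show "K (H w) = 0" by (simp add: cinner_self)
    next
      assume 0: "K (H w) = 0"
      have "inner x (Y w) = 0" if x: "x \<in> range (bop_apply ?M)" for x
      proof -
        obtain y where "x = ?M y" using x by (metis imageE)
        then have "cinner x (Y w) = cinner y (K (H w))"
          using Y(1)[of y w] by (simp add: bop_rep_eq selfadjoint_cinner[OF K] selfadjoint_cinner[OF H])
        then show ?thesis by (simp add: 0 inner_eq_Re_cinner)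
      qed
      then have "inner (Y w) (Y w) = 0" by (rule closure_orthogonal[OF _ Y(2)])
      then show "Y w = 0" by simp
    qed
    also have "\<dots> \<longleftrightarrow> P w = 0"
      using kerK[of "H w"] Hker[of w] HP(1) by (metis times_bop.rep_eq)
    finally show ?thesis .
  qed
  ultimately have UY: "adj_op Y * Y = P" by (intro projection_eq_if_kernel_eq P) auto
  show thesis by (rule that[of Y]) (fact YU UY PY UP supp UM)+
qed

context positive_pair
begin

text \<open>A' and B' are compressions of affine functions \<alpha>(R) and \<beta>(R). With H =
  \<beta>(R)^(1/2) and Z = (\<alpha>/\<beta>)(R) one has B' = K H H K and A' = K H Z H K. The
  unitary of \<open>polar_unitary\<close> carries H K to the square root of B', hence Z to W and H
  f(Z) H to the integrand \<phi>. The affine parameters cover the comparable pair itself as well as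
  every pair shifted by \<epsilon> C.\<close>

lemma max_f_div_formula:
  fixes a0 a1 b0 b1 lo hi :: real and f :: "real \<Rightarrow> real"
  assumes pvm': "spectral_pvm P R E lo hi" and lohi: "lo \<le> hi"
    and f: "continuous_on {0<..} f"
    and a: "\<And>t. t \<in> {lo..hi} \<Longrightarrow> 0 < a0 + a1 * t" and b: "\<And>t. t \<in> {lo..hi} \<Longrightarrow> 0 < b0 + b1 * t"
    and A': "A' = compress A B (a0 *\<^sub>R P + a1 *\<^sub>R R)" and B': "B' = compress A B (b0 *\<^sub>R P + b1 *\<^sub>R R)"
    and tc: "trace_class B'"
  defines "\<phi> \<equiv> \<lambda>t. (b0 + b1 * t) * f ((a0 + a1 * t) / (b0 + b1 * t))"
  shows "max_f_div_comparable f A' B' = infsum (\<lambda>e. \<integral>t. indicat_real {lo..hi} t * \<phi> t \<partial>\<mu> (K e)) some_onb"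
    "(\<lambda>e. \<integral>t. indicat_real {lo..hi} t * \<phi> t \<partial>\<mu> (K e)) summable_on some_onb"
proof -
  interpret I: spectral_pvm P R E lo hi by (rule pvm')
  define \<alpha> \<beta> where "\<alpha> t = a0 + a1 * t" and "\<beta> t = b0 + b1 * t" for t
  have pos: "0 < \<alpha> t" "0 < \<beta> t" if "t \<in> {lo..hi}" for t using a[OF that] b[OF that] by (simp_all add: \<alpha>_def \<beta>_def)
  define Q S where "Q = a0 *\<^sub>R P + a1 *\<^sub>R R" and "S = b0 *\<^sub>R P + b1 *\<^sub>R R"
  have Q: "I.fcalc \<alpha> Q" and S: "I.fcalc \<beta> S"
    unfolding \<alpha>_def \<beta>_def Q_def S_def by (rule I.fcalc_affine)+
  have c\<alpha>: "continuous_on {lo..hi} \<alpha>" and c\<beta>: "continuous_on {lo..hi} \<beta>"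
    unfolding \<alpha>_def \<beta>_def by (intro continuous_intros)+
  have nz: "\<alpha> t \<noteq> 0" "\<beta> t \<noteq> 0" "sqrt (\<beta> t) \<noteq> 0" if "t \<in> {lo..hi}" for t using pos[OF that] by auto
  define \<zeta> where "\<zeta> t = \<alpha> t / \<beta> t" for t
  have c\<zeta>: "continuous_on {lo..hi} \<zeta>" unfolding \<zeta>_def using nz by (intro continuous_intros c\<alpha> c\<beta>) auto
  have \<zeta>pos: "0 < \<zeta> t" if "t \<in> {lo..hi}" for t using pos[OF that] by (simp add: \<zeta>_def)
  have cs: "continuous_on {lo..hi} (\<lambda>t. sqrt (\<beta> t))" by (intro continuous_intros c\<beta>)
  obtain H where H: "I.fcalc (\<lambda>t. sqrt (\<beta> t)) H" using I.fcalc_exists[OF cs] by blast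
  obtain Z where Z: "I.fcalc \<zeta> Z" using I.fcalc_exists[OF c\<zeta>] by blast
  have cf: "continuous_on {lo..hi} (\<lambda>t. f (\<zeta> t))"
    by (rule continuous_on_compose2[OF f c\<zeta>]) (use \<zeta>pos in auto)
  obtain F where F: "I.fcalc (\<lambda>t. f (\<zeta> t)) F" using I.fcalc_exists[OF cf] by blast
  obtain Hi where Hi: "Hi * H = P" using I.fcalc_inverse[OF cs nz(3) H] by metis
  obtain Zi where Zi: "I.fcalc (\<lambda>t. 1 / \<zeta> t) Zi" "Z * Zi = P" "Zi * Z = P"
    using I.fcalc_inverse[OF c\<zeta> _ Z] \<zeta>pos by (metis less_irrefl)
  have HXH: "I.fcalc (\<lambda>t. \<beta> t * g t) (H * X * H)" if X: "I.fcalc g X" "continuous_on {lo..hi} g" for g X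
  proof (rule I.fcalc_cong)
    show "I.fcalc (\<lambda>t. sqrt (\<beta> t) * g t * sqrt (\<beta> t)) (H * X * H)"
      by (rule I.fcalc_mult[OF I.fcalc_mult[OF H X(1) cs X(2)] H _ cs]) (intro continuous_intros cs X)
    show "sqrt (\<beta> t) * g t * sqrt (\<beta> t) = \<beta> t * g t" if "t \<in> {lo..hi}" for t
    proof -
      have "sqrt (\<beta> t) * sqrt (\<beta> t) = \<beta> t" using pos(2)[OF that] by simp
      then show ?thesis by (simp add: mult.commute mult.left_commute)
    qed
  qed
  have HH: "H * H = S"
    by (rule I.fcalc_unique[OF I.fcalc_cong[OF I.fcalc_mult[OF H H cs cs]] S]) (use pos(2) in \<open>simp add: less_imp_le\<close>)
  have HZH: "H * Z * H = Q"
    by (rule I.fcalc_unique[OF I.fcalc_cong[OF HXH[OF Z c\<zeta>]] Q]) (use nz(2) in \<open>simp add: \<zeta>_def\<close>)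
  have corner: "P * X = X" "X * P = X" if "I.fcalc g X" for g X using I.fcalc_corner[OF that] by auto
  have sa: "selfadjoint_op H" by (rule I.fcalc_selfadjoint[OF H])
  have BK: "B' = K * (H * H) * K" by (simp add: B' HH compress_def S_def)
  have B'pos: "positive_op B'" unfolding BK by (intro positive_op_sandwich K positive_op_square sa)
  have kerK: "K x = 0 \<longleftrightarrow> P x = 0" for x
    by (simp add: sqrt_op_zero_iff[OF C] support_proj_zero_iff[OF positive_selfadjoint[OF C]])
  obtain Y where Y: "Y * adj_op Y = P" "adj_op Y * Y = P" "P * Y = Y" "adj_op Y * P = adj_op Y"
    "support_proj B' = P" "\<And>x. adj_op Y (sqrt_op B' x) = H (K x)"
    using polar_unitary[OF B'pos sa K P_proj BK support_sqrt_mult(1)[OF C] corner[OF H] Hi kerK] by metis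
  let ?M = "sqrt_op B'"
  define U where "U = adj_op Y"
  note Y = Y[folded U_def]
  have M: "selfadjoint_op ?M" by (rule sqrt_op_selfadjoint[OF B'pos])
  have PP: "P * P = P" using P_proj by (simp add: projection_op_def)
  have cU: "cinner (Y x) y = cinner x (U y)" for x y by (simp add: U_def cinner_adj)
  have PU: "P * U = U" using Y(1,2,4) by (metis mult.assoc)
  define W where "W = Y * Z * U"
  have cW: "cinner (W x) y = cinner (Z (U x)) (U y)" for x y by (simp add: W_def bop_rep_eq cU)
  have Zpos: "positive_op Z" by (rule I.fcalc_positive[OF Z c\<zeta>]) (use \<zeta>pos less_imp_le in blast)
  have Wpos: "positive_op W" using Zpos by (simp add: positive_op_def cW)
  have Wcorner: "W \<in> corner P" unfolding corner_def W_def using Y(3,4) by (simp add: mult.assoc) (simp add: mult.assoc[symmetric])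
  \<comment> \<open>For any X, conjugating by the unitary and sandwiching with the square root of B'
    is the same as sandwiching H X H with K. It is used for X = Z to recognize A', and for X = F to
    compute the trace.\<close>
  have sandwich: "cinner ((?M * (Y * X * U) * ?M) x) y = cinner ((K * (H * X * H) * K) x) y" for X x y
    by (simp add: bop_rep_eq selfadjoint_cinner[OF M] cU Y(6) selfadjoint_cinner[OF K] selfadjoint_cinner[OF sa])
  have MWM: "A' = ?M * W * ?M"
  proof (rule bop_eqI)
    fix x
    have "cinner (A' x - (?M * W * ?M) x) (A' x - (?M * W * ?M) x) = 0"
      using sandwich[of Z x] by (simp add: cinner_diff_left W_def A' compress_def HZH Q_def[symmetric])
    then show "A' x = (?M * W * ?M) x" by (simp add: cinner_self)
  qed
  have Winv: "invertible_on P W"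
    unfolding invertible_on_def
  proof (intro bexI[of _ "Y * Zi * U"] conjI)
    have "Y * Zi * U * W = Y * Zi * (U * Y) * Z * U" "W * (Y * Zi * U) = Y * Z * (U * Y) * Zi * U"
      by (simp_all add: W_def mult.assoc)
    then have "Y * Zi * U * W = Y * (Zi * Z) * U" "W * (Y * Zi * U) = Y * (Z * Zi) * U"
      using corner(1)[OF Z] corner(1)[OF Zi(1)] by (simp_all add: Y(2) mult.assoc)
    then show "Y * Zi * U * W = P" "W * (Y * Zi * U) = P"
      using PU Y(1) by (simp_all add: Zi mult.assoc)
    show "Y * Zi * U \<in> corner P" unfolding corner_def using Y(3,4) by (simp add: mult.assoc) (simp add: mult.assoc[symmetric])
  qed
  have rel: "rel_op A' B' = W"
    unfolding rel_op_def Let_def Y(5)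
  proof (rule the_equality)
    show "W \<in> corner P \<and> positive_op W \<and> invertible_on P W \<and> A' = ?M * W * ?M"
      using Wcorner Wpos Winv MWM by blast
    show "W' = W" if "W' \<in> corner P \<and> positive_op W' \<and> invertible_on P W' \<and> A' = ?M * W' * ?M" for W'
      by (rule corner_unique[OF B'pos]) (use that Wcorner Wpos MWM Y(5) positive_selfadjoint in auto)
  qed
  \<comment> \<open>The minimum and maximum of \<zeta> are form bounds for W. The minimum is
    positive, so f is continuous on the interval between them.\<close>
  obtain t0 where t0: "t0 \<in> {lo..hi}" "\<And>t. t \<in> {lo..hi} \<Longrightarrow> \<zeta> t0 \<le> \<zeta> t"
    using continuous_attains_inf[OF compact_Icc _ c\<zeta>] lohi by auto
  obtain t1 where t1: "t1 \<in> {lo..hi}" "\<And>t. t \<in> {lo..hi} \<Longrightarrow> \<zeta> t \<le> \<zeta> t1"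
    using continuous_attains_sup[OF compact_Icc _ c\<zeta>] lohi by auto
  have nU: "(norm (P (U x)))\<^sup>2 = (norm (P x))\<^sup>2" for x
  proof -
    have "complex_of_real ((norm (U x))\<^sup>2) = cinner ((Y * U) x) x" by (simp add: bop_rep_eq cU cinner_self)
    also have "\<dots> = of_real ((norm (P x))\<^sup>2)" by (simp add: Y(1) projection_cinner[OF P_proj])
    finally have "(norm (U x))\<^sup>2 = (norm (P x))\<^sup>2" by (simp del: of_real_power)
    moreover have "P (U x) = U x" using PU by (metis times_bop.rep_eq)
    ultimately show ?thesis by simp
  qed
  have iW: "inner (W x) x = inner (Z (U x)) (U x)" for x by (simp add: inner_eq_Re_cinner cW)
  interpret W: spectral_pvm P W "spectral_measure_on P W" "\<zeta> t0" "\<zeta> t1"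
  proof (rule spectral_measure_on[OF Wpos Wcorner P_proj])
    show "0 \<le> \<zeta> t0" using \<zeta>pos[OF t0(1)] by simp
    show "\<zeta> t0 * (norm (P x))\<^sup>2 \<le> inner (W x) x" for x
      using I.fcalc_bounds(1)[OF Z c\<zeta> t0(2), of "U x"] by (simp add: iW nU)
    show "inner (W x) x \<le> \<zeta> t1 * (norm (P x))\<^sup>2" for x
      using I.fcalc_bounds(2)[OF Z c\<zeta> t1(2), of "U x"] by (simp add: iW nU)
  qed
  have "continuous_on {\<zeta> t0..\<zeta> t1} f"
    by (rule continuous_on_subset[OF f]) (use \<zeta>pos[OF t0(1)] in auto)
  then obtain X where X: "W.fcalc f X" using W.fcalc_exists by blast
  \<comment> \<open>The same polynomials applied to W converge to f(W) and, after conjugation, to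
    the conjugate of f(Z).\<close>
  have "X = Y * F * U"
  proof -
    obtain p where p: "uniform_limit {\<zeta> t0..\<zeta> t1} (\<lambda>n. poly (p n)) f sequentially" "(\<lambda>n. poly_op P (p n) W) \<longlonglongrightarrow> X"
      using X unfolding W.fcalc_def by blast
    have "(\<lambda>n. poly_op P (p n) Z) \<longlonglongrightarrow> F"
      by (rule I.poly_op_comp_tendsto[OF Z c\<zeta> F cf p(1)]) (use t0 t1 in auto)
    then have "(\<lambda>n. Y * poly_op P (p n) Z * U) \<longlonglongrightarrow> Y * F * U" by (intro tendsto_intros)
    then show ?thesis
      using p(2) LIMSEQ_unique unfolding W_def poly_op_conj[OF Y(1,2,3,4) corner[OF Z] PP] by blast
  qed
  moreover have "cfc_on P f W = X" by (rule W.cfc_on_eq[OF X])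
  ultimately have cfc: "cfc_on (support_proj B') f (rel_op A' B') = Y * F * U" by (simp add: rel Y(5))
  have saX: "selfadjoint_op (Y * F * U)" using W.fcalc_selfadjoint[OF X] \<open>X = Y * F * U\<close> by simp
  have inner_eq: "inner ((Y * F * U) (?M e)) (?M e) = (\<integral>t. indicat_real {lo..hi} t * \<phi> t \<partial>\<mu> (K e))" for e
  proof -
    have "inner ((Y * F * U) (?M e)) (?M e) = inner ((H * F * H) (K e)) (K e)"
      using sandwich[of F e e]
      by (simp add: inner_eq_Re_cinner times_bop.rep_eq selfadjoint_cinner[OF M] selfadjoint_cinner[OF K])
    also have "\<dots> = (\<integral>t. indicat_real {lo..hi} t * (\<beta> t * f (\<zeta> t)) \<partial>\<mu> (K e))"
      by (rule I.fcalc_inner[OF HXH[OF F cf]]) (intro continuous_intros c\<beta> cf)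
    finally show ?thesis by (simp add: \<phi>_def \<beta>_def \<alpha>_def \<zeta>_def)
  qed
  show "max_f_div_comparable f A' B' = infsum (\<lambda>e. \<integral>t. indicat_real {lo..hi} t * \<phi> t \<partial>\<mu> (K e)) some_onb"
    unfolding max_f_div_comparable_def cfc trace_sandwich(2)[OF B'pos tc saX] inner_eq ..
  show "(\<lambda>e. \<integral>t. indicat_real {lo..hi} t * \<phi> t \<partial>\<mu> (K e)) summable_on some_onb"
    using trace_sandwich(3)[OF B'pos tc saX] unfolding inner_eq .
qed

end

section \<open>The scalar perspective of a convex function\<close>

lemma ell2_nontrivial: "\<exists>v :: ell2. v \<noteq> 0"
proof -
  define v where "v = Ell2 (\<lambda>n. if n = 0 then 1 else 0)"
  have "summable (\<lambda>n :: nat. (cmod (if n = 0 then 1 else 0))\<^sup>2)"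
    by (rule summable_finite[of "{0}"]) auto
  then have "ell2_coord v 0 = 1" by (simp add: v_def Ell2_inverse)
  then have "v \<noteq> 0" by (auto simp: zero_ell2.rep_eq)
  then show ?thesis ..
qed

text \<open>With lo = hi = x the calculus lives on a single point, where f agrees with a
  constant.\<close>

lemma cfc_on_scalar:
  fixes x :: real
  assumes x: "0 \<le> x"
  shows "cfc_on 1 f (x *\<^sub>R (1 :: 'a::complex_hilbert bop)) = f x *\<^sub>R 1"
proof -
  have one: "projection_op (1 :: 'a bop)" by (simp add: projection_op_def selfadjoint_intros)
  interpret spectral_pvm "1 :: 'a bop" "x *\<^sub>R 1" "spectral_measure_on 1 (x *\<^sub>R 1)" x x
    by (rule spectral_measure_on[OF _ _ one x])
      (use x in \<open>simp_all add: positive_op_scaleR positive_op_one corner_def bop_rep_eq power2_norm_eq_inner\<close>)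
  have "fcalc f (f x *\<^sub>R 1 + 0 *\<^sub>R (x *\<^sub>R 1))"
    by (rule fcalc_cong[OF fcalc_affine]) auto
  from cfc_on_eq[OF this] show ?thesis by simp
qed

text \<open>On positive scalar operators of the sequence space the operator inequality is the scalar
  one times the identity; a nonzero vector reads off its sign.\<close>

lemma operator_convex_imp_convex:
  assumes f: "operator_convex f"
  shows "convex_on {0<..} f"
proof (rule convex_onI)
  fix t x y :: real assume t: "0 < t" "t < 1" and xy: "x \<in> {0<..}" "y \<in> {0<..}"
  define z where "z = (1 - t) * x + t * y"
  have z: "0 \<le> z" using t xy by (simp add: z_def)
  have pos: "positive_op (x *\<^sub>R (1 :: ell2 bop)) \<and> invertible_on 1 (x *\<^sub>R (1 :: ell2 bop))" if "0 < x" for x :: real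
  proof
    show "positive_op (x *\<^sub>R (1 :: ell2 bop))" using that by (intro positive_op_scaleR positive_op_one) simp
    show "invertible_on 1 (x *\<^sub>R (1 :: ell2 bop))"
      unfolding invertible_on_def
      by (rule bexI[of _ "(1 / x) *\<^sub>R 1"]) (use that in \<open>simp_all add: corner_def\<close>)
  qed
  have comb: "(1 - t) *\<^sub>R x *\<^sub>R (1 :: ell2 bop) + t *\<^sub>R y *\<^sub>R 1 = z *\<^sub>R 1"
    by (simp add: z_def scaleR_add_left)
  have "cfc_on 1 f ((1 - t) *\<^sub>R x *\<^sub>R (1 :: ell2 bop) + t *\<^sub>R y *\<^sub>R 1)
      \<le>\<^sub>B (1 - t) *\<^sub>R cfc_on 1 f (x *\<^sub>R 1) + t *\<^sub>R cfc_on 1 f (y *\<^sub>R 1)"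
    using f[unfolded operator_convex_def, rule_format, of "x *\<^sub>R 1" "y *\<^sub>R 1" t] pos xy t by simp
  then have "f z *\<^sub>R (1 :: ell2 bop) \<le>\<^sub>B (1 - t) *\<^sub>R f x *\<^sub>R 1 + t *\<^sub>R f y *\<^sub>R 1"
    unfolding comb using xy z by (simp add: cfc_on_scalar)
  then have "positive_op (((1 - t) * f x + t * f y - f z) *\<^sub>R (1 :: ell2 bop))"
    by (simp add: op_le_def scaleR_add_left scaleR_diff_left)
  moreover obtain v :: ell2 where "v \<noteq> 0" using ell2_nontrivial by blast
  ultimately have "0 \<le> ((1 - t) * f x + t * f y - f z) * inner v v" "0 < inner v v"
    using positive_op_inner[of "((1 - t) * f x + t * f y - f z) *\<^sub>R 1" v] by (simp_all add: bop_rep_eq)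
  then have "0 \<le> (1 - t) * f x + t * f y - f z" by (simp add: zero_le_mult_iff)
  then show "f ((1 - t) *\<^sub>R x + t *\<^sub>R y) \<le> (1 - t) * f x + t * f y" by (simp add: z_def)
qed (rule convex_real_interval)

section \<open>Shifted perspectives and their monotone limits\<close>

lemma antimono_tendsto_at_right:
  fixes u :: "real \<Rightarrow> real"
  assumes u: "\<And>a b. 0 < a \<Longrightarrow> a \<le> b \<Longrightarrow> b < 1 \<Longrightarrow> u b \<le> u a"
  shows "((\<lambda>a. ereal (u a)) \<longlongrightarrow> (SUP a\<in>{0<..<1}. ereal (u a))) (at_right 0)"
proof (rule order_tendstoI)
  fix y assume "y < (SUP a\<in>{0<..<1}. ereal (u a))"
  then obtain b where b: "0 < b" "b < 1" "y < ereal (u b)" by (auto simp: less_SUP_iff)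
  have "eventually (\<lambda>a. a \<in> {0<..<b}) (at_right 0)" using b(1) by (rule eventually_at_right_real)
  then show "eventually (\<lambda>a. y < ereal (u a)) (at_right 0)"
  proof eventually_elim
    case (elim a)
    then have "ereal (u b) \<le> ereal (u a)" using u[of a b] b by simp
    then show ?case using b(3) by (rule less_le_trans[rotated])
  qed
next
  fix y assume y: "(SUP a\<in>{0<..<1}. ereal (u a)) < y"
  have "eventually (\<lambda>a. a \<in> {0<..<1::real}) (at_right 0)" by (rule eventually_at_right_real) simp
  then show "eventually (\<lambda>a. ereal (u a) < y) (at_right 0)"
    by eventually_elim (use y in \<open>meson SUP_upper le_less_trans\<close>)
qed

definition shifted_perspective :: "(real \<Rightarrow> real) \<Rightarrow> real \<Rightarrow> real \<Rightarrow> real"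
  where "shifted_perspective f a t = (1 - t + a) * f ((t + a) / (1 - t + a))"

context
  fixes f :: "real \<Rightarrow> real"
  assumes conv: "convex_on {0<..} f"
begin

lemma convex_continuous: "continuous_on {0<..} f"
  by (rule convex_on_continuous[OF _ conv]) simp

text \<open>The quotient (x + d) / (y + d) is the convex combination of x / y and 1 with weights y /
  (y + d) and d / (y + d). The last term is the perspective at (d, d).\<close>

lemma perspective_subadditive:
  assumes "0 < x" "0 < y" "0 \<le> d"
  shows "(y + d) * f ((x + d) / (y + d)) \<le> y * f (x / y) + d * f 1"
proof -
  define s where "s = d / (y + d)"
  have s: "0 \<le> s" "s \<le> 1" "1 - s = y / (y + d)" using assms by (simp_all add: s_def field_simps)
  have "(x + d) / (y + d) = (1 - s) *\<^sub>R (x / y) + s *\<^sub>R 1"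
    using assms unfolding s(3) by (simp add: s_def add_divide_distrib)
  then have "f ((x + d) / (y + d)) \<le> (1 - s) * f (x / y) + s * f 1"
    using convex_onD[OF conv s(1,2), of "x / y" 1] assms by simp
  then have "(y + d) * f ((x + d) / (y + d)) \<le> (y + d) * ((1 - s) * f (x / y) + s * f 1)"
    using assms by (intro mult_left_mono) auto
  also have "\<dots> = y * f (x / y) + d * f 1"
    using assms unfolding s(3) by (simp add: s_def distrib_left)
  finally show ?thesis .
qed

lemma shifted_perspective_antimono:
  assumes "0 < t + a" "0 < 1 - t + a" "a \<le> b"
  shows "shifted_perspective f b t - b * f 1 \<le> shifted_perspective f a t - a * f 1"
proof -
  have "(1 - t + a + (b - a)) * f ((t + a + (b - a)) / (1 - t + a + (b - a)))
      \<le> (1 - t + a) * f ((t + a) / (1 - t + a)) + (b - a) * f 1"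
    by (rule perspective_subadditive) (use assms in auto)
  then show ?thesis by (simp add: shifted_perspective_def algebra_simps)
qed

text \<open>The perspective of a supporting line f(1) + p (s - 1) is the linear function y f(1) + p
  (x - y). Here x - y = 2 t - 1, and y - a = 1 - t lies in [0, 1], so l = |f(1)| + |p| works for all
  a at once. Including a = 0 serves the comparable case.\<close>

lemma shifted_perspective_lower:
  obtains l where "0 \<le> l" "\<And>a t. 0 \<le> a \<Longrightarrow> a \<le> 1 \<Longrightarrow> 0 < t + a \<Longrightarrow> 0 < 1 - t + a \<Longrightarrow> t \<in> {0..1} \<Longrightarrow>
    - l \<le> shifted_perspective f a t - a * f 1"
proof -
  \<comment> \<open>The right derivative of f at 1, as an infimum of difference quotients.\<close>
  define p where "p = Inf ((\<lambda>t. (f 1 - f t) / (1 - t)) ` ({1<..} \<inter> {0<..}))"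
  have p: "f 1 + p * (s - 1) \<le> f s" if "0 < s" for s
    unfolding p_def by (rule convex_le_Inf_differential[OF conv]) (use that in \<open>auto simp: interior_open\<close>)
  show thesis
  proof (rule that[of "\<bar>f 1\<bar> + \<bar>p\<bar>"])
    fix a t :: real assume a: "0 \<le> a" "a \<le> 1" "0 < t + a" "0 < 1 - t + a" "t \<in> {0..1}"
    have "(1 - t + a) * (f 1 + p * ((t + a) / (1 - t + a) - 1)) \<le> shifted_perspective f a t"
      unfolding shifted_perspective_def using a by (intro mult_left_mono p divide_pos_pos) auto
    moreover have "(1 - t + a) * (f 1 + p * ((t + a) / (1 - t + a) - 1)) = (1 - t + a) * f 1 + p * (2 * t - 1)"
      using a(4) by (simp add: field_simps)
    ultimately have le: "(1 - t) * f 1 + p * (2 * t - 1) \<le> shifted_perspective f a t - a * f 1"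
      by (simp add: algebra_simps)
    have "\<bar>(1 - t) * f 1\<bar> \<le> 1 * \<bar>f 1\<bar>" "\<bar>p * (2 * t - 1)\<bar> \<le> \<bar>p\<bar> * 1"
      unfolding abs_mult using a(5) by (intro mult_right_mono mult_left_mono; simp add: abs_le_iff)+
    then show "- (\<bar>f 1\<bar> + \<bar>p\<bar>) \<le> shifted_perspective f a t - a * f 1" using le by linarith
  qed simp
qed

text \<open>Subtracting a f(1) makes the value decrease in a, so the limit exists in the extended
  reals; the subtracted term tends to 0.\<close>

lemma shifted_perspective_limit:
  assumes t: "t \<in> {0..1}"
  obtains L where "((\<lambda>a. ereal (shifted_perspective f a t)) \<longlongrightarrow> L) (at_right 0)"
proof -
  have "((\<lambda>a. ereal (shifted_perspective f a t - a * f 1)) \<longlongrightarrow>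
      (SUP a\<in>{0<..<1}. ereal (shifted_perspective f a t - a * f 1))) (at_right 0)"
    by (rule antimono_tendsto_at_right, rule shifted_perspective_antimono) (use t in auto)
  moreover have "((\<lambda>a. ereal (a * f 1)) \<longlongrightarrow> ereal (0 * f 1)) (at_right 0)"
    by (intro tendsto_intros)
  ultimately have "((\<lambda>a. ereal (shifted_perspective f a t - a * f 1) + ereal (a * f 1)) \<longlongrightarrow>
      (SUP a\<in>{0<..<1}. ereal (shifted_perspective f a t - a * f 1)) + ereal (0 * f 1)) (at_right 0)"
    by (intro tendsto_add_ereal_general1) auto
  then show thesis by (intro that) simp
qed

text \<open>Inside the interval continuity of f is enough. At an end point the limit L exists
  already, and a substitution identifies it with \<open>slope_at_inf\<close> or
  \<open>value_at_0\<close>; this also shows that the limits in those definitions exist.\<close>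

lemma shifted_perspective_tendsto:
  assumes t: "t \<in> {0..1}"
  shows "((\<lambda>a. ereal (shifted_perspective f a t)) \<longlongrightarrow> perspective f t (1 - t)) (at_right 0)"
proof -
  obtain L where L: "((\<lambda>a. ereal (shifted_perspective f a t)) \<longlongrightarrow> L) (at_right 0)"
    using shifted_perspective_limit[OF t] by blast
  consider "0 < t" "t < 1" | "t = 1" | "t = 0" using t by force
  then show ?thesis
  proof cases
    case 1
    have "isCont f (t / (1 - t))"
      using convex_continuous 1 by (intro continuous_on_interior[of "{0<..}"]) (auto simp: interior_open)
    moreover have "((\<lambda>a. (t + a) / (1 - t + a)) \<longlongrightarrow> (t + 0) / (1 - t + 0)) (at_right 0)"
      using 1 by (intro tendsto_intros) auto
    ultimately have "((\<lambda>a. f ((t + a) / (1 - t + a))) \<longlongrightarrow> f (t / (1 - t))) (at_right 0)"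
      by (intro isCont_tendsto_compose[of "t / (1 - t)" f]) simp_all
    moreover have "((\<lambda>a. 1 - t + a) \<longlongrightarrow> 1 - t + 0) (at_right 0)" by (intro tendsto_intros)
    ultimately have "((\<lambda>a. (1 - t + a) * f ((t + a) / (1 - t + a))) \<longlongrightarrow> (1 - t + 0) * f (t / (1 - t))) (at_right 0)"
      by (intro tendsto_mult)
    then show ?thesis using 1 by (simp add: shifted_perspective_def perspective_def)
  next
    case 2
    \<comment> \<open>The substitution a = 1 / (s - 1) turns (1 + a) / a into s, so the value is
      f(s) / (s - 1). The factor 1 - 1 / s, which tends to 1, corrects it to f(s) / s.\<close>
    have top: "filterlim (\<lambda>s :: real. - 1 + s) at_top at_top"
      by (rule filterlim_tendsto_add_at_top[OF tendsto_const filterlim_ident])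
    have fl: "filterlim (\<lambda>s :: real. inverse (- 1 + s)) (at_right 0) at_top"
      by (rule filterlim_compose[OF filterlim_inverse_at_right_top top])
    have "((\<lambda>s. ereal (shifted_perspective f (inverse (- 1 + s)) 1) * ereal (1 + - 1 * inverse s)) \<longlongrightarrow> L * ereal (1 + - 1 * 0)) at_top"
    proof (rule tendsto_mult_ereal)
      show "((\<lambda>s. ereal (shifted_perspective f (inverse (- 1 + s)) 1)) \<longlongrightarrow> L) at_top"
        using filterlim_compose[OF L fl] 2 by simp
      show "((\<lambda>s :: real. ereal (1 + - 1 * inverse s)) \<longlongrightarrow> ereal (1 + - 1 * 0)) at_top"
        by (intro tendsto_intros tendsto_inverse_0_at_top filterlim_ident)
    qed simp
    moreover have "eventually (\<lambda>s. ereal (shifted_perspective f (inverse (- 1 + s)) 1) * ereal (1 + - 1 * inverse s) = ereal (f s / s)) at_top"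
      using eventually_gt_at_top[of 1]
    proof eventually_elim
      case (elim s)
      have "(1 + inverse (- 1 + s)) / inverse (- 1 + s) = s" using elim by (simp add: field_simps)
      then have "shifted_perspective f (inverse (- 1 + s)) 1 * (1 + - 1 * inverse s) = inverse (- 1 + s) * f s * (1 - inverse s)"
        by (simp add: shifted_perspective_def)
      also have "\<dots> = f s / s" using elim by (simp add: field_simps)
      finally show ?case by simp
    qed
    ultimately have "((\<lambda>s. ereal (f s / s)) \<longlongrightarrow> L * ereal (1 + - 1 * 0)) at_top"
      by (rule Lim_transform_eventually)
    then have "((\<lambda>s. ereal (f s / s)) \<longlongrightarrow> L) at_top" by (simp add: one_ereal_def[symmetric])
    then have "slope_at_inf f = L" unfolding slope_at_inf_def by (intro tendsto_Lim) simp_all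
    then show ?thesis using L 2 by (simp add: perspective_def one_ereal_def[symmetric])
  next
    case 3
    \<comment> \<open>The substitution a = d / (1 - d) turns a / (1 + a) into d, so the value is
      f(d) / (1 - d), corrected by the factor 1 - d.\<close>
    have fl: "filterlim (\<lambda>d :: real. d / (1 - d)) (at_right 0) (at_right 0)"
      unfolding filterlim_at
    proof
      have "eventually (\<lambda>d. d \<in> {0<..<1::real}) (at_right 0)" by (rule eventually_at_right_real) simp
      then show "eventually (\<lambda>d :: real. d / (1 - d) \<in> {0<..} \<and> d / (1 - d) \<noteq> 0) (at_right 0)"
        by eventually_elim simp
      have "((\<lambda>d :: real. d / (1 - d)) \<longlongrightarrow> 0 / (1 - 0)) (at_right 0)" by (intro tendsto_intros) auto
      then show "((\<lambda>d :: real. d / (1 - d)) \<longlongrightarrow> 0) (at_right 0)" by simp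
    qed
    have "((\<lambda>d. ereal (shifted_perspective f (d / (1 - d)) 0) * ereal (1 - d)) \<longlongrightarrow> L * ereal (1 - 0)) (at_right 0)"
    proof (rule tendsto_mult_ereal)
      show "((\<lambda>d. ereal (shifted_perspective f (d / (1 - d)) 0)) \<longlongrightarrow> L) (at_right 0)"
        using filterlim_compose[OF L fl] 3 by simp
      show "((\<lambda>d :: real. ereal (1 - d)) \<longlongrightarrow> ereal (1 - 0)) (at_right 0)" by (intro tendsto_intros)
    qed simp
    moreover have "eventually (\<lambda>d. d \<in> {0<..<1::real}) (at_right 0)" by (rule eventually_at_right_real) simp
    then have "eventually (\<lambda>d. ereal (shifted_perspective f (d / (1 - d)) 0) * ereal (1 - d) = ereal (f d)) (at_right 0)"
    proof eventually_elim
      case (elim d)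
      have "1 + d / (1 - d) = 1 / (1 - d)" using elim by (simp add: field_simps)
      moreover have "d / (1 - d) / (1 / (1 - d)) = d" using elim by simp
      ultimately have "shifted_perspective f (d / (1 - d)) 0 * (1 - d) = f d"
        using elim by (simp add: shifted_perspective_def)
      then show ?case by simp
    qed
    ultimately have "((\<lambda>d. ereal (f d)) \<longlongrightarrow> L * ereal (1 - 0)) (at_right 0)"
      by (rule Lim_transform_eventually)
    then have "((\<lambda>d. ereal (f d)) \<longlongrightarrow> L) (at_right 0)" by (simp add: one_ereal_def[symmetric])
    then have "value_at_0 f = L" unfolding value_at_0_def by (intro tendsto_Lim) simp_all
    then show ?thesis using L 3 by (simp add: perspective_def one_ereal_def[symmetric])
  qed
qed

lemma shifted_perspective_continuous:
  assumes "0 < lo + a" "0 < 1 - hi + a"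
  shows "continuous_on {lo..hi} (shifted_perspective f a)"
  unfolding shifted_perspective_def
proof (intro continuous_intros continuous_on_compose2[OF convex_continuous])
  show "(\<lambda>t. (t + a) / (1 - t + a)) ` {lo..hi} \<subseteq> {0<..}"
    using assms by (auto intro!: divide_pos_pos)
  show "\<forall>t\<in>{lo..hi}. 1 - t + a \<noteq> 0" using assms by auto
qed

lemma perspective_measurable: "(\<lambda>r. perspective f r (1 - r)) \<in> borel_measurable borel"
proof -
  have "continuous_on {0<..<1} (\<lambda>r. (1 - r) * f (r / (1 - r)))"
    by (intro continuous_intros continuous_on_compose2[OF convex_continuous]) auto
  then have 1: "(\<lambda>r. indicat_real {0<..<1} r *\<^sub>R ((1 - r) * f (r / (1 - r)))) \<in> borel_measurable borel"
    by (rule borel_measurable_continuous_on_indicator[rotated]) simp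
  have "(\<lambda>r. perspective f r (1 - r)) = (\<lambda>r. if r \<in> {0<..<1} then ereal (indicat_real {0<..<1} r *\<^sub>R ((1 - r) * f (r / (1 - r))))
      else if r = 1 then slope_at_inf f * ereal r else value_at_0 f * ereal (1 - r))"
    by (auto simp: perspective_def fun_eq_iff)
  also have "\<dots> \<in> borel_measurable borel" using 1 by measurable
  finally show ?thesis .
qed

end

section \<open>The trace of the perspective\<close>

context positive_pair
begin

text \<open>Links the real sum of \<open>max_f_div_formula\<close> with the \<open>ennreal\<close>
  sum of \<open>perspective_decomposition\<close>. Adding l to the integrand adds l times the mass
  of \<mu> at K e, which is l <C e, e>, and these sum to l \<tau>.\<close>

lemma trace_bridge:
  assumes pvm': "spectral_pvm P R E lo hi" and tc: "trace_class C"
    and cont: "continuous_on {lo..hi} \<phi>" and le: "\<And>t. t \<in> {lo..hi} \<Longrightarrow> - l \<le> \<phi> t"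
    and sum: "(\<lambda>e. \<integral>t. indicat_real {lo..hi} t * \<phi> t \<partial>\<mu> (K e)) summable_on some_onb"
    and q: "\<And>t. t \<in> {lo..hi} \<Longrightarrow> q t = ennreal (\<phi> t + l)"
  defines "v \<equiv> infsum (\<lambda>e. \<integral>t. indicat_real {lo..hi} t * \<phi> t \<partial>\<mu> (K e)) some_onb"
    and "\<tau> \<equiv> infsum (\<lambda>e. inner (C e) e) some_onb"
  shows "infsum (\<lambda>e. \<integral>\<^sup>+t. q t \<partial>\<mu> (K e)) some_onb = ennreal (v + l * \<tau>)" "0 \<le> v + l * \<tau>"
proof -
  interpret I: spectral_pvm P R E lo hi by (rule pvm')
  have "bounded (\<phi> ` {lo..hi})" by (intro compact_imp_bounded compact_continuous_image cont compact_Icc)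
  then obtain b where b: "\<forall>t\<in>{lo..hi}. \<bar>\<phi> t\<bar> \<le> b" by (auto simp: bounded_iff simp del: atLeastAtMost_iff)
  have meas: "(\<lambda>t. indicat_real {lo..hi} t * \<phi> t) \<in> borel_measurable borel"
    using borel_measurable_continuous_on_indicator[OF _ cont] by simp
  have int: "integrable (\<mu> x) (\<lambda>t. indicat_real {lo..hi} t * \<phi> t)" for x
    by (rule I.integrable_bounded[OF meas, of b]) (use b in auto)
  define w where "w e = (\<integral>t. indicat_real {lo..hi} t * \<phi> t \<partial>\<mu> (K e)) + l * inner (C e) e" for e
  have w: "(\<integral>\<^sup>+t. q t \<partial>\<mu> (K e)) = ennreal (w e)" "0 \<le> w e" for e
  proof -
    interpret finite_measure "\<mu> (K e)" by (rule finite_mu)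
    have "measure (\<mu> (K e)) UNIV = inner (C e) e"
      by (simp add: measure_mu E_UNIV support_sqrt_apply[OF C] norm_sqrt_op[OF C])
    then have iw: "(\<integral>t. indicat_real {lo..hi} t * \<phi> t + l \<partial>\<mu> (K e)) = w e"
      using int[of "K e"] by (simp add: w_def mult.commute)
    have int': "integrable (\<mu> (K e)) (\<lambda>t. indicat_real {lo..hi} t * \<phi> t + l)" using int by simp
    have nn: "AE t in \<mu> (K e). 0 \<le> indicat_real {lo..hi} t * \<phi> t + l"
      using I.AE_bounds[of "K e"]
    proof eventually_elim
      case (elim t)
      then show ?case using le[OF elim] by simp
    qed
    have "(\<integral>\<^sup>+t. q t \<partial>\<mu> (K e)) = (\<integral>\<^sup>+t. ennreal (indicat_real {lo..hi} t * \<phi> t + l) \<partial>\<mu> (K e))"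
    proof (rule nn_integral_cong_AE)
      show "AE t in \<mu> (K e). q t = ennreal (indicat_real {lo..hi} t * \<phi> t + l)"
        using I.AE_bounds[of "K e"]
      proof eventually_elim
        case (elim t)
        then show ?case using q[OF elim] by simp
      qed
    qed
    also have "\<dots> = ennreal (w e)" unfolding iw[symmetric] by (rule nn_integral_eq_integral[OF int' nn])
    finally show "(\<integral>\<^sup>+t. q t \<partial>\<mu> (K e)) = ennreal (w e)" .
    show "0 \<le> w e" unfolding iw[symmetric] by (rule integral_nonneg_AE[OF nn])
  qed
  have sC: "(\<lambda>e. inner (C e) e) summable_on some_onb"
    using hs_summable[of K] tc by (simp add: trace_class_positive_iff[OF C] norm_sqrt_op[OF C])
  have sw: "w summable_on some_onb"
    unfolding w_def by (intro summable_on_add summable_on_cmult_right sum sC)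
  have iw: "infsum w some_onb = v + l * \<tau>"
    unfolding w_def v_def \<tau>_def
    by (simp add: infsum_add[OF sum summable_on_cmult_right[OF sC]] infsum_cmult_right')
  show "infsum (\<lambda>e. \<integral>\<^sup>+t. q t \<partial>\<mu> (K e)) some_onb = ennreal (v + l * \<tau>)"
    unfolding w(1) by (subst infsum_ennreal[OF sw]) (simp_all add: w(2) iw)
  show "0 \<le> v + l * \<tau>" unfolding iw[symmetric] by (rule infsum_nonneg) (rule w(2))
qed

text \<open>B \<le> l A says P - R \<le> l R, that is R \<ge> P / (1 + l); likewise A \<le> l B says
  R \<le> l P / (1 + l). Both are tested on the range of K.\<close>

lemma comparable_bounds:
  assumes "comparable_ops A B"
  obtains lo hi where "0 < lo" "lo \<le> hi" "hi < 1" "spectral_pvm P R E lo hi"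
proof -
  obtain l0 where l0: "0 < l0" "inverse l0 *\<^sub>R B \<le>\<^sub>B A" "A \<le>\<^sub>B l0 *\<^sub>R B"
    using assms unfolding comparable_ops_def by blast
  \<comment> \<open>Enlarging the constant to at least 1 ensures lo \<le> hi.\<close>
  define l where "l = max l0 1"
  have l: "1 \<le> l" "l0 \<le> l" by (simp_all add: l_def)
  have BA: "inner (B x) x \<le> l * inner (A x) x" for x
  proof -
    have "inverse l0 * inner (B x) x \<le> inner (A x) x"
      using positive_op_inner[of "A - inverse l0 *\<^sub>R B" x] l0(2) by (simp add: op_le_def bop_rep_eq inner_diff_left)
    then have "inner (B x) x \<le> l0 * inner (A x) x" using l0(1) by (simp add: field_simps)
    also have "\<dots> \<le> l * inner (A x) x" using l(2) positive_op_inner[OF A] by (rule mult_right_mono)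
    finally show ?thesis .
  qed
  have AB: "inner (A x) x \<le> l * inner (B x) x" for x
  proof -
    have "inner (A x) x \<le> l0 * inner (B x) x"
      using positive_op_inner[of "l0 *\<^sub>R B - A" x] l0(3) by (simp add: op_le_def bop_rep_eq inner_diff_left)
    also have "\<dots> \<le> l * inner (B x) x" using l(2) positive_op_inner[OF B] by (rule mult_right_mono)
    finally show ?thesis .
  qed
  define lo hi where "lo = 1 / (1 + l)" and "hi = l / (1 + l)"
  have lh: "0 < lo" "lo \<le> hi" "hi < 1" using l by (simp_all add: lo_def hi_def divide_right_mono)
  have iR: "inner (R (K y)) (K y) = inner (A y) y" for y
  proof -
    have "inner (R (K y)) (K y) = inner (compress A B R y) y"
      by (simp add: compress_def bop_rep_eq selfadjoint_inner[OF K])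
    also have "compress A B R = A" by (rule RS_pair(4)[OF A B, symmetric])
    finally show ?thesis .
  qed
  have iP: "inner (P (K y)) (K y) = inner (A y) y + inner (B y) y" for y
    using norm_sqrt_op[OF C, of y]
    by (simp add: support_sqrt_apply[OF C] power2_norm_eq_inner bop_rep_eq inner_add_left)
  have PC: "P \<in> corner P" using P_proj by (simp add: corner_def projection_op_def)
  have cor: "s *\<^sub>R P + r *\<^sub>R R \<in> corner P" for r s
    using PC RS_pair(1)[OF A B] by (simp add: corner_def algebra_simps)
  have "0 \<le> inner ((- lo *\<^sub>R P + 1 *\<^sub>R R) x) x" for x
  proof (rule corner_positive_density[OF C cor])
    show "0 \<le> inner ((- lo *\<^sub>R P + 1 *\<^sub>R R) (K y)) (K y)" for y
      using BA[of y] l by (simp add: bop_rep_eq inner_add_left iR lo_def field_simps inner_diff_left iP)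
  qed
  moreover have "0 \<le> inner ((hi *\<^sub>R P + (- 1) *\<^sub>R R) x) x" for x
  proof (rule corner_positive_density[OF C cor])
    show "0 \<le> inner ((hi *\<^sub>R P + (- 1) *\<^sub>R R) (K y)) (K y)" for y
      using AB[of y] l by (simp add: bop_rep_eq inner_add_left iR hi_def field_simps inner_diff_left iP)
  qed
  ultimately have "spectral_pvm P R E lo hi"
    using lh by (intro spectral_pvm_bounds) (simp_all add: bop_rep_eq inner_diff_left inner_add_left projection_inner[OF P_proj])
  then show thesis using lh by (intro that)
qed

lemma compress_affine: "compress A B (r *\<^sub>R P + s *\<^sub>R R) = r *\<^sub>R C + s *\<^sub>R A"
proof -
  have "compress A B (r *\<^sub>R P + s *\<^sub>R R) = r *\<^sub>R compress A B P + s *\<^sub>R compress A B R"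
    by (simp add: compress_def algebra_simps)
  then show ?thesis using RS_pair(4)[OF A B] by (simp add: compress_P)
qed

lemma ext_trace_op_perspective:
  assumes conv: "convex_on {0<..} f" and tc: "trace_class A" "trace_class B"
  shows "op_perspective f A B \<in> hatB_pos_plus_C1_sa \<and> ext_trace (op_perspective f A B) = max_f_div f A B"
proof -
  define g where "g r = perspective f r (1 - r)" for r
  obtain l where l: "0 \<le> l" and le: "\<And>a t. 0 \<le> a \<Longrightarrow> a \<le> 1 \<Longrightarrow> 0 < t + a \<Longrightarrow> 0 < 1 - t + a \<Longrightarrow> t \<in> {0..1} \<Longrightarrow>
      - l \<le> shifted_perspective f a t - a * f 1"
    using shifted_perspective_lower[OF conv] by metis
  have tcC: "trace_class C" by (rule trace_class_positive_add[OF A tc(1) B tc(2)])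
  have g: "g \<in> borel_measurable borel" unfolding g_def by (rule perspective_measurable[OF conv])
  have h_tendsto: "((\<lambda>a. ereal (shifted_perspective f a t + (l - a * f 1))) \<longlongrightarrow> g t + ereal l) (at_right 0)"
    if t: "t \<in> {0..1}" for t
  proof -
    have "((\<lambda>a. ereal (l - a * f 1)) \<longlongrightarrow> ereal (l - 0 * f 1)) (at_right 0)" by (intro tendsto_intros)
    then have "((\<lambda>a. ereal (shifted_perspective f a t) + ereal (l - a * f 1)) \<longlongrightarrow> g t + ereal (l - 0 * f 1)) (at_right 0)"
      unfolding g_def by (intro tendsto_add_ereal_general1 shifted_perspective_tendsto[OF conv t]) auto
    then show ?thesis by simp
  qed
  \<comment> \<open>At the end points g is accessible only as a limit, so the bound is inherited
    from the shifted functions.\<close>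
  have gl: "ereal (- l) \<le> g t" if t: "t \<in> {0..1}" for t
  proof -
    have "0 \<le> g t + ereal l"
    proof (rule tendsto_lowerbound[OF h_tendsto[OF t]])
      have "eventually (\<lambda>a. a \<in> {0<..<1::real}) (at_right 0)" by (rule eventually_at_right_real) simp
      then show "eventually (\<lambda>a. 0 \<le> ereal (shifted_perspective f a t + (l - a * f 1))) (at_right 0)"
      proof eventually_elim
        case (elim a)
        then show ?case using le[of a t] t by simp
      qed
    qed simp
    then show ?thesis by (cases "g t") auto
  qed
  have op: "op_perspective f A B = (\<lambda>\<rho>\<in>normal_pos. ereal_integral (\<nu> \<rho>) g)"
    by (simp add: op_perspective_def g_def[abs_def])
  define \<tau> where "\<tau> = infsum (\<lambda>e. inner (C e) e) some_onb"
  define I where "I = infsum (\<lambda>e. \<integral>\<^sup>+t. e2ennreal (g t + ereal l) \<partial>\<mu> (K e)) some_onb"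
  note dec = perspective_decomposition[OF tc g l gl, folded op, folded \<tau>_def I_def]
  have "max_f_div f A B = enn2ereal I + ereal (- l * \<tau>)"
  proof (cases "comparable_ops A B")
    case True
    obtain lo hi where lh: "0 < lo" "lo \<le> hi" "hi < 1" and pvm': "spectral_pvm P R E lo hi"
      using comparable_bounds[OF True] by metis
    \<comment> \<open>The parameters of \<open>max_f_div_formula\<close> for the unshifted pair are
      a0 = 0, a1 = 1, b0 = 1, b1 = -1, admissible because 0 < lo and hi < 1.\<close>
    have \<phi>: "shifted_perspective f 0 t = (1 + (- 1) * t) * f ((0 + 1 * t) / (1 + (- 1) * t))" for t
      by (simp add: shifted_perspective_def)
    have AB: "A = compress A B (0 *\<^sub>R P + 1 *\<^sub>R R)" "B = compress A B (1 *\<^sub>R P + (- 1) *\<^sub>R R)"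
      by (simp_all only: compress_affine) simp_all
    have pos: "0 < 0 + 1 * t" "0 < 1 + (- 1) * t" if "t \<in> {lo..hi}" for t using that lh by auto
    note F = max_f_div_formula[OF pvm' lh(2) convex_continuous[OF conv] pos AB tc(2), folded \<phi>]
    define v where "v = infsum (\<lambda>e. \<integral>t. indicat_real {lo..hi} t * shifted_perspective f 0 t \<partial>\<mu> (K e)) some_onb"
    have cont: "continuous_on {lo..hi} (shifted_perspective f 0)"
      by (rule shifted_perspective_continuous[OF conv]) (use lh in auto)
    have low: "- l \<le> shifted_perspective f 0 t" if "t \<in> {lo..hi}" for t
      using le[of 0 t] that lh by simp
    have q: "e2ennreal (g t + ereal l) = ennreal (shifted_perspective f 0 t + l)" if "t \<in> {lo..hi}" for t
      using that lh by (simp add: g_def perspective_def shifted_perspective_def)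
    have sum: "(\<lambda>e. \<integral>t. indicat_real {lo..hi} t * shifted_perspective f 0 t \<partial>\<mu> (K e)) summable_on some_onb"
      by (rule F(2))
    note br = trace_bridge[OF pvm' tcC cont low sum q]
    have "I = ennreal (v + l * \<tau>)" unfolding I_def v_def \<tau>_def by (rule br(1))
    moreover have "0 \<le> v + l * \<tau>" unfolding v_def \<tau>_def by (rule br(2))
    moreover have v: "max_f_div_comparable f A B = v" unfolding v_def by (rule F(1))
    ultimately show ?thesis using True by (simp add: max_f_div_def)
  next
    case False
    define v where "v a = infsum (\<lambda>e. \<integral>t. indicat_real {0..1} t * shifted_perspective f a t \<partial>\<mu> (K e)) some_onb" for a
    have v: "max_f_div_comparable f (A + a *\<^sub>R C) (B + a *\<^sub>R C) = v a"
      and sum: "(\<lambda>e. \<integral>t. indicat_real {0..1} t * shifted_perspective f a t \<partial>\<mu> (K e)) summable_on some_onb"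
      if a: "0 < a" for a
    proof -
      have \<phi>: "shifted_perspective f a t = ((1 + a) + (- 1) * t) * f ((a + 1 * t) / ((1 + a) + (- 1) * t))" for t
        by (simp add: shifted_perspective_def algebra_simps)
      have AB: "A + a *\<^sub>R C = compress A B (a *\<^sub>R P + 1 *\<^sub>R R)" "B + a *\<^sub>R C = compress A B ((1 + a) *\<^sub>R P + (- 1) *\<^sub>R R)"
        by (simp_all only: compress_affine) (simp_all add: algebra_simps)
      have tcB: "trace_class (B + a *\<^sub>R C)"
        by (intro trace_class_positive_add trace_class_positive_scaleR positive_op_scaleR A B C tc) (use a in auto)
      have pos: "0 < a + 1 * t" "0 < (1 + a) + (- 1) * t" if "t \<in> {0..1}" for t using that a by auto
      note F = max_f_div_formula[OF spectral_pvm_axioms zero_le_one convex_continuous[OF conv] pos AB tcB, folded \<phi>]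
      show "max_f_div_comparable f (A + a *\<^sub>R C) (B + a *\<^sub>R C) = v a" unfolding v_def by (rule F(1))
      show "(\<lambda>e. \<integral>t. indicat_real {0..1} t * shifted_perspective f a t \<partial>\<mu> (K e)) summable_on some_onb"
        by (rule F(2))
    qed
    have "((\<lambda>a. ereal (max_f_div_comparable f (A + a *\<^sub>R C) (B + a *\<^sub>R C))) \<longlongrightarrow> enn2ereal I + ereal (- l * \<tau>)) (at_right 0)"
    \<comment> \<open>Decreasing sequences turn the limit into monotone convergence; staying below 1
      keeps the lower bound \<open>le\<close> available.\<close>
    proof (rule tendsto_at_right_sequentially[of 0 1])
      fix s :: "nat \<Rightarrow> real" assume s: "\<And>n. 0 < s n" "\<And>n. s n < 1" "decseq s" "s \<longlonglongrightarrow> 0"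
      have fl: "filterlim s (at_right 0) sequentially"
        using s unfolding filterlim_at by (auto simp: less_imp_neq[OF s(1), symmetric])
      \<comment> \<open>The correction - s n f(1) makes Q increase with n, and l makes it
        nonnegative. The indicator secures measurability and makes monotonicity trivial off the unit
        interval.\<close>
      define Q where "Q n t = ennreal (indicat_real {0..1} t * (shifted_perspective f (s n) t + (l - s n * f 1)))" for n t
      have cont: "continuous_on {0..1} (shifted_perspective f (s n))" for n
        by (rule shifted_perspective_continuous[OF conv]) (use s(1)[of n] in auto)
      have low: "0 \<le> shifted_perspective f (s n) t + (l - s n * f 1)" if "t \<in> {0..1}" for n t
        using le[of "s n" t] s(1,2)[of n] that by simp
      have Qm: "Q n \<in> borel_measurable (\<mu> x)" for n x
      proof -
        have "continuous_on {0..1} (\<lambda>t. shifted_perspective f (s n) t + (l - s n * f 1))"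
          by (intro continuous_intros cont)
        then have "(\<lambda>t. indicat_real {0..1} t * (shifted_perspective f (s n) t + (l - s n * f 1))) \<in> borel_measurable borel"
          using borel_measurable_continuous_on_indicator[of "{0..1}" "\<lambda>t. shifted_perspective f (s n) t + (l - s n * f 1)"] by simp
        then show ?thesis unfolding Q_def by simp
      qed
      have Qinc: "incseq Q"
      proof (intro incseq_SucI le_funI)
        fix n t
        have "s (Suc n) \<le> s n" using s(3) by (simp add: decseqD)
        then show "Q n t \<le> Q (Suc n) t"
          using shifted_perspective_antimono[OF conv, of t "s (Suc n)" "s n"] s(1)[of "Suc n"]
          by (auto simp: Q_def indicator_def intro!: ennreal_leI)
      qed
      have Qsup: "(SUP n. Q n t) = e2ennreal (g t + ereal l)" if t: "t \<in> {0..1}" for t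
      proof (rule LIMSEQ_unique)
        show "(\<lambda>n. Q n t) \<longlonglongrightarrow> (SUP n. Q n t)"
          using Qinc by (intro LIMSEQ_SUP) (auto simp: incseq_def le_fun_def)
        have "(\<lambda>n. e2ennreal (ereal (shifted_perspective f (s n) t + (l - s n * f 1)))) \<longlonglongrightarrow> e2ennreal (g t + ereal l)"
          by (intro tendsto_e2ennrealI filterlim_compose[OF h_tendsto[OF t] fl])
        then show "(\<lambda>n. Q n t) \<longlonglongrightarrow> e2ennreal (g t + ereal l)" using t by (simp add: Q_def)
      qed
      have "I = infsum (\<lambda>e. SUP n. \<integral>\<^sup>+t. Q n t \<partial>\<mu> (K e)) some_onb"
        unfolding I_def
      proof (rule infsum_cong)
        fix e :: 'a
        have "(\<integral>\<^sup>+t. e2ennreal (g t + ereal l) \<partial>\<mu> (K e)) = (\<integral>\<^sup>+t. (SUP n. Q n t) \<partial>\<mu> (K e))"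
        proof (rule nn_integral_cong_AE)
          show "AE t in \<mu> (K e). e2ennreal (g t + ereal l) = (SUP n. Q n t)"
            using AE_bounds[of "K e"] by eventually_elim (simp only: Qsup)
        qed
        also have "\<dots> = (SUP n. \<integral>\<^sup>+t. Q n t \<partial>\<mu> (K e))"
          by (rule nn_integral_monotone_convergence_SUP[OF Qinc Qm])
        finally show "(\<integral>\<^sup>+t. e2ennreal (g t + ereal l) \<partial>\<mu> (K e)) = (SUP n. \<integral>\<^sup>+t. Q n t \<partial>\<mu> (K e))" .
      qed
      also have "\<dots> = (SUP n. infsum (\<lambda>e. \<integral>\<^sup>+t. Q n t \<partial>\<mu> (K e)) some_onb)"
        by (rule infsum_ennreal_SUP_nat)
          (use Qinc in \<open>auto simp: incseq_def le_fun_def intro!: nn_integral_mono\<close>)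
      finally have ISUP: "I = (SUP n. infsum (\<lambda>e. \<integral>\<^sup>+t. Q n t \<partial>\<mu> (K e)) some_onb)" .
      have "incseq (\<lambda>n. infsum (\<lambda>e. \<integral>\<^sup>+t. Q n t \<partial>\<mu> (K e)) some_onb)"
        using Qinc by (auto simp: incseq_def le_fun_def intro!: infsum_mono nn_integral_mono)
      then have "(\<lambda>n. infsum (\<lambda>e. \<integral>\<^sup>+t. Q n t \<partial>\<mu> (K e)) some_onb) \<longlonglongrightarrow> I"
        unfolding ISUP by (rule LIMSEQ_SUP)
      \<comment> \<open>\<open>trace_bridge\<close> is applied with l - s n f(1) in place of l, so
        the correction reappears as a multiple of \<tau>, the trace of C.\<close>
      moreover have bridge: "infsum (\<lambda>e. \<integral>\<^sup>+t. Q n t \<partial>\<mu> (K e)) some_onb = ennreal (v (s n) + (l - s n * f 1) * \<tau>)"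
        "0 \<le> v (s n) + (l - s n * f 1) * \<tau>" for n
      proof -
        have low': "- (l - s n * f 1) \<le> shifted_perspective f (s n) t" if "t \<in> {0..1}" for t
          using low[OF that, of n] by simp
        have q: "Q n t = ennreal (shifted_perspective f (s n) t + (l - s n * f 1))" if "t \<in> {0..1}" for t
          using that by (simp add: Q_def)
        note br = trace_bridge[OF spectral_pvm_axioms tcC cont low' sum[OF s(1)] q]
        show "infsum (\<lambda>e. \<integral>\<^sup>+t. Q n t \<partial>\<mu> (K e)) some_onb = ennreal (v (s n) + (l - s n * f 1) * \<tau>)"
          unfolding v_def \<tau>_def by (rule br(1))
        show "0 \<le> v (s n) + (l - s n * f 1) * \<tau>" unfolding v_def \<tau>_def by (rule br(2))
      qed
      ultimately have "(\<lambda>n. ennreal (v (s n) + (l - s n * f 1) * \<tau>)) \<longlonglongrightarrow> I" by simp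
      then have "(\<lambda>n. ereal (v (s n) + (l - s n * f 1) * \<tau>)) \<longlonglongrightarrow> enn2ereal I"
        by (simp only: tendsto_enn2ereal_iff[symmetric] enn2ereal_ennreal[OF bridge(2)])
      moreover have "(\<lambda>n. ereal (- (l - s n * f 1) * \<tau>)) \<longlonglongrightarrow> ereal (- (l - 0 * f 1) * \<tau>)"
        by (intro tendsto_intros s)
      \<comment> \<open>Removing the shift is harmless even for infinite I, because the limit of the
        second summand is finite.\<close>
      ultimately have "(\<lambda>n. ereal (v (s n) + (l - s n * f 1) * \<tau>) + ereal (- (l - s n * f 1) * \<tau>))
          \<longlonglongrightarrow> enn2ereal I + ereal (- (l - 0 * f 1) * \<tau>)"
        by (intro tendsto_add_ereal_general1) auto
      moreover have "ereal (v (s n) + (l - s n * f 1) * \<tau>) + ereal (- (l - s n * f 1) * \<tau>) = ereal (v (s n))" for n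
        by (simp add: algebra_simps)
      ultimately have "(\<lambda>n. ereal (v (s n))) \<longlonglongrightarrow> enn2ereal I + ereal (- (l - 0 * f 1) * \<tau>)"
        by (simp only:)
      then show "(\<lambda>n. ereal (max_f_div_comparable f (A + s n *\<^sub>R C) (B + s n *\<^sub>R C)))
          \<longlonglongrightarrow> enn2ereal I + ereal (- l * \<tau>)"
        by (simp add: v[OF s(1)])
    qed simp
    then show ?thesis using False by (simp add: max_f_div_def tendsto_Lim)
  qed
  then show ?thesis using dec by simp
qed

end

theorem proposition7p13:
  fixes f :: "real \<Rightarrow> real" and A B :: "'a::complex_hilbert bop"
  assumes "operator_convex f"
    and "positive_op A" and "trace_class A"
    and "positive_op B" and "trace_class B"
  shows "op_perspective f A B \<in> hatB_pos_plus_C1_sa \<and>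
    ext_trace (op_perspective f A B) = max_f_div f A B"
proof -
  interpret positive_pair A B using assms by unfold_locales
  show ?thesis using assms by (intro ext_trace_op_perspective operator_convex_imp_convex)
qed

end
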